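(* Let $N\subseteq H\subseteq G$ be closed subgroups of a compact Lie group $G$ with $N$ normal in $G$, and put $J=G/N$, $J_0=H/N$. Assume that $N\subseteq G$ is orthogonally final. If $X$ is an orthogonal $H$-spectrum, then the natural map $$J_+\wedge_{J_0}(\Phi^NX)\longrightarrow\Phi^N(G_+\wedge_HX)$$ is an isomorphism of orthogonal $J$-spectra.
   Context: **Orthogonal spectra.** $\mathcal T$ is the category of based compactly generated weak Hausdorff spaces. For finite dimensional real inner product spaces $V,W$, $\mathbf O(V,W)$ is the space of points $f\wedge x$ with $f\colon V\to W$ a linear isometric embedding and $x$ in the one-point compactification of the orthogonal complement of $f(V)$ (a subspace of $\mathcal L(V,W)_+\wedge S^W$), with composition $(f\wedge x)(g\wedge y)=fg\wedge(x+f(y))$. An orthogonal spectrum is a continuous functor to $\mathcal T$ from the full subcategory on the Euclidean spaces $\mathbb R^m$; an orthogonal $G$-spectrum is one with continuous $G$-action. It is evaluated on an $n$-dimensional orthogonal $G$-representation $V$ by $A_V=\mathcal L(\mathbb R^n,V)_+\wedge_{\mathrm O_{\mathbb R^n}}A_{\mathbb R^n}$ with diagonal action. The functor $G_+\wedge_H-$ is the (levelwise) left adjoint of the restriction $i^*$ from orthogonal $G$-spectra to orthogonal $H$-spectra; similarly for $J_+\wedge_{J_0}-$ and the restriction $i_J^*$ along $i_J\colon J_0\subseteq J$. **Geometric fixed points.** Let $\mathcal O_E$ (resp. $\mathcal O_{E_0}$) be the category of orthogonal $G$-representations (resp. $H$-representations) with morphism spaces $\mathbf O(V,W)^N$, fixed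 points of the conjugation action. For an orthogonal $G$-spectrum $A$, $\Phi^NA$ is the orthogonal $J$-spectrum $(\Phi^NA)_U=\int^{W\in\mathcal O_E}\mathbf O(W^N,U)\wedge(A_W)^N$ ($U$ with trivial action); for an orthogonal $H$-spectrum $X$ the orthogonal $J_0$-spectrum $\Phi^NX$ is defined in the same way using $\mathcal O_{E_0}$. **Orthogonally final.** $i\colon N\subseteq G$ is orthogonally final if for every orthogonal $N$-representation $W$ there is an orthogonal $G$-representation $V$ and an $N$-linear isometric embedding $W\to i^*V$ inducing an isomorphism $W^N\cong(i^*V)^N$. **The natural map.** Restriction of representations gives $\mathcal O_E\to\mathcal O_{E_0}$, which (when $N\subseteq G$ is orthogonally final) induces isomorphisms $\int^{V\in\mathcal O_E}\mathbf O(V^N,-)\wedge(X_{i^*V})^N\cong\Phi^NX$ and $i_J^*\Phi^NY\cong\Phi^N(i^*Y)$ for orthogonal $H$-spectra $X$ and $G$-spectra $Y$. The natural map of the claim is adjoint to the composite $\Phi^NX\to\Phi^N(i^*(G_+\wedge_HX))\cong i_J^*\Phi^N(G_+\wedge_HX)$ whose first map is induced by the unit $X\to i^*(G_+\wedge_HX)$. *)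

theory Defs
  imports "HOL-Analysis.Analysis" "HOL-Analysis.Finite_Function_Topology" "HOL-Algebra.Coset"
begin

section \<open>Compact Lie groups\<close>

definition topological_group :: "'g monoid \<Rightarrow> 'g topology \<Rightarrow> bool" where
  "topological_group G T \<longleftrightarrow>
     group G \<and> topspace T = carrier G \<and>
     continuous_map (prod_topology T T) T (\<lambda>(x, y). x \<otimes>\<^bsub>G\<^esub> y) \<and>
     continuous_map T T (\<lambda>x. inv\<^bsub>G\<^esub> x)"

definition partial_deriv :: "nat \<Rightarrow> ((nat \<Rightarrow> real) \<Rightarrow> real) \<Rightarrow> (nat \<Rightarrow> real) \<Rightarrow> real" where
  "partial_deriv i f x = deriv (\<lambda>t. f (x(i := t))) (x i)"

text \<open>\<open>Ck_on d S k f\<close>: the function \<open>f\<close> is \<open>k\<close> times continuously differentiable on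
  the open subset \<open>S\<close> of \<open>Euclidean_space d\<close>. (The dimension is a number rather than a type,
  since zero-dimensional Lie groups, i.e. finite groups, have to be covered.)\<close>

fun Ck_on :: "nat \<Rightarrow> (nat \<Rightarrow> real) set \<Rightarrow> nat \<Rightarrow> ((nat \<Rightarrow> real) \<Rightarrow> real) \<Rightarrow> bool" where
  "Ck_on d S 0 f \<longleftrightarrow> continuous_map (subtopology (Euclidean_space d) S) euclideanreal f"
| "Ck_on d S (Suc k) f \<longleftrightarrow>
     continuous_map (subtopology (Euclidean_space d) S) euclideanreal f \<and>
     (\<forall>i<d. (\<forall>x\<in>S. (\<lambda>t. f (x(i := t))) differentiable (at (x i))) \<and>
            Ck_on d S k (partial_deriv i f))"

definition smooth_on ::
    "nat \<Rightarrow> nat \<Rightarrow> (nat \<Rightarrow> real) set \<Rightarrow> ((nat \<Rightarrow> real) \<Rightarrow> (nat \<Rightarrow> real)) \<Rightarrow> bool" where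
  "smooth_on d e S f \<longleftrightarrow> (\<forall>j<e. \<forall>k. Ck_on d S k (\<lambda>x. f x j))"

definition is_chart :: "'g topology \<Rightarrow> nat \<Rightarrow> 'g set \<times> ('g \<Rightarrow> nat \<Rightarrow> real) \<Rightarrow> bool" where
  "is_chart T d = (\<lambda>(U, \<phi>). openin T U \<and> openin (Euclidean_space d) (\<phi> ` U) \<and>
     homeomorphic_map (subtopology T U) (subtopology (Euclidean_space d) (\<phi> ` U)) \<phi>)"

definition smooth_atlas :: "'g topology \<Rightarrow> nat \<Rightarrow> ('g set \<times> ('g \<Rightarrow> nat \<Rightarrow> real)) set \<Rightarrow> bool" where
  "smooth_atlas T d \<A> \<longleftrightarrow>
     (\<forall>c\<in>\<A>. is_chart T d c) \<and> \<Union> (fst ` \<A>) = topspace T \<and>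
     (\<forall>(U, \<phi>)\<in>\<A>. \<forall>(V, \<psi>)\<in>\<A>. smooth_on d d (\<phi> ` (U \<inter> V)) (\<lambda>x. \<psi> (inv_into U \<phi> x)))"

definition fst_half :: "nat \<Rightarrow> (nat \<Rightarrow> real) \<Rightarrow> nat \<Rightarrow> real" where
  "fst_half d z = (\<lambda>i. if i < d then z i else 0)"

definition snd_half :: "nat \<Rightarrow> (nat \<Rightarrow> real) \<Rightarrow> nat \<Rightarrow> real" where
  "snd_half d z = (\<lambda>i. if i < d then z (d + i) else 0)"

text \<open>Second countability of the manifold is automatic by compactness.\<close>

definition compact_Lie_group :: "'g monoid \<Rightarrow> 'g topology \<Rightarrow> bool" where
  "compact_Lie_group G T \<longleftrightarrow>
     topological_group G T \<and> compact_space T \<and> Hausdorff_space T \<and>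
     (\<exists>d \<A>. smooth_atlas T d \<A> \<and>
        (\<forall>(U, \<phi>)\<in>\<A>. \<forall>(V, \<psi>)\<in>\<A>. \<forall>(W, \<eta>)\<in>\<A>.
           smooth_on (d + d) d
             {z \<in> topspace (Euclidean_space (d + d)).
                fst_half d z \<in> \<phi> ` U \<and> snd_half d z \<in> \<psi> ` V \<and>
                inv_into U \<phi> (fst_half d z) \<otimes>\<^bsub>G\<^esub> inv_into V \<psi> (snd_half d z) \<in> W}
             (\<lambda>z. \<eta> (inv_into U \<phi> (fst_half d z) \<otimes>\<^bsub>G\<^esub> inv_into V \<psi> (snd_half d z)))) \<and>
        (\<forall>(U, \<phi>)\<in>\<A>. \<forall>(V, \<psi>)\<in>\<A>.
           smooth_on d d {x \<in> \<phi> ` U. inv\<^bsub>G\<^esub> (inv_into U \<phi> x) \<in> V}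
             (\<lambda>x. \<psi> (inv\<^bsub>G\<^esub> (inv_into U \<phi> x)))))"

definition quotient_topology :: "'a topology \<Rightarrow> ('a \<Rightarrow> 'b) \<Rightarrow> 'b topology" where
  "quotient_topology X q =
     topology (\<lambda>U. U \<subseteq> q ` topspace X \<and> openin X {x \<in> topspace X. q x \<in> U})"

lemma istopology_quotient:
  "istopology (\<lambda>U. U \<subseteq> q ` topspace X \<and> openin X {x \<in> topspace X. q x \<in> U})"
proof -
  have "openin X {x \<in> topspace X. q x \<in> \<Union>\<K>}"
    if "\<And>K. K \<in> \<K> \<Longrightarrow> openin X {x \<in> topspace X. q x \<in> K}" for \<K>
  proof -
    have "{x \<in> topspace X. q x \<in> \<Union>\<K>} = (\<Union>K\<in>\<K>. {x \<in> topspace X. q x \<in> K})" by auto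
    then show ?thesis using that by auto
  qed
  moreover have "openin X {x \<in> topspace X. q x \<in> S \<inter> T}"
    if "openin X {x \<in> topspace X. q x \<in> S}" "openin X {x \<in> topspace X. q x \<in> T}" for S T
  proof -
    have "{x \<in> topspace X. q x \<in> S \<inter> T}
        = {x \<in> topspace X. q x \<in> S} \<inter> {x \<in> topspace X. q x \<in> T}" by auto
    then show ?thesis using that by auto
  qed
  ultimately show ?thesis
    unfolding istopology_def by (auto simp del: Union_iff)
qed

lemma openin_quotient_topology:
  "openin (quotient_topology X q) U \<longleftrightarrow>
     U \<subseteq> q ` topspace X \<and> openin X {x \<in> topspace X. q x \<in> U}"
  by (simp add: quotient_topology_def topology_inverse'[OF istopology_quotient])

definition factor_group_topology :: "'g monoid \<Rightarrow> 'g topology \<Rightarrow> 'g set \<Rightarrow> 'g set topology" where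
  "factor_group_topology G T N = quotient_topology T (\<lambda>g. N #>\<^bsub>G\<^esub> g)"


section \<open>Compactly generated weak Hausdorff spaces\<close>

text \<open>Both notions test a space against all maps from compact Hausdorff spaces. HOL forces a
  choice of type for the test spaces, and \<open>'a set set\<close> is large enough. Indeed, let
  \<open>u : K \<rightarrow> X\<close> be continuous with \<open>K\<close> compact Hausdorff, and let \<open>S \<subseteq> K\<close> contain one point of
  every nonempty fibre. The closure of \<open>S\<close> is a compact Hausdorff space with the same image as
  \<open>K\<close>, and it is a quotient of the Stone-Cech compactification of the discrete space \<open>S\<close>, whose
  points are ultrafilters on a set of cardinality at most that of \<open>X\<close>. So images of compact
  Hausdorff spaces are the same for all test types. Once \<open>X\<close> is weak Hausdorff, these images are
  compact Hausdorff subspaces and determine the compactly generated topology; \<open>k_ification\<close> is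
  only applied to weak Hausdorff spaces below.

  The library's \<open>k_space\<close> tests on all compact subsets and is a different notion, since compact
  subsets of weak Hausdorff spaces need not be Hausdorff.\<close>

definition weak_Hausdorff :: "'a topology \<Rightarrow> bool" where
  "weak_Hausdorff X \<longleftrightarrow>
     (\<forall>(K :: 'a set set topology) u.
        compact_space K \<and> Hausdorff_space K \<and> continuous_map K X u \<longrightarrow>
        closedin X (u ` topspace K))"

definition k_open :: "'a topology \<Rightarrow> 'a set \<Rightarrow> bool" where
  "k_open X U \<longleftrightarrow> U \<subseteq> topspace X \<and>
     (\<forall>(K :: 'a set set topology) u.
        compact_space K \<and> Hausdorff_space K \<and> continuous_map K X u \<longrightarrow>
        openin K {k \<in> topspace K. u k \<in> U})"

definition k_ification :: "'a topology \<Rightarrow> 'a topology" where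
  "k_ification X = topology (k_open X)"

lemma istopology_k_open: "istopology (k_open X)"
proof -
  have "k_open X (S \<inter> T)" if "k_open X S" "k_open X T" for S T
    unfolding k_open_def
  proof (intro conjI allI impI)
    show "S \<inter> T \<subseteq> topspace X" using that by (auto simp: k_open_def)
    fix K :: "'a set set topology" and u
    assume K: "compact_space K \<and> Hausdorff_space K \<and> continuous_map K X u"
    have "{k \<in> topspace K. u k \<in> S \<inter> T}
        = {k \<in> topspace K. u k \<in> S} \<inter> {k \<in> topspace K. u k \<in> T}" by auto
    then show "openin K {k \<in> topspace K. u k \<in> S \<inter> T}"
      using that K by (simp add: k_open_def openin_Int)
  qed
  moreover have "k_open X (\<Union>\<K>)" if "\<forall>S\<in>\<K>. k_open X S" for \<K>
    unfolding k_open_def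
  proof (intro conjI allI impI)
    show "\<Union>\<K> \<subseteq> topspace X" using that by (auto simp: k_open_def)
    fix K :: "'a set set topology" and u
    assume K: "compact_space K \<and> Hausdorff_space K \<and> continuous_map K X u"
    have "{k \<in> topspace K. u k \<in> \<Union>\<K>} = (\<Union>S\<in>\<K>. {k \<in> topspace K. u k \<in> S})" by auto
    moreover have "openin K {k \<in> topspace K. u k \<in> S}" if "S \<in> \<K>" for S
      using K that \<open>\<forall>S\<in>\<K>. k_open X S\<close> unfolding k_open_def by blast
    ultimately show "openin K {k \<in> topspace K. u k \<in> \<Union>\<K>}" by auto
  qed
  ultimately show ?thesis unfolding istopology_def by blast
qed

lemma openin_k_ification: "openin (k_ification X) U \<longleftrightarrow> k_open X U"
  by (simp add: k_ification_def topology_inverse'[OF istopology_k_open])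

definition compactly_generated :: "'a topology \<Rightarrow> bool" where
  "compactly_generated X \<longleftrightarrow> (\<forall>U. openin X U \<longleftrightarrow> k_open X U)"

definition k_prod :: "'a topology \<Rightarrow> 'b topology \<Rightarrow> ('a \<times> 'b) topology" where
  "k_prod X Y = k_ification (prod_topology X Y)"

record 'a pspace =
  ptop :: "'a topology"
  pt :: 'a

definition based_CGWH :: "'a pspace \<Rightarrow> bool" where
  "based_CGWH X \<longleftrightarrow>
     pt X \<in> topspace (ptop X) \<and> compactly_generated (ptop X) \<and> weak_Hausdorff (ptop X)"

text \<open>The space \<open>X\<^sub>+\<close>, with \<open>None\<close> as the new isolated base point.\<close>

definition adjoin_pt :: "'a topology \<Rightarrow> 'a option pspace" where
  "adjoin_pt X = \<lparr>ptop = topology (\<lambda>U. U \<subseteq> insert None (Some ` topspace X) \<and> openin X {x. Some x \<in> U}),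
                  pt = None\<rparr>"

lemma istopology_adjoin_pt:
  "istopology (\<lambda>U. U \<subseteq> insert None (Some ` topspace X) \<and> openin X {x. Some x \<in> U})"
proof -
  have "openin X {x. Some x \<in> \<Union>\<K>}" if "\<And>K. K \<in> \<K> \<Longrightarrow> openin X {x. Some x \<in> K}" for \<K>
  proof -
    have "{x. Some x \<in> \<Union>\<K>} = (\<Union>K\<in>\<K>. {x. Some x \<in> K})" by auto
    then show ?thesis using that by auto
  qed
  moreover have "openin X {x. Some x \<in> S \<inter> T}"
    if "openin X {x. Some x \<in> S}" "openin X {x. Some x \<in> T}" for S T
  proof -
    have "{x. Some x \<in> S \<inter> T} = {x. Some x \<in> S} \<inter> {x. Some x \<in> T}" by auto
    then show ?thesis using that by auto
  qed
  ultimately show ?thesis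
    unfolding istopology_def by (auto simp del: Union_iff)
qed

lemma openin_adjoin_pt:
  "openin (ptop (adjoin_pt X)) U \<longleftrightarrow>
     U \<subseteq> insert None (Some ` topspace X) \<and> openin X {x. Some x \<in> U}"
  by (simp add: adjoin_pt_def topology_inverse'[OF istopology_adjoin_pt])

text \<open>A point of \<open>X \<and> Y\<close> is represented by the pair \<open>(x, y)\<close> if neither component is the base
  point, and all of \<open>X \<or> Y\<close> by the pair of base points; \<open>smash_pt X Y\<close> is the quotient map from
  the product.\<close>

definition smash_pt :: "'a pspace \<Rightarrow> 'b pspace \<Rightarrow> 'a \<times> 'b \<Rightarrow> 'a \<times> 'b" where
  "smash_pt X Y = (\<lambda>(x, y). if x = pt X \<or> y = pt Y then (pt X, pt Y) else (x, y))"

definition smash :: "'a pspace \<Rightarrow> 'b pspace \<Rightarrow> ('a \<times> 'b) pspace" where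
  "smash X Y = \<lparr>ptop = quotient_topology (k_prod (ptop X) (ptop Y)) (smash_pt X Y),
                pt = (pt X, pt Y)\<rparr>"

text \<open>Coequalizers of compactly generated weak Hausdorff spaces: a quotient of such a space
  \<open>X\<close> by an equivalence relation is weak Hausdorff iff the relation is closed in the compactly
  generated product, so the coequalizer of two maps \<open>p\<close>, \<open>q\<close>, with \<open>R\<close> the set of pairs \<open>(p y, q y)\<close>, is the
  quotient by the smallest closed equivalence relation containing \<open>R\<close>.\<close>

definition closed_equiv_hull :: "'a topology \<Rightarrow> ('a \<times> 'a) set \<Rightarrow> ('a \<times> 'a) set" where
  "closed_equiv_hull X R = \<Inter> {E. equiv (topspace X) E \<and> closedin (k_prod X X) E \<and> R \<subseteq> E}"

definition coeq_class :: "'a pspace \<Rightarrow> ('a \<times> 'a) set \<Rightarrow> 'a \<Rightarrow> 'a set" where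
  "coeq_class X R x = closed_equiv_hull (ptop X) R `` {x}"

definition coeq :: "'a pspace \<Rightarrow> ('a \<times> 'a) set \<Rightarrow> 'a set pspace" where
  "coeq X R = \<lparr>ptop = quotient_topology (ptop X) (coeq_class X R), pt = coeq_class X R (pt X)\<rparr>"

text \<open>Maps out of a coequalizer are written below as \<open>the_elem (F ` z)\<close>: the common value of
  \<open>F\<close> on the points of the class \<open>z\<close>.\<close>


section \<open>Inner product spaces and the spaces O(V, W)\<close>

text \<open>Finite dimensional real inner product spaces are taken to be the finite dimensional
  subspaces of a fixed inner product space of countable dimension; every such space is isometric to
  one of these. The norm that the library provides on \<open>nat \<Rightarrow>\<^sub>0 real\<close> is the \<open>l\<^sup>1\<close> norm
  and is not the norm of this inner product, but on a finite dimensional subspace both induce the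
  same topology.\<close>

type_synonym vect = "nat \<Rightarrow>\<^sub>0 real"

definition ip :: "vect \<Rightarrow> vect \<Rightarrow> real" where
  "ip x y = (\<Sum>i\<in>Poly_Mapping.keys x. Poly_Mapping.lookup x i * Poly_Mapping.lookup y i)"

definition inner_product_space :: "vect set \<Rightarrow> bool" where
  "inner_product_space V \<longleftrightarrow> subspace V \<and> (\<exists>B. finite B \<and> V = span B)"

definition Euc :: "nat \<Rightarrow> vect set" where
  "Euc m = {v. Poly_Mapping.keys v \<subseteq> {..<m}}"

definition isos :: "vect set \<Rightarrow> vect set \<Rightarrow> (vect \<Rightarrow> vect) set" where
  "isos V W = {f \<in> V \<rightarrow>\<^sub>E W.
     (\<forall>x\<in>V. \<forall>y\<in>V. f (x + y) = f x + f y) \<and> (\<forall>c. \<forall>x\<in>V. f (c *\<^sub>R x) = c *\<^sub>R f x) \<and>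
     (\<forall>x\<in>V. \<forall>y\<in>V. ip (f x) (f y) = ip x y)}"

text \<open>The topology of pointwise convergence is the usual one on linear maps between finite
  dimensional spaces.\<close>

definition iso_top :: "vect set \<Rightarrow> vect set \<Rightarrow> (vect \<Rightarrow> vect) topology" where
  "iso_top V W = subtopology (product_topology (\<lambda>_. top_of_set W) V) (isos V W)"

definition sphere_sp :: "vect set \<Rightarrow> vect option pspace" where
  "sphere_sp V = \<lparr>ptop = Alexandroff_compactification (top_of_set V), pt = None\<rparr>"

type_synonym omor = "(vect \<Rightarrow> vect) option \<times> vect option"

text \<open>The pair \<open>(Some f, Some x)\<close> is the point \<open>f \<and> x\<close>, and \<open>(None, None)\<close> is the base point.\<close>

definition Omor :: "vect set \<Rightarrow> vect set \<Rightarrow> omor set" where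
  "Omor V W = insert (None, None)
     {(Some f, Some x) | f x. f \<in> isos V W \<and> x \<in> W \<and> (\<forall>v\<in>V. ip (f v) x = 0)}"

definition Osp :: "vect set \<Rightarrow> vect set \<Rightarrow> omor pspace" where
  "Osp V W = \<lparr>ptop = subtopology (ptop (smash (adjoin_pt (iso_top V W)) (sphere_sp W))) (Omor V W),
              pt = (None, None)\<rparr>"

definition Olin :: "(vect \<Rightarrow> vect) \<Rightarrow> omor" where
  "Olin f = (Some f, Some 0)"

text \<open>Composition with source \<open>V\<close>; morphisms are extensional functions, so that the source has
  to be mentioned.\<close>

definition Ocomp :: "vect set \<Rightarrow> omor \<Rightarrow> omor \<Rightarrow> omor" where
  "Ocomp V \<phi> \<psi> = (case (\<phi>, \<psi>) of
     ((Some f, Some x), (Some g, Some y)) \<Rightarrow> (Some (compose V f g), Some (x + f y))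
   | _ \<Rightarrow> (None, None))"

definition Oid :: "vect set \<Rightarrow> omor" where
  "Oid V = Olin (\<lambda>v\<in>V. v)"


section \<open>Orthogonal spectra\<close>

text \<open>An orthogonal \<open>G\<close>-spectrum: the values at \<open>\<real>\<^sup>m\<close>, the maps
  \<open>O(\<real>\<^sup>m, \<real>\<^sup>n) \<and> A\<^sub>m \<rightarrow> A\<^sub>n\<close>, and the action of \<open>G\<close>.\<close>

record ('g, 'a) ospectrum =
  lvl :: "nat \<Rightarrow> 'a pspace"
  str :: "nat \<Rightarrow> nat \<Rightarrow> omor \<Rightarrow> 'a \<Rightarrow> 'a"
  act :: "'g \<Rightarrow> nat \<Rightarrow> 'a \<Rightarrow> 'a"

abbreviation lvl_set :: "('g, 'a) ospectrum \<Rightarrow> nat \<Rightarrow> 'a set" where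
  "lvl_set A m \<equiv> topspace (ptop (lvl A m))"

definition orthogonal_spectrum :: "'g monoid \<Rightarrow> 'g topology \<Rightarrow> ('g, 'a) ospectrum \<Rightarrow> bool" where
  "orthogonal_spectrum G T A \<longleftrightarrow>
     (\<forall>m. based_CGWH (lvl A m)) \<and>
     (\<forall>m n. continuous_map (k_prod (ptop (Osp (Euc m) (Euc n))) (ptop (lvl A m))) (ptop (lvl A n))
              (\<lambda>(\<phi>, a). str A m n \<phi> a)) \<and>
     (\<forall>m n. \<forall>a\<in>lvl_set A m. str A m n (None, None) a = pt (lvl A n)) \<and>
     (\<forall>m n. \<forall>\<phi>\<in>Omor (Euc m) (Euc n). str A m n \<phi> (pt (lvl A m)) = pt (lvl A n)) \<and>
     (\<forall>m. \<forall>a\<in>lvl_set A m. str A m m (Oid (Euc m)) a = a) \<and>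
     (\<forall>l m n. \<forall>\<psi>\<in>Omor (Euc l) (Euc m). \<forall>\<phi>\<in>Omor (Euc m) (Euc n). \<forall>a\<in>lvl_set A l.
        str A l n (Ocomp (Euc l) \<phi> \<psi>) a = str A m n \<phi> (str A l m \<psi> a)) \<and>
     (\<forall>m. continuous_map (k_prod T (ptop (lvl A m))) (ptop (lvl A m)) (\<lambda>(g, a). act A g m a)) \<and>
     (\<forall>m. \<forall>a\<in>lvl_set A m. act A \<one>\<^bsub>G\<^esub> m a = a) \<and>
     (\<forall>m. \<forall>g\<in>carrier G. \<forall>h\<in>carrier G. \<forall>a\<in>lvl_set A m.
        act A (g \<otimes>\<^bsub>G\<^esub> h) m a = act A g m (act A h m a)) \<and>
     (\<forall>m. \<forall>g\<in>carrier G. act A g m (pt (lvl A m)) = pt (lvl A m)) \<and>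
     (\<forall>m n. \<forall>g\<in>carrier G. \<forall>\<phi>\<in>Omor (Euc m) (Euc n). \<forall>a\<in>lvl_set A m.
        act A g n (str A m n \<phi> a) = str A m n \<phi> (act A g m a))"

definition ospectrum_morphism ::
    "'g monoid \<Rightarrow> 'g topology \<Rightarrow> ('g, 'a) ospectrum \<Rightarrow> ('g, 'b) ospectrum \<Rightarrow> (nat \<Rightarrow> 'a \<Rightarrow> 'b) \<Rightarrow> bool" where
  "ospectrum_morphism G T A B F \<longleftrightarrow>
     orthogonal_spectrum G T A \<and> orthogonal_spectrum G T B \<and>
     (\<forall>m. continuous_map (ptop (lvl A m)) (ptop (lvl B m)) (F m)) \<and>
     (\<forall>m. F m (pt (lvl A m)) = pt (lvl B m)) \<and>
     (\<forall>m n. \<forall>\<phi>\<in>Omor (Euc m) (Euc n). \<forall>a\<in>lvl_set A m.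
        F n (str A m n \<phi> a) = str B m n \<phi> (F m a)) \<and>
     (\<forall>m. \<forall>g\<in>carrier G. \<forall>a\<in>lvl_set A m. F m (act A g m a) = act B g m (F m a))"

definition ospectrum_isomorphism ::
    "'g monoid \<Rightarrow> 'g topology \<Rightarrow> ('g, 'a) ospectrum \<Rightarrow> ('g, 'b) ospectrum \<Rightarrow> (nat \<Rightarrow> 'a \<Rightarrow> 'b) \<Rightarrow> bool" where
  "ospectrum_isomorphism G T A B F \<longleftrightarrow>
     ospectrum_morphism G T A B F \<and>
     (\<exists>F'. ospectrum_morphism G T B A F' \<and>
        (\<forall>m. (\<forall>a\<in>lvl_set A m. F' m (F m a) = a) \<and> (\<forall>b\<in>lvl_set B m. F m (F' m b) = b)))"

definition res_spectrum :: "'g set \<Rightarrow> ('g, 'a) ospectrum \<Rightarrow> ('g, 'a) ospectrum" where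
  "res_spectrum H A = A\<lparr>act := restrict (act A) H\<rparr>"


subsection \<open>The functor from \<open>H\<close>-spectra to \<open>G\<close>-spectra left adjoint to restriction\<close>

text \<open>Levelwise \<open>G\<^sub>+ \<and>\<^sub>H X\<close>, the coequalizer of \<open>gh \<and> x\<close> and \<open>g \<and> hx\<close>.\<close>

definition ind_pre :: "'g topology \<Rightarrow> ('g, 'a) ospectrum \<Rightarrow> nat \<Rightarrow> ('g option \<times> 'a) pspace" where
  "ind_pre T X m = smash (adjoin_pt T) (lvl X m)"

definition ind_pt :: "'g topology \<Rightarrow> ('g, 'a) ospectrum \<Rightarrow> nat \<Rightarrow> 'g option \<Rightarrow> 'a \<Rightarrow> 'g option \<times> 'a" where
  "ind_pt T X m p x = smash_pt (adjoin_pt T) (lvl X m) (p, x)"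

definition ind_rel ::
    "'g monoid \<Rightarrow> 'g topology \<Rightarrow> 'g set \<Rightarrow> ('g, 'a) ospectrum \<Rightarrow> nat \<Rightarrow>
      (('g option \<times> 'a) \<times> ('g option \<times> 'a)) set" where
  "ind_rel G T H X m =
     {(ind_pt T X m (Some (g \<otimes>\<^bsub>G\<^esub> h)) x, ind_pt T X m (Some g) (act X h m x)) | g h x.
        g \<in> carrier G \<and> h \<in> H \<and> x \<in> lvl_set X m}"

definition ind_class ::
    "'g monoid \<Rightarrow> 'g topology \<Rightarrow> 'g set \<Rightarrow> ('g, 'a) ospectrum \<Rightarrow> nat \<Rightarrow> 'g option \<Rightarrow> 'a \<Rightarrow>
      ('g option \<times> 'a) set" where
  "ind_class G T H X m p x = coeq_class (ind_pre T X m) (ind_rel G T H X m) (ind_pt T X m p x)"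

definition ind_spectrum ::
    "'g monoid \<Rightarrow> 'g topology \<Rightarrow> 'g set \<Rightarrow> ('g, 'a) ospectrum \<Rightarrow> ('g, ('g option \<times> 'a) set) ospectrum" where
  "ind_spectrum G T H X =
     \<lparr>lvl = (\<lambda>m. coeq (ind_pre T X m) (ind_rel G T H X m)),
      str = (\<lambda>m n \<phi> z. the_elem ((\<lambda>(p, x). ind_class G T H X n p (str X m n \<phi> x)) ` z)),
      act = (\<lambda>g m z. the_elem ((\<lambda>(p, x). ind_class G T H X m (map_option (\<lambda>k. g \<otimes>\<^bsub>G\<^esub> k) p) x) ` z))\<rparr>"

definition ind_unit ::
    "'g monoid \<Rightarrow> 'g topology \<Rightarrow> 'g set \<Rightarrow> ('g, 'a) ospectrum \<Rightarrow> nat \<Rightarrow> 'a \<Rightarrow> ('g option \<times> 'a) set" where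
  "ind_unit G T H X m x = ind_class G T H X m (Some \<one>\<^bsub>G\<^esub>) x"

text \<open>The map \<open>G\<^sub>+ \<and>\<^sub>H X \<rightarrow> Y\<close>, \<open>g \<and> x \<mapsto> g u(x)\<close>, adjoint to a map \<open>u\<close> from \<open>X\<close> to the
  restriction of the \<open>G\<close>-spectrum \<open>Y\<close>.\<close>

definition ind_adjoint ::
    "('g, 'b) ospectrum \<Rightarrow> (nat \<Rightarrow> 'a \<Rightarrow> 'b) \<Rightarrow> nat \<Rightarrow> ('g option \<times> 'a) set \<Rightarrow> 'b" where
  "ind_adjoint Y u m z =
     the_elem ((\<lambda>(p, x). case p of None \<Rightarrow> pt (lvl Y m) | Some g \<Rightarrow> act Y g m (u m x)) ` z)"


section \<open>Orthogonal representations and evaluation of spectra\<close>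

type_synonym 'g rep = "vect set \<times> ('g \<Rightarrow> vect \<Rightarrow> vect)"

definition reps :: "'g monoid \<Rightarrow> 'g topology \<Rightarrow> 'g rep set" where
  "reps G T = {(V, \<rho>). inner_product_space V \<and> \<rho> \<in> carrier G \<rightarrow>\<^sub>E isos V V \<and>
     \<rho> \<one>\<^bsub>G\<^esub> = (\<lambda>v\<in>V. v) \<and>
     (\<forall>g\<in>carrier G. \<forall>h\<in>carrier G. \<rho> (g \<otimes>\<^bsub>G\<^esub> h) = compose V (\<rho> g) (\<rho> h)) \<and>
     continuous_map (prod_topology T (top_of_set V)) (top_of_set V) (\<lambda>(g, v). \<rho> g v)}"

definition zero_rep :: "'g monoid \<Rightarrow> 'g rep" where
  "zero_rep G = ({0}, \<lambda>g\<in>carrier G. \<lambda>v\<in>{0}. v)"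

definition res_rep :: "'g set \<Rightarrow> 'g rep \<Rightarrow> 'g rep" where
  "res_rep H V = (fst V, restrict (snd V) H)"

definition rep_fix :: "'g set \<Rightarrow> 'g rep \<Rightarrow> vect set" where
  "rep_fix N V = {v \<in> fst V. \<forall>n\<in>N. snd V n v = v}"

text \<open>The morphism space \<open>O(V, W)\<^sup>N\<close>, for the conjugation action of \<open>G\<close> on \<open>O(V, W)\<close>, and the
  functor \<open>V \<mapsto> V\<^sup>N\<close> on it.\<close>

definition Oconj :: "'g monoid \<Rightarrow> 'g rep \<Rightarrow> 'g rep \<Rightarrow> 'g \<Rightarrow> omor \<Rightarrow> omor" where
  "Oconj G V W g \<phi> =
     Ocomp (fst V) (Olin (snd W g)) (Ocomp (fst V) \<phi> (Olin (snd V (inv\<^bsub>G\<^esub> g))))"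

definition Omor_fix :: "'g monoid \<Rightarrow> 'g set \<Rightarrow> 'g rep \<Rightarrow> 'g rep \<Rightarrow> omor set" where
  "Omor_fix G N V W = {\<phi> \<in> Omor (fst V) (fst W). \<forall>n\<in>N. Oconj G V W n \<phi> = \<phi>}"

definition Ofix :: "'g set \<Rightarrow> 'g rep \<Rightarrow> omor \<Rightarrow> omor" where
  "Ofix N V \<phi> = (map_option (\<lambda>f. restrict f (rep_fix N V)) (fst \<phi>), snd \<phi>)"

definition orthogonally_final :: "'g monoid \<Rightarrow> 'g topology \<Rightarrow> 'g set \<Rightarrow> bool" where
  "orthogonally_final G T N \<longleftrightarrow>
     (\<forall>W \<in> reps (G\<lparr>carrier := N\<rparr>) (subtopology T N).
        \<exists>V \<in> reps G T. \<exists>f \<in> isos (fst W) (fst V).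
          (\<forall>n\<in>N. \<forall>w\<in>fst W. f (snd W n w) = snd (res_rep N V) n (f w)) \<and>
          bij_betw f (rep_fix N W) (rep_fix N (res_rep N V)))"

text \<open>The value \<open>A\<^sub>V = L(\<real>\<^sup>n, V)\<^sub>+ \<and>\<^sub>O\<^sub>(\<^sub>n\<^sub>) A\<^sub>n\<close> at an inner product space \<open>V\<close> of dimension \<open>n\<close>.\<close>

type_synonym 'a evpt = "(vect \<Rightarrow> vect) option \<times> 'a"

definition ev_pre :: "('g, 'a) ospectrum \<Rightarrow> vect set \<Rightarrow> 'a evpt pspace" where
  "ev_pre A V = smash (adjoin_pt (iso_top (Euc (dim V)) V)) (lvl A (dim V))"

definition ev_pt :: "('g, 'a) ospectrum \<Rightarrow> vect set \<Rightarrow> (vect \<Rightarrow> vect) option \<Rightarrow> 'a \<Rightarrow> 'a evpt" where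
  "ev_pt A V p a = smash_pt (adjoin_pt (iso_top (Euc (dim V)) V)) (lvl A (dim V)) (p, a)"

definition ev_rel :: "('g, 'a) ospectrum \<Rightarrow> vect set \<Rightarrow> ('a evpt \<times> 'a evpt) set" where
  "ev_rel A V =
     {(ev_pt A V (Some (compose (Euc (dim V)) f k)) a,
       ev_pt A V (Some f) (str A (dim V) (dim V) (Olin k) a)) | f k a.
        f \<in> isos (Euc (dim V)) V \<and> k \<in> isos (Euc (dim V)) (Euc (dim V)) \<and> a \<in> lvl_set A (dim V)}"

definition ev :: "('g, 'a) ospectrum \<Rightarrow> vect set \<Rightarrow> 'a evpt set pspace" where
  "ev A V = coeq (ev_pre A V) (ev_rel A V)"

definition ev_class :: "('g, 'a) ospectrum \<Rightarrow> vect set \<Rightarrow> (vect \<Rightarrow> vect) option \<Rightarrow> 'a \<Rightarrow> 'a evpt set" where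
  "ev_class A V p a = coeq_class (ev_pre A V) (ev_rel A V) (ev_pt A V p a)"

text \<open>The diagonal action \<open>g(f \<and> a) = gf \<and> ga\<close> on \<open>A\<^sub>V\<close>, the effect \<open>A\<^sub>V \<rightarrow> A\<^sub>W\<close> of a point
  \<open>\<phi>\<close> of \<open>O(V, W)\<close> (which sends \<open>f \<and> a\<close> to \<open>k \<and> (k\<^sup>-\<^sup>1\<phi>f)(a)\<close>, for any isometry \<open>k\<close> from a
  Euclidean space to \<open>W\<close>), and the value at \<open>V\<close> of a morphism of spectra.\<close>

definition ev_act :: "('g, 'a) ospectrum \<Rightarrow> 'g rep \<Rightarrow> 'g \<Rightarrow> 'a evpt set \<Rightarrow> 'a evpt set" where
  "ev_act A V g z =
     the_elem ((\<lambda>(p, a). ev_class A (fst V)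
                  (map_option (\<lambda>f. compose (Euc (dim (fst V))) (snd V g) f) p)
                  (act A g (dim (fst V)) a)) ` z)"

definition frame :: "vect set \<Rightarrow> vect \<Rightarrow> vect" where
  "frame W = (SOME k. k \<in> isos (Euc (dim W)) W)"

definition frame_inv :: "vect set \<Rightarrow> vect \<Rightarrow> vect" where
  "frame_inv W = (\<lambda>w\<in>W. inv_into (Euc (dim W)) (frame W) w)"

definition ev_map :: "('g, 'a) ospectrum \<Rightarrow> vect set \<Rightarrow> vect set \<Rightarrow> omor \<Rightarrow> 'a evpt set \<Rightarrow> 'a evpt set" where
  "ev_map A V W \<phi> z =
     the_elem ((\<lambda>(p, a). case p of
         None \<Rightarrow> pt (ev A W)
       | Some f \<Rightarrow> ev_class A W (Some (frame W))
           (str A (dim V) (dim W)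
              (Ocomp (Euc (dim V)) (Olin (frame_inv W)) (Ocomp (Euc (dim V)) \<phi> (Olin f))) a)) ` z)"

definition ev_hom ::
    "('g, 'b) ospectrum \<Rightarrow> (nat \<Rightarrow> 'a \<Rightarrow> 'b) \<Rightarrow> vect set \<Rightarrow> 'a evpt set \<Rightarrow> 'b evpt set" where
  "ev_hom B F V z = the_elem ((\<lambda>(p, a). ev_class B V p (F (dim V) a)) ` z)"

text \<open>The fixed points \<open>(A\<^sub>V)\<^sup>N\<close>, a closed subspace of \<open>A\<^sub>V\<close>.\<close>

definition ev_fix :: "'g set \<Rightarrow> ('g, 'a) ospectrum \<Rightarrow> 'g rep \<Rightarrow> 'a evpt set pspace" where
  "ev_fix N A V =
     \<lparr>ptop = subtopology (ptop (ev A (fst V))) {z. \<forall>n\<in>N. ev_act A V n z = z}, pt = pt (ev A (fst V))\<rparr>"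


section \<open>Geometric fixed points\<close>

text \<open>The coend of \<open>O(V\<^sup>N, \<real>\<^sup>m) \<and> (A\<^sub>V)\<^sup>N\<close> over the category of orthogonal \<open>G\<close>-representations
  with morphism spaces \<open>O(V, W)\<^sup>N\<close>, presented as a coequalizer of the disjoint union of these
  spaces; \<open>gfix_rel\<close> identifies all base points and
  \<open>\<theta>\<phi>\<^sup>N \<and> a\<close> with \<open>\<theta> \<and> \<phi>(a)\<close> for all \<open>\<phi>\<close> in \<open>O(V, W)\<^sup>N\<close>.\<close>

type_synonym ('g, 'a) gfixpt = "'g rep \<times> (omor \<times> 'a evpt set)"

definition gfix_summand :: "'g set \<Rightarrow> ('g, 'a) ospectrum \<Rightarrow> nat \<Rightarrow> 'g rep \<Rightarrow> (omor \<times> 'a evpt set) pspace" where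
  "gfix_summand N A m V = smash (Osp (rep_fix N V) (Euc m)) (ev_fix N A V)"

definition gfix_pre ::
    "'g monoid \<Rightarrow> 'g topology \<Rightarrow> 'g set \<Rightarrow> ('g, 'a) ospectrum \<Rightarrow> nat \<Rightarrow> ('g, 'a) gfixpt pspace" where
  "gfix_pre G T N A m =
     \<lparr>ptop = sum_topology (\<lambda>V. ptop (gfix_summand N A m V)) (reps G T),
      pt = (zero_rep G, pt (gfix_summand N A m (zero_rep G)))\<rparr>"

definition gfix_pt ::
    "'g set \<Rightarrow> ('g, 'a) ospectrum \<Rightarrow> nat \<Rightarrow> 'g rep \<Rightarrow> omor \<Rightarrow> 'a evpt set \<Rightarrow> ('g, 'a) gfixpt" where
  "gfix_pt N A m V \<theta> a = (V, smash_pt (Osp (rep_fix N V) (Euc m)) (ev_fix N A V) (\<theta>, a))"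

definition gfix_rel ::
    "'g monoid \<Rightarrow> 'g topology \<Rightarrow> 'g set \<Rightarrow> ('g, 'a) ospectrum \<Rightarrow> nat \<Rightarrow>
      (('g, 'a) gfixpt \<times> ('g, 'a) gfixpt) set" where
  "gfix_rel G T N A m =
     {((V, pt (gfix_summand N A m V)), (W, pt (gfix_summand N A m W))) | V W.
        V \<in> reps G T \<and> W \<in> reps G T} \<union>
     {(gfix_pt N A m V (Ocomp (rep_fix N V) \<theta> (Ofix N V \<phi>)) a,
       gfix_pt N A m W \<theta> (ev_map A (fst V) (fst W) \<phi> a)) | V W \<theta> \<phi> a.
        V \<in> reps G T \<and> W \<in> reps G T \<and> \<phi> \<in> Omor_fix G N V W \<and>
        \<theta> \<in> Omor (rep_fix N W) (Euc m) \<and> a \<in> topspace (ptop (ev_fix N A V))}"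

definition gfix_class ::
    "'g monoid \<Rightarrow> 'g topology \<Rightarrow> 'g set \<Rightarrow> ('g, 'a) ospectrum \<Rightarrow> nat \<Rightarrow> 'g rep \<Rightarrow> omor \<Rightarrow> 'a evpt set \<Rightarrow>
      ('g, 'a) gfixpt set" where
  "gfix_class G T N A m V \<theta> a =
     coeq_class (gfix_pre G T N A m) (gfix_rel G T N A m) (gfix_pt N A m V \<theta> a)"

text \<open>The group \<open>G\<close> acts by \<open>g(\<theta> \<and> a) = \<theta>g\<^sup>-\<^sup>1 \<and> ga\<close>, that is, by conjugation on
  \<open>O(V\<^sup>N, \<real>\<^sup>m)\<close> with \<open>\<real>\<^sup>m\<close> carrying the trivial action. This factors through \<open>G/N\<close>, whose
  elements are the cosets \<open>j\<close>.\<close>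

definition gfix ::
    "'g monoid \<Rightarrow> 'g topology \<Rightarrow> 'g set \<Rightarrow> ('g, 'a) ospectrum \<Rightarrow> ('g set, ('g, 'a) gfixpt set) ospectrum" where
  "gfix G T N A =
     \<lparr>lvl = (\<lambda>m. coeq (gfix_pre G T N A m) (gfix_rel G T N A m)),
      str = (\<lambda>m n \<psi> z. the_elem
               ((\<lambda>(V, \<theta>, a). gfix_class G T N A n V (Ocomp (rep_fix N V) \<psi> \<theta>) a) ` z)),
      act = (\<lambda>j m z. the_elem
               ((\<lambda>(g, V, \<theta>, a). gfix_class G T N A m V
                    (Ocomp (rep_fix N V) \<theta> (Olin (restrict (snd V (inv\<^bsub>G\<^esub> g)) (rep_fix N V))))
                    (ev_act A V g a)) ` (j \<times> z)))\<rparr>"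

definition gfix_hom ::
    "'g monoid \<Rightarrow> 'g topology \<Rightarrow> 'g set \<Rightarrow> ('g, 'b) ospectrum \<Rightarrow> (nat \<Rightarrow> 'a \<Rightarrow> 'b) \<Rightarrow>
      nat \<Rightarrow> ('g, 'a) gfixpt set \<Rightarrow> ('g, 'b) gfixpt set" where
  "gfix_hom G T N B F m z =
     the_elem ((\<lambda>(V, \<theta>, a). gfix_class G T N B m V \<theta> (ev_hom B F (fst V) a)) ` z)"


section \<open>The natural map\<close>

text \<open>For a \<open>G\<close>-spectrum \<open>Y\<close>, the map from the geometric fixed points of \<open>Y\<close>, with action
  restricted along \<open>H/N \<subseteq> G/N\<close>, to the geometric fixed points of the \<open>H\<close>-spectrum underlying \<open>Y\<close>
  that is induced by restricting the representations in the coend. It is bijective if \<open>N \<subseteq> G\<close> is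
  orthogonally final.\<close>

definition gfix_res ::
    "'g monoid \<Rightarrow> 'g topology \<Rightarrow> 'g set \<Rightarrow> 'g set \<Rightarrow> ('g, 'a) ospectrum \<Rightarrow>
      nat \<Rightarrow> ('g, 'a) gfixpt set \<Rightarrow> ('g, 'a) gfixpt set" where
  "gfix_res G T H N Y m z =
     the_elem ((\<lambda>(V, \<theta>, a). gfix_class (G\<lparr>carrier := H\<rparr>) (subtopology T H) N (res_spectrum H Y) m
                  (res_rep H V) \<theta> a) ` z)"

definition gfix_res_inv ::
    "'g monoid \<Rightarrow> 'g topology \<Rightarrow> 'g set \<Rightarrow> 'g set \<Rightarrow> ('g, 'a) ospectrum \<Rightarrow>
      nat \<Rightarrow> ('g, 'a) gfixpt set \<Rightarrow> ('g, 'a) gfixpt set" where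
  "gfix_res_inv G T H N Y m = inv_into (lvl_set (gfix G T N Y) m) (gfix_res G T H N Y m)"

definition natural_map ::
    "'g monoid \<Rightarrow> 'g topology \<Rightarrow> 'g set \<Rightarrow> 'g set \<Rightarrow> ('g, 'a) ospectrum \<Rightarrow> nat \<Rightarrow>
      ('g set option \<times> ('g, 'a) gfixpt set) set \<Rightarrow> ('g, ('g option \<times> 'a) set) gfixpt set" where
  "natural_map G T H N X =
     (let Y = ind_spectrum G T H X in
      ind_adjoint (gfix G T N Y)
        (\<lambda>m z. gfix_res_inv G T H N Y m
           (gfix_hom (G\<lparr>carrier := H\<rparr>) (subtopology T H) N (res_spectrum H Y) (ind_unit G T H X) m z)))"

end

theory Submission
  imports Defs
begin

text \<open>The coequalizer defining \<open>G\<^sub>+ \<and>\<^sub>H X\<close> identifies \<open>g \<and> x\<close> with \<open>g' \<and> x'\<close> only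
  if \<open>g\<^sup>-\<^sup>1g' \<in> H\<close> and \<open>x = g\<^sup>-\<^sup>1g'x'\<close>, because this relation is already closed. As \<open>N\<close> is normal and
  contained in \<open>H\<close>, the \<open>N\<close>-fixed points of \<open>(G\<^sub>+ \<and>\<^sub>H X)\<^sub>V\<close> are therefore exactly the points \<open>gy\<close> with
  \<open>y\<close> an \<open>N\<close>-fixed point of \<open>X\<^sub>V\<close>, and \<open>(g, y) \<mapsto> gy\<close> is a quotient map onto them. Hence
  \<open>\<theta> \<and> gy \<mapsto> gN \<and> (\<theta>g \<and> y)\<close> is a continuous inverse of the natural map; it respects a morphism
  \<open>\<phi>\<close> of \<open>O(V, W)\<^sup>N\<close> since \<open>g\<^sup>-\<^sup>1\<phi>g\<close> again lies in \<open>O(V, W)\<^sup>N\<close>. Orthogonal finality has two uses: every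
  point of the geometric fixed points of an \<open>H\<close>-spectrum has a representative at a restricted
  \<open>G\<close>-representation, and two \<open>N\<close>-embeddings of the same representation into \<open>G\<close>-representations, with
  the same fixed points, can be amalgamated in a third one.\<close>

text \<open>A coequalizer is a quotient by a closed hull, so its generating relation does not show
  which points have been identified. Classes are told apart by continuous maps into another
  compactly generated weak Hausdorff space that respect the generators. Hence every formula with
  \<open>the_elem\<close> needs continuity and compatibility before it has a value, and every
  injectivity statement needs a suitable target. For \<open>\<kappa>\<close> that target is the
  quotient by the explicit relation \<open>fib\<close>; for the values of a spectrum it is the
  Euclidean level.

  Continuity jointly in a parameter, such as a group element or a point of a morphism space, rests
  on one property of the product \<open>k_prod\<close>: it preserves quotient maps.

  Neither (g, y) -> gy nor the comparison induced by restricting representations has an inverse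
  given by a formula. Both inverses are made by arbitrary choices on representatives, a presentation
  z = gy or an extension of an H-representation, and the proof that the choice does not matter is
  the core of each argument.\<close>

definition CGWH :: "'a topology \<Rightarrow> bool" where
  "CGWH X \<longleftrightarrow> compactly_generated X \<and> weak_Hausdorff X"

lemma based_CGWH_iff: "based_CGWH X \<longleftrightarrow> pt X \<in> topspace (ptop X) \<and> CGWH (ptop X)"
  by (auto simp: based_CGWH_def CGWH_def)

lemma continuous_map_point: "continuous_map X Y f \<Longrightarrow> x \<in> topspace X \<Longrightarrow> f x \<in> topspace Y"
  using continuous_map_funspace by blast

lemma continuous_map_comp: "continuous_map Y Z g \<Longrightarrow> continuous_map X Y f \<Longrightarrow> continuous_map X Z (\<lambda>x. g (f x))"
  using continuous_map_compose[of X Y f Z g] by (simp add: o_def)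

lemma topspace_quotient_topology [simp]: "topspace (quotient_topology X q) = q ` topspace X"
proof -
  have "{x \<in> topspace X. q x \<in> q ` topspace X} = topspace X" by auto
  then have "openin (quotient_topology X q) (q ` topspace X)"
    by (simp add: openin_quotient_topology)
  moreover have "topspace (quotient_topology X q) \<subseteq> q ` topspace X"
    using openin_quotient_topology[of X q "topspace (quotient_topology X q)"] by simp
  ultimately show ?thesis by (simp add: openin_subset subset_antisym)
qed

lemma quotient_map_quotient_topology: "quotient_map X (quotient_topology X q) q"
  by (auto simp: quotient_map_def openin_quotient_topology)

lemma homeomorphic_map_quotient_topology:
  "inj_on e (topspace X) \<Longrightarrow> homeomorphic_map X (quotient_topology X e) e"
  by (simp add: homeomorphic_map_def quotient_map_quotient_topology)

text \<open>Copies a test space along an injection, so that it gets the type over which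
  \<open>weak_Hausdorff\<close> and \<open>k_open\<close> quantify.\<close>

lemma homeomorphic_copy:
  assumes "inj_on e (topspace X)"
  obtains Y j where "homeomorphic_maps X Y e j"
  using homeomorphic_map_quotient_topology[OF assms] homeomorphic_map_maps by blast

lemma homeomorphic_maps_compact_Hausdorff:
  assumes "homeomorphic_maps X Y e j" "compact_space X" "Hausdorff_space X"
  shows "compact_space Y" "Hausdorff_space Y"
  using assms homeomorphic_Hausdorff_space homeomorphic_compact_space homeomorphic_maps_imp_homeomorphic_space
  by (metis homeomorphic_space_def)+

section \<open>Weak Hausdorff spaces\<close>

text \<open>Points of the closure of a set \<open>S\<close> of fibre representatives are determined by the traces
  on \<open>S\<close> of their neighbourhoods.\<close>

lemma test_space_image:
  fixes K :: "'k topology" and X :: "'a topology"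
  assumes K: "compact_space K" "Hausdorff_space K" and u: "continuous_map K X u"
  obtains L :: "'a set set topology" and v
  where "compact_space L" "Hausdorff_space L" "continuous_map L X v" "v ` topspace L = u ` topspace K"
proof -
  define S where "S = inv_into (topspace K) u ` u ` topspace K"
  define C where "C = K closure_of S"
  \<comment> \<open>\<open>u\<close> is injective on \<open>S\<close>, so the trace of a
    neighbourhood on \<open>S\<close> can be recorded by its image in \<open>X\<close>. This makes
    \<open>e k\<close> a set of subsets of \<open>X\<close>, a point of the prescribed type.\<close>
  define e where "e k = {u ` (U \<inter> S) | U. openin K U \<and> k \<in> U}" for k
  have SK: "S \<subseteq> topspace K" unfolding S_def by (auto intro: inv_into_into)
  have injS: "inj_on u S"
    unfolding S_def by (rule inj_onI) (auto simp: f_inv_into_f)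
  have SC: "S \<subseteq> C" unfolding C_def by (simp add: SK closure_of_subset)
  have CK: "C \<subseteq> topspace K" unfolding C_def by (simp add: closure_of_subset_topspace)
  have closedC: "closedin K C" unfolding C_def by simp
  have "inj_on e C"
  proof (rule inj_onI, rule ccontr)
    fix k k' assume k: "k \<in> C" "k' \<in> C" "e k = e k'" "k \<noteq> k'"
    have "k \<in> topspace K" "k' \<in> topspace K" using k CK by auto
    then obtain U U' where U: "openin K U" "openin K U'" "k \<in> U" "k' \<in> U'" "disjnt U U'"
      using K(2) k(4) unfolding Hausdorff_space_def by metis
    have "u ` (U \<inter> S) \<in> e k'" using U k(3) unfolding e_def by blast
    then obtain U2 where U2: "openin K U2" "k' \<in> U2" "u ` (U \<inter> S) = u ` (U2 \<inter> S)"
      unfolding e_def by blast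
    then have eq: "U \<inter> S = U2 \<inter> S" using inj_on_image_eq_iff[OF injS, of "U \<inter> S" "U2 \<inter> S"] by simp
    \<comment> \<open>\<open>k'\<close> is adherent to \<open>S\<close>, so \<open>S\<close> has a
      point in both \<open>U2\<close> and \<open>U'\<close>. Equality of traces puts it in
      \<open>U\<close> as well, but \<open>U\<close> and \<open>U'\<close> are disjoint.\<close>
    have "openin K (U2 \<inter> U')" "k' \<in> U2 \<inter> U'" using U U2 by auto
    then obtain s where "s \<in> S" "s \<in> U2 \<inter> U'"
      using k(2) unfolding C_def in_closure_of by metis
    then show False using eq U by (auto simp: disjnt_iff)
  qed
  then obtain L j where L: "homeomorphic_maps (subtopology K C) L e j"
    using CK homeomorphic_copy[of e "subtopology K C"]
    by (metis closedC closedin_subset topspace_subtopology_subset)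
  have cC: "compact_space (subtopology K C)" "Hausdorff_space (subtopology K C)"
    using K closedC closedin_compact_space compact_space_subtopology Hausdorff_space_subtopology by blast+
  show ?thesis
  proof
    show "compact_space L" "Hausdorff_space L"
      using homeomorphic_maps_compact_Hausdorff[OF L cC] by auto
    show "continuous_map L X (u \<circ> j)"
      using L u by (meson continuous_map_compose continuous_map_from_subtopology homeomorphic_maps_def)
    have "j ` topspace L = C"
      using L CK by (metis closedC closedin_subset homeomorphic_imp_surjective_map homeomorphic_maps_map topspace_subtopology_subset)
    moreover have "u ` S = u ` topspace K"
      unfolding S_def by (rule image_inv_into_cancel) auto
    ultimately show "(u \<circ> j) ` topspace L = u ` topspace K"
      using image_mono[OF SC, of u] image_mono[OF CK, of u]
      by (metis image_comp subset_antisym)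
  qed
qed

text \<open>\<open>test_space_image\<close> replaces \<open>K\<close> by a space of the prescribed
  type with the same image.\<close>

lemma WH_closed_image:
  assumes "weak_Hausdorff X" "compact_space K" "Hausdorff_space K" "continuous_map K X u"
  shows "closedin X (u ` topspace K)"
  using test_space_image[OF assms(2-4)] assms(1) unfolding weak_Hausdorff_def by metis

lemma WH_closed_map:
  assumes "weak_Hausdorff X" "compact_space K" "Hausdorff_space K" "continuous_map K X u"
  shows "closed_map K X u"
  unfolding closed_map_def
proof (intro allI impI)
  fix C assume C: "closedin K C"
  then have "compact_space (subtopology K C)" "Hausdorff_space (subtopology K C)"
    using assms closedin_compact_space compact_space_subtopology Hausdorff_space_subtopology by blast+
  then show "closedin X (u ` C)"
    using WH_closed_image[OF assms(1), of "subtopology K C" u] C assms(4)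
    by (metis closedin_subset continuous_map_from_subtopology topspace_subtopology_subset)
qed

text \<open>A compact Hausdorff space is normal, and being normal Hausdorff passes along closed
  continuous surjections.\<close>

lemma WH_Hausdorff_image:
  assumes "weak_Hausdorff X" "compact_space K" "Hausdorff_space K" "continuous_map K X u"
  shows "compact_space (subtopology X (u ` topspace K))" "Hausdorff_space (subtopology X (u ` topspace K))"
proof -
  show "compact_space (subtopology X (u ` topspace K))"
    using assms by (meson compact_space_def compact_space_subtopology image_compactin)
  have im: "u ` topspace K \<subseteq> topspace X" by (simp add: assms(4) continuous_map_image_subset_topspace)
  have "closed_map K (subtopology X (u ` topspace K)) u"
    by (simp add: WH_closed_map assms closed_map_into_subtopology)
  then show "Hausdorff_space (subtopology X (u ` topspace K))"
    using normal_Hausdorff_space_closed_continuous_map_image[of K "subtopology X (u ` topspace K)" u] assms im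
      compact_Hausdorff_or_regular_imp_normal_space continuous_map_into_subtopology
    by (metis image_subset_iff_funcset inf.absorb_iff2 order_refl topspace_subtopology)
qed

text \<open>A test space that injects into the prescribed type can be copied there directly.\<close>

lemma k_openD_inj:
  fixes X :: "'a topology" and K :: "'k topology" and e :: "'k \<Rightarrow> 'a set set"
  assumes U: "k_open X U" and K: "compact_space K" "Hausdorff_space K" and u: "continuous_map K X u"
    and e: "inj_on e (topspace K)"
  shows "openin K {k \<in> topspace K. u k \<in> U}"
proof -
  obtain L j where L: "homeomorphic_maps K L e j" using homeomorphic_copy[OF e] by blast
  note compact_Lp = homeomorphic_maps_compact_Hausdorff[OF L K]
  have "continuous_map L X (u \<circ> j)"
    using L u continuous_map_compose[of L K j X u] by (simp add: homeomorphic_maps_def)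
  then have "openin L {k \<in> topspace L. (u \<circ> j) k \<in> U}" using U compact_Lp unfolding k_open_def by blast
  then have "openin K {k \<in> topspace K. e k \<in> {k \<in> topspace L. (u \<circ> j) k \<in> U}}"
    using L openin_continuous_map_preimage unfolding homeomorphic_maps_def by blast
  moreover have "{k \<in> topspace K. e k \<in> {k \<in> topspace L. (u \<circ> j) k \<in> U}} = {k \<in> topspace K. u k \<in> U}"
    using L by (auto simp: homeomorphic_maps_def continuous_map_def Pi_iff)
  ultimately show ?thesis by simp
qed

text \<open>The image of a test map into a weak Hausdorff space is itself compact Hausdorff, and its
  points, being points of \<open>X\<close>, inject into the prescribed type as double singletons.
  Test the image, then pull back to \<open>K\<close>.\<close>

lemma k_openD:
  assumes X: "weak_Hausdorff X" and U: "k_open X U"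
    and K: "compact_space K" "Hausdorff_space K" and u: "continuous_map K X u"
  shows "openin K {k \<in> topspace K. u k \<in> U}"
proof -
  let ?D = "subtopology X (u ` topspace K)"
  have im: "u ` topspace K \<subseteq> topspace X" using u by (simp add: continuous_map_image_subset_topspace)
  have "openin ?D {x \<in> topspace ?D. x \<in> U}"
    by (rule k_openD_inj[OF U WH_Hausdorff_image[OF X K u], where e = "\<lambda>x. {{x}}"]) (auto simp: inj_on_def)
  moreover have "continuous_map K ?D u" using u by (simp add: continuous_map_in_subtopology)
  ultimately have "openin K {k \<in> topspace K. u k \<in> {x \<in> topspace ?D. x \<in> U}}"
    using openin_continuous_map_preimage by blast
  moreover have "{k \<in> topspace K. u k \<in> {x \<in> topspace ?D. x \<in> U}} = {k \<in> topspace K. u k \<in> U}"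
    using im by auto
  ultimately show ?thesis by simp
qed

section \<open>Compactly generated topologies and k-ification\<close>

lemma openin_imp_k_open: "openin X U \<Longrightarrow> k_open X U"
  unfolding k_open_def using openin_continuous_map_preimage openin_subset by blast

lemma topspace_k_ification [simp]: "topspace (k_ification X) = topspace X"
  by (metis k_open_def openin_imp_k_open openin_k_ification openin_subset openin_topspace subset_antisym)

lemma topspace_k_prod [simp]: "topspace (k_prod X Y) = topspace X \<times> topspace Y"
  by (simp add: k_prod_def)

lemma continuous_map_from_k_ification:
  "continuous_map X Z f \<Longrightarrow> continuous_map (k_ification X) Z f"
  by (auto simp: continuous_map_def openin_k_ification openin_imp_k_open)

lemma compactly_generatedD:
  "compactly_generated X \<Longrightarrow> k_open X U \<Longrightarrow> openin X U"
  by (simp add: compactly_generated_def)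

lemma compactly_generatedI:
  "(\<And>U. k_open X U \<Longrightarrow> openin X U) \<Longrightarrow> compactly_generated X"
  unfolding compactly_generated_def by (metis openin_imp_k_open)

lemma continuous_map_into_k_ification_test:
  assumes X: "weak_Hausdorff X" and K: "compact_space K" "Hausdorff_space K" and u: "continuous_map K X u"
  shows "continuous_map K (k_ification X) u"
  unfolding continuous_map_def
proof (intro conjI allI impI)
  show "u \<in> topspace K \<rightarrow> topspace (k_ification X)" using u by (simp add: continuous_map_funspace)
qed (simp add: k_openD[OF X _ K u] openin_k_ification)

text \<open>The universal property of \<open>k_ification\<close>: continuity on a compactly
  generated space is tested on compact Hausdorff spaces, and these have the same maps to
  \<open>X\<close> and to its k-ification.\<close>

lemma continuous_map_into_k_ification:
  fixes K :: "'k topology"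
  assumes X: "weak_Hausdorff X" and K: "compactly_generated K" and u: "continuous_map K X u"
  shows "continuous_map K (k_ification X) u"
  unfolding continuous_map_def
proof (intro conjI allI impI)
  show "u \<in> topspace K \<rightarrow> topspace (k_ification X)" using u by (simp add: continuous_map_funspace)
  fix U assume U: "openin (k_ification X) U"
  have "k_open K {x \<in> topspace K. u x \<in> U}"
    unfolding k_open_def
  proof (intro conjI allI impI)
    fix L :: "'k set set topology" and v
    assume L: "compact_space L \<and> Hausdorff_space L \<and> continuous_map L K v"
    then have "openin L {l \<in> topspace L. (u \<circ> v) l \<in> U}"
      using k_openD[OF X] U u openin_k_ification continuous_map_compose by blast
    moreover have "{l \<in> topspace L. (u \<circ> v) l \<in> U} = {l \<in> topspace L. v l \<in> {x \<in> topspace K. u x \<in> U}}"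
      using L by (auto simp: continuous_map_def Pi_iff)
    ultimately show "openin L {l \<in> topspace L. v l \<in> {x \<in> topspace K. u x \<in> U}}" by simp
  qed auto
  then show "openin K {x \<in> topspace K. u x \<in> U}" using K compactly_generatedD by blast
qed

lemma WH_finer:
  assumes "weak_Hausdorff X" "topspace Y = topspace X" "\<And>U. openin X U \<Longrightarrow> openin Y U"
  shows "weak_Hausdorff Y"
  unfolding weak_Hausdorff_def
proof (intro allI impI)
  fix K :: "'a set set topology" and u
  assume K: "compact_space K \<and> Hausdorff_space K \<and> continuous_map K Y u"
  then have "continuous_map K X u" using assms by (auto simp: continuous_map_def)
  then have "closedin X (u ` topspace K)" using K WH_closed_image[OF assms(1)] by blast
  then show "closedin Y (u ` topspace K)" using assms by (auto simp: closedin_def)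
qed

text \<open>Test maps into \<open>X\<close> are test maps into its k-ification, so a second
  k-ification adds no open sets. The topology only gets finer, which preserves weak
  Hausdorffness.\<close>

lemma CGWH_k_ification:
  fixes X :: "'a topology"
  assumes X: "weak_Hausdorff X"
  shows "CGWH (k_ification X)"
  unfolding CGWH_def
proof
  show "compactly_generated (k_ification X)"
  proof (rule compactly_generatedI)
    fix U assume U: "k_open (k_ification X) U"
    show "openin (k_ification X) U"
      unfolding openin_k_ification k_open_def
    proof (intro conjI allI impI)
      show "U \<subseteq> topspace X" using U by (simp add: k_open_def)
      fix K :: "'a set set topology" and u
      assume "compact_space K \<and> Hausdorff_space K \<and> continuous_map K X u"
      then show "openin K {k \<in> topspace K. u k \<in> U}"
        using U continuous_map_into_k_ification_test[OF X] unfolding k_open_def by blast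
    qed
  qed
  show "weak_Hausdorff (k_ification X)"
    using WH_finer[OF X] by (simp add: openin_imp_k_open openin_k_ification)
qed

lemma Hausdorff_imp_WH: "Hausdorff_space X \<Longrightarrow> weak_Hausdorff X"
  unfolding weak_Hausdorff_def
  by (meson compact_space_def compactin_imp_closedin image_compactin)

lemma compact_Hausdorff_imp_CGWH:
  fixes X :: "'a topology"
  assumes "compact_space X" "Hausdorff_space X"
  shows "CGWH X"
  unfolding CGWH_def
proof
  show WH: "weak_Hausdorff X" using assms Hausdorff_imp_WH by blast
  show "compactly_generated X"
  proof (rule compactly_generatedI)
    fix U assume U: "k_open X U"
    have "openin X {x \<in> topspace X. id x \<in> U}"
      using k_openD[OF WH U assms, of id] by simp
    moreover have "{x \<in> topspace X. id x \<in> U} = U" using U by (auto simp: k_open_def)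
    ultimately show "openin X U" by simp
  qed
qed

section \<open>Products of compactly generated weak Hausdorff spaces\<close>

text \<open>The image of a test map lies in the product of its two projections. That product is a
  closed box and a Hausdorff subspace, in which the compact image is closed.\<close>

lemma WH_prod:
  fixes X :: "'a topology" and Y :: "'b topology"
  assumes "weak_Hausdorff X" "weak_Hausdorff Y"
  shows "weak_Hausdorff (prod_topology X Y)"
  unfolding weak_Hausdorff_def
proof (intro allI impI)
  fix K :: "('a \<times> 'b) set set topology" and u
  assume "compact_space K \<and> Hausdorff_space K \<and> continuous_map K (prod_topology X Y) u"
  then have K: "compact_space K" "Hausdorff_space K" and u: "continuous_map K (prod_topology X Y) u"
    and u1: "continuous_map K X (fst \<circ> u)" and u2: "continuous_map K Y (snd \<circ> u)"
    by (simp_all add: continuous_map_pairwise)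
  let ?A = "(fst \<circ> u) ` topspace K" and ?B = "(snd \<circ> u) ` topspace K"
  have sub: "u ` topspace K \<subseteq> ?A \<times> ?B"
  proof
    fix y assume "y \<in> u ` topspace K"
    then obtain k where "k \<in> topspace K" "y = u k" by blast
    then show "y \<in> ?A \<times> ?B" by (metis SigmaI comp_apply imageI prod.collapse)
  qed
  have "Hausdorff_space (subtopology (prod_topology X Y) (?A \<times> ?B))"
    using WH_Hausdorff_image(2)[OF assms(1) K u1] WH_Hausdorff_image(2)[OF assms(2) K u2]
    by (simp add: subtopology_Times Hausdorff_space_prod_topology)
  moreover have "continuous_map K (subtopology (prod_topology X Y) (?A \<times> ?B)) u"
    using u sub by (simp add: continuous_map_in_subtopology image_subset_iff_funcset[symmetric])
  ultimately have "closedin (subtopology (prod_topology X Y) (?A \<times> ?B)) (u ` topspace K)"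
    using K by (meson compact_space_def compactin_imp_closedin image_compactin)
  moreover have "closedin (prod_topology X Y) (?A \<times> ?B)"
    using WH_closed_image[OF assms(1) K u1] WH_closed_image[OF assms(2) K u2]
    by (simp add: closedin_prod_Times_iff)
  ultimately show "closedin (prod_topology X Y) (u ` topspace K)"
    using closedin_trans_full by blast
qed

lemma CGWH_k_prod [intro]: "CGWH X \<Longrightarrow> CGWH Y \<Longrightarrow> CGWH (k_prod X Y)"
  unfolding k_prod_def by (simp add: CGWH_def CGWH_k_ification[unfolded CGWH_def] WH_prod)

lemma k_prod_fst: "continuous_map (k_prod X Y) X fst"
  and k_prod_snd: "continuous_map (k_prod X Y) Y snd"
  unfolding k_prod_def by (simp_all add: continuous_map_from_k_ification continuous_map_fst continuous_map_snd)

lemma continuous_map_into_k_prod: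
  assumes "CGWH X" "CGWH Y" "CGWH K" "continuous_map K X u" "continuous_map K Y v"
  shows "continuous_map K (k_prod X Y) (\<lambda>k. (u k, v k))"
  unfolding k_prod_def
  using assms by (intro continuous_map_into_k_ification) (auto simp: CGWH_def WH_prod continuous_map_pairedI)

lemma continuous_map_from_prod_topology:
  "continuous_map (prod_topology X Y) Z f \<Longrightarrow> continuous_map (k_prod X Y) Z f"
  unfolding k_prod_def by (rule continuous_map_from_k_ification)

lemma k_prod_eq_prod_topology:
  assumes "compactly_generated (prod_topology X Y)"
  shows "k_prod X Y = prod_topology X Y"
  using assms unfolding k_prod_def topology_eq openin_k_ification compactly_generated_def by simp

lemma continuous_map_k_prod_comp:
  assumes f: "continuous_map (k_prod X Y) Z (\<lambda>(x, y). f x y)" and "CGWH X" "CGWH Y" "CGWH K"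
    and "continuous_map K X u" "continuous_map K Y v"
  shows "continuous_map K Z (\<lambda>k. f (u k) (v k))"
  using continuous_map_compose[OF continuous_map_into_k_prod[OF assms(2-6)] f] by (simp add: o_def)

text \<open>A point is the image of a one-point test space.\<close>

lemma closedin_WH_point:
  assumes "weak_Hausdorff X" "x \<in> topspace X"
  shows "closedin X {x}"
  using WH_closed_image[OF assms(1), of "discrete_topology {()}" "\<lambda>_. x"] assms(2)
  by (simp add: compact_space_discrete_topology)

text \<open>A test map into the product is a pair of test maps; the complement of \<open>S\<close>
  is then k-open by definition.\<close>

lemma closedin_k_prodI:
  fixes X :: "'a topology" and Y :: "'b topology"
  assumes S: "S \<subseteq> topspace X \<times> topspace Y"
    and test: "\<And>(K :: ('a \<times> 'b) set set topology) u v. compact_space K \<Longrightarrow> Hausdorff_space K \<Longrightarrow>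
      continuous_map K X u \<Longrightarrow> continuous_map K Y v \<Longrightarrow> closedin K {k \<in> topspace K. (u k, v k) \<in> S}"
  shows "closedin (k_prod X Y) S"
proof -
  have "k_open (prod_topology X Y) (topspace X \<times> topspace Y - S)"
    unfolding k_open_def
  proof (intro conjI allI impI)
    fix K :: "('a \<times> 'b) set set topology" and u
    assume K: "compact_space K \<and> Hausdorff_space K \<and> continuous_map K (prod_topology X Y) u"
    then have "closedin K {k \<in> topspace K. ((fst \<circ> u) k, (snd \<circ> u) k) \<in> S}"
      by (intro test) (auto simp: continuous_map_pairwise o_def)
    then have "openin K (topspace K - {k \<in> topspace K. ((fst \<circ> u) k, (snd \<circ> u) k) \<in> S})" by blast
    moreover have "topspace K - {k \<in> topspace K. ((fst \<circ> u) k, (snd \<circ> u) k) \<in> S}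
        = {k \<in> topspace K. u k \<in> topspace X \<times> topspace Y - S}"
      using K continuous_map_funspace[of K "prod_topology X Y" u] by (auto simp: Pi_iff)
    ultimately show "openin K {k \<in> topspace K. u k \<in> topspace X \<times> topspace Y - S}" by simp
  qed auto
  then show ?thesis
    using S by (simp add: closedin_def k_prod_def openin_k_ification[symmetric])
qed

text \<open>Two test maps \<open>u\<close> and \<open>v\<close> can only agree where
  \<open>v\<close> lands in the closed set \<open>u(K)\<close>. On that closed part of
  \<open>K\<close> both take values in a Hausdorff space, where the coincidence set is
  closed.\<close>

lemma closedin_diagonal_k_prod:
  assumes X: "weak_Hausdorff X"
  shows "closedin (k_prod X X) {(x, y). x \<in> topspace X \<and> x = y}"
proof (rule closedin_k_prodI)
  fix K :: "('a \<times> 'a) set set topology" and u v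
  assume K: "compact_space K" "Hausdorff_space K" and u: "continuous_map K X u" and v: "continuous_map K X v"
  let ?A = "u ` topspace K" and ?K' = "{k \<in> topspace K. v k \<in> u ` topspace K}"
  have K': "closedin K ?K'"
    using WH_closed_image[OF X K u] v closedin_continuous_map_preimage by blast
  have "closedin (subtopology K ?K') {k \<in> topspace (subtopology K ?K'). u k = v k}"
  proof (rule closedin_continuous_maps_eq)
    show "Hausdorff_space (subtopology X ?A)" by (rule WH_Hausdorff_image[OF X K u])
    show "continuous_map (subtopology K ?K') (subtopology X ?A) u"
      using u by (auto simp: continuous_map_in_subtopology continuous_map_from_subtopology)
    show "continuous_map (subtopology K ?K') (subtopology X ?A) v"
      using v by (auto simp: continuous_map_in_subtopology continuous_map_from_subtopology)
  qed
  then have "closedin K {k \<in> topspace (subtopology K ?K'). u k = v k}"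
    using K' closedin_trans_full by blast
  moreover have "{k \<in> topspace (subtopology K ?K'). u k = v k}
      = {k \<in> topspace K. (u k, v k) \<in> {(x, y). x \<in> topspace X \<and> x = y}}"
    using continuous_map_point[OF u] by (auto simp: image_iff) metis
  ultimately show "closedin K {k \<in> topspace K. (u k, v k) \<in> {(x, y). x \<in> topspace X \<and> x = y}}" by simp
qed auto

text \<open>Pull back the diagonal of \<open>Z\<close>. The kernel of a map to such a space is thus
  one of the closed equivalence relations over which \<open>closed_equiv_hull\<close> is
  intersected.\<close>

lemma closedin_kernel:
  assumes X: "CGWH X" and Z: "CGWH Z" and f: "continuous_map X Z f"
  shows "closedin (k_prod X X) {(x, y). x \<in> topspace X \<and> y \<in> topspace X \<and> f x = f y}"
proof -
  have "continuous_map (k_prod X X) (k_prod Z Z) (\<lambda>p. ((f \<circ> fst) p, (f \<circ> snd) p))"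
    using X Z f by (intro continuous_map_into_k_prod continuous_map_compose[OF k_prod_fst f]
        continuous_map_compose[OF k_prod_snd f] CGWH_k_prod)
  moreover have "weak_Hausdorff Z" using Z by (simp add: CGWH_def)
  ultimately have "closedin (k_prod X X) {p \<in> topspace (k_prod X X).
      ((f \<circ> fst) p, (f \<circ> snd) p) \<in> {(x, y). x \<in> topspace Z \<and> x = y}}"
    using closedin_continuous_map_preimage[OF _ closedin_diagonal_k_prod] by blast
  moreover have "{p \<in> topspace (k_prod X X). ((f \<circ> fst) p, (f \<circ> snd) p) \<in> {(x, y). x \<in> topspace Z \<and> x = y}}
      = {(x, y). x \<in> topspace X \<and> y \<in> topspace X \<and> f x = f y}"
  proof (rule Set.set_eqI)
    fix p :: "'a \<times> 'a"
    obtain x y where p: "p = (x, y)" by (cases p)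
    show "p \<in> {p \<in> topspace (k_prod X X). ((f \<circ> fst) p, (f \<circ> snd) p) \<in> {(x, y). x \<in> topspace Z \<and> x = y}}
      \<longleftrightarrow> p \<in> {(x, y). x \<in> topspace X \<and> y \<in> topspace X \<and> f x = f y}"
      unfolding p using continuous_map_point[OF f, of x] by simp blast
  qed
  ultimately show ?thesis by simp
qed

section \<open>Products with quotient maps\<close>

text \<open>Around (x0, k0), regularity of \<open>K\<close> gives a compact neighbourhood
  \<open>C\<close> of k0 inside the slice of \<open>W\<close> over x0. The points whose slice
  contains \<open>C\<close> form an open set of \<open>X\<close>, because the tube lemma makes it
  k-open; an open box around (x0, k0) results.\<close>

lemma openin_prod_test:
  fixes X :: "'a topology" and K :: "'k topology"
  assumes X: "compactly_generated X" and K: "compact_space K" "Hausdorff_space K"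
    and W: "W \<subseteq> topspace X \<times> topspace K"
    and slice: "\<And>x. x \<in> topspace X \<Longrightarrow> openin K {k \<in> topspace K. (x, k) \<in> W}"
    and test: "\<And>(L :: 'a set set topology) u. compact_space L \<Longrightarrow> Hausdorff_space L \<Longrightarrow> continuous_map L X u \<Longrightarrow>
      openin (prod_topology L K) {(l, k). l \<in> topspace L \<and> k \<in> topspace K \<and> (u l, k) \<in> W}"
  shows "openin (prod_topology X K) W"
proof (subst openin_subopen, intro ballI)
  fix p assume "p \<in> W"
  then obtain x0 k0 where p: "p = (x0, k0)" "x0 \<in> topspace X" "k0 \<in> topspace K" "(x0, k0) \<in> W" using W by auto
  have "neighbourhood_base_of (closedin K) K"
    using K by (simp add: compact_Hausdorff_imp_regular_space neighbourhood_base_of_closedin)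
  then obtain U C where U: "openin K U" "closedin K C" "k0 \<in> U" "U \<subseteq> C" "C \<subseteq> {k \<in> topspace K. (x0, k) \<in> W}"
    using slice[OF p(2)] p(3,4)
    unfolding neighbourhood_base_of_def neighbourhood_base_at_def by (metis (no_types, lifting) mem_Collect_eq)
  have cC: "compactin K C" using U K by (simp add: closedin_compact_space)
  define V where "V = {x \<in> topspace X. \<forall>k\<in>C. (x, k) \<in> W}"
  have "k_open X V"
    unfolding k_open_def
  proof (intro conjI allI impI)
    fix L :: "'a set set topology" and u
    assume L: "compact_space L \<and> Hausdorff_space L \<and> continuous_map L X u"
    let ?W = "{(l, k). l \<in> topspace L \<and> k \<in> topspace K \<and> (u l, k) \<in> W}"
    have oW: "openin (prod_topology L K) ?W" using L test by blast
    show "openin L {k \<in> topspace L. u k \<in> V}"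
    proof (subst openin_subopen, intro ballI)
      fix l assume "l \<in> {k \<in> topspace L. u k \<in> V}"
      then have l: "l \<in> topspace L" "{l} \<times> C \<subseteq> ?W" using U by (auto simp: V_def)
      \<comment> \<open>Compactness of \<open>C\<close> thickens the slice over \<open>l\<close> to
        a strip over a neighbourhood of \<open>l\<close>.\<close>
      obtain A B where AB: "openin L A" "openin K B" "l \<in> A" "C \<subseteq> B" "A \<times> B \<subseteq> ?W"
        using tube_lemma_right[OF oW cC l] by blast
      have "A \<subseteq> {k \<in> topspace L. u k \<in> V}"
      proof
        fix a assume a: "a \<in> A"
        then have "a \<in> topspace L" using AB openin_subset by blast
        moreover have "u a \<in> topspace X" using L calculation continuous_map_funspace by blast
        moreover have "(u a, k) \<in> W" if "k \<in> C" for k using AB a that by blast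
        ultimately show "a \<in> {k \<in> topspace L. u k \<in> V}" by (simp add: V_def)
      qed
      then show "\<exists>T. openin L T \<and> l \<in> T \<and> T \<subseteq> {k \<in> topspace L. u k \<in> V}" using AB by blast
    qed
  qed (auto simp: V_def)
  then have "openin X V" using X compactly_generatedD by blast
  then have "openin (prod_topology X K) (V \<times> U)" using U by (simp add: openin_prod_Times_iff)
  moreover have "p \<in> V \<times> U" using p U by (auto simp: V_def)
  moreover have "V \<times> U \<subseteq> W" using U by (auto simp: V_def)
  ultimately show "\<exists>T. openin (prod_topology X K) T \<and> p \<in> T \<and> T \<subseteq> W" by blast
qed

text \<open>The key to products with quotient maps. Against a test map (a, b) the factor
  \<open>Y\<close> can be replaced by the test space \<open>K\<close> through \<open>b\<close>, and
  the ordinary product of a quotient map with the locally compact space \<open>K\<close> is again a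
  quotient map.\<close>

lemma k_prod_quotient_test:
  fixes X :: "'a topology" and Y :: "'b topology" and Z :: "'z topology" and K :: "'k topology"
  assumes X: "CGWH X" and Y: "weak_Hausdorff Y" and q: "quotient_map X Z q"
    and P: "k_open (prod_topology X Y) {(x, y). x \<in> topspace X \<and> y \<in> topspace Y \<and> (q x, y) \<in> U}"
    and K: "compact_space K" "Hausdorff_space K" and a: "continuous_map K Z a" and b: "continuous_map K Y b"
  shows "openin K {k \<in> topspace K. (a k, b k) \<in> U}"
proof -
  let ?P = "{(x, y). x \<in> topspace X \<and> y \<in> topspace Y \<and> (q x, y) \<in> U}"
  define W where "W = {(x, k). x \<in> topspace X \<and> k \<in> topspace K \<and> (q x, b k) \<in> U}"
  have WH: "weak_Hausdorff (prod_topology X Y)" using X Y by (simp add: CGWH_def WH_prod)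
  have bY: "b k \<in> topspace Y" if "k \<in> topspace K" for k using b that continuous_map_funspace by blast
  have oW: "openin (prod_topology X K) W"
  proof (rule openin_prod_test)
    fix x assume x: "x \<in> topspace X"
    then have "continuous_map K (prod_topology X Y) (\<lambda>k. (x, b k))" using b by (simp add: continuous_map_paired)
    from k_openD[OF WH P K this] show "openin K {k \<in> topspace K. (x, k) \<in> W}"
      using x bY by (auto simp: W_def cong: conj_cong)
  next
    fix L :: "'a set set topology" and u
    assume L: "compact_space L" "Hausdorff_space L" "continuous_map L X u"
    have "continuous_map (prod_topology L K) (prod_topology X Y) (\<lambda>p. ((u \<circ> fst) p, (b \<circ> snd) p))"
      using L b by (intro continuous_map_pairedI continuous_map_compose[OF continuous_map_fst]
          continuous_map_compose[OF continuous_map_snd])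
    moreover have "compact_space (prod_topology L K)" "Hausdorff_space (prod_topology L K)"
      using L K by (simp_all add: compact_space_prod_topology Hausdorff_space_prod_topology)
    ultimately have "openin (prod_topology L K) {p \<in> topspace (prod_topology L K). ((u \<circ> fst) p, (b \<circ> snd) p) \<in> ?P}"
      using k_openD[OF WH P] by blast
    moreover have "{p \<in> topspace (prod_topology L K). ((u \<circ> fst) p, (b \<circ> snd) p) \<in> ?P}
       = {(l, k). l \<in> topspace L \<and> k \<in> topspace K \<and> (u l, k) \<in> W}"
      using L(3) bY continuous_map_funspace by (fastforce simp: W_def)
    ultimately show "openin (prod_topology L K) {(l, k). l \<in> topspace L \<and> k \<in> topspace K \<and> (u l, k) \<in> W}" by simp
  qed (use X K in \<open>auto simp: W_def CGWH_def\<close>)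
  \<comment> \<open>The set \<open>U\<close> pulled back along \<open>b\<close> in the second
    coordinate. The test map then factors through the graph k -> (a k, k).\<close>
  define U' where "U' = {(z, k). z \<in> topspace Z \<and> k \<in> topspace K \<and> (z, b k) \<in> U}"
  have qi: "q ` topspace X = topspace Z" using q by (simp add: quotient_map_def)
  have "quotient_map (prod_topology X K) (prod_topology Z K) (\<lambda>(x, y). (q x, y))"
    using K q by (intro quotient_map_prod_left) (auto simp: compact_imp_locally_compact_space)
  moreover have "W = {p \<in> topspace (prod_topology X K). (\<lambda>(x, y). (q x, y)) p \<in> U'}"
    using qi by (auto simp: W_def U'_def)
  moreover have "U' \<subseteq> topspace (prod_topology Z K)" by (auto simp: U'_def)
  ultimately have "openin (prod_topology Z K) U'" using oW by (simp add: quotient_map_def)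
  moreover have "continuous_map K (prod_topology Z K) (\<lambda>k. (a k, id k))"
    using a by (intro continuous_map_pairedI) auto
  ultimately have "openin K {k \<in> topspace K. (a k, id k) \<in> U'}" using openin_continuous_map_preimage by blast
  moreover have "{k \<in> topspace K. (a k, id k) \<in> U'} = {k \<in> topspace K. (a k, b k) \<in> U}"
    using a continuous_map_funspace by (fastforce simp: U'_def)
  ultimately show ?thesis by simp
qed

text \<open>For a test map \<open>u\<close> to \<open>Z\<close>, the preimage of its image in
  \<open>X\<close> has to be closed. Against v : L -> X, the pairs (k, l) with u k = q (v l) form a
  closed set since the kernel of \<open>q\<close> is closed, and projecting away the compact factor
  \<open>K\<close> keeps it closed.\<close>

lemma CGWH_quotient:
  fixes X :: "'a topology" and Z :: "'z topology"
  assumes X: "CGWH X" and q: "quotient_map X Z q"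
    and E: "closedin (k_prod X X) {(x, y). x \<in> topspace X \<and> y \<in> topspace X \<and> q x = q y}"
  shows "CGWH Z"
proof -
  have WHX: "weak_Hausdorff X" and CGX: "compactly_generated X" using X by (auto simp: CGWH_def)
  \<comment> \<open>The complement of the kernel of \<open>q\<close> with its first coordinate
    already pushed down to \<open>Z\<close>, the shape that \<open>k_prod_quotient_test\<close>
    expects.\<close>
  let ?U = "{(z, x). x \<in> topspace X \<and> z \<noteq> q x}"
  have qi: "q ` topspace X = topspace Z" using q by (simp add: quotient_map_def)
  have qc: "continuous_map X Z q" using q by (rule quotient_imp_continuous_map)
  have "openin (k_prod X X) (topspace (k_prod X X) - {(x, y). x \<in> topspace X \<and> y \<in> topspace X \<and> q x = q y})"
    using E by blast
  moreover have "topspace (k_prod X X) - {(x, y). x \<in> topspace X \<and> y \<in> topspace X \<and> q x = q y}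
      = {(x, y). x \<in> topspace X \<and> y \<in> topspace X \<and> (q x, y) \<in> ?U}" by auto
  ultimately have P: "k_open (prod_topology X X) {(x, y). x \<in> topspace X \<and> y \<in> topspace X \<and> (q x, y) \<in> ?U}"
    unfolding k_prod_def openin_k_ification by (simp only:)
  have WHZ: "weak_Hausdorff Z"
    unfolding weak_Hausdorff_def
  proof (intro allI impI)
    fix K :: "'z set set topology" and u
    assume K: "compact_space K \<and> Hausdorff_space K \<and> continuous_map K Z u"
    let ?S = "{x \<in> topspace X. q x \<in> u ` topspace K}"
    have "k_open X (topspace X - ?S)"
      unfolding k_open_def
    proof (intro conjI allI impI)
      fix L :: "'a set set topology" and v
      assume L: "compact_space L \<and> Hausdorff_space L \<and> continuous_map L X v"
      have vX: "v l \<in> topspace X" if "l \<in> topspace L" for l using L that continuous_map_funspace by blast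
      let ?D = "{p \<in> topspace (prod_topology K L). u (fst p) = q (v (snd p))}"
      have "openin (prod_topology K L) {p \<in> topspace (prod_topology K L). ((u \<circ> fst) p, (v \<circ> snd) p) \<in> ?U}"
        using K L by (intro k_prod_quotient_test[OF X WHX q P])
          (auto simp: compact_space_prod_topology Hausdorff_space_prod_topology o_def
            intro: continuous_map_comp[OF _ continuous_map_fst] continuous_map_comp[OF _ continuous_map_snd])
      moreover have "{p \<in> topspace (prod_topology K L). ((u \<circ> fst) p, (v \<circ> snd) p) \<in> ?U}
          = topspace (prod_topology K L) - ?D"
        using vX by auto
      ultimately have "closedin (prod_topology K L) ?D" by (simp add: closedin_def)
      moreover have "closed_map (prod_topology K L) L snd" using K closed_map_snd by blast
      ultimately have "closedin L (snd ` ?D)" unfolding closed_map_def by blast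
      then have "openin L (topspace L - snd ` ?D)" by blast
      moreover have "snd ` ?D = {l \<in> topspace L. q (v l) \<in> u ` topspace K}"
        by (force simp: image_iff)
      moreover have "topspace L - {l \<in> topspace L. q (v l) \<in> u ` topspace K}
          = {l \<in> topspace L. v l \<in> topspace X - ?S}"
        using vX by auto
      ultimately show "openin L {k \<in> topspace L. v k \<in> topspace X - ?S}" by simp
    qed auto
    then have "closedin X ?S" using CGX compactly_generatedD by (auto simp: closedin_def)
    then show "closedin Z (u ` topspace K)"
      using q K continuous_map_image_subset_topspace[of K Z u] unfolding quotient_map_closedin by blast
  qed
  moreover have "compactly_generated Z"
  proof (rule compactly_generatedI)
    fix U assume U: "k_open Z U"
    have "k_open X {x \<in> topspace X. q x \<in> U}"
      unfolding k_open_def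
    proof (intro conjI allI impI)
      fix L :: "'a set set topology" and v
      assume L: "compact_space L \<and> Hausdorff_space L \<and> continuous_map L X v"
      then have "openin L {l \<in> topspace L. (q \<circ> v) l \<in> U}"
        using k_openD[OF WHZ U] qc continuous_map_compose by blast
      moreover have "{l \<in> topspace L. (q \<circ> v) l \<in> U} = {l \<in> topspace L. v l \<in> {x \<in> topspace X. q x \<in> U}}"
        using L continuous_map_funspace by fastforce
      ultimately show "openin L {k \<in> topspace L. v k \<in> {x \<in> topspace X. q x \<in> U}}" by simp
    qed auto
    then show "openin Z U" using q U CGX compactly_generatedD unfolding quotient_map_def k_open_def by blast
  qed
  ultimately show ?thesis by (simp add: CGWH_def)
qed

text \<open>\<open>k_prod\<close> preserves quotient maps: openness in the product is decided by
  test maps, and those are handled by \<open>k_prod_quotient_test\<close>.\<close>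

lemma k_open_quotient_prod:
  assumes X: "CGWH X" and S: "CGWH S" and Z: "CGWH Z" and q: "quotient_map X Z q"
  shows "quotient_map (k_prod X S) (k_prod Z S) (\<lambda>(x, s). (q x, s))"
  unfolding quotient_map_def
proof (intro conjI allI impI)
  show "(\<lambda>(x, s). (q x, s)) ` topspace (k_prod X S) = topspace (k_prod Z S)"
    using q by (auto simp: quotient_map_def image_iff) blast+
  have qc: "continuous_map X Z q" using q by (rule quotient_imp_continuous_map)
  have c: "continuous_map (k_prod X S) (k_prod Z S) (\<lambda>p. (q (fst p), snd p))"
    using X S Z by (intro continuous_map_into_k_prod CGWH_k_prod continuous_map_comp[OF qc k_prod_fst] k_prod_snd)
  fix U assume U: "U \<subseteq> topspace (k_prod Z S)"
  let ?P = "{x \<in> topspace (k_prod X S). (case x of (x, s) \<Rightarrow> (q x, s)) \<in> U}"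
  show "openin (k_prod X S) ?P = openin (k_prod Z S) U"
  proof
    assume P: "openin (k_prod X S) ?P"
    have "?P = {(x, y). x \<in> topspace X \<and> y \<in> topspace S \<and> (q x, y) \<in> U}" by auto
    then have P': "k_open (prod_topology X S) {(x, y). x \<in> topspace X \<and> y \<in> topspace S \<and> (q x, y) \<in> U}"
      using P unfolding k_prod_def openin_k_ification by (simp only:)
    show "openin (k_prod Z S) U"
      unfolding k_prod_def openin_k_ification k_open_def
    proof (intro conjI allI impI)
      show "U \<subseteq> topspace (prod_topology Z S)" using U by simp
      fix K :: "('c \<times> 'b) set set topology" and u
      assume K: "compact_space K \<and> Hausdorff_space K \<and> continuous_map K (prod_topology Z S) u"
      then have "openin K {k \<in> topspace K. (fst (u k), snd (u k)) \<in> U}"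
        using S by (intro k_prod_quotient_test[OF X _ q P']) (auto simp: CGWH_def continuous_map_pairwise o_def)
      then show "openin K {k \<in> topspace K. u k \<in> U}" by simp
    qed
  next
    assume "openin (k_prod Z S) U"
    from openin_continuous_map_preimage[OF c this] show "openin (k_prod X S) ?P" by (simp add: case_prod_beta)
  qed
qed

lemma continuous_map_k_prod_swap:
  assumes "CGWH X" "CGWH Y" "continuous_map (k_prod X Y) Z (\<lambda>(x, y). f x y)"
  shows "continuous_map (k_prod Y X) Z (\<lambda>(y, x). f x y)"
  using continuous_map_k_prod_comp[OF assms(3,1,2) CGWH_k_prod[OF assms(2,1)] k_prod_snd k_prod_fst]
  by (simp add: case_prod_beta')

text \<open>For families of maps on a quotient that must be continuous jointly with a parameter in
  \<open>S\<close>, as for group actions and structure maps.\<close>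

lemma continuous_map_quotient_param:
  assumes X: "CGWH X" and S: "CGWH S" and Z: "CGWH Z" and q: "quotient_map X Z q"
    and h: "continuous_map (k_prod S X) W (\<lambda>(s, x). h s (q x))"
  shows "continuous_map (k_prod S Z) W (\<lambda>(s, z). h s z)"
proof -
  have "continuous_map (k_prod X S) W (\<lambda>(x, s). h s (q x))"
    using continuous_map_k_prod_swap[OF S X h] .
  then have "continuous_map (k_prod X S) W ((\<lambda>(z, s). h s z) \<circ> (\<lambda>(x, s). (q x, s)))"
    by (simp add: o_def case_prod_beta')
  then have "continuous_map (k_prod Z S) W (\<lambda>(z, s). h s z)"
    using k_open_quotient_prod[OF X S Z q] continuous_compose_quotient_map by blast
  then show ?thesis using continuous_map_k_prod_swap[OF Z S, of W "\<lambda>z s. h s z"] by simp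
qed

section \<open>Constructions with compactly generated weak Hausdorff spaces\<close>

text \<open>A k-open subset of \<open>C\<close> becomes k-open in \<open>X\<close> once the
  complement of \<open>C\<close> is added, because a test map into \<open>X\<close> restricts to a
  test map on the closed, hence compact, preimage of \<open>C\<close>.\<close>

lemma CGWH_closed_subtopology:
  fixes X :: "'a topology"
  assumes X: "CGWH X" and C: "closedin X C"
  shows "CGWH (subtopology X C)"
  unfolding CGWH_def
proof
  have CX: "C \<subseteq> topspace X" using C closedin_subset by blast
  show "weak_Hausdorff (subtopology X C)"
    unfolding weak_Hausdorff_def
  proof (intro allI impI)
    fix K :: "'a set set topology" and u
    assume "compact_space K \<and> Hausdorff_space K \<and> continuous_map K (subtopology X C) u"
    then show "closedin (subtopology X C) (u ` topspace K)"
      using X C WH_closed_image[of X K u]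
      by (auto simp: CGWH_def continuous_map_in_subtopology closedin_closed_subtopology)
  qed
  show "compactly_generated (subtopology X C)"
  proof (rule compactly_generatedI)
    fix U assume U: "k_open (subtopology X C) U"
    have "k_open X (U \<union> (topspace X - C))"
      unfolding k_open_def
    proof (intro conjI allI impI)
      show "U \<union> (topspace X - C) \<subseteq> topspace X" using U CX by (auto simp: k_open_def)
      fix K :: "'a set set topology" and u
      assume K: "compact_space K \<and> Hausdorff_space K \<and> continuous_map K X u"
      let ?K = "{k \<in> topspace K. u k \<in> C}"
      have clK: "closedin K ?K" using K C closedin_continuous_map_preimage by blast
      have "compact_space (subtopology K ?K)" "Hausdorff_space (subtopology K ?K)"
        using K clK closedin_compact_space compact_space_subtopology Hausdorff_space_subtopology by blast+
      moreover have "continuous_map (subtopology K ?K) (subtopology X C) u"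
        using K by (auto simp: continuous_map_in_subtopology continuous_map_from_subtopology)
      ultimately have "openin (subtopology K ?K) {k \<in> topspace (subtopology K ?K). u k \<in> U}"
        using U unfolding k_open_def by blast
      then have "closedin (subtopology K ?K) (topspace (subtopology K ?K) - {k \<in> topspace (subtopology K ?K). u k \<in> U})"
        by blast
      then have "closedin K (topspace (subtopology K ?K) - {k \<in> topspace (subtopology K ?K). u k \<in> U})"
        using clK closedin_trans_full by blast
      then have "openin K (topspace K - (topspace (subtopology K ?K) - {k \<in> topspace (subtopology K ?K). u k \<in> U}))"
        by blast
      moreover have "topspace K - (topspace (subtopology K ?K) - {k \<in> topspace (subtopology K ?K). u k \<in> U})
          = {k \<in> topspace K. u k \<in> U \<union> (topspace X - C)}"
        using K U continuous_map_point[of K X u] by (auto simp: k_open_def)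
      ultimately show "openin K {k \<in> topspace K. u k \<in> U \<union> (topspace X - C)}" by simp
    qed
    then have "openin X (U \<union> (topspace X - C))" using X compactly_generatedD by (auto simp: CGWH_def)
    moreover have "U = (U \<union> (topspace X - C)) \<inter> C" using U by (auto simp: k_open_def)
    ultimately show "openin (subtopology X C) U" unfolding openin_subtopology by blast
  qed
qed

lemma clopen_sub_image_closed:
  assumes X: "weak_Hausdorff X" and K: "compact_space K" "Hausdorff_space K" and C: "closedin K C"
    and u: "continuous_map (subtopology K C) X u"
  shows "closedin X (u ` C)"
proof -
  have "C \<subseteq> topspace K" using C closedin_subset by blast
  then have "topspace (subtopology K C) = C" by auto
  moreover have "compact_space (subtopology K C)" "Hausdorff_space (subtopology K C)"
    using K C closedin_compact_space compact_space_subtopology Hausdorff_space_subtopology by blast+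
  ultimately show ?thesis using WH_closed_image[OF X _ _ u] by simp
qed

lemma openin_sum_slice: "i \<in> I \<Longrightarrow> openin (X i) U \<Longrightarrow> openin (sum_topology X I) ({i} \<times> U)"
proof -
  assume i: "i \<in> I" and U: "openin (X i) U"
  have "{x. (j, x) \<in> {i} \<times> U} = (if j = i then U else {})" for j by auto
  then show ?thesis using openin_subset[OF U] i U by (auto simp: openin_sum_topology)
qed

lemma closedin_sum_slice: "i \<in> I \<Longrightarrow> closedin (X i) U \<Longrightarrow> closedin (sum_topology X I) ({i} \<times> U)"
proof -
  assume i: "i \<in> I" and U: "closedin (X i) U"
  have "{x. (j, x) \<in> {i} \<times> U} = (if j = i then U else {})" for j by auto
  then show ?thesis using closedin_subset[OF U] i U by (auto simp: closedin_sum_topology)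
qed

text \<open>Each summand is open and closed, so a test map splits into test maps to the single
  summands.\<close>

lemma CGWH_sum:
  fixes X :: "'i \<Rightarrow> 'a topology"
  assumes X: "\<And>i. i \<in> I \<Longrightarrow> CGWH (X i)"
  shows "CGWH (sum_topology X I)"
  unfolding CGWH_def
proof
  show "weak_Hausdorff (sum_topology X I)"
    unfolding weak_Hausdorff_def
  proof (intro allI impI)
    fix K :: "('i \<times> 'a) set set topology" and u
    assume K: "compact_space K \<and> Hausdorff_space K \<and> continuous_map K (sum_topology X I) u"
    then have ut: "u k \<in> Sigma I (topspace \<circ> X)" if "k \<in> topspace K" for k
      using that continuous_map_point[of K "sum_topology X I" u] by auto
    show "closedin (sum_topology X I) (u ` topspace K)"
      unfolding closedin_sum_topology
    proof (intro conjI ballI)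
      show "u ` topspace K \<subseteq> Sigma I (topspace \<circ> X)" using ut by (rule image_subsetI)
      fix i assume i: "i \<in> I"
      let ?K = "{k \<in> topspace K. u k \<in> {i} \<times> topspace (X i)}"
      have "closedin (sum_topology X I) ({i} \<times> topspace (X i))"
        using i by (rule closedin_sum_slice) simp
      then have "closedin K ?K" using K closedin_continuous_map_preimage by blast
      moreover have "continuous_map (subtopology K ?K) (X i) (\<lambda>k. snd (u k))"
        unfolding continuous_map_def
      proof (intro conjI allI impI)
        show "(\<lambda>k. snd (u k)) \<in> topspace (subtopology K ?K) \<rightarrow> topspace (X i)" by auto
        fix U assume U: "openin (X i) U"
        have "openin (sum_topology X I) ({i} \<times> U)"
          using i U by (rule openin_sum_slice)
        then have "openin K {k \<in> topspace K. u k \<in> {i} \<times> U}" using K openin_continuous_map_preimage by blast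
        moreover have "{x \<in> topspace (subtopology K ?K). snd (u x) \<in> U} = {k \<in> topspace K. u k \<in> {i} \<times> U} \<inter> ?K"
          by (rule Set.set_eqI) (simp add: mem_Times_iff, use openin_subset[OF U] in blast)
        ultimately show "openin (subtopology K ?K) {x \<in> topspace (subtopology K ?K). snd (u x) \<in> U}"
          unfolding openin_subtopology by blast
      qed
      ultimately have "closedin (X i) ((\<lambda>k. snd (u k)) ` ?K)"
        using clopen_sub_image_closed[of "X i" K ?K] K X[OF i] by (simp add: CGWH_def)
      moreover have "(\<lambda>k. snd (u k)) ` ?K = {x. (i, x) \<in> u ` topspace K}"
        using ut by (force simp: image_iff)
      ultimately show "closedin (X i) {x. (i, x) \<in> u ` topspace K}" by simp
    qed
  qed
  show "compactly_generated (sum_topology X I)"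
  proof (rule compactly_generatedI)
    fix U assume U: "k_open (sum_topology X I) U"
    have "openin (X i) {x. (i, x) \<in> U}" if i: "i \<in> I" for i
    proof -
      have "k_open (X i) {x. (i, x) \<in> U}"
        unfolding k_open_def
      proof (intro conjI allI impI)
        show "{x. (i, x) \<in> U} \<subseteq> topspace (X i)" using U by (auto simp: k_open_def)
        fix K :: "'a set set topology" and u
        assume K: "compact_space K \<and> Hausdorff_space K \<and> continuous_map K (X i) u"
        have "continuous_map (X i) (sum_topology X I) (\<lambda>x. (i, x))"
          using i by (rule continuous_map_component_injection)
        then have c: "continuous_map K (sum_topology X I) (\<lambda>k. (i, u k))" using K continuous_map_comp by blast
        have "openin K {k \<in> topspace K. (i, u k) \<in> U}"
        \<comment> \<open>Test spaces for a summand are made of sets of sets of its points. Tagging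
          all these points with \<open>i\<close> embeds them among the test spaces for the
          sum.\<close>
        proof (rule k_openD_inj[OF U _ _ c, where e = "\<lambda>S. (\<lambda>A. Pair i ` A) ` S"])
          show "inj_on (\<lambda>S. (\<lambda>A. Pair i ` A) ` S) (topspace K)"
            by (intro inj_on_image) (simp add: inj_on_def)
        qed (use K in auto)
        then show "openin K {k \<in> topspace K. u k \<in> {x. (i, x) \<in> U}}" by simp
      qed
      then show ?thesis using X[OF i] compactly_generatedD by (auto simp: CGWH_def)
    qed
    moreover have "U \<subseteq> Sigma I (topspace \<circ> X)" using U by (auto simp: k_open_def)
    ultimately show "openin (sum_topology X I) U" by (auto simp: openin_sum_topology)
  qed
qed

section \<open>Adjoining a base point\<close>

lemma topspace_adjoin_pt [simp]: "topspace (ptop (adjoin_pt X)) = insert None (Some ` topspace X)"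
proof -
  have "openin (ptop (adjoin_pt X)) (insert None (Some ` topspace X))"
    by (simp add: openin_adjoin_pt image_iff)
  from openin_subset[OF this] show ?thesis
    using openin_adjoin_pt[of X "topspace (ptop (adjoin_pt X))"] by (simp add: subset_antisym)
qed

lemma pt_adjoin_pt [simp]: "pt (adjoin_pt X) = None"
  by (simp add: adjoin_pt_def)

lemma continuous_map_Some_adjoin_pt: "continuous_map X (ptop (adjoin_pt X)) Some"
  unfolding continuous_map_def
proof (intro conjI allI impI)
  fix U assume "openin (ptop (adjoin_pt X)) U"
  then have U: "U \<subseteq> insert None (Some ` topspace X)" "openin X {x. Some x \<in> U}" by (auto simp: openin_adjoin_pt)
  then have "{x \<in> topspace X. Some x \<in> U} = {x. Some x \<in> U}" by auto
  then show "openin X {x \<in> topspace X. Some x \<in> U}" using U by simp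
qed auto

lemma closedin_adjoin_pt:
  "closedin (ptop (adjoin_pt X)) C \<longleftrightarrow> C \<subseteq> insert None (Some ` topspace X) \<and> closedin X {x. Some x \<in> C}"
proof -
  have "{x. Some x \<in> insert None (Some ` topspace X) - C} = topspace X - {x. Some x \<in> C}" by auto
  then show ?thesis by (auto simp: closedin_def openin_adjoin_pt)
qed

lemma continuous_map_the_adjoin_pt:
  "continuous_map (subtopology (ptop (adjoin_pt X)) (Some ` topspace X)) X the"
  unfolding continuous_map_def
proof (intro conjI allI impI)
  fix U assume U: "openin X U"
  have "{x \<in> topspace (subtopology (ptop (adjoin_pt X)) (Some ` topspace X)). the x \<in> U} = Some ` U \<inter> (Some ` topspace X)"
    using openin_subset[OF U] by auto
  moreover have "openin (ptop (adjoin_pt X)) (Some ` U)"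
    using U openin_subset[OF U] by (auto simp: openin_adjoin_pt image_iff)
  ultimately show "openin (subtopology (ptop (adjoin_pt X)) (Some ` topspace X))
      {x \<in> topspace (subtopology (ptop (adjoin_pt X)) (Some ` topspace X)). the x \<in> U}"
    by (metis openin_subtopology)
qed auto

lemma clopen_Some_adjoin_pt:
  "openin (ptop (adjoin_pt X)) (Some ` topspace X)" "closedin (ptop (adjoin_pt X)) (Some ` topspace X)"
  "openin (ptop (adjoin_pt X)) {None}" "closedin (ptop (adjoin_pt X)) {None}"
  by (auto simp: openin_adjoin_pt closedin_adjoin_pt image_iff)

lemma CGWH_adjoin_pt:
  fixes X :: "'a topology"
  assumes X: "CGWH X"
  shows "CGWH (ptop (adjoin_pt X))"
  unfolding CGWH_def
proof
  show "weak_Hausdorff (ptop (adjoin_pt X))"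
    unfolding weak_Hausdorff_def
  proof (intro allI impI)
    fix K :: "'a option set set topology" and u
    assume K: "compact_space K \<and> Hausdorff_space K \<and> continuous_map K (ptop (adjoin_pt X)) u"
    let ?K = "{k \<in> topspace K. u k \<in> Some ` topspace X}"
    have "closedin K ?K" using K closedin_continuous_map_preimage clopen_Some_adjoin_pt(2) by blast
    moreover have "continuous_map (subtopology K ?K) (subtopology (ptop (adjoin_pt X)) (Some ` topspace X)) u"
      using K by (auto simp: continuous_map_in_subtopology continuous_map_from_subtopology)
    then have "continuous_map (subtopology K ?K) X (\<lambda>k. the (u k))"
      using continuous_map_comp[OF continuous_map_the_adjoin_pt] by blast
    ultimately have "closedin X ((\<lambda>k. the (u k)) ` ?K)"
      using clopen_sub_image_closed[of X K ?K] K X by (simp add: CGWH_def)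
    moreover have "u k \<in> insert None (Some ` topspace X)" if "k \<in> topspace K" for k
      using K that continuous_map_point[of K "ptop (adjoin_pt X)" u] by auto
    moreover from this have "(\<lambda>k. the (u k)) ` ?K = {x. Some x \<in> u ` topspace K}"
      by (force simp: image_iff)
    ultimately show "closedin (ptop (adjoin_pt X)) (u ` topspace K)"
      by (auto simp: closedin_adjoin_pt)
  qed
  show "compactly_generated (ptop (adjoin_pt X))"
  proof (rule compactly_generatedI)
    fix U assume U: "k_open (ptop (adjoin_pt X)) U"
    have "k_open X {x. Some x \<in> U}"
      unfolding k_open_def
    proof (intro conjI allI impI)
      show "{x. Some x \<in> U} \<subseteq> topspace X" using U by (auto simp: k_open_def)
      fix K :: "'a set set topology" and u
      assume K: "compact_space K \<and> Hausdorff_space K \<and> continuous_map K X u"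
      then have c: "continuous_map K (ptop (adjoin_pt X)) (\<lambda>k. Some (u k))"
        using continuous_map_comp[OF continuous_map_Some_adjoin_pt] by blast
      have "openin K {k \<in> topspace K. Some (u k) \<in> U}"
      proof (rule k_openD_inj[OF U _ _ c, where e = "\<lambda>S. (\<lambda>A. Some ` A) ` S"])
        show "inj_on (\<lambda>S. (\<lambda>A. Some ` A) ` S) (topspace K)"
          by (intro inj_on_image) (simp add: inj_on_def)
      qed (use K in auto)
      then show "openin K {k \<in> topspace K. u k \<in> {x. Some x \<in> U}}" by simp
    qed
    then have "openin X {x. Some x \<in> U}" using X compactly_generatedD by (auto simp: CGWH_def)
    then show "openin (ptop (adjoin_pt X)) U" using U by (auto simp: openin_adjoin_pt k_open_def)
  qed
qed

section \<open>Smash products\<close>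

lemma quotient_map_smash: "quotient_map (k_prod (ptop X) (ptop Y)) (ptop (smash X Y)) (smash_pt X Y)"
  by (simp add: smash_def quotient_map_quotient_topology)

lemma pt_smash [simp]: "pt (smash X Y) = (pt X, pt Y)"
  by (simp add: smash_def)

lemma topspace_smash:
  "pt X \<in> topspace (ptop X) \<Longrightarrow> pt Y \<in> topspace (ptop Y) \<Longrightarrow>
   topspace (ptop (smash X Y)) = insert (pt X, pt Y) ((topspace (ptop X) - {pt X}) \<times> (topspace (ptop Y) - {pt Y}))"
proof (intro equalityI subsetI)
  fix p assume "p \<in> topspace (ptop (smash X Y))"
  then obtain x y where "x \<in> topspace (ptop X)" "y \<in> topspace (ptop Y)" "p = smash_pt X Y (x, y)"
    by (auto simp: smash_def)
  then show "p \<in> insert (pt X, pt Y) ((topspace (ptop X) - {pt X}) \<times> (topspace (ptop Y) - {pt Y}))"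
    by (auto simp: smash_pt_def)
next
  fix p assume "p \<in> insert (pt X, pt Y) ((topspace (ptop X) - {pt X}) \<times> (topspace (ptop Y) - {pt Y}))"
    and "pt X \<in> topspace (ptop X)" "pt Y \<in> topspace (ptop Y)"
  then have "p = smash_pt X Y p" "p \<in> topspace (ptop X) \<times> topspace (ptop Y)"
    by (auto simp: smash_pt_def split: if_splits)
  then show "p \<in> topspace (ptop (smash X Y))" by (simp add: smash_def image_eqI)
qed

text \<open>The kernel of the collapse is the union of the diagonal and the square of the wedge,
  both closed, so \<open>CGWH_quotient\<close> applies.\<close>

lemma based_CGWH_smash:
  assumes X: "based_CGWH X" and Y: "based_CGWH Y"
  shows "based_CGWH (smash X Y)"
proof -
  let ?P = "k_prod (ptop X) (ptop Y)"
  have cX: "CGWH (ptop X)" "pt X \<in> topspace (ptop X)" and cY: "CGWH (ptop Y)" "pt Y \<in> topspace (ptop Y)"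
    using X Y by (auto simp: based_CGWH_iff)
  have cP: "CGWH ?P" using cX cY by blast
  let ?V = "{p \<in> topspace ?P. fst p \<in> {pt X}} \<union> {p \<in> topspace ?P. snd p \<in> {pt Y}}"
  have V: "closedin ?P ?V"
    using cX cY closedin_WH_point[of "ptop X" "pt X"] closedin_WH_point[of "ptop Y" "pt Y"]
    by (intro closedin_Un closedin_continuous_map_preimage[OF k_prod_fst] closedin_continuous_map_preimage[OF k_prod_snd])
       (auto simp: CGWH_def)
  have "closedin (k_prod ?P ?P) ({p \<in> topspace (k_prod ?P ?P). fst p \<in> ?V} \<inter> {p \<in> topspace (k_prod ?P ?P). snd p \<in> ?V})"
    by (intro closedin_Int closedin_continuous_map_preimage[OF k_prod_fst V] closedin_continuous_map_preimage[OF k_prod_snd V])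
  moreover have "closedin (k_prod ?P ?P) {(x, y). x \<in> topspace ?P \<and> x = y}"
    using closedin_diagonal_k_prod[of ?P] cP unfolding CGWH_def by blast
  ultimately have "closedin (k_prod ?P ?P) ({(x, y). x \<in> topspace ?P \<and> x = y} \<union>
      ({p \<in> topspace (k_prod ?P ?P). fst p \<in> ?V} \<inter> {p \<in> topspace (k_prod ?P ?P). snd p \<in> ?V}))"
    by blast
  moreover have "{(x, y). x \<in> topspace ?P \<and> x = y} \<union>
      ({p \<in> topspace (k_prod ?P ?P). fst p \<in> ?V} \<inter> {p \<in> topspace (k_prod ?P ?P). snd p \<in> ?V})
    = {(p, p'). p \<in> topspace ?P \<and> p' \<in> topspace ?P \<and> smash_pt X Y p = smash_pt X Y p'}"
    by (auto simp: smash_pt_def split: if_splits)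
  ultimately have "CGWH (ptop (smash X Y))"
    using CGWH_quotient[OF cP quotient_map_smash] by simp
  then show ?thesis using cX cY by (simp add: based_CGWH_iff topspace_smash)
qed

lemma based_CGWH_adjoin_pt: "CGWH X \<Longrightarrow> based_CGWH (adjoin_pt X)"
  by (simp add: based_CGWH_iff CGWH_adjoin_pt)

section \<open>Coequalizers\<close>

lemma closed_equiv_hull_props:
  assumes "R \<subseteq> topspace X \<times> topspace X"
  shows "equiv (topspace X) (closed_equiv_hull X R)" "closedin (k_prod X X) (closed_equiv_hull X R)"
    "R \<subseteq> closed_equiv_hull X R"
proof -
  let ?F = "{E. equiv (topspace X) E \<and> closedin (k_prod X X) E \<and> R \<subseteq> E}"
  \<comment> \<open>The indiscrete relation makes the family nonempty; an empty intersection would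
    be the whole type.\<close>
  have "topspace X \<times> topspace X \<in> ?F"
    using assms by (auto simp: equiv_def refl_on_def sym_def trans_def)
       (metis closedin_topspace topspace_k_prod)
  then have ne: "?F \<noteq> {}" by blast
  show "R \<subseteq> closed_equiv_hull X R" by (auto simp: closed_equiv_hull_def)
  show "closedin (k_prod X X) (closed_equiv_hull X R)"
    unfolding closed_equiv_hull_def using ne by (intro closedin_Inter) auto
  have "refl_on (topspace X) (\<Inter>?F)" "sym (\<Inter>?F)" "trans (\<Inter>?F)" "\<Inter>?F \<subseteq> topspace X \<times> topspace X"
    subgoal by (auto simp: refl_on_def equiv_def)
    subgoal by (auto simp: sym_def equiv_def)
    subgoal by (intro trans_INTER[of ?F id, simplified]) (auto simp: equiv_def)
    subgoal using ne by (auto simp: equiv_def)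
    done
  then show "equiv (topspace X) (closed_equiv_hull X R)"
    unfolding closed_equiv_hull_def equiv_def by blast
qed

lemma quotient_map_coeq: "quotient_map (ptop X) (ptop (coeq X R)) (coeq_class X R)"
  by (simp add: coeq_def quotient_map_quotient_topology)

lemma topspace_coeq [simp]: "topspace (ptop (coeq X R)) = coeq_class X R ` topspace (ptop X)"
  by (simp add: coeq_def)

lemma pt_coeq [simp]: "pt (coeq X R) = coeq_class X R (pt X)"
  by (simp add: coeq_def)

lemma coeq_class_eq_iff:
  assumes "R \<subseteq> topspace (ptop X) \<times> topspace (ptop X)" "x \<in> topspace (ptop X)" "y \<in> topspace (ptop X)"
  shows "coeq_class X R x = coeq_class X R y \<longleftrightarrow> (x, y) \<in> closed_equiv_hull (ptop X) R"
  unfolding coeq_class_def using closed_equiv_hull_props[OF assms(1)] assms(2,3) by (simp add: eq_equiv_class_iff)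

lemma coeq_class_rel:
  "R \<subseteq> topspace (ptop X) \<times> topspace (ptop X) \<Longrightarrow> (x, y) \<in> R \<Longrightarrow> coeq_class X R x = coeq_class X R y"
  using coeq_class_eq_iff[of R X x y] closed_equiv_hull_props(3)[of R "ptop X"] by blast

lemma based_CGWH_coeq:
  assumes X: "based_CGWH X" and R: "R \<subseteq> topspace (ptop X) \<times> topspace (ptop X)"
  shows "based_CGWH (coeq X R)"
proof -
  have "{(x, y). x \<in> topspace (ptop X) \<and> y \<in> topspace (ptop X) \<and> coeq_class X R x = coeq_class X R y}
     = closed_equiv_hull (ptop X) R"
    using coeq_class_eq_iff[OF R] closed_equiv_hull_props(1)[OF R] by (auto simp: equiv_def)
  then have "CGWH (ptop (coeq X R))"
    using CGWH_quotient[OF _ quotient_map_coeq[of X R]] X closed_equiv_hull_props(2)[OF R]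
    by (simp add: based_CGWH_iff)
  then show ?thesis using X by (simp add: based_CGWH_iff)
qed

text \<open>The kernel of \<open>f\<close> is a closed equivalence relation containing
  \<open>R\<close>, so it contains the hull. This is how information is extracted from an equality
  of classes.\<close>

lemma coeq_class_lift:
  assumes X: "CGWH (ptop X)" and R: "R \<subseteq> topspace (ptop X) \<times> topspace (ptop X)"
    and W: "CGWH W" and f: "continuous_map (ptop X) W f" and fR: "\<And>x y. (x, y) \<in> R \<Longrightarrow> f x = f y"
    and x: "x \<in> topspace (ptop X)" "y \<in> topspace (ptop X)" "coeq_class X R x = coeq_class X R y"
  shows "f x = f y"
proof -
  let ?E = "{(x, y). x \<in> topspace (ptop X) \<and> y \<in> topspace (ptop X) \<and> f x = f y}"
  have "equiv (topspace (ptop X)) ?E" by (auto simp: equiv_def refl_on_def sym_def trans_def)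
  then have "closed_equiv_hull (ptop X) R \<subseteq> ?E"
    unfolding closed_equiv_hull_def using closedin_kernel[OF X W f] R fR by blast
  then show ?thesis using x coeq_class_eq_iff[OF R x(1,2)] by blast
qed

lemma coeq_class_subset:
  assumes "R \<subseteq> topspace (ptop X) \<times> topspace (ptop X)" "x \<in> topspace (ptop X)"
  shows "x \<in> coeq_class X R x" "coeq_class X R x \<subseteq> topspace (ptop X)"
    "y \<in> coeq_class X R x \<Longrightarrow> coeq_class X R y = coeq_class X R x"
  using closed_equiv_hull_props(1)[OF assms(1)] assms(2) unfolding coeq_class_def
  by (auto simp: equiv_def refl_on_def dest: symD transD)

text \<open>Gives the \<open>the_elem\<close> formulas of the definitions their value:
  \<open>f\<close> is constant on every class.\<close>

lemma coeq_the_elem: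
  assumes X: "CGWH (ptop X)" and R: "R \<subseteq> topspace (ptop X) \<times> topspace (ptop X)"
    and W: "CGWH W" and f: "continuous_map (ptop X) W f" and fR: "\<And>x y. (x, y) \<in> R \<Longrightarrow> f x = f y"
    and x: "x \<in> topspace (ptop X)"
  shows "the_elem (f ` coeq_class X R x) = f x"
proof -
  have "f y = f x" if "y \<in> coeq_class X R x" for y
  proof (rule coeq_class_lift[OF X R W f fR])
    show "y \<in> topspace (ptop X)" using coeq_class_subset(2)[OF R x] that by (rule subsetD)
    show "coeq_class X R y = coeq_class X R x" using coeq_class_subset(3)[OF R x that] .
  qed (use x in auto)
  then have "f ` coeq_class X R x \<subseteq> {f x}" by blast
  moreover have "f x \<in> f ` coeq_class X R x" using coeq_class_subset(1)[OF R x] by (rule imageI)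
  ultimately have "f ` coeq_class X R x = {f x}" by blast
  then show ?thesis by simp
qed

lemma continuous_map_quotient_param1:
  assumes X: "CGWH X" and S: "CGWH S" and Z: "CGWH Z" and q: "quotient_map X Z q"
    and h: "continuous_map (k_prod X S) W (\<lambda>(x, s). h (q x) s)"
  shows "continuous_map (k_prod Z S) W (\<lambda>(z, s). h z s)"
proof -
  have "continuous_map (k_prod X S) W ((\<lambda>(z, s). h z s) \<circ> (\<lambda>(x, s). (q x, s)))"
    using h by (simp add: o_def case_prod_beta')
  then show ?thesis using k_open_quotient_prod[OF X S Z q] continuous_compose_quotient_map by blast
qed

text \<open>The product with \<open>S\<close> is a disjoint union of the clopen parts
  \<open>?B i\<close>, and each of them projects continuously to \<open>S\<close> and to
  \<open>X i\<close>.\<close>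

lemma continuous_map_sum_param:
  assumes X: "\<And>i. i \<in> I \<Longrightarrow> CGWH (X i)" and S: "CGWH S"
    and h: "\<And>i. i \<in> I \<Longrightarrow> continuous_map (k_prod S (X i)) W (\<lambda>(s, x). h s (i, x))"
  shows "continuous_map (k_prod S (sum_topology X I)) W (\<lambda>(s, p). h s p)"
  unfolding continuous_map_def
proof (intro conjI allI impI)
  let ?P = "k_prod S (sum_topology X I)"
  show "(\<lambda>(s, p). h s p) \<in> topspace ?P \<rightarrow> topspace W"
    using continuous_map_point[OF h] by auto
  fix U assume U: "openin W U"
  let ?B = "\<lambda>i. {p \<in> topspace ?P. snd p \<in> {i} \<times> topspace (X i)}"
  have "openin ?P {p \<in> ?B i. h (fst p) (snd p) \<in> U}" if i: "i \<in> I" for i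
  proof -
    have o: "openin ?P (?B i)"
      by (rule openin_continuous_map_preimage[OF k_prod_snd openin_sum_slice[where X = X, OF i openin_topspace]])
    have c: "closedin ?P (?B i)"
      by (rule closedin_continuous_map_preimage[OF k_prod_snd closedin_sum_slice[where X = X, OF i closedin_topspace]])
    have C: "CGWH (subtopology ?P (?B i))"
      using CGWH_closed_subtopology[OF CGWH_k_prod[OF S CGWH_sum[OF X]] c] by simp
    have "continuous_map (subtopology (sum_topology X I) ({i} \<times> topspace (X i))) (X i) snd"
      unfolding continuous_map_def
    proof (intro conjI allI impI)
      fix U assume U: "openin (X i) U"
      have "{x \<in> topspace (subtopology (sum_topology X I) ({i} \<times> topspace (X i))). snd x \<in> U} = {i} \<times> U"
        using openin_subset[OF U] i by auto
      then show "openin (subtopology (sum_topology X I) ({i} \<times> topspace (X i)))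
          {x \<in> topspace (subtopology (sum_topology X I) ({i} \<times> topspace (X i))). snd x \<in> U}"
        using openin_sum_slice[where X = X, OF i U] openin_subset[OF U] by (auto simp: openin_subtopology)
    qed auto
    moreover have "continuous_map (subtopology ?P (?B i)) (subtopology (sum_topology X I) ({i} \<times> topspace (X i))) snd"
      by (auto simp: continuous_map_in_subtopology intro: continuous_map_from_subtopology k_prod_snd)
    ultimately have "continuous_map (subtopology ?P (?B i)) (X i) (\<lambda>p. snd (snd p))" by (rule continuous_map_comp)
    moreover have "continuous_map (subtopology ?P (?B i)) S fst"
      by (intro continuous_map_from_subtopology k_prod_fst)
    ultimately have "continuous_map (subtopology ?P (?B i)) W (\<lambda>p. h (fst p) (i, snd (snd p)))"
      using continuous_map_k_prod_comp[OF h[OF i] S X[OF i] C] by blast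
    from openin_continuous_map_preimage[OF this U]
    have "openin ?P {p \<in> topspace (subtopology ?P (?B i)). h (fst p) (i, snd (snd p)) \<in> U}"
      using o openin_trans_full by blast
    moreover have "{p \<in> topspace (subtopology ?P (?B i)). h (fst p) (i, snd (snd p)) \<in> U} = {p \<in> ?B i. h (fst p) (snd p) \<in> U}"
      by auto
    ultimately show ?thesis by simp
  qed
  then have "openin ?P (\<Union>i\<in>I. {p \<in> ?B i. h (fst p) (snd p) \<in> U})" by blast
  moreover have "(\<Union>i\<in>I. {p \<in> ?B i. h (fst p) (snd p) \<in> U}) = {x \<in> topspace ?P. (case x of (s, p) \<Rightarrow> h s p) \<in> U}"
    by auto
  ultimately show "openin ?P {x \<in> topspace ?P. (case x of (s, p) \<Rightarrow> h s p) \<in> U}" by simp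
qed

text \<open>Statements without a parameter are obtained from those with one by taking a one-point
  parameter space.\<close>

lemma continuous_map_unparam:
  assumes L: "CGWH L" and h: "continuous_map (k_prod (discrete_topology {()}) L) W (\<lambda>(s, z). h z)"
  shows "continuous_map L W h"
proof -
  have "CGWH (discrete_topology {()})" by (intro compact_Hausdorff_imp_CGWH) (simp_all add: compact_space_discrete_topology)
  then have "continuous_map L W (\<lambda>z. h z)"
    using continuous_map_k_prod_comp[OF h _ L L, of "\<lambda>_. ()" "\<lambda>z. z"] L by simp
  then show ?thesis by simp
qed

lemma coeq_class_const:
  assumes "CGWH (ptop X)" and R: "R \<subseteq> topspace (ptop X) \<times> topspace (ptop X)"
    and "CGWH W" and "continuous_map (ptop X) W f" and "\<And>x y. (x, y) \<in> R \<Longrightarrow> f x = f y"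
    and x: "x \<in> topspace (ptop X)" and y: "y \<in> coeq_class X R x"
  shows "f y = f x"
proof (rule coeq_class_lift[OF assms(1-5)])
  show "y \<in> topspace (ptop X)" using coeq_class_subset(2)[OF R x] y by (rule subsetD)
  show "coeq_class X R y = coeq_class X R x" using coeq_class_subset(3)[OF R x y] .
qed (use x in auto)

section \<open>Inner product spaces\<close>

lemma lookup_scaleR [simp]: "Poly_Mapping.lookup (c *\<^sub>R (x :: vect)) i = c * Poly_Mapping.lookup x i"
proof -
  have "finite {i. c *\<^sub>R Poly_Mapping.lookup x i \<noteq> 0}"
    by (rule finite_subset[OF _ finite_keys[of x]]) (auto simp: in_keys_iff)
  then show ?thesis by (simp add: scaleR_poly_mapping_def)
qed

lemma ip_superset:
  assumes "finite A" "Poly_Mapping.keys x \<subseteq> A"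
  shows "ip x y = (\<Sum>i\<in>A. Poly_Mapping.lookup x i * Poly_Mapping.lookup y i)"
  unfolding ip_def using assms by (intro sum.mono_neutral_left) (auto simp: in_keys_iff)

lemma ip_commute: "ip x y = ip y x"
  using ip_superset[of "Poly_Mapping.keys x \<union> Poly_Mapping.keys y" x y]
    ip_superset[of "Poly_Mapping.keys x \<union> Poly_Mapping.keys y" y x]
  by (simp add: mult.commute)

lemma ip_add_right: "ip x (y + z) = ip x y + ip x z"
  by (simp add: ip_def lookup_add algebra_simps sum.distrib)

lemma ip_scaleR_right: "ip x (c *\<^sub>R y) = c * ip x y"
  by (simp add: ip_def sum_distrib_left algebra_simps)

lemma ip_add_left: "ip (x + y) z = ip x z + ip y z"
  by (metis ip_add_right ip_commute)

lemma ip_scaleR_left: "ip (c *\<^sub>R x) y = c * ip x y"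
  by (metis ip_scaleR_right ip_commute)

lemma ip_zero [simp]: "ip 0 x = 0" "ip x 0 = 0"
  using ip_scaleR_left[of 0 x x] ip_scaleR_right[of x 0 x] by simp_all

lemma ip_minus_left: "ip (- x) y = - ip x y"
  using ip_scaleR_left[of "-1" x y] by simp

lemma ip_diff_left: "ip (x - y) z = ip x z - ip y z"
  using ip_add_left[of x "- y" z] by (simp add: ip_minus_left)

lemma ip_diff_right: "ip x (y - z) = ip x y - ip x z"
  by (metis ip_commute ip_diff_left)

lemmas ip_simps = ip_add_left ip_add_right ip_scaleR_left ip_scaleR_right ip_diff_left ip_diff_right

lemma ip_sum_left: "ip (\<Sum>i\<in>A. f i) y = (\<Sum>i\<in>A. ip (f i) y)"
  by (induction A rule: infinite_finite_induct) (auto simp: ip_add_left)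

lemma ip_sum_right: "ip x (\<Sum>i\<in>A. f i) = (\<Sum>i\<in>A. ip x (f i))"
  by (induction A rule: infinite_finite_induct) (auto simp: ip_add_right)

lemma ip_self_nonneg: "0 \<le> ip x x"
  unfolding ip_def by (intro sum_nonneg) auto

lemma ip_self_eq_0 [simp]: "ip x x = 0 \<longleftrightarrow> x = 0"
proof
  assume "ip x x = 0"
  then have "\<forall>i\<in>Poly_Mapping.keys x. Poly_Mapping.lookup x i * Poly_Mapping.lookup x i = 0"
    unfolding ip_def by (subst (asm) sum_nonneg_eq_0_iff) auto
  then show "x = 0" by (simp add: poly_mapping_eqI in_keys_iff)
qed simp

lemma inner_product_space_props:
  assumes "inner_product_space V"
  shows "0 \<in> V" "\<And>x y. x \<in> V \<Longrightarrow> y \<in> V \<Longrightarrow> x + y \<in> V" "\<And>c x. x \<in> V \<Longrightarrow> c *\<^sub>R x \<in> V"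
    "\<And>x y. x \<in> V \<Longrightarrow> y \<in> V \<Longrightarrow> x - y \<in> V" "subspace V"
    "\<And>f (A :: nat set). (\<And>i. i \<in> A \<Longrightarrow> f i \<in> V) \<Longrightarrow> (\<Sum>i\<in>A. f i) \<in> V"
  using assms unfolding inner_product_space_def
  by (auto intro: subspace_0 subspace_add subspace_scale subspace_diff subspace_sum)

lemma Euc_iff: "x \<in> Euc n \<longleftrightarrow> (\<forall>i\<ge>n. Poly_Mapping.lookup x i = 0)"
  by (auto simp: Euc_def in_keys_iff) (meson not_le)

abbreviation evec :: "nat \<Rightarrow> vect" where "evec i \<equiv> Poly_Mapping.single i 1"

lemma evec_Euc: "i < n \<Longrightarrow> evec i \<in> Euc n"
  by (auto simp: Euc_def)

lemma ip_evec [simp]: "ip (evec i) x = Poly_Mapping.lookup x i"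
  by (simp add: ip_def)

lemma ip_evec_right [simp]: "ip x (evec i) = Poly_Mapping.lookup x i"
  by (metis ip_commute ip_evec)

lemma Euc_expand: "x \<in> Euc n \<Longrightarrow> x = (\<Sum>i<n. Poly_Mapping.lookup x i *\<^sub>R evec i)"
  by (rule poly_mapping_eqI)
     (auto simp: lookup_sum lookup_single when_def Euc_iff if_distrib[of "(*) _"] cong: if_cong)

lemma Euc_span: "Euc n = span (evec ` {..<n})"
proof
  show "Euc n \<subseteq> span (evec ` {..<n})"
  proof
    fix x assume "x \<in> Euc n"
    then show "x \<in> span (evec ` {..<n})"
      by (subst Euc_expand) (assumption, intro span_sum span_scale span_base imageI, simp)
  qed
  have "subspace (Euc n)" by (auto simp: subspace_def Euc_iff lookup_add)
  then show "span (evec ` {..<n}) \<subseteq> Euc n" by (intro span_minimal) (auto intro: evec_Euc)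
qed

lemma inner_product_space_Euc [simp]: "inner_product_space (Euc n)"
  unfolding inner_product_space_def Euc_span by (auto intro: exI[of _ "evec ` {..<n}"])

section \<open>Orthonormal systems\<close>

definition orthonormal :: "nat \<Rightarrow> (nat \<Rightarrow> vect) \<Rightarrow> bool" where
  "orthonormal n b \<longleftrightarrow> (\<forall>i<n. \<forall>j<n. ip (b i) (b j) = (if i = j then 1 else 0))"

lemma orthonormal_coeff:
  assumes "orthonormal n b" "j < n"
  shows "ip (\<Sum>i<n. c i *\<^sub>R b i) (b j) = c j"
proof -
  have "ip (\<Sum>i<n. c i *\<^sub>R b i) (b j) = (\<Sum>i<n. if i = j then c i else 0)"
    unfolding ip_sum_left ip_scaleR_left using assms by (intro sum.cong) (auto simp: orthonormal_def)
  then show ?thesis using assms by simp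
qed

lemma orthonormal_inj: "orthonormal n b \<Longrightarrow> inj_on b {..<n}"
  unfolding orthonormal_def inj_on_def by (metis lessThan_iff zero_neq_one)

lemma orthonormal_independent:
  assumes o: "orthonormal n b"
  shows "independent (b ` {..<n})"
  unfolding independent_explicit_finite_subsets
proof (intro allI impI ballI)
  fix S u v assume S: "S \<subseteq> b ` {..<n}" "finite S" "(\<Sum>v\<in>S. u v *\<^sub>R v) = 0" "v \<in> S"
  have "ip v w = (if v = w then 1 else 0)" if "v \<in> S" "w \<in> S" for v w
  proof -
    have "v \<in> b ` {..<n}" "w \<in> b ` {..<n}" using S(1) that by auto
    then obtain i j where "i < n" "j < n" "v = b i" "w = b j" by auto
    then show ?thesis using o inj_onD[OF orthonormal_inj[OF o], of i j] by (auto simp: orthonormal_def)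
  qed
  then have "ip (\<Sum>w\<in>S. u w *\<^sub>R w) v = (\<Sum>w\<in>S. if w = v then u w else 0)"
    unfolding ip_sum_left ip_scaleR_left using S(4) by (intro sum.cong) auto
  then show "u v = 0" using S by simp
qed

lemma Gram_Schmidt:
  assumes "finite B" "independent (B :: vect set)"
  shows "\<exists>b. orthonormal (card B) b \<and> span (b ` {..<card B}) = span B"
  using assms
proof (induction B rule: finite_induct)
  case empty
  then show ?case by (auto simp: orthonormal_def)
next
  case (insert v B)
  then have iB: "independent B" "v \<notin> span B" by (auto simp: independent_insert)
  let ?n = "card B"
  obtain b where b: "orthonormal ?n b" "span (b ` {..<?n}) = span B" using insert.IH iB by blast
  \<comment> \<open>\<open>w\<close> is the component of the new vector orthogonal to the span built
    so far, and \<open>c\<close> normalises it.\<close>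
  define w where "w = v - (\<Sum>i<?n. ip v (b i) *\<^sub>R b i)"
  define c where "c = inverse (sqrt (ip w w))"
  define b' where "b' = b(?n := c *\<^sub>R w)"
  have sB: "(\<Sum>i<?n. ip v (b i) *\<^sub>R b i) \<in> span B"
    unfolding b(2)[symmetric] by (intro span_sum span_scale span_base) auto
  have w0: "w \<noteq> 0" using sB iB(2) by (auto simp: w_def)
  then have "ip w w > 0" using ip_self_nonneg[of w] by (metis ip_self_eq_0 order_less_le)
  then have c: "c * c * ip w w = 1" "c \<noteq> 0" by (auto simp: c_def field_simps)
  have wb: "ip w (b j) = 0" if "j < ?n" for j
    using orthonormal_coeff[OF b(1) that] by (simp add: w_def ip_diff_left)
  have "orthonormal (Suc ?n) b'"
    using b(1) wb c by (auto simp: orthonormal_def b'_def less_Suc_eq ip_scaleR_left ip_scaleR_right ip_commute[of "b _" w])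
  moreover have "span (b' ` {..<Suc ?n}) = span (insert v B)"
  proof -
    have im: "b' ` {..<Suc ?n} = insert (c *\<^sub>R w) (b ` {..<?n})"
      by (auto simp: b'_def lessThan_Suc image_iff)
    \<comment> \<open>Both spans consist of the x that differ from an element of span B by a
      multiple of the new vector. Since \<open>w\<close> is \<open>v\<close> up to an element of
      span B, the multiples correspond by the nonzero factor \<open>c\<close>.\<close>
    have "span (insert (c *\<^sub>R w) (b ` {..<?n})) = {x. \<exists>k. x - k *\<^sub>R (c *\<^sub>R w) \<in> span B}"
      by (simp add: span_insert b(2))
    also have "\<dots> = {x. \<exists>k. x - k *\<^sub>R v \<in> span B}"
    proof safe
      fix x k assume "x - k *\<^sub>R c *\<^sub>R w \<in> span B"
      then have "x - k *\<^sub>R c *\<^sub>R w - (k * c) *\<^sub>R (\<Sum>i<?n. ip v (b i) *\<^sub>R b i) \<in> span B"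
        using sB span_diff span_scale by blast
      moreover have "x - k *\<^sub>R c *\<^sub>R w - (k * c) *\<^sub>R (\<Sum>i<?n. ip v (b i) *\<^sub>R b i) = x - (k * c) *\<^sub>R v"
        by (simp add: w_def algebra_simps)
      ultimately show "\<exists>k. x - k *\<^sub>R v \<in> span B" by metis
    next
      fix x k assume "x - k *\<^sub>R v \<in> span B"
      then have "x - k *\<^sub>R v + k *\<^sub>R (\<Sum>i<?n. ip v (b i) *\<^sub>R b i) \<in> span B"
        using sB span_add span_scale by blast
      moreover have "x - k *\<^sub>R v + k *\<^sub>R (\<Sum>i<?n. ip v (b i) *\<^sub>R b i) = x - (k / c) *\<^sub>R (c *\<^sub>R w)"
        using c(2) by (simp add: w_def algebra_simps)
      ultimately show "\<exists>k. x - k *\<^sub>R c *\<^sub>R w \<in> span B" by metis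
    qed
    also have "\<dots> = span (insert v B)" by (simp add: span_insert)
    finally show ?thesis using im by simp
  qed
  ultimately show ?case using insert.hyps by auto
qed

section \<open>Linear isometric embeddings and frames\<close>

lemma isosD:
  assumes "f \<in> isos V W"
  shows "\<And>x. x \<in> V \<Longrightarrow> f x \<in> W" "\<And>x y. x \<in> V \<Longrightarrow> y \<in> V \<Longrightarrow> f (x + y) = f x + f y"
    "\<And>c x. x \<in> V \<Longrightarrow> f (c *\<^sub>R x) = c *\<^sub>R f x" "\<And>x y. x \<in> V \<Longrightarrow> y \<in> V \<Longrightarrow> ip (f x) (f y) = ip x y"
    "f \<in> extensional V" "f \<in> V \<rightarrow>\<^sub>E W"
  using assms by (auto simp: isos_def PiE_def)

lemma isosI:
  assumes "f \<in> extensional V" "\<And>x. x \<in> V \<Longrightarrow> f x \<in> W" "\<And>x y. x \<in> V \<Longrightarrow> y \<in> V \<Longrightarrow> f (x + y) = f x + f y"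
    "\<And>c x. x \<in> V \<Longrightarrow> f (c *\<^sub>R x) = c *\<^sub>R f x" "\<And>x y. x \<in> V \<Longrightarrow> y \<in> V \<Longrightarrow> ip (f x) (f y) = ip x y"
  shows "f \<in> isos V W"
  using assms by (auto simp: isos_def PiE_def)

lemma isos_zero: "f \<in> isos V W \<Longrightarrow> 0 \<in> V \<Longrightarrow> f 0 = 0"
  using isosD(3)[of f V W 0 0] by simp

lemma isos_sum:
  assumes V: "inner_product_space V" and f: "f \<in> isos V W" and "\<And>i. i \<in> A \<Longrightarrow> b i \<in> V" "finite (A :: nat set)"
  shows "f (\<Sum>i\<in>A. c i *\<^sub>R b i) = (\<Sum>i\<in>A. c i *\<^sub>R f (b i))"
  using assms(4,3)
proof (induction A rule: finite_induct)
  case empty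
  then show ?case using isos_zero[OF f] inner_product_space_props[OF V] by simp
next
  case (insert a A)
  then have "(\<Sum>i\<in>A. c i *\<^sub>R b i) \<in> V" using inner_product_space_props[OF V] by auto
  then show ?case using insert isosD[OF f] inner_product_space_props[OF V] by simp
qed

lemma isos_diff:
  assumes V: "inner_product_space V" and f: "f \<in> isos V W" and "x \<in> V" "y \<in> V"
  shows "f (x - y) = f x - f y"
  using isosD(2)[OF f, of x "(-1) *\<^sub>R y"] isosD(3)[OF f, of y "-1"] assms(3,4) inner_product_space_props(3)[OF V, of y "-1"]
  by simp

lemma isos_inj:
  assumes V: "inner_product_space V" and f: "f \<in> isos V W"
  shows "inj_on f V"
proof (rule inj_onI)
  fix x y assume xy: "x \<in> V" "y \<in> V" "f x = f y"
  then have "f (x - y) = 0" using isos_diff[OF V f] by simp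
  then have "ip (x - y) (x - y) = 0"
    using isosD(4)[OF f, of "x - y" "x - y"] inner_product_space_props(4)[OF V xy(1,2)] by simp
  then show "x = y" by simp
qed

lemma compose_isos:
  assumes U: "inner_product_space U" and f: "f \<in> isos V W" and g: "g \<in> isos U V"
  shows "compose U f g \<in> isos U W"
  using inner_product_space_props[OF U] isosD[OF f] isosD[OF g]
  by (intro isosI) (simp_all add: compose_def)

lemma id_isos: "inner_product_space V \<Longrightarrow> (\<lambda>v\<in>V. v) \<in> isos V V"
  by (intro isosI) (auto simp: inner_product_space_props)

lemma restrict_isos:
  assumes U: "inner_product_space U" and f: "f \<in> isos V W" and "U \<subseteq> V" "\<And>u. u \<in> U \<Longrightarrow> f u \<in> W'"
  shows "restrict f U \<in> isos U W'"
  using inner_product_space_props[OF U] isosD[OF f] assms(3,4) by (intro isosI) (auto simp: subset_iff)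

lemma orthonormal_image_evec:
  assumes k: "k \<in> isos (Euc n) V"
  shows "orthonormal n (\<lambda>i. k (evec i))"
  using isosD(4)[OF k] by (auto simp: orthonormal_def evec_Euc lookup_single)

lemma inner_product_space_dim:
  assumes V: "inner_product_space V"
  obtains B where "finite B" "independent B" "span B = V" "card B = dim V"
proof -
  obtain B where B: "B \<subseteq> V" "independent B" "V \<subseteq> span B" "card B = dim V" using basis_exists by blast
  obtain C where "finite C" "V = span C" using V by (auto simp: inner_product_space_def)
  then have "finite B" using independent_span_bound[of C B] B by blast
  moreover have "span B = V" using B V by (simp add: inner_product_space_def span_minimal subset_antisym)
  ultimately show ?thesis using that B by blast
qed

text \<open>The choice in \<open>frame\<close> is meaningful: an orthonormal basis of
  \<open>V\<close> yields an isometry that sends the standard basis to it.\<close>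

lemma frame_isos:
  assumes V: "inner_product_space V"
  shows "frame V \<in> isos (Euc (dim V)) V"
proof -
  obtain B where B: "finite B" "independent B" "span B = V" "card B = dim V" using inner_product_space_dim[OF V] by blast
  have "\<exists>b. orthonormal (dim V) b \<and> span (b ` {..<dim V}) = V"
    using Gram_Schmidt[OF B(1,2)] by (simp only: B(3,4))
  then obtain b where b: "orthonormal (dim V) b" "span (b ` {..<dim V}) = V" by blast
  have bV: "b i \<in> V" if "i < dim V" for i using span_base[of "b i" "b ` {..<dim V}"] that unfolding b(2) by simp
  define k where "k = (\<lambda>x\<in>Euc (dim V). \<Sum>i<dim V. Poly_Mapping.lookup x i *\<^sub>R b i)"
  have "k \<in> isos (Euc (dim V)) V"
  proof (rule isosI)
    fix x y assume xy: "x \<in> Euc (dim V)" "y \<in> Euc (dim V)"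
    then show "k (x + y) = k x + k y"
      using inner_product_space_props(2)[of "Euc (dim V)" x y]
      by (simp add: k_def lookup_add scaleR_add_left sum.distrib)
    have "ip (k x) (k y) = (\<Sum>i<dim V. Poly_Mapping.lookup x i * Poly_Mapping.lookup y i)"
    proof -
      have "ip (\<Sum>i<dim V. Poly_Mapping.lookup x i *\<^sub>R b i) (\<Sum>j<dim V. Poly_Mapping.lookup y j *\<^sub>R b j)
          = (\<Sum>j<dim V. Poly_Mapping.lookup y j * Poly_Mapping.lookup x j)"
        unfolding ip_sum_right ip_scaleR_right using orthonormal_coeff[OF b(1)] by (intro sum.cong) auto
      then show ?thesis using xy by (simp add: k_def mult.commute)
    qed
    also have "\<dots> = ip x y" using xy by (intro ip_superset[symmetric]) (auto simp: Euc_def)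
    finally show "ip (k x) (k y) = ip x y" .
  next
    fix x assume "x \<in> Euc (dim V)"
    then show "k x \<in> V" using bV by (auto simp: k_def intro!: inner_product_space_props(6)[OF V] inner_product_space_props(3)[OF V])
  next
    fix c x assume "x \<in> Euc (dim V)"
    then show "k (c *\<^sub>R x) = c *\<^sub>R k x"
      using inner_product_space_props(3)[of "Euc (dim V)" x c]
      by (simp add: k_def scaleR_sum_right)
  qed (auto simp: k_def)
  then show ?thesis unfolding frame_def by (rule someI[where P = "\<lambda>k. k \<in> isos (Euc (dim V)) V"])
qed

text \<open>The images of the standard basis vectors are dim V orthonormal, hence independent,
  vectors of \<open>V\<close>. A vector outside their span would give dim V + 1 independent
  vectors.\<close>

lemma isos_Euc_surj:
  assumes V: "inner_product_space V" and k: "k \<in> isos (Euc (dim V)) V"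
  shows "k ` Euc (dim V) = V" "bij_betw k (Euc (dim V)) V"
    "\<And>v. v \<in> V \<Longrightarrow> v = (\<Sum>i<dim V. ip v (k (evec i)) *\<^sub>R k (evec i))"
proof -
  let ?n = "dim V" and ?b = "\<lambda>i. k (evec i)"
  have o: "orthonormal ?n ?b" by (rule orthonormal_image_evec[OF k])
  have bV: "?b ` {..<?n} \<subseteq> V" using isosD(1)[OF k] evec_Euc by blast
  obtain B where B: "finite B" "independent B" "span B = V" "card B = dim V" using inner_product_space_dim[OF V] by blast
  have "V \<subseteq> span (?b ` {..<?n})"
  proof (rule ccontr)
    assume "\<not> V \<subseteq> span (?b ` {..<?n})"
    then obtain v where v: "v \<in> V" "v \<notin> span (?b ` {..<?n})" by blast
    then have "independent (insert v (?b ` {..<?n}))" by (intro independent_insertI orthonormal_independent[OF o])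
    then have "card (insert v (?b ` {..<?n})) \<le> card B"
      using independent_span_bound[OF B(1)] v bV B(3) by blast
    moreover have "v \<notin> ?b ` {..<?n}" using v(2) span_base[of v "?b ` {..<?n}"] by argo
    ultimately show False using B(4) by (simp add: card_image[OF orthonormal_inj[OF o]])
  qed
  moreover have "span (?b ` {..<?n}) \<subseteq> k ` Euc ?n"
  proof (rule span_minimal)
    show "?b ` {..<?n} \<subseteq> k ` Euc ?n" using evec_Euc by blast
    have E: "inner_product_space (Euc ?n)" by simp
    show "subspace (k ` Euc ?n)"
      unfolding subspace_def
    proof (intro conjI ballI allI)
      show "0 \<in> k ` Euc ?n"
        using isos_zero[OF k inner_product_space_props(1)[OF E]] inner_product_space_props(1)[OF E] image_eqI[of 0 k 0] by simp
      show "x + y \<in> k ` Euc ?n" if "x \<in> k ` Euc ?n" "y \<in> k ` Euc ?n" for x y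
      proof -
        obtain x' y' where "x' \<in> Euc ?n" "y' \<in> Euc ?n" "x = k x'" "y = k y'" using \<open>x \<in> _\<close> \<open>y \<in> _\<close> by auto
        then show ?thesis
          using isosD(2)[OF k, of x' y'] inner_product_space_props(2)[OF E, of x' y'] by (simp add: image_iff) metis
      qed
      show "c *\<^sub>R x \<in> k ` Euc ?n" if "x \<in> k ` Euc ?n" for c x
      proof -
        obtain x' where "x' \<in> Euc ?n" "x = k x'" using \<open>x \<in> _\<close> by auto
        then show ?thesis
          using isosD(3)[OF k, of x' c] inner_product_space_props(3)[OF E, of x' c] by (simp add: image_iff) metis
      qed
    qed
  qed
  ultimately show im: "k ` Euc ?n = V" using isosD(1)[OF k] by blast
  then show "bij_betw k (Euc ?n) V" using isos_inj[OF _ k] by (simp add: bij_betw_def)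
  fix v assume "v \<in> V"
  then obtain x where x: "x \<in> Euc ?n" "v = k x" using im by blast
  have "v = (\<Sum>i<?n. Poly_Mapping.lookup x i *\<^sub>R ?b i)"
    using isos_sum[OF _ k, of "{..<?n}" evec "Poly_Mapping.lookup x"] Euc_expand[OF x(1)] x(2) evec_Euc by simp
  moreover have "ip v (?b i) = Poly_Mapping.lookup x i" if "i < ?n" for i
    using isosD(4)[OF k x(1) evec_Euc[OF that]] x by simp
  ultimately show "v = (\<Sum>i<?n. ip v (?b i) *\<^sub>R ?b i)" by simp
qed

definition orthonormal_basis :: "vect set \<Rightarrow> nat \<Rightarrow> vect" where
  "orthonormal_basis V i = frame V (evec i)"

lemma orthonormal_basis:
  assumes V: "inner_product_space V"
  shows "i < dim V \<Longrightarrow> orthonormal_basis V i \<in> V" "orthonormal (dim V) (orthonormal_basis V)"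
    "v \<in> V \<Longrightarrow> v = (\<Sum>i<dim V. ip v (orthonormal_basis V i) *\<^sub>R orthonormal_basis V i)"
  using isosD(1)[OF frame_isos[OF V] evec_Euc] orthonormal_image_evec[OF frame_isos[OF V]]
    isos_Euc_surj(3)[OF V frame_isos[OF V]] by (auto simp: orthonormal_basis_def[abs_def])

lemma inverse_isos:
  assumes V: "inner_product_space V" and W: "inner_product_space W" and f: "f \<in> isos V W" and im: "f ` V = W"
  shows "(\<lambda>w\<in>W. inv_into V f w) \<in> isos W V"
proof -
  have inj: "inj_on f V" by (rule isos_inj[OF V f])
  have inv: "inv_into V f w \<in> V" "f (inv_into V f w) = w" if "w \<in> W" for w
    using that im by (auto simp: inv_into_into f_inv_into_f)
  have eq: "inv_into V f w = v" if "v \<in> V" "f v = w" for v w using inj that by (simp add: inv_into_f_eq)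
  show ?thesis
  proof (rule isosI)
    fix x y assume xy: "x \<in> W" "y \<in> W"
    have "inv_into V f (x + y) = inv_into V f x + inv_into V f y"
      using xy inv isosD(2)[OF f] inner_product_space_props(2)[OF V] by (intro eq) auto
    then show "(\<lambda>w\<in>W. inv_into V f w) (x + y) = (\<lambda>w\<in>W. inv_into V f w) x + (\<lambda>w\<in>W. inv_into V f w) y"
      using xy inner_product_space_props(2)[OF W] by simp
    show "ip ((\<lambda>w\<in>W. inv_into V f w) x) ((\<lambda>w\<in>W. inv_into V f w) y) = ip x y"
      using xy isosD(4)[OF f] inv by (metis restrict_apply')
  next
    fix c x assume x: "x \<in> W"
    have "inv_into V f (c *\<^sub>R x) = c *\<^sub>R inv_into V f x"
      using x inv isosD(3)[OF f] inner_product_space_props(3)[OF V] by (intro eq) auto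
    then show "(\<lambda>w\<in>W. inv_into V f w) (c *\<^sub>R x) = c *\<^sub>R (\<lambda>w\<in>W. inv_into V f w) x"
      using x inner_product_space_props(3)[OF W] by simp
  qed (use inv in auto)
qed

lemma frame_inv_isos: "inner_product_space V \<Longrightarrow> frame_inv V \<in> isos V (Euc (dim V))"
  unfolding frame_inv_def using inverse_isos[OF inner_product_space_Euc] frame_isos isos_Euc_surj(1) by blast

lemma frame_inv:
  assumes V: "inner_product_space V"
  shows "x \<in> Euc (dim V) \<Longrightarrow> frame_inv V (frame V x) = x" "v \<in> V \<Longrightarrow> frame V (frame_inv V v) = v"
  using isos_Euc_surj(1)[OF V frame_isos[OF V]] isos_inj[OF inner_product_space_Euc frame_isos[OF V]]
    isosD(1)[OF frame_isos[OF V]]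
  by (auto simp: frame_inv_def f_inv_into_f)

section \<open>Topology on spaces of isometries\<close>

text \<open>The library distance is the sum of all coordinate distances, so it bounds each of
  them.\<close>

lemma continuous_lookup: "continuous_on UNIV (\<lambda>x :: vect. Poly_Mapping.lookup x i)"
proof -
  have "\<bar>Poly_Mapping.lookup x i - Poly_Mapping.lookup y i\<bar> \<le> dist x y" for x y :: vect
  proof (cases "i \<in> Poly_Mapping.keys x \<union> Poly_Mapping.keys y")
    case True
    then have "dist (Poly_Mapping.lookup x i) (Poly_Mapping.lookup y i)
      \<le> (\<Sum>n\<in>Poly_Mapping.keys x \<union> Poly_Mapping.keys y. dist (Poly_Mapping.lookup x n) (Poly_Mapping.lookup y n))"
      by (intro member_le_sum) auto
    then show ?thesis by (simp add: dist_poly_mapping_def dist_real_def)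
  next
    case False
    then show ?thesis by (simp add: in_keys_iff)
  qed
  then show ?thesis unfolding continuous_on_iff by (metis dist_real_def le_less_trans)
qed

lemma continuous_ip: "continuous_on UNIV (\<lambda>x. ip x y)"
proof -
  have "(\<lambda>x. ip x y) = (\<lambda>x. \<Sum>i\<in>Poly_Mapping.keys y. Poly_Mapping.lookup y i * Poly_Mapping.lookup x i)"
    by (rule ext) (simp add: ip_commute[of _ y] ip_def[of y])
  then show ?thesis by (simp only:) (intro continuous_intros continuous_lookup)
qed

lemma continuous_map_ip: "continuous_map S (top_of_set V) f \<Longrightarrow> continuous_map S euclideanreal (\<lambda>s. ip (f s) y)"
  using continuous_map_comp[of euclidean euclideanreal "\<lambda>x. ip x y" S f] continuous_ip[of y]
  by (simp add: continuous_map_in_subtopology)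

text \<open>In finite dimension a map is a finite combination of basis vectors with its inner
  products as coefficients. This lets continuity be checked on \<open>ip\<close>, whatever norm
  defines the topology.\<close>

lemma continuous_map_into_ips:
  assumes V: "inner_product_space V" and f: "\<And>s. s \<in> topspace S \<Longrightarrow> f s \<in> V"
    and c: "\<And>v. v \<in> V \<Longrightarrow> continuous_map S euclideanreal (\<lambda>s. ip (f s) v)"
  shows "continuous_map S (top_of_set V) f"
proof -
  have "continuous_map S euclidean (\<lambda>s. \<Sum>i<dim V. ip (f s) (orthonormal_basis V i) *\<^sub>R orthonormal_basis V i)"
  proof (intro continuous_map_sum)
    fix i assume "i \<in> {..<dim V}"
    then have "continuous_map S euclideanreal (\<lambda>s. ip (f s) (orthonormal_basis V i))" using c orthonormal_basis(1)[OF V] by simp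
    moreover have "continuous_map euclideanreal euclidean (\<lambda>t. t *\<^sub>R orthonormal_basis V i)"
      by (simp, intro continuous_intros)
    ultimately show "continuous_map S euclidean (\<lambda>s. ip (f s) (orthonormal_basis V i) *\<^sub>R orthonormal_basis V i)"
      using continuous_map_comp by blast
  qed simp
  then have "continuous_map S euclidean f"
    by (rule continuous_map_eq) (use orthonormal_basis(3)[OF V] f in simp)
  then show ?thesis using f by (auto simp: continuous_map_in_subtopology)
qed

lemma continuous_map_ip2:
  assumes V: "inner_product_space V" and "continuous_map S (top_of_set V) f" "continuous_map S (top_of_set V) g"
  shows "continuous_map S euclideanreal (\<lambda>s. ip (f s) (g s))"
proof -
  have "continuous_map S euclideanreal (\<lambda>s. \<Sum>i<dim V. ip (f s) (orthonormal_basis V i) * ip (g s) (orthonormal_basis V i))"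
    using assms by (intro continuous_map_sum continuous_map_real_mult continuous_map_ip) auto
  then show ?thesis
  proof (rule continuous_map_eq)
    fix s assume s: "s \<in> topspace S"
    have fV: "f s \<in> V" "g s \<in> V" using continuous_map_point[OF assms(2) s] continuous_map_point[OF assms(3) s] by auto
    have "ip (f s) (g s) = ip (f s) (\<Sum>i<dim V. ip (g s) (orthonormal_basis V i) *\<^sub>R orthonormal_basis V i)" using orthonormal_basis(3)[OF V fV(2)] by simp
    then show "(\<Sum>i<dim V. ip (f s) (orthonormal_basis V i) * ip (g s) (orthonormal_basis V i)) = ip (f s) (g s)"
      by (simp add: ip_sum_right ip_scaleR_right mult.commute)
  qed
qed

lemma topspace_iso_top [simp]: "topspace (iso_top V W) = isos V W"
  by (auto simp: iso_top_def isos_def)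

lemma continuous_map_into_iso_top:
  "continuous_map S (iso_top V W) f \<longleftrightarrow>
     (\<forall>s\<in>topspace S. f s \<in> isos V W) \<and> (\<forall>v\<in>V. continuous_map S (top_of_set W) (\<lambda>s. f s v))"
  unfolding iso_top_def continuous_map_in_subtopology continuous_map_componentwise
  using isosD(5) by (auto simp: image_subset_iff Pi_iff)

text \<open>Evaluation is jointly continuous although isometries carry only the pointwise topology:
  f(x) is a finite combination of the values of f on a basis, with the coordinates of x as
  coefficients.\<close>

lemma continuous_map_apply:
  assumes V: "inner_product_space V" and W: "inner_product_space W"
    and f: "continuous_map S (iso_top V W) f" and x: "continuous_map S (top_of_set V) x"
  shows "continuous_map S (top_of_set W) (\<lambda>s. f s (x s))"
proof (rule continuous_map_into_ips[OF W])
  have fx: "f s \<in> isos V W" "x s \<in> V" if "s \<in> topspace S" for s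
    using continuous_map_point[OF f that] continuous_map_point[OF x that] by auto
  then show "f s (x s) \<in> W" if "s \<in> topspace S" for s using that isosD(1) by blast
  fix w assume "w \<in> W"
  have "continuous_map S euclideanreal (\<lambda>s. \<Sum>i<dim V. ip (x s) (orthonormal_basis V i) * ip (f s (orthonormal_basis V i)) w)"
    using f orthonormal_basis(1)[OF V]
    by (intro continuous_map_sum continuous_map_real_mult continuous_map_ip[OF x] continuous_map_ip[where V = W])
       (auto simp: continuous_map_into_iso_top)
  then show "continuous_map S euclideanreal (\<lambda>s. ip (f s (x s)) w)"
  proof (rule continuous_map_eq)
    fix s assume s: "s \<in> topspace S"
    have "f s (x s) = f s (\<Sum>i<dim V. ip (x s) (orthonormal_basis V i) *\<^sub>R orthonormal_basis V i)" using orthonormal_basis(3)[OF V fx(2)[OF s]] by simp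
    also have "\<dots> = (\<Sum>i<dim V. ip (x s) (orthonormal_basis V i) *\<^sub>R f s (orthonormal_basis V i))"
      using orthonormal_basis(1)[OF V] by (intro isos_sum[OF V fx(1)[OF s]]) auto
    finally show "(\<Sum>i<dim V. ip (x s) (orthonormal_basis V i) * ip (f s (orthonormal_basis V i)) w) = ip (f s (x s)) w"
      by (simp add: ip_sum_left ip_scaleR_left)
  qed
qed

lemma continuous_map_compose_isos:
  assumes U: "inner_product_space U" and V: "inner_product_space V" and W: "inner_product_space W"
    and f: "continuous_map S (iso_top V W) f" and g: "continuous_map S (iso_top U V) g"
  shows "continuous_map S (iso_top U W) (\<lambda>s. compose U (f s) (g s))"
  unfolding continuous_map_into_iso_top
proof (intro conjI ballI)
  fix s assume "s \<in> topspace S"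
  then show "compose U (f s) (g s) \<in> isos U W"
    using compose_isos[OF U, of "f s" V W "g s"] continuous_map_point[OF f] continuous_map_point[OF g] by simp
next
  fix v assume v: "v \<in> U"
  have "continuous_map S (top_of_set V) (\<lambda>s. g s v)" using g v by (simp add: continuous_map_into_iso_top)
  from continuous_map_apply[OF V W f this] show "continuous_map S (top_of_set W) (\<lambda>s. compose U (f s) (g s) v)"
    using v by (simp add: compose_def)
qed

text \<open>The ball is closed and lies in the image of a cube under the coordinate map. The cube
  has half side \<open>sqrt r\<close>, because every squared coordinate is at most
  \<open>ip v v\<close>.\<close>

lemma compactin_ip_ball:
  assumes V: "inner_product_space V"
  shows "compactin (top_of_set V) {v \<in> V. ip v v \<le> r}"
proof -
  let ?n = "dim V"
  let ?P = "product_topology (\<lambda>_. euclideanreal) {..<?n}"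
  let ?F = "\<lambda>c. \<Sum>i<?n. c i *\<^sub>R orthonormal_basis V i"
  have F: "continuous_map ?P (top_of_set V) ?F"
  proof (rule continuous_map_into_ips[OF V])
    show "?F s \<in> V" for s
      using orthonormal_basis(1)[OF V] by (intro inner_product_space_props(6)[OF V] inner_product_space_props(3)[OF V]) auto
    show "continuous_map ?P euclideanreal (\<lambda>s. ip (?F s) v)" for v
      unfolding ip_sum_left ip_scaleR_left
      by (intro continuous_map_sum continuous_map_real_mult continuous_map_product_projection) auto
  qed
  have "compactin ?P (PiE {..<?n} (\<lambda>_. {- sqrt r..sqrt r}))" by (simp add: compactin_PiE)
  then have "compactin (top_of_set V) (?F ` PiE {..<?n} (\<lambda>_. {- sqrt r..sqrt r}))"
    using F image_compactin by blast
  moreover have "{v \<in> V. ip v v \<le> r} \<subseteq> ?F ` PiE {..<?n} (\<lambda>_. {- sqrt r..sqrt r})"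
  proof safe
    fix v assume v: "v \<in> V" "ip v v \<le> r"
    have "ip v v = ip v (\<Sum>i<?n. ip v (orthonormal_basis V i) *\<^sub>R orthonormal_basis V i)" using orthonormal_basis(3)[OF V v(1)] by simp
    then have s: "ip v v = (\<Sum>i<?n. (ip v (orthonormal_basis V i))\<^sup>2)"
      by (simp add: ip_sum_right ip_scaleR_right power2_eq_square)
    have "(ip v (orthonormal_basis V i))\<^sup>2 \<le> r" if "i < ?n" for i
      using member_le_sum[of i "{..<?n}" "\<lambda>i. (ip v (orthonormal_basis V i))\<^sup>2"] that s v(2) by simp
    then have "\<bar>ip v (orthonormal_basis V i)\<bar> \<le> sqrt r" if "i < ?n" for i
      using that real_le_rsqrt[of "\<bar>ip v (orthonormal_basis V i)\<bar>"] by simp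
    then have "(\<lambda>i\<in>{..<?n}. ip v (orthonormal_basis V i)) \<in> PiE {..<?n} (\<lambda>_. {- sqrt r..sqrt r})"
      by (auto simp: abs_le_iff) (metis minus_le_iff)
    moreover have "v = ?F (\<lambda>i\<in>{..<?n}. ip v (orthonormal_basis V i))" using orthonormal_basis(3)[OF V v(1)] by simp
    ultimately show "v \<in> ?F ` PiE {..<?n} (\<lambda>_. {- sqrt r..sqrt r})" by blast
  qed
  moreover have "closedin (top_of_set V) {v \<in> V. ip v v \<le> r}"
    using closedin_continuous_map_preimage[OF continuous_map_ip2[OF V continuous_map_id continuous_map_id], of "{..r}"]
    by simp
  ultimately show ?thesis by (rule closed_compactin)
qed

lemma Hausdorff_top_of_set [simp]: "Hausdorff_space (top_of_set (V :: vect set))"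
  by (simp add: Hausdorff_space_subtopology)

lemma locally_compact_ips:
  assumes V: "inner_product_space V"
  shows "locally_compact_space (top_of_set V)"
  unfolding locally_compact_space_def
proof
  fix x assume "x \<in> topspace (top_of_set V)"
  then have x: "x \<in> V" by simp
  have "openin (top_of_set V) {v \<in> V. ip v v < ip x x + 1}"
    using openin_continuous_map_preimage[OF continuous_map_ip2[OF V continuous_map_id continuous_map_id], of "{..<ip x x + 1}"]
    by simp
  moreover have "compactin (top_of_set V) {v \<in> V. ip v v \<le> ip x x + 1}" by (rule compactin_ip_ball[OF V])
  ultimately show "\<exists>U K. openin (top_of_set V) U \<and> compactin (top_of_set V) K \<and> x \<in> U \<and> U \<subseteq> K"
    using x by (intro exI[of _ "{v \<in> V. ip v v < ip x x + 1}"] exI[of _ "{v \<in> V. ip v v \<le> ip x x + 1}"]) auto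
qed

lemma Hausdorff_iso_top [simp]: "Hausdorff_space (iso_top V W)"
  unfolding iso_top_def by (intro Hausdorff_space_subtopology) (simp add: Hausdorff_space_product_topology)

text \<open>Linearity and preservation of \<open>ip\<close> are closed conditions in the product,
  and an isometry sends v into the ball of squared radius \<open>ip v v\<close>; the product of
  these balls is compact.\<close>

lemma compact_iso_top:
  assumes V: "inner_product_space V" and W: "inner_product_space W"
  shows "compact_space (iso_top V W)"
proof -
  let ?P = "product_topology (\<lambda>_. top_of_set W) V"
  have ev: "continuous_map ?P (top_of_set W) (\<lambda>f. f v)" if "v \<in> V" for v
    using that continuous_map_product_projection[of v V "\<lambda>_. top_of_set W"] by simp
  have lin: "continuous_map ?P (top_of_set W) (\<lambda>f. a *\<^sub>R f x + b *\<^sub>R f y)" if "x \<in> V" "y \<in> V" for a b x y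
  proof (rule continuous_map_into_ips[OF W])
    show "a *\<^sub>R s x + b *\<^sub>R s y \<in> W" if "s \<in> topspace ?P" for s
      using that \<open>x \<in> V\<close> \<open>y \<in> V\<close> inner_product_space_props(2,3)[OF W] by (auto simp: PiE_def Pi_iff)
    show "continuous_map ?P euclideanreal (\<lambda>s. ip (a *\<^sub>R s x + b *\<^sub>R s y) v)" for v
      unfolding ip_simps using that
      by (intro continuous_map_add continuous_map_real_mult continuous_map_ip[OF ev]) auto
  qed
  \<comment> \<open>The coefficients 1 here and 0 in \<open>S2\<close> bring both linearity
    conditions into the shape covered by \<open>lin\<close>.\<close>
  define S1 where "S1 x y = {f \<in> topspace ?P. f (x + y) = 1 *\<^sub>R f x + 1 *\<^sub>R f y}" for x y
  define S2 where "S2 c x = {f \<in> topspace ?P. f (c *\<^sub>R x) = c *\<^sub>R f x + 0 *\<^sub>R f x}" for c x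
  define S3 where "S3 x y = {f \<in> topspace ?P. ip (f x) (f y) = ip x y}" for x y
  have c1: "closedin ?P (S1 x y)" if "x \<in> V" "y \<in> V" for x y
    unfolding S1_def using that inner_product_space_props(2)[OF V]
    by (intro closedin_continuous_maps_eq[OF Hausdorff_top_of_set[of W]] ev lin) auto
  have c2: "closedin ?P (S2 c x)" if "x \<in> V" for c x
    unfolding S2_def using that inner_product_space_props(3)[OF V]
    by (intro closedin_continuous_maps_eq[OF Hausdorff_top_of_set[of W]] ev lin) auto
  have c3: "closedin ?P (S3 x y)" if "x \<in> V" "y \<in> V" for x y
  proof -
    have "Hausdorff_space euclideanreal" by simp
    then show ?thesis unfolding S3_def
      using that by (rule closedin_continuous_maps_eq[OF _ continuous_map_ip2[OF W ev ev]]) simp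
  qed
  have "0 \<in> V" by (rule inner_product_space_props(1)[OF V])
  have "closedin ?P (\<Inter>p\<in>V \<times> V. S1 (fst p) (snd p) \<inter> S3 (fst p) (snd p))"
    by (rule closedin_Inter; use \<open>0 \<in> V\<close> c1 c3 in \<open>auto intro!: closedin_Int\<close>)
  moreover have "closedin ?P (\<Inter>q\<in>UNIV \<times> V. S2 (fst q) (snd q))"
    by (rule closedin_Inter; use \<open>0 \<in> V\<close> c2 in \<open>auto\<close>)
  ultimately have "closedin ?P ((\<Inter>p\<in>V \<times> V. S1 (fst p) (snd p) \<inter> S3 (fst p) (snd p)) \<inter> (\<Inter>q\<in>UNIV \<times> V. S2 (fst q) (snd q)))"
    by (rule closedin_Int)
  moreover have "(\<Inter>p\<in>V \<times> V. S1 (fst p) (snd p) \<inter> S3 (fst p) (snd p)) \<inter> (\<Inter>q\<in>UNIV \<times> V. S2 (fst q) (snd q)) = isos V W"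
    using \<open>0 \<in> V\<close> by (auto simp: S1_def S2_def S3_def isos_def)
  ultimately have cl: "closedin ?P (isos V W)" by simp
  have "compactin ?P (PiE V (\<lambda>v. {w \<in> W. ip w w \<le> ip v v}))"
    using compactin_ip_ball[OF W] by (simp add: compactin_PiE)
  moreover have "isos V W \<subseteq> PiE V (\<lambda>v. {w \<in> W. ip w w \<le> ip v v})"
  proof
    fix f assume f: "f \<in> isos V W"
    show "f \<in> PiE V (\<lambda>v. {w \<in> W. ip w w \<le> ip v v})"
      using isosD(1,4,5)[OF f] by (intro PiE_I) (auto simp: extensional_def)
  qed
  ultimately have "compactin ?P (isos V W)" using cl closed_compactin by blast
  then show ?thesis unfolding iso_top_def by (rule compact_space_subtopology)
qed

section \<open>The spaces of morphisms\<close>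

lemma Hausdorff_adjoin_pt:
  assumes X: "Hausdorff_space X"
  shows "Hausdorff_space (ptop (adjoin_pt X))"
  unfolding Hausdorff_space_def
proof (intro allI impI)
  have S: "openin (ptop (adjoin_pt X)) (Some ` U)" if "openin X U" for U
    using that openin_subset[OF that] by (auto simp: openin_adjoin_pt image_iff)
  fix p q assume pq: "p \<in> topspace (ptop (adjoin_pt X)) \<and> q \<in> topspace (ptop (adjoin_pt X)) \<and> p \<noteq> q"
  show "\<exists>U V. openin (ptop (adjoin_pt X)) U \<and> openin (ptop (adjoin_pt X)) V \<and> p \<in> U \<and> q \<in> V \<and> disjnt U V"
  proof (cases p)
    case None
    then show ?thesis using pq clopen_Some_adjoin_pt(1,3)[of X]
      by (intro exI[of _ "{None}"] exI[of _ "Some ` topspace X"]) (auto simp: disjnt_def)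
  next
    case p: (Some x)
    show ?thesis
    proof (cases q)
      case None
      then show ?thesis using pq clopen_Some_adjoin_pt(1,3)[of X]
        by (intro exI[of _ "Some ` topspace X"] exI[of _ "{None}"]) (auto simp: disjnt_def)
    next
      case q: (Some y)
      have "x \<in> topspace X" "y \<in> topspace X" "x \<noteq> y" using pq p q by auto
      then obtain U V where "openin X U" "openin X V" "x \<in> U" "y \<in> V" "disjnt U V"
        using X unfolding Hausdorff_space_def by metis
      then show ?thesis using S p q
        by (intro exI[of _ "Some ` U"] exI[of _ "Some ` V"]) (auto simp: disjnt_def)
    qed
  qed
qed

lemma compact_adjoin_pt:
  assumes X: "compact_space X"
  shows "compact_space (ptop (adjoin_pt X))"
proof -
  have "compactin (ptop (adjoin_pt X)) (Some ` topspace X)"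
    using X continuous_map_Some_adjoin_pt image_compactin unfolding compact_space_def by blast
  moreover have "compactin (ptop (adjoin_pt X)) {None}" by simp
  ultimately have "compactin (ptop (adjoin_pt X)) ({None} \<union> Some ` topspace X)" by (intro compactin_Un)
  then show ?thesis by (simp add: compact_space_def)
qed

lemma continuous_map_the_Alexandroff:
  "continuous_map (subtopology (Alexandroff_compactification X) (Some ` topspace X)) X the"
  unfolding continuous_map_def
proof (intro conjI allI impI)
  fix U assume U: "openin X U"
  have "{x \<in> topspace (subtopology (Alexandroff_compactification X) (Some ` topspace X)). the x \<in> U}
      = Some ` U \<inter> (Some ` topspace X)"
    using openin_subset[OF U] by auto
  then show "openin (subtopology (Alexandroff_compactification X) (Some ` topspace X))
      {x \<in> topspace (subtopology (Alexandroff_compactification X) (Some ` topspace X)). the x \<in> U}"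
    using U unfolding openin_subtopology by (metis openin_Alexandroff_compactification_image_Some)
qed auto

definition Osmash :: "vect set \<Rightarrow> vect set \<Rightarrow> omor topology" where
  "Osmash V W = ptop (smash (adjoin_pt (iso_top V W)) (sphere_sp W))"

definition Osmash_nonbase :: "vect set \<Rightarrow> vect set \<Rightarrow> omor set" where
  "Osmash_nonbase V W = Some ` isos V W \<times> Some ` W"

locale ips_pair =
  fixes V W :: "vect set"
  assumes V: "inner_product_space V" and W: "inner_product_space W"
begin

abbreviation "Lp \<equiv> ptop (adjoin_pt (iso_top V W))"
abbreviation "Sp \<equiv> Alexandroff_compactification (top_of_set W)"

lemma compact_Lp: "compact_space Lp" "Hausdorff_space Lp"
  using compact_iso_top[OF V W] by (simp_all add: compact_adjoin_pt Hausdorff_adjoin_pt)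

lemma compact_Sp: "compact_space Sp" "Hausdorff_space Sp"
  using locally_compact_ips[OF W] by (simp_all add: Hausdorff_space_Alexandroff_compactification)

text \<open>Both factors are compact Hausdorff, so their ordinary product is already compactly
  generated.\<close>

lemma k_prod_eq: "k_prod Lp Sp = prod_topology Lp Sp"
  using compact_Lp compact_Sp compact_Hausdorff_imp_CGWH[of "prod_topology Lp Sp"]
  by (intro k_prod_eq_prod_topology) (simp add: CGWH_def compact_space_prod_topology Hausdorff_space_prod_topology)

lemma based_Osmash: "based_CGWH (smash (adjoin_pt (iso_top V W)) (sphere_sp W))"
  using compact_Lp compact_Sp by (intro based_CGWH_smash) (auto simp: based_CGWH_iff sphere_sp_def compact_Hausdorff_imp_CGWH)

lemma topspace_Osmash: "topspace (Osmash V W) = insert (None, None) (Osmash_nonbase V W)"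
  unfolding Osmash_def by (subst topspace_smash) (auto simp: sphere_sp_def Osmash_nonbase_def)

lemma quotient_Osmash:
  "quotient_map (prod_topology Lp Sp) (Osmash V W) (smash_pt (adjoin_pt (iso_top V W)) (sphere_sp W))"
  using quotient_map_smash[of "adjoin_pt (iso_top V W)" "sphere_sp W"] k_prod_eq
  by (simp add: Osmash_def sphere_sp_def)

lemma smash_pt_simps:
  "smash_pt (adjoin_pt (iso_top V W)) (sphere_sp W) (Some f, Some x) = (Some f, Some x)"
  "smash_pt (adjoin_pt (iso_top V W)) (sphere_sp W) (None, y) = (None, None)"
  "smash_pt (adjoin_pt (iso_top V W)) (sphere_sp W) (p, None) = (None, None)"
  by (auto simp: smash_pt_def sphere_sp_def)

lemma smash_pt_Osmash_nonbase: "p \<in> Osmash_nonbase V W \<Longrightarrow> smash_pt (adjoin_pt (iso_top V W)) (sphere_sp W) p = p"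
  by (auto simp: Osmash_nonbase_def smash_pt_simps)

lemma smash_pt_preimage_Osmash_nonbase:
  "{p \<in> topspace (prod_topology Lp Sp). smash_pt (adjoin_pt (iso_top V W)) (sphere_sp W) p \<in> Osmash_nonbase V W} = Osmash_nonbase V W"
  by (auto simp: Osmash_nonbase_def smash_pt_def sphere_sp_def)

lemma openin_Osmash_nonbase: "openin (Osmash V W) (Osmash_nonbase V W)"
proof -
  have "openin (prod_topology Lp Sp) (Osmash_nonbase V W)"
    using clopen_Some_adjoin_pt(1)[of "iso_top V W"] openin_topspace[of "top_of_set W"]
    by (auto simp: Osmash_nonbase_def openin_prod_Times_iff simp del: openin_topspace)
  moreover have "Osmash_nonbase V W \<subseteq> topspace (Osmash V W)" using topspace_Osmash by blast
  then have "openin (prod_topology Lp Sp) {p \<in> topspace (prod_topology Lp Sp).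
      smash_pt (adjoin_pt (iso_top V W)) (sphere_sp W) p \<in> Osmash_nonbase V W} \<longleftrightarrow> openin (Osmash V W) (Osmash_nonbase V W)"
    using quotient_Osmash unfolding quotient_map_def by blast
  ultimately show ?thesis by (simp only: smash_pt_preimage_Osmash_nonbase)
qed

lemma quotient_Osmash_nonbase:
  "quotient_map (subtopology (prod_topology Lp Sp) (Osmash_nonbase V W)) (subtopology (Osmash V W) (Osmash_nonbase V W))
     (smash_pt (adjoin_pt (iso_top V W)) (sphere_sp W))"
  using quotient_map_restriction[OF quotient_Osmash smash_pt_preimage_Osmash_nonbase] openin_Osmash_nonbase by blast

text \<open>Off the base point the smash projection is the identity on an open set, and a quotient
  map by restriction.\<close>

lemma Osmash_nonbase_components:
  "continuous_map (subtopology (Osmash V W) (Osmash_nonbase V W)) (iso_top V W) (\<lambda>p. the (fst p))"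
  "continuous_map (subtopology (Osmash V W) (Osmash_nonbase V W)) (top_of_set W) (\<lambda>p. the (snd p))"
proof -
  let ?q = "smash_pt (adjoin_pt (iso_top V W)) (sphere_sp W)"
  let ?P = "subtopology (prod_topology Lp Sp) (Osmash_nonbase V W)"
  have "continuous_map ?P (subtopology Lp (Some ` topspace (iso_top V W))) fst"
    "continuous_map ?P (subtopology Sp (Some ` topspace (top_of_set W))) snd"
    by (auto simp: continuous_map_in_subtopology Osmash_nonbase_def
        intro!: continuous_map_from_subtopology continuous_map_fst continuous_map_snd)
  then have "continuous_map ?P (iso_top V W) (\<lambda>p. the (fst p))" "continuous_map ?P (top_of_set W) (\<lambda>p. the (snd p))"
    using continuous_map_comp[OF continuous_map_the_adjoin_pt] continuous_map_comp[OF continuous_map_the_Alexandroff] by blast+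
  then have "continuous_map ?P (iso_top V W) ((\<lambda>p. the (fst p)) \<circ> ?q)" "continuous_map ?P (top_of_set W) ((\<lambda>p. the (snd p)) \<circ> ?q)"
    by (auto simp: smash_pt_Osmash_nonbase elim!: continuous_map_eq)
  then show "continuous_map (subtopology (Osmash V W) (Osmash_nonbase V W)) (iso_top V W) (\<lambda>p. the (fst p))"
    "continuous_map (subtopology (Osmash V W) (Osmash_nonbase V W)) (top_of_set W) (\<lambda>p. the (snd p))"
    using continuous_compose_quotient_map[OF quotient_Osmash_nonbase] by blast+
qed

lemma continuous_map_into_Osmash:
  assumes "continuous_map S (iso_top V W) f" "continuous_map S (top_of_set W) x"
  shows "continuous_map S (Osmash V W) (\<lambda>s. (Some (f s), Some (x s)))"
proof -
  have "continuous_map S (prod_topology Lp Sp) (\<lambda>s. (Some (f s), Some (x s)))"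
    using assms by (intro continuous_map_pairedI continuous_map_comp[OF continuous_map_Some_adjoin_pt] continuous_map_comp[OF continuous_map_Some])
  from continuous_map_comp[OF quotient_imp_continuous_map[OF quotient_Osmash] this] show ?thesis by (simp add: smash_pt_simps)
qed

text \<open>The complements of these closed sets are small neighbourhoods of the base point;
  \<open>r\<close> bounds the squared length. They turn continuity at the base point into closedness
  of preimages.\<close>

definition Osmash_ball :: "real \<Rightarrow> omor set" where
  "Osmash_ball r = {(Some f, Some x) | f x. f \<in> isos V W \<and> x \<in> W \<and> ip x x \<le> r}"

text \<open>It is the image of a test space, the product of the compact space of isometries and a
  compact ball.\<close>

lemma closedin_Osmash_ball: "closedin (Osmash V W) (Osmash_ball r)"
proof -
  let ?B = "subtopology (top_of_set W) {x \<in> W. ip x x \<le> r}"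
  let ?K = "prod_topology (iso_top V W) ?B"
  have "compact_space ?B" using compactin_ip_ball[OF W] compact_space_subtopology by blast
  then have K: "compact_space ?K" "Hausdorff_space ?K"
    using compact_iso_top[OF V W] Hausdorff_space_subtopology[OF Hausdorff_top_of_set]
    by (simp_all add: compact_space_prod_topology Hausdorff_space_prod_topology)
  have "continuous_map ?K (Osmash V W) (\<lambda>p. (Some (fst p), Some (snd p)))"
  proof (rule continuous_map_into_Osmash)
    have "continuous_map ?K ?B snd" by (rule continuous_map_snd)
    then show "continuous_map ?K (top_of_set W) snd" by (simp add: continuous_map_in_subtopology)
  qed (rule continuous_map_fst)
  then have "closedin (Osmash V W) ((\<lambda>p. (Some (fst p), Some (snd p))) ` topspace ?K)"
    using based_Osmash K by (intro WH_closed_image) (auto simp: Osmash_def based_CGWH_iff CGWH_def)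
  moreover have "(\<lambda>p. (Some (fst p), Some (snd p))) ` topspace ?K = Osmash_ball r"
    by (force simp: Osmash_ball_def)
  ultimately show ?thesis by simp
qed

lemma Omor_iff: "p \<in> Omor V W \<longleftrightarrow> p = (None, None) \<or> p \<in> Osmash_nonbase V W \<and> (\<forall>v\<in>V. ip (the (fst p) v) (the (snd p)) = 0)"
  by (auto simp: Omor_def Osmash_nonbase_def)

text \<open>Failure of orthogonality to f(v) for some v is an open condition on the open part away
  from the base point.\<close>

lemma closedin_Omor: "closedin (Osmash V W) (Omor V W)"
proof -
  let ?N = "subtopology (Osmash V W) (Osmash_nonbase V W)"
  have tN: "topspace ?N = Osmash_nonbase V W" using topspace_Osmash by auto
  have "openin (Osmash V W) {p \<in> Osmash_nonbase V W. ip (the (fst p) v) (the (snd p)) \<noteq> 0}" if v: "v \<in> V" for v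
  proof -
    have "continuous_map ?N (top_of_set W) (\<lambda>p. the (fst p) v)"
      using Osmash_nonbase_components(1) v by (auto simp: continuous_map_into_iso_top)
    then have "continuous_map ?N euclideanreal (\<lambda>p. ip (the (fst p) v) (the (snd p)))"
      using Osmash_nonbase_components(2) continuous_map_ip2[OF W] by blast
    moreover have "open (- {0 :: real})" by (intro open_Compl closed_singleton)
    then have "openin euclideanreal (- {0})" by simp
    ultimately have "openin ?N {p \<in> topspace ?N. ip (the (fst p) v) (the (snd p)) \<in> - {0}}"
      by (rule openin_continuous_map_preimage)
    then have "openin (Osmash V W) {p \<in> topspace ?N. ip (the (fst p) v) (the (snd p)) \<in> - {0}}"
      using openin_Osmash_nonbase openin_trans_full by blast
    then show ?thesis unfolding tN by simp
  qed
  then have "openin (Osmash V W) (\<Union>v\<in>V. {p \<in> Osmash_nonbase V W. ip (the (fst p) v) (the (snd p)) \<noteq> 0})" by blast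
  moreover have "(\<Union>v\<in>V. {p \<in> Osmash_nonbase V W. ip (the (fst p) v) (the (snd p)) \<noteq> 0}) = topspace (Osmash V W) - Omor V W"
    unfolding topspace_Osmash by (auto simp: Omor_iff) (auto simp: Osmash_nonbase_def)
  moreover have "Omor V W \<subseteq> topspace (Osmash V W)" unfolding topspace_Osmash by (auto simp: Omor_iff)
  ultimately show ?thesis by (simp add: closedin_def)
qed

lemma ptop_Osp: "ptop (Osp V W) = subtopology (Osmash V W) (Omor V W)"
  by (simp add: Osp_def Osmash_def)

lemma topspace_Osp: "topspace (ptop (Osp V W)) = Omor V W"
  using closedin_subset[OF closedin_Omor] by (auto simp: ptop_Osp)

lemma based_Osp: "based_CGWH (Osp V W)"
proof -
  have "CGWH (Osmash V W)" using based_Osmash by (simp add: based_CGWH_iff Osmash_def)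
  then have "CGWH (ptop (Osp V W))" unfolding ptop_Osp using closedin_Omor by (rule CGWH_closed_subtopology)
  moreover have "pt (Osp V W) \<in> Omor V W" by (simp add: Osp_def Omor_def)
  ultimately show ?thesis by (simp add: based_CGWH_iff topspace_Osp)
qed

text \<open>Splits continuity into the two coordinates off the base point and closed preimages of
  balls for the behaviour at it.\<close>

lemma Osp_contI:
  assumes h: "\<And>s. s \<in> topspace S \<Longrightarrow> h s \<in> Omor V W"
    and S0: "openin S {s \<in> topspace S. h s \<noteq> (None, None)}"
    and h1: "continuous_map (subtopology S {s \<in> topspace S. h s \<noteq> (None, None)}) (iso_top V W) (\<lambda>s. the (fst (h s)))"
    and h2: "continuous_map (subtopology S {s \<in> topspace S. h s \<noteq> (None, None)}) (top_of_set W) (\<lambda>s. the (snd (h s)))"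
    and cl: "\<And>r. closedin S {s \<in> topspace S. h s \<in> Osmash_ball r}"
  shows "continuous_map S (ptop (Osp V W)) h"
proof -
  let ?S0 = "{s \<in> topspace S. h s \<noteq> (None, None)}"
  let ?q = "smash_pt (adjoin_pt (iso_top V W)) (sphere_sp W)"
  have nb: "h s \<in> Osmash_nonbase V W" if "s \<in> ?S0" for s using that h Omor_iff by blast
  have c0: "continuous_map (subtopology S ?S0) (Osmash V W) h"
    using continuous_map_into_Osmash[OF h1 h2]
  proof (rule continuous_map_eq)
    fix s assume "s \<in> topspace (subtopology S ?S0)"
    then show "(Some (the (fst (h s))), Some (the (snd (h s)))) = h s" using nb[of s] by (auto simp: Osmash_nonbase_def)
  qed
  have "continuous_map S (Osmash V W) h"
    unfolding continuous_map_def
  proof (intro conjI allI impI)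
    show "h \<in> topspace S \<rightarrow> topspace (Osmash V W)" using h topspace_Osmash Omor_iff by blast
    fix U assume U: "openin (Osmash V W) U"
    have "openin (subtopology S ?S0) {s \<in> topspace (subtopology S ?S0). h s \<in> U}"
      using c0 U openin_continuous_map_preimage by blast
    then have o1: "openin S {s \<in> topspace (subtopology S ?S0). h s \<in> U}" using S0 openin_trans_full by blast
    show "openin S {x \<in> topspace S. h x \<in> U}"
    proof (cases "(None, None) \<in> U")
      case False
      then have "{x \<in> topspace S. h x \<in> U} = {s \<in> topspace (subtopology S ?S0). h s \<in> U}" by auto
      then show ?thesis using o1 by simp
    next
      case True
      have "openin (prod_topology Lp Sp) {p \<in> topspace (prod_topology Lp Sp). ?q p \<in> U}"
        using openin_continuous_map_preimage[OF quotient_imp_continuous_map[OF quotient_Osmash] U] .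
      moreover have "compactin Lp (topspace Lp)" using compact_Lp by (simp add: compact_space_def)
      moreover have "None \<in> topspace Sp" by simp
      moreover have "topspace Lp \<times> {None} \<subseteq> {p \<in> topspace (prod_topology Lp Sp). ?q p \<in> U}"
        using True by (auto simp: smash_pt_simps)
      \<comment> \<open>The space of isometries is compact, so a neighbourhood of the base point
        contains all f \<and> x with x near infinity, uniformly in f.\<close>
      ultimately have "\<exists>A O'. openin Lp A \<and> openin Sp O' \<and> topspace Lp \<subseteq> A \<and> None \<in> O' \<and>
          A \<times> O' \<subseteq> {p \<in> topspace (prod_topology Lp Sp). ?q p \<in> U}"
        by (rule tube_lemma_left)
      then obtain A O' where O': "openin Sp O'" "topspace Lp \<subseteq> A" "None \<in> O'"
          "A \<times> O' \<subseteq> {p \<in> topspace (prod_topology Lp Sp). ?q p \<in> U}" by blast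
      then obtain C where C: "compactin (top_of_set W) C" "O' = insert None (Some ` (W - C))"
        unfolding openin_Alexandroff_compactification by auto
      have "compactin euclideanreal ((\<lambda>x. ip x x) ` C)"
        using image_compactin[OF C(1) continuous_map_ip2[OF W continuous_map_id continuous_map_id]] by simp
      then have "bounded ((\<lambda>x. ip x x) ` C)" by (simp add: compact_imp_bounded)
      \<comment> \<open>The complement of a neighbourhood of infinity is compact, so squared lengths
        on it are bounded by some \<open>r\<close>. Everything outside the ball of this
        \<open>r\<close> lies in \<open>U\<close>.\<close>
      then obtain r where r: "\<And>x. x \<in> C \<Longrightarrow> \<bar>ip x x\<bar> \<le> r" by (auto simp: bounded_iff)
      have "h s \<in> U" if s: "s \<in> topspace S" "h s \<notin> Osmash_ball r" for s
      proof (cases "h s = (None, None)")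
        case False
        then have "h s \<in> Osmash_nonbase V W" using nb[of s] s by simp
        then obtain f x where fx: "h s = (Some f, Some x)" "f \<in> isos V W" "x \<in> W" by (auto simp: Osmash_nonbase_def)
        have "x \<notin> C"
        proof
          assume "x \<in> C"
          then have "ip x x \<le> r" using r[of x] by linarith
          then have "h s \<in> Osmash_ball r" unfolding Osmash_ball_def using fx by blast
          then show False using s(2) by contradiction
        qed
        then have "(Some f, Some x) \<in> A \<times> O'" using fx O'(2) C(2) by auto
        then show ?thesis using O'(4) fx by (auto simp: smash_pt_simps)
      qed (use True in simp)
      then have "{x \<in> topspace S. h x \<in> U} = {s \<in> topspace (subtopology S ?S0). h s \<in> U} \<union>
          (topspace S - {s \<in> topspace S. h s \<in> Osmash_ball r})"
      proof -
        have "(None, None) \<notin> Osmash_ball r" by (auto simp: Osmash_ball_def)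
        then show ?thesis using \<open>\<And>s. s \<in> topspace S \<Longrightarrow> h s \<notin> Osmash_ball r \<Longrightarrow> h s \<in> U\<close> by auto
      qed
      moreover have "openin S (topspace S - {s \<in> topspace S. h s \<in> Osmash_ball r})" using cl by blast
      ultimately show ?thesis using o1 by auto
    qed
  qed
  then show ?thesis using h by (auto simp: ptop_Osp continuous_map_in_subtopology)
qed

lemma Osp_contD:
  assumes h: "continuous_map S (ptop (Osp V W)) h"
  shows "\<And>s. s \<in> topspace S \<Longrightarrow> h s \<in> Omor V W"
    "openin S {s \<in> topspace S. h s \<noteq> (None, None)}"
    "continuous_map (subtopology S {s \<in> topspace S. h s \<noteq> (None, None)}) (iso_top V W) (\<lambda>s. the (fst (h s)))"
    "continuous_map (subtopology S {s \<in> topspace S. h s \<noteq> (None, None)}) (top_of_set W) (\<lambda>s. the (snd (h s)))"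
    "\<And>r. closedin S {s \<in> topspace S. h s \<in> Osmash_ball r}"
proof -
  show O: "\<And>s. s \<in> topspace S \<Longrightarrow> h s \<in> Omor V W" using continuous_map_point[OF h] topspace_Osp by simp
  have h': "continuous_map S (Osmash V W) h" using h by (simp add: ptop_Osp continuous_map_in_subtopology)
  have eq: "{s \<in> topspace S. h s \<noteq> (None, None)} = {s \<in> topspace S. h s \<in> Osmash_nonbase V W}"
    using O Omor_iff by (auto simp: Osmash_nonbase_def)
  show "openin S {s \<in> topspace S. h s \<noteq> (None, None)}"
    unfolding eq by (rule openin_continuous_map_preimage[OF h' openin_Osmash_nonbase])
  have "continuous_map (subtopology S {s \<in> topspace S. h s \<in> Osmash_nonbase V W}) (subtopology (Osmash V W) (Osmash_nonbase V W)) h"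
    using h' by (auto simp: continuous_map_in_subtopology continuous_map_from_subtopology)
  then show "continuous_map (subtopology S {s \<in> topspace S. h s \<noteq> (None, None)}) (iso_top V W) (\<lambda>s. the (fst (h s)))"
    "continuous_map (subtopology S {s \<in> topspace S. h s \<noteq> (None, None)}) (top_of_set W) (\<lambda>s. the (snd (h s)))"
    unfolding eq using continuous_map_comp[OF Osmash_nonbase_components(1)] continuous_map_comp[OF Osmash_nonbase_components(2)] by blast+
  show "closedin S {s \<in> topspace S. h s \<in> Osmash_ball r}" for r
    by (rule closedin_continuous_map_preimage[OF h' closedin_Osmash_ball])
qed

lemma Olin_in_Omor: "f \<in> isos V W \<Longrightarrow> Olin f \<in> Omor V W"
  using inner_product_space_props(1)[OF W] by (auto simp: Olin_def Omor_def)

lemma continuous_map_Olin: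
  assumes f: "continuous_map S (iso_top V W) f"
  shows "continuous_map S (ptop (Osp V W)) (\<lambda>s. Olin (f s))"
proof -
  have "continuous_map S (Osmash V W) (\<lambda>s. (Some (f s), Some 0))"
    using f inner_product_space_props(1)[OF W] by (intro continuous_map_into_Osmash) auto
  then show ?thesis using Olin_in_Omor continuous_map_point[OF f] by (auto simp: ptop_Osp continuous_map_in_subtopology Olin_def)
qed

end

section \<open>Composition of morphisms\<close>

lemma Ocomp_simps [simp]:
  "Ocomp U (Some f, Some x) (Some g, Some y) = (Some (compose U f g), Some (x + f y))"
  "Ocomp U (None, None) \<psi> = (None, None)" "Ocomp U \<phi> (None, None) = (None, None)"
  by (auto simp: Ocomp_def split: prod.splits option.splits)

lemma Omor_cases:
  assumes "\<phi> \<in> Omor V W"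
  obtains "\<phi> = (None, None)" | f x where "\<phi> = (Some f, Some x)" "f \<in> isos V W" "x \<in> W" "\<And>v. v \<in> V \<Longrightarrow> ip (f v) x = 0"
  using assms by (auto simp: Omor_def)

lemma Omor_None [simp]: "(None, None) \<in> Omor V W"
  by (simp add: Omor_def)

lemma Omor_Some: "(Some f, Some x) \<in> Omor V W \<longleftrightarrow> f \<in> isos V W \<and> x \<in> W \<and> (\<forall>v\<in>V. ip (f v) x = 0)"
  by (auto simp: Omor_def)

lemma Ocomp_in_Omor:
  assumes U: "inner_product_space U" and V: "inner_product_space V" and W: "inner_product_space W"
    and \<phi>: "\<phi> \<in> Omor V W" and \<psi>: "\<psi> \<in> Omor U V"
  shows "Ocomp U \<phi> \<psi> \<in> Omor U W"
  using \<phi>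
proof (cases rule: Omor_cases)
  case 1
  then show ?thesis by simp
next
  case \<phi>: (2 f x)
  show ?thesis using \<psi>
  proof (cases rule: Omor_cases)
    case 1
    then show ?thesis by simp
  next
    case \<psi>: (2 g y)
    have "ip (f (g v)) (x + f y) = 0" if "v \<in> U" for v
      using that \<phi> \<psi> isosD(1)[OF \<psi>(2)] isosD(4)[OF \<phi>(2), of "g v" y] by (simp add: ip_add_right)
    moreover have "x + f y \<in> W" using \<phi> \<psi> isosD(1)[OF \<phi>(2)] inner_product_space_props(2)[OF W] by simp
    ultimately show ?thesis
      using \<phi> \<psi> compose_isos[OF U \<phi>(2) \<psi>(2)] by (simp add: Omor_Some compose_def)
  qed
qed

lemma Ocomp_eq_None_iff:
  "\<phi> \<in> Omor V W \<Longrightarrow> \<psi> \<in> Omor U V \<Longrightarrow> Ocomp U \<phi> \<psi> = (None, None) \<longleftrightarrow> \<phi> = (None, None) \<or> \<psi> = (None, None)"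
  by (auto elim!: Omor_cases)

lemma Ocomp_assoc:
  assumes "inner_product_space U" "inner_product_space V" "\<phi> \<in> Omor W X" "\<psi> \<in> Omor V W" "\<theta> \<in> Omor U V"
  shows "Ocomp U (Ocomp V \<phi> \<psi>) \<theta> = Ocomp U \<phi> (Ocomp U \<psi> \<theta>)"
  using assms(3-5)
  by (auto elim!: Omor_cases simp: compose_def fun_eq_iff isosD(1,2) algebra_simps)

lemma Ocomp_Olin: "inner_product_space V \<Longrightarrow> f \<in> isos V W \<Longrightarrow> Ocomp U (Olin f) (Olin g) = Olin (compose U f g)"
  by (simp add: Olin_def isos_zero inner_product_space_props(1))

lemma isos_ext: "f \<in> isos V W \<Longrightarrow> g \<in> isos V W' \<Longrightarrow> (\<And>v. v \<in> V \<Longrightarrow> f v = g v) \<Longrightarrow> f = g"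
  by (rule extensionalityI[of _ V]) (auto dest: isosD(5))

lemma compose_id_isos:
  assumes "f \<in> isos V W"
  shows "compose V f (\<lambda>v\<in>V. v) = f" "compose V (\<lambda>w\<in>W. w) f = f"
  using isosD(1,5)[OF assms] by (auto simp: fun_eq_iff compose_def extensional_def restrict_def)

lemma Ocomp_id_right: "inner_product_space V \<Longrightarrow> \<phi> \<in> Omor V W \<Longrightarrow> Ocomp V \<phi> (Oid V) = \<phi>"
  by (auto elim!: Omor_cases simp: Oid_def Olin_def isos_zero inner_product_space_props(1) compose_id_isos)

lemma Ocomp_id_left: "\<phi> \<in> Omor V W \<Longrightarrow> Ocomp V (Oid W) \<phi> = \<phi>"
  by (auto elim!: Omor_cases simp: Oid_def Olin_def compose_id_isos)

text \<open>By orthogonality the squared length of x + f(y) is the sum of those of x and y. A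
  composite in the ball of \<open>r\<close> therefore comes from two factors in the balls of
  \<open>r\<close>, and this controls the base point.\<close>

lemma continuous_map_Ocomp:
  assumes U: "inner_product_space U" and V: "inner_product_space V" and W: "inner_product_space W"
    and \<phi>: "continuous_map S (ptop (Osp V W)) \<phi>" and \<psi>: "continuous_map S (ptop (Osp U V)) \<psi>"
  shows "continuous_map S (ptop (Osp U W)) (\<lambda>s. Ocomp U (\<phi> s) (\<psi> s))"
proof -
  interpret VW: ips_pair V W by (rule ips_pair.intro[OF V W])
  interpret UV: ips_pair U V by (rule ips_pair.intro[OF U V])
  interpret UW: ips_pair U W by (rule ips_pair.intro[OF U W])
  note D1 = VW.Osp_contD[OF \<phi>] and D2 = UV.Osp_contD[OF \<psi>]
  let ?A = "{s \<in> topspace S. \<phi> s \<noteq> (None, None)}" and ?B = "{s \<in> topspace S. \<psi> s \<noteq> (None, None)}"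
  let ?C = "{s \<in> topspace S. Ocomp U (\<phi> s) (\<psi> s) \<noteq> (None, None)}"
  have C: "?C = ?A \<inter> ?B" using Ocomp_eq_None_iff[OF D1(1) D2(1)] by auto
  have c: "continuous_map (subtopology S ?C) (iso_top V W) (\<lambda>s. the (fst (\<phi> s)))"
    "continuous_map (subtopology S ?C) (top_of_set W) (\<lambda>s. the (snd (\<phi> s)))"
    "continuous_map (subtopology S ?C) (iso_top U V) (\<lambda>s. the (fst (\<psi> s)))"
    "continuous_map (subtopology S ?C) (top_of_set V) (\<lambda>s. the (snd (\<psi> s)))"
    using continuous_map_from_subtopology_mono[OF D1(3), of ?C] continuous_map_from_subtopology_mono[OF D1(4), of ?C]
      continuous_map_from_subtopology_mono[OF D2(3), of ?C] continuous_map_from_subtopology_mono[OF D2(4), of ?C] C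
    by auto
  have split: "\<exists>f x g y. \<phi> s = (Some f, Some x) \<and> \<psi> s = (Some g, Some y) \<and> f \<in> isos V W \<and> x \<in> W \<and> g \<in> isos U V \<and> y \<in> V
      \<and> ip (f y) x = 0" if "s \<in> ?C" for s
  proof -
    have "s \<in> ?A" "s \<in> ?B" using that C by auto
    then show ?thesis using D1(1)[of s] D2(1)[of s] by (auto elim!: Omor_cases)
  qed
  show ?thesis
  proof (rule UW.Osp_contI)
    show "Ocomp U (\<phi> s) (\<psi> s) \<in> Omor U W" if "s \<in> topspace S" for s
      using Ocomp_in_Omor[OF U V W D1(1)[OF that] D2(1)[OF that]] .
    show "openin S ?C" unfolding C using D1(2) D2(2) by blast
    show "continuous_map (subtopology S ?C) (iso_top U W) (\<lambda>s. the (fst (Ocomp U (\<phi> s) (\<psi> s))))"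
      using continuous_map_compose_isos[OF U V W c(1,3)]
    proof (rule continuous_map_eq)
      fix s assume "s \<in> topspace (subtopology S ?C)"
      then have "s \<in> ?C" by auto
      from split[OF this]
      show "compose U (the (fst (\<phi> s))) (the (fst (\<psi> s))) = the (fst (Ocomp U (\<phi> s) (\<psi> s)))" by auto
    qed
    show "continuous_map (subtopology S ?C) (top_of_set W) (\<lambda>s. the (snd (Ocomp U (\<phi> s) (\<psi> s))))"
    proof (rule continuous_map_eq)
      show "continuous_map (subtopology S ?C) (top_of_set W) (\<lambda>s. the (snd (\<phi> s)) + the (fst (\<phi> s)) (the (snd (\<psi> s))))"
      proof (rule continuous_map_into_ips[OF W])
        show "the (snd (\<phi> s)) + the (fst (\<phi> s)) (the (snd (\<psi> s))) \<in> W" if "s \<in> topspace (subtopology S ?C)" for s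
        proof -
          have "s \<in> ?C" using that by auto
          from split[OF this] show ?thesis
            using inner_product_space_props(2)[OF W] isosD(1) by (auto simp: split_paired_all)
        qed
        show "continuous_map (subtopology S ?C) euclideanreal
             (\<lambda>s. ip (the (snd (\<phi> s)) + the (fst (\<phi> s)) (the (snd (\<psi> s)))) v)" for v
          unfolding ip_add_left
          by (intro continuous_map_add continuous_map_ip[OF c(2)] continuous_map_ip[OF continuous_map_apply[OF V W c(1,4)]])
      qed
    next
      fix s assume "s \<in> topspace (subtopology S ?C)"
      then have "s \<in> ?C" by auto
      from split[OF this]
      show "the (snd (\<phi> s)) + the (fst (\<phi> s)) (the (snd (\<psi> s))) = the (snd (Ocomp U (\<phi> s) (\<psi> s)))" by auto
    qed
    show "closedin S {s \<in> topspace S. Ocomp U (\<phi> s) (\<psi> s) \<in> UW.Osmash_ball r}" for r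
    proof -
      \<comment> \<open>\<open>?E\<close> is closed and avoids both base points; the lengths vary
        continuously on it, so the condition on their sum cuts out a closed subset
        \<open>?F\<close>.\<close>
      let ?E = "{s \<in> topspace S. \<phi> s \<in> VW.Osmash_ball r} \<inter> {s \<in> topspace S. \<psi> s \<in> UV.Osmash_ball r}"
      let ?F = "{s \<in> topspace (subtopology S ?E).
          ip (the (snd (\<phi> s))) (the (snd (\<phi> s))) + ip (the (snd (\<psi> s))) (the (snd (\<psi> s))) \<in> {..r}}"
      have E: "closedin S ?E" using D1(5) D2(5) by blast
      have EC: "?E \<subseteq> ?C" unfolding C by (auto simp: VW.Osmash_ball_def UV.Osmash_ball_def)
      have "continuous_map (subtopology S ?E) euclideanreal
         (\<lambda>s. ip (the (snd (\<phi> s))) (the (snd (\<phi> s))) + ip (the (snd (\<psi> s))) (the (snd (\<psi> s))))"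
        using continuous_map_from_subtopology_mono[OF c(2) EC] continuous_map_from_subtopology_mono[OF c(4) EC]
        by (intro continuous_map_add continuous_map_ip2[OF W] continuous_map_ip2[OF V])
      from closedin_continuous_map_preimage[OF this, of "{..r}"] have "closedin (subtopology S ?E) ?F" by simp
      then have "closedin S ?F" using E closedin_trans_full by blast
      moreover have "?F = {s \<in> topspace S. Ocomp U (\<phi> s) (\<psi> s) \<in> UW.Osmash_ball r}"
      proof (rule Set.set_eqI)
        fix s
        show "s \<in> ?F \<longleftrightarrow> s \<in> {s \<in> topspace S. Ocomp U (\<phi> s) (\<psi> s) \<in> UW.Osmash_ball r}"
        proof (cases "s \<in> ?C")
          case False
          then show ?thesis using EC by (auto simp: UW.Osmash_ball_def)
        next
          case True
          then obtain f x g y where s: "\<phi> s = (Some f, Some x)" "\<psi> s = (Some g, Some y)" "f \<in> isos V W" "x \<in> W"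
            "g \<in> isos U V" "y \<in> V" "ip (f y) x = 0" using split by blast
          have "ip (x + f y) (x + f y) = ip x x + ip y y"
            using s(7) isosD(4)[OF s(3) s(6) s(6)] by (simp add: ip_simps ip_commute[of x "f y"])
          moreover have "compose U f g \<in> isos U W" using compose_isos[OF U] s by blast
          moreover have "x + f y \<in> W" using s isosD(1) inner_product_space_props(2)[OF W] by blast
          moreover have "s \<in> topspace S" using True by simp
          ultimately show ?thesis using s ip_self_nonneg[of x] ip_self_nonneg[of y]
            by (auto simp: VW.Osmash_ball_def UV.Osmash_ball_def UW.Osmash_ball_def)
        qed
      qed
      ultimately show ?thesis by simp
    qed
  qed
qed

section \<open>Topological groups and spectra in compactly generated spaces\<close>

lemma closedin_eq_maps:
  assumes K: "CGWH K" and Z: "CGWH Z" and u: "continuous_map K Z u" and v: "continuous_map K Z v"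
  shows "closedin K {k \<in> topspace K. u k = v k}"
proof -
  have "weak_Hausdorff Z" using Z by (simp add: CGWH_def)
  then have "closedin K {k \<in> topspace K. (u k, v k) \<in> {(x, y). x \<in> topspace Z \<and> x = y}}"
    by (rule closedin_continuous_map_preimage[OF continuous_map_into_k_prod[OF Z Z K u v] closedin_diagonal_k_prod])
  moreover have "{k \<in> topspace K. (u k, v k) \<in> {(x, y). x \<in> topspace Z \<and> x = y}} = {k \<in> topspace K. u k = v k}"
    using continuous_map_point[OF u] by auto
  ultimately show ?thesis by simp
qed

text \<open>The product is only required to be continuous on the compactly generated product, which is
  all that is available for the quotient group.\<close>

definition k_group :: "'g monoid \<Rightarrow> 'g topology \<Rightarrow> bool" where
  "k_group G T \<longleftrightarrow> group G \<and> topspace T = carrier G \<and> CGWH T \<and>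
     continuous_map (k_prod T T) T (\<lambda>(x, y). x \<otimes>\<^bsub>G\<^esub> y) \<and> continuous_map T T (\<lambda>x. inv\<^bsub>G\<^esub> x)"

lemma compact_Lie_group_imp_k_group: "compact_Lie_group G T \<Longrightarrow> k_group G T"
  by (auto simp: compact_Lie_group_def topological_group_def k_group_def
      intro: compact_Hausdorff_imp_CGWH continuous_map_from_prod_topology)

lemma k_groupD:
  assumes "k_group G T"
  shows "group G" "topspace T = carrier G" "CGWH T"
    "CGWH K \<Longrightarrow> continuous_map K T u \<Longrightarrow> continuous_map K T v \<Longrightarrow> continuous_map K T (\<lambda>k. u k \<otimes>\<^bsub>G\<^esub> v k)"
    "continuous_map K T u \<Longrightarrow> continuous_map K T (\<lambda>k. inv\<^bsub>G\<^esub> u k)"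
  using assms continuous_map_k_prod_comp[of T T T "\<lambda>x y. x \<otimes>\<^bsub>G\<^esub> y" K u v] continuous_map_comp[of T T "\<lambda>x. inv\<^bsub>G\<^esub> x" K u]
  by (auto simp: k_group_def)

lemma k_group_subgroup:
  assumes G: "k_group G T" and H: "subgroup H G" "closedin T H"
  shows "k_group (G\<lparr>carrier := H\<rparr>) (subtopology T H)"
  unfolding k_group_def
proof (intro conjI)
  interpret group G using G by (rule k_groupD)
  have HT: "H \<subseteq> topspace T" using H(2) closedin_subset by blast
  then show t: "topspace (subtopology T H) = carrier (G\<lparr>carrier := H\<rparr>)" by auto
  show "group (G\<lparr>carrier := H\<rparr>)" using H(1) subgroup_imp_group by blast
  show c: "CGWH (subtopology T H)" using CGWH_closed_subtopology[OF k_groupD(3)[OF G] H(2)] .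
  have i: "continuous_map (subtopology T H) T (\<lambda>x. x)" by (simp add: continuous_map_from_subtopology)
  have "continuous_map (k_prod (subtopology T H) (subtopology T H)) T (\<lambda>p. fst p \<otimes>\<^bsub>G\<^esub> snd p)"
    using c by (intro k_groupD(4)[OF G] CGWH_k_prod continuous_map_comp[OF i k_prod_fst] continuous_map_comp[OF i k_prod_snd])
  then show "continuous_map (k_prod (subtopology T H) (subtopology T H)) (subtopology T H)
      (\<lambda>(x, y). x \<otimes>\<^bsub>G\<lparr>carrier := H\<rparr>\<^esub> y)"
    using subgroup.m_closed[OF H(1)] by (auto simp: continuous_map_in_subtopology case_prod_beta')
  have "continuous_map (subtopology T H) T (\<lambda>x. inv\<^bsub>G\<^esub> x)" by (rule k_groupD(5)[OF G i])
  then have "continuous_map (subtopology T H) (subtopology T H) (\<lambda>x. inv\<^bsub>G\<^esub> x)"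
    using subgroup.m_inv_closed[OF H(1)] by (auto simp: continuous_map_in_subtopology)
  then show "continuous_map (subtopology T H) (subtopology T H) (\<lambda>x. inv\<^bsub>G\<lparr>carrier := H\<rparr>\<^esub> x)"
    by (rule continuous_map_eq) (use HT m_inv_consistent[OF H(1)] in auto)
qed

lemma orthogonal_spectrumD:
  assumes A: "orthogonal_spectrum G T A" and G: "k_group G T"
  shows "based_CGWH (lvl A m)" "CGWH (ptop (lvl A m))" "pt (lvl A m) \<in> lvl_set A m"
    "CGWH K \<Longrightarrow> continuous_map K (ptop (Osp (Euc m) (Euc n))) \<phi> \<Longrightarrow> continuous_map K (ptop (lvl A m)) a \<Longrightarrow>
      continuous_map K (ptop (lvl A n)) (\<lambda>k. str A m n (\<phi> k) (a k))"
    "f \<in> Omor (Euc m) (Euc n) \<Longrightarrow> x \<in> lvl_set A m \<Longrightarrow> str A m n f x \<in> lvl_set A n"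
    "x \<in> lvl_set A m \<Longrightarrow> str A m n (None, None) x = pt (lvl A n)"
    "f \<in> Omor (Euc m) (Euc n) \<Longrightarrow> str A m n f (pt (lvl A m)) = pt (lvl A n)"
    "x \<in> lvl_set A m \<Longrightarrow> str A m m (Oid (Euc m)) x = x"
    "f' \<in> Omor (Euc l) (Euc m) \<Longrightarrow> f \<in> Omor (Euc m) (Euc n) \<Longrightarrow> y \<in> lvl_set A l \<Longrightarrow>
        str A l n (Ocomp (Euc l) f f') y = str A m n f (str A l m f' y)"
    "CGWH K \<Longrightarrow> continuous_map K T g \<Longrightarrow> continuous_map K (ptop (lvl A m)) a \<Longrightarrow>
      continuous_map K (ptop (lvl A m)) (\<lambda>k. act A (g k) m (a k))"
    "h \<in> carrier G \<Longrightarrow> x \<in> lvl_set A m \<Longrightarrow> act A h m x \<in> lvl_set A m"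
    "x \<in> lvl_set A m \<Longrightarrow> act A \<one>\<^bsub>G\<^esub> m x = x"
    "h \<in> carrier G \<Longrightarrow> h' \<in> carrier G \<Longrightarrow> x \<in> lvl_set A m \<Longrightarrow> act A (h \<otimes>\<^bsub>G\<^esub> h') m x = act A h m (act A h' m x)"
    "h \<in> carrier G \<Longrightarrow> act A h m (pt (lvl A m)) = pt (lvl A m)"
    "h \<in> carrier G \<Longrightarrow> f \<in> Omor (Euc m) (Euc n) \<Longrightarrow> x \<in> lvl_set A m \<Longrightarrow>
        act A h n (str A m n f x) = str A m n f (act A h m x)"
proof -
  note A' = A[unfolded orthogonal_spectrum_def]
  interpret ips_pair "Euc m" "Euc n" by unfold_locales simp_all
  have a: "\<forall>m. based_CGWH (lvl A m)"
    "\<forall>m n. continuous_map (k_prod (ptop (Osp (Euc m) (Euc n))) (ptop (lvl A m))) (ptop (lvl A n)) (\<lambda>(\<phi>, a). str A m n \<phi> a)"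
    "\<forall>m n. \<forall>a\<in>lvl_set A m. str A m n (None, None) a = pt (lvl A n)"
    "\<forall>m n. \<forall>\<phi>\<in>Omor (Euc m) (Euc n). str A m n \<phi> (pt (lvl A m)) = pt (lvl A n)"
    "\<forall>m. \<forall>a\<in>lvl_set A m. str A m m (Oid (Euc m)) a = a"
    using A' by - (elim conjE, assumption)+
  show b: "based_CGWH (lvl A m)" for m using a(1) by blast
  then show c: "CGWH (ptop (lvl A m))" for m by (simp add: based_CGWH_iff)
  show "pt (lvl A m) \<in> lvl_set A m" using b by (simp add: based_CGWH_iff)
  have s: "continuous_map (k_prod (ptop (Osp (Euc m) (Euc n))) (ptop (lvl A m))) (ptop (lvl A n)) (\<lambda>(\<phi>, a). str A m n \<phi> a)"
    using a(2) by simp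
  then show "CGWH K \<Longrightarrow> continuous_map K (ptop (Osp (Euc m) (Euc n))) \<phi> \<Longrightarrow> continuous_map K (ptop (lvl A m)) a \<Longrightarrow>
      continuous_map K (ptop (lvl A n)) (\<lambda>k. str A m n (\<phi> k) (a k))"
    using continuous_map_k_prod_comp[OF s _ c] based_Osp by (simp add: based_CGWH_iff)
  show "f \<in> Omor (Euc m) (Euc n) \<Longrightarrow> x \<in> lvl_set A m \<Longrightarrow> str A m n f x \<in> lvl_set A n"
    using continuous_map_point[OF s, of "(f, x)"] topspace_Osp by simp
  have t: "continuous_map (k_prod T (ptop (lvl A m))) (ptop (lvl A m)) (\<lambda>(g, a). act A g m a)"
    using A' by blast
  then show "CGWH K \<Longrightarrow> continuous_map K T g \<Longrightarrow> continuous_map K (ptop (lvl A m)) a \<Longrightarrow>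
      continuous_map K (ptop (lvl A m)) (\<lambda>k. act A (g k) m (a k))"
    using continuous_map_k_prod_comp[OF t k_groupD(3)[OF G] c] by blast
  show "h \<in> carrier G \<Longrightarrow> x \<in> lvl_set A m \<Longrightarrow> act A h m x \<in> lvl_set A m"
    using continuous_map_point[OF t, of "(h, x)"] k_groupD(2)[OF G] by simp
  show "x \<in> lvl_set A m \<Longrightarrow> str A m n (None, None) x = pt (lvl A n)" using a(3) by simp
  show "f \<in> Omor (Euc m) (Euc n) \<Longrightarrow> str A m n f (pt (lvl A m)) = pt (lvl A n)" using a(4) by simp
  show "x \<in> lvl_set A m \<Longrightarrow> str A m m (Oid (Euc m)) x = x" using a(5) by simp
  show "f' \<in> Omor (Euc l) (Euc m) \<Longrightarrow> f \<in> Omor (Euc m) (Euc n) \<Longrightarrow> y \<in> lvl_set A l \<Longrightarrow>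
        str A l n (Ocomp (Euc l) f f') y = str A m n f (str A l m f' y)" using A' by blast
  show "x \<in> lvl_set A m \<Longrightarrow> act A \<one>\<^bsub>G\<^esub> m x = x" using A' by blast
  show "h \<in> carrier G \<Longrightarrow> h' \<in> carrier G \<Longrightarrow> x \<in> lvl_set A m \<Longrightarrow> act A (h \<otimes>\<^bsub>G\<^esub> h') m x = act A h m (act A h' m x)"
    using A' by blast
  show "h \<in> carrier G \<Longrightarrow> act A h m (pt (lvl A m)) = pt (lvl A m)" using A' by blast
  show "h \<in> carrier G \<Longrightarrow> f \<in> Omor (Euc m) (Euc n) \<Longrightarrow> x \<in> lvl_set A m \<Longrightarrow>
        act A h n (str A m n f x) = str A m n f (act A h m x)" using A' by blast
qed

lemma Oid_in_Omor: "inner_product_space V \<Longrightarrow> Oid V \<in> Omor V V"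
  unfolding Oid_def by (intro ips_pair.Olin_in_Omor ips_pair.intro id_isos)

lemma CGWH_Osp: "inner_product_space V \<Longrightarrow> inner_product_space W \<Longrightarrow> CGWH (ptop (Osp V W))"
  using ips_pair.based_Osp[OF ips_pair.intro] by (simp add: based_CGWH_iff)

lemma topspace_Osp': "inner_product_space V \<Longrightarrow> inner_product_space W \<Longrightarrow> topspace (ptop (Osp V W)) = Omor V W"
  using ips_pair.topspace_Osp[OF ips_pair.intro] by simp

text \<open>The summand over the adjoined point is clopen and collapses to the base point, so S x X
  already maps onto the smash product as a quotient.\<close>

lemma quotient_map_smash_adjoin_pt:
  assumes S: "CGWH S" "s0 \<in> topspace S" and X: "based_CGWH X"
  shows "quotient_map (k_prod S (ptop X)) (ptop (smash (adjoin_pt S) X)) (\<lambda>(s, x). smash_pt (adjoin_pt S) X (Some s, x))"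
    (is "quotient_map ?P ?Q ?s")
  unfolding quotient_map_def
proof (intro conjI allI impI)
  let ?A = "ptop (adjoin_pt S)" and ?q = "smash_pt (adjoin_pt S) X"
  let ?R = "k_prod ?A (ptop X)"
  have cX: "CGWH (ptop X)" "pt X \<in> topspace (ptop X)" using X by (auto simp: based_CGWH_iff)
  have cA: "CGWH ?A" using S CGWH_adjoin_pt by blast
  have q: "quotient_map ?R ?Q ?q" by (rule quotient_map_smash)
  have base: "?q (None, x) = (None, pt X)" "?q (Some s, pt X) = (None, pt X)" for s x
    by (auto simp: smash_pt_def)
  show "?s ` topspace ?P = topspace ?Q"
  proof
    show "?s ` topspace ?P \<subseteq> topspace ?Q" using continuous_map_point[OF quotient_imp_continuous_map[OF q]] by auto
    show "topspace ?Q \<subseteq> ?s ` topspace ?P"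
    proof
      fix z assume "z \<in> topspace ?Q"
      then have "z \<in> ?q ` topspace ?R" using q by (simp add: quotient_map_def)
      then obtain p x where z: "z = ?q (p, x)" "p \<in> topspace ?A" "x \<in> topspace (ptop X)" by auto
      show "z \<in> ?s ` topspace ?P"
      proof (cases p)
        case None
        \<comment> \<open>The base point needs a preimage over \<open>S\<close> itself;
          \<open>s0\<close> provides it.\<close>
        then have "z = ?s (s0, pt X)" using z base by simp
        then show ?thesis using S cX by (intro image_eqI[of _ _ "(s0, pt X)"]) auto
      next
        case (Some s)
        then show ?thesis using z by (intro image_eqI[of _ _ "(s, x)"]) auto
      qed
    qed
  qed
  fix U assume U: "U \<subseteq> topspace ?Q"
  let ?sU = "{p \<in> topspace ?P. ?s p \<in> U}" and ?qU = "{p \<in> topspace ?R. ?q p \<in> U}"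
  have c: "continuous_map ?P ?Q ?s"
  proof -
    have "continuous_map ?P ?R (\<lambda>p. (Some (fst p), snd p))"
      using S cX cA by (intro continuous_map_into_k_prod CGWH_k_prod continuous_map_comp[OF continuous_map_Some_adjoin_pt k_prod_fst] k_prod_snd)
    from continuous_map_comp[OF quotient_imp_continuous_map[OF q] this] show ?thesis by (simp add: case_prod_beta')
  qed
  show "openin ?P ?sU = openin ?Q U"
  proof
    assume "openin ?Q U"
    then show "openin ?P ?sU" using openin_continuous_map_preimage[OF c] by blast
  next
    assume sU: "openin ?P ?sU"
    let ?C = "{p \<in> topspace ?R. fst p \<in> Some ` topspace S}" and ?D = "{p \<in> topspace ?R. fst p \<in> {None}}"
    have C: "openin ?R ?C" "closedin ?R ?C" and D: "openin ?R ?D"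
      by (rule openin_continuous_map_preimage[OF k_prod_fst] closedin_continuous_map_preimage[OF k_prod_fst],
          rule clopen_Some_adjoin_pt)+
    have cC: "CGWH (subtopology ?R ?C)" using CGWH_closed_subtopology[OF CGWH_k_prod[OF cA cX(1)] C(2)] .
    have "continuous_map (subtopology ?R ?C) (subtopology ?A (Some ` topspace S)) fst"
      by (auto simp: continuous_map_in_subtopology intro: continuous_map_from_subtopology k_prod_fst)
    then have "continuous_map (subtopology ?R ?C) S (\<lambda>p. the (fst p))"
      using continuous_map_comp[OF continuous_map_the_adjoin_pt] by blast
    moreover have "continuous_map (subtopology ?R ?C) (ptop X) snd"
      by (intro continuous_map_from_subtopology k_prod_snd)
    ultimately have "continuous_map (subtopology ?R ?C) ?P (\<lambda>p. (the (fst p), snd p))"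
      using continuous_map_into_k_prod[OF S(1) cX(1) cC] by blast
    from openin_continuous_map_preimage[OF this sU]
    have "openin ?R {p \<in> topspace (subtopology ?R ?C). (the (fst p), snd p) \<in> ?sU}"
      using C(1) openin_trans_full by blast
    moreover have "{p \<in> topspace (subtopology ?R ?C). (the (fst p), snd p) \<in> ?sU} = ?qU \<inter> ?C"
      by auto
    moreover have "?qU \<inter> ?D = (if (None, pt X) \<in> U then ?D else {})"
      using base by auto
    then have "openin ?R (?qU \<inter> ?D)" using D by simp
    ultimately have "openin ?R ((?qU \<inter> ?C) \<union> (?qU \<inter> ?D))" by auto
    moreover have "(?qU \<inter> ?C) \<union> (?qU \<inter> ?D) = ?qU" by auto
    ultimately have "openin ?R ?qU" by simp
    then show "openin ?Q U" using q U unfolding quotient_map_def by blast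
  qed
qed

section \<open>Induced spectra\<close>

lemma res_spectrum_orthogonal:
  assumes kG: "k_group G T" and H: "subgroup H G" and cH: "closedin T H" and Y: "orthogonal_spectrum G T Y"
  shows "orthogonal_spectrum (G\<lparr>carrier := H\<rparr>) (subtopology T H) (res_spectrum H Y)"
proof -
  interpret G: group G using kG by (rule k_groupD)
  note YD = orthogonal_spectrumD[OF Y kG]
  have c: "continuous_map (k_prod (subtopology T H) (ptop (lvl Y m))) (ptop (lvl Y m)) (\<lambda>(g, a). restrict (act Y) H g m a)" for m
  proof -
    have "continuous_map (k_prod (subtopology T H) (ptop (lvl Y m))) (subtopology T H) fst" by (rule k_prod_fst)
    then have "continuous_map (k_prod (subtopology T H) (ptop (lvl Y m))) T fst" by (simp add: continuous_map_in_subtopology)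
    then have "continuous_map (k_prod (subtopology T H) (ptop (lvl Y m))) (ptop (lvl Y m)) (\<lambda>p. act Y (fst p) m (snd p))"
      using k_groupD(3)[OF k_group_subgroup[OF kG H cH]] YD(2) by (intro YD(10) k_prod_snd CGWH_k_prod)
    then show ?thesis by (rule continuous_map_eq) auto
  qed
  show ?thesis
    using Y subgroup.mem_carrier[OF H] c G.one_closed subgroup.one_closed[OF H] subgroup.m_closed[OF H]
    unfolding orthogonal_spectrum_def by (simp add: res_spectrum_def)
qed

text \<open>Stated for a \<open>k_group\<close>, so that the theory applies to H in G and again to
  H/N in G/N.\<close>

locale ind_setup =
  fixes G :: "'g monoid" and T :: "'g topology" and H :: "'g set" and X :: "('g, 'a) ospectrum"
  assumes kG: "k_group G T" and H: "subgroup H G" and cH: "closedin T H"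
    and X: "orthogonal_spectrum (G\<lparr>carrier := H\<rparr>) (subtopology T H) X"
begin

sublocale G: group G using kG by (rule k_groupD)

lemmas kH = k_group_subgroup[OF kG H cH]
lemmas XD = orthogonal_spectrumD[OF X kH]

lemma HG: "h \<in> H \<Longrightarrow> h \<in> carrier G"
  using subgroup.mem_carrier[OF H] .

lemmas topspace_T = k_groupD(2)[OF kG] and CGWH_T = k_groupD(3)[OF kG]

text \<open>The point g \<and> x; the classes of all such pairs exhaust the induced level, by
  \<open>\<kappa>_surj\<close>.\<close>

definition \<kappa> :: "nat \<Rightarrow> 'g \<Rightarrow> 'a \<Rightarrow> ('g option \<times> 'a) set" where
  "\<kappa> m g x = ind_class G T H X m (Some g) x"

abbreviation "I \<equiv> ind_spectrum G T H X"

lemma based_pre: "based_CGWH (ind_pre T X m)"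
  unfolding ind_pre_def using CGWH_T XD(1) by (intro based_CGWH_smash based_CGWH_adjoin_pt)

lemma ind_pt_in: "p \<in> insert None (Some ` carrier G) \<Longrightarrow> x \<in> lvl_set X m \<Longrightarrow> ind_pt T X m p x \<in> topspace (ptop (ind_pre T X m))"
  using continuous_map_point[OF quotient_imp_continuous_map[OF quotient_map_smash], of "(p, x)" "adjoin_pt T" "lvl X m"]
  by (simp add: ind_pt_def ind_pre_def topspace_T)

lemma ind_rel_sub: "ind_rel G T H X m \<subseteq> topspace (ptop (ind_pre T X m)) \<times> topspace (ptop (ind_pre T X m))"
  unfolding ind_rel_def using HG XD(11) by (auto intro!: ind_pt_in)

lemma lvl_I [simp]: "lvl I m = coeq (ind_pre T X m) (ind_rel G T H X m)"
  by (simp add: ind_spectrum_def)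

lemma based_I: "based_CGWH (lvl I m)"
  using based_CGWH_coeq[OF based_pre ind_rel_sub] by simp

lemma CGWH_I: "CGWH (ptop (lvl I m))" using based_I by (simp add: based_CGWH_iff)

lemma CGWH_prod: "CGWH (k_prod T (ptop (lvl X m)))" using CGWH_T XD(2) by blast

lemma quotient_ind_pt:
  "quotient_map (k_prod T (ptop (lvl X m))) (ptop (ind_pre T X m)) (\<lambda>(g, x). ind_pt T X m (Some g) x)"
  using quotient_map_smash_adjoin_pt[OF CGWH_T _ XD(1), of "\<one>\<^bsub>G\<^esub>" m] topspace_T by (simp add: ind_pt_def ind_pre_def)

lemma quotient_\<kappa>: "quotient_map (k_prod T (ptop (lvl X m))) (ptop (lvl I m)) (\<lambda>(g, x). \<kappa> m g x)"
  using quotient_map_compose[OF quotient_ind_pt quotient_map_coeq]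
  by (simp add: o_def case_prod_beta' \<kappa>_def ind_class_def)

lemma continuous_map_\<kappa>:
  assumes "CGWH K" "continuous_map K T g" "continuous_map K (ptop (lvl X m)) x"
  shows "continuous_map K (ptop (lvl I m)) (\<lambda>k. \<kappa> m (g k) (x k))"
  using continuous_map_k_prod_comp[OF quotient_imp_continuous_map[OF quotient_\<kappa>] CGWH_T XD(2) assms] .

lemma \<kappa>_in: "g \<in> carrier G \<Longrightarrow> x \<in> lvl_set X m \<Longrightarrow> \<kappa> m g x \<in> lvl_set I m"
  using continuous_map_point[OF quotient_imp_continuous_map[OF quotient_\<kappa>], of "(g, x)" m] topspace_T by simp

lemma \<kappa>_surj:
  assumes "z \<in> lvl_set I m"
  obtains g x where "g \<in> carrier G" "x \<in> lvl_set X m" "z = \<kappa> m g x"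
proof -
  have "z \<in> (\<lambda>(g, x). \<kappa> m g x) ` topspace (k_prod T (ptop (lvl X m)))"
    using quotient_\<kappa>[of m] assms unfolding quotient_map_def by simp
  then show ?thesis using that topspace_T by auto
qed

lemma ind_pt_base: "ind_pt T X m None x = (None, pt (lvl X m))" "ind_pt T X m p (pt (lvl X m)) = (None, pt (lvl X m))"
  by (auto simp: ind_pt_def smash_pt_def)

lemma \<kappa>_base: "pt (lvl I m) = \<kappa> m g (pt (lvl X m))" "ind_class G T H X m None x = pt (lvl I m)"
  by (auto simp: \<kappa>_def ind_class_def ind_pt_base ind_pre_def)

lemma \<kappa>_rel: "g \<in> carrier G \<Longrightarrow> h \<in> H \<Longrightarrow> x \<in> lvl_set X m \<Longrightarrow> \<kappa> m (g \<otimes>\<^bsub>G\<^esub> h) x = \<kappa> m g (act X h m x)"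
  unfolding \<kappa>_def ind_class_def by (rule coeq_class_rel[OF ind_rel_sub]) (auto simp: ind_rel_def)

text \<open>The universal property of the induced level, in the two forms in which it is used: the
  value of a \<open>the_elem\<close> formula and a consequence of equal points.\<close>

lemma ind_lift:
  assumes W: "CGWH W" and F: "continuous_map (k_prod T (ptop (lvl X m))) W (\<lambda>(g, x). F (Some g, x))"
    and F0: "\<And>g. g \<in> carrier G \<Longrightarrow> F (Some g, pt (lvl X m)) = F (None, pt (lvl X m))"
    and FR: "\<And>g h x. g \<in> carrier G \<Longrightarrow> h \<in> H \<Longrightarrow> x \<in> lvl_set X m \<Longrightarrow> F (Some (g \<otimes>\<^bsub>G\<^esub> h), x) = F (Some g, act X h m x)"
  shows "g \<in> carrier G \<Longrightarrow> x \<in> lvl_set X m \<Longrightarrow> the_elem (F ` \<kappa> m g x) = F (Some g, x)"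
    "g \<in> carrier G \<Longrightarrow> x \<in> lvl_set X m \<Longrightarrow> g' \<in> carrier G \<Longrightarrow> x' \<in> lvl_set X m \<Longrightarrow> \<kappa> m g x = \<kappa> m g' x' \<Longrightarrow>
      F (Some g, x) = F (Some g', x')"
proof -
  have Fs: "F (ind_pt T X m (Some g) x) = F (Some g, x)" if "g \<in> carrier G" for g x
    using F0[OF that] by (auto simp: ind_pt_def smash_pt_def)
  have "continuous_map (k_prod T (ptop (lvl X m))) W (F \<circ> (\<lambda>(g, x). ind_pt T X m (Some g) x))"
    using F by (rule continuous_map_eq) (auto simp: Fs topspace_T)
  then have c: "continuous_map (ptop (ind_pre T X m)) W F"
    using continuous_compose_quotient_map[OF quotient_ind_pt] by blast
  have R: "F p = F p'" if "(p, p') \<in> ind_rel G T H X m" for p p'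
    using that FR HG Fs by (auto simp: ind_rel_def)
  have cp: "CGWH (ptop (ind_pre T X m))" using based_pre by (simp add: based_CGWH_iff)
  show "g \<in> carrier G \<Longrightarrow> x \<in> lvl_set X m \<Longrightarrow> the_elem (F ` \<kappa> m g x) = F (Some g, x)"
    unfolding \<kappa>_def ind_class_def using coeq_the_elem[OF cp ind_rel_sub W c R ind_pt_in, of "Some g" x] Fs by simp
  show "g \<in> carrier G \<Longrightarrow> x \<in> lvl_set X m \<Longrightarrow> g' \<in> carrier G \<Longrightarrow> x' \<in> lvl_set X m \<Longrightarrow> \<kappa> m g x = \<kappa> m g' x' \<Longrightarrow>
      F (Some g, x) = F (Some g', x')"
    unfolding \<kappa>_def ind_class_def
    using coeq_class_lift[OF cp ind_rel_sub W c R ind_pt_in ind_pt_in, of "Some g" x "Some g'" x'] Fs by simp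
qed

text \<open>The fibres of \<open>\<kappa>\<close>. The first disjunct alone is an orbit relation; the second one identifies the
  copies of the base point.\<close>

definition fib :: "nat \<Rightarrow> (('g \<times> 'a) \<times> ('g \<times> 'a)) set" where
  "fib m = {((g, x), (g', x')). g \<in> carrier G \<and> g' \<in> carrier G \<and> x \<in> lvl_set X m \<and> x' \<in> lvl_set X m \<and>
     (inv\<^bsub>G\<^esub> g \<otimes>\<^bsub>G\<^esub> g' \<in> H \<and> x = act X (inv\<^bsub>G\<^esub> g \<otimes>\<^bsub>G\<^esub> g') m x' \<or> x = pt (lvl X m) \<and> x' = pt (lvl X m))}"

lemma act_inv_X: "h \<in> H \<Longrightarrow> x \<in> lvl_set X m \<Longrightarrow> act X (inv\<^bsub>G\<^esub> h) m (act X h m x) = x"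
  using XD(13)[of "inv\<^bsub>G\<^esub> h" h x m] XD(12)[of x m] subgroup.m_inv_closed[OF H] HG by simp

lemma equiv_fib: "equiv (topspace (k_prod T (ptop (lvl X m)))) (fib m)"
proof (rule equivI)
  show "fib m \<subseteq> topspace (k_prod T (ptop (lvl X m))) \<times> topspace (k_prod T (ptop (lvl X m)))"
    by (auto simp: fib_def topspace_T)
  show "refl_on (topspace (k_prod T (ptop (lvl X m)))) (fib m)"
    using XD(12) subgroup.one_closed[OF H] by (auto simp: fib_def topspace_T refl_on_def)
  show "sym (fib m)"
  proof (rule symI, clarsimp simp: fib_def)
    fix g x g' x' assume a: "g \<in> carrier G" "g' \<in> carrier G" "x \<in> lvl_set X m" "x' \<in> lvl_set X m"
      "inv\<^bsub>G\<^esub> g \<otimes>\<^bsub>G\<^esub> g' \<in> H \<and> x = act X (inv\<^bsub>G\<^esub> g \<otimes>\<^bsub>G\<^esub> g') m x' \<or> x = pt (lvl X m) \<and> x' = pt (lvl X m)"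
      "x' = pt (lvl X m) \<longrightarrow> x \<noteq> pt (lvl X m)"
    have e: "inv\<^bsub>G\<^esub> g' \<otimes>\<^bsub>G\<^esub> g = inv\<^bsub>G\<^esub> (inv\<^bsub>G\<^esub> g \<otimes>\<^bsub>G\<^esub> g')" using a by (simp add: G.inv_mult_group)
    show "inv\<^bsub>G\<^esub> g' \<otimes>\<^bsub>G\<^esub> g \<in> H \<and> x' = act X (inv\<^bsub>G\<^esub> g' \<otimes>\<^bsub>G\<^esub> g) m x"
      unfolding e using a act_inv_X[of "inv\<^bsub>G\<^esub> g \<otimes>\<^bsub>G\<^esub> g'" x' m] subgroup.m_inv_closed[OF H] by auto
  qed
  show "trans (fib m)"
  proof (rule transI, clarsimp simp: fib_def)
    fix g x g' x' g'' x'' assume a: "g \<in> carrier G" "g' \<in> carrier G" "g'' \<in> carrier G"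
      "x \<in> lvl_set X m" "x' \<in> lvl_set X m" "x'' \<in> lvl_set X m"
      "inv\<^bsub>G\<^esub> g \<otimes>\<^bsub>G\<^esub> g' \<in> H \<and> x = act X (inv\<^bsub>G\<^esub> g \<otimes>\<^bsub>G\<^esub> g') m x' \<or> x = pt (lvl X m) \<and> x' = pt (lvl X m)"
      "inv\<^bsub>G\<^esub> g' \<otimes>\<^bsub>G\<^esub> g'' \<in> H \<and> x' = act X (inv\<^bsub>G\<^esub> g' \<otimes>\<^bsub>G\<^esub> g'') m x'' \<or> x' = pt (lvl X m) \<and> x'' = pt (lvl X m)"
      "x = pt (lvl X m) \<longrightarrow> x'' \<noteq> pt (lvl X m)"
    let ?h = "inv\<^bsub>G\<^esub> g \<otimes>\<^bsub>G\<^esub> g'" and ?h' = "inv\<^bsub>G\<^esub> g' \<otimes>\<^bsub>G\<^esub> g''"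
    \<comment> \<open>Elements of H fix the base point. A mixture of the two disjuncts would
      therefore make both ends base points, which is excluded.\<close>
    have pt: "act X h m (pt (lvl X m)) = pt (lvl X m)" if "h \<in> H" for h using XD(14) that by simp
    have "?h \<in> H" "?h' \<in> H" "x = act X ?h m x'" "x' = act X ?h' m x''"
      using a(7-9) pt act_inv_X[of ?h' x'' m] XD(14) subgroup.m_inv_closed[OF H] a(6)
      by (metis (no_types, lifting) partial_object.select_convs(1) partial_object.surjective partial_object.update_convs(1))+
    moreover have "inv\<^bsub>G\<^esub> g \<otimes>\<^bsub>G\<^esub> g'' = ?h \<otimes>\<^bsub>G\<^esub> ?h'"
      using a(1-3) by (simp add: G.m_assoc[symmetric]) (simp add: G.m_assoc)
    ultimately show "inv\<^bsub>G\<^esub> g \<otimes>\<^bsub>G\<^esub> g'' \<in> H \<and> x = act X (inv\<^bsub>G\<^esub> g \<otimes>\<^bsub>G\<^esub> g'') m x''"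
      using XD(13)[of ?h ?h' x'' m] a(6) subgroup.m_closed[OF H] by simp
  qed
qed

text \<open>The orbit part lives over the closed set of pairs with quotient in H, where it is a
  coincidence set of continuous maps. The rest is the square of the closed base point fibre.\<close>

lemma closedin_fib: "closedin (k_prod (k_prod T (ptop (lvl X m))) (k_prod T (ptop (lvl X m)))) (fib m)"
proof -
  let ?P = "k_prod T (ptop (lvl X m))"
  let ?PP = "k_prod ?P ?P"
  have cPP: "CGWH ?PP" using CGWH_prod by blast
  have c: "continuous_map ?PP T (\<lambda>p. fst (fst p))" "continuous_map ?PP T (\<lambda>p. fst (snd p))"
    "continuous_map ?PP (ptop (lvl X m)) (\<lambda>p. snd (fst p))" "continuous_map ?PP (ptop (lvl X m)) (\<lambda>p. snd (snd p))"
    using continuous_map_comp[OF k_prod_fst k_prod_fst] continuous_map_comp[OF k_prod_fst k_prod_snd]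
      continuous_map_comp[OF k_prod_snd k_prod_fst] continuous_map_comp[OF k_prod_snd k_prod_snd] by blast+
  let ?h = "\<lambda>p. inv\<^bsub>G\<^esub> (fst (fst p)) \<otimes>\<^bsub>G\<^esub> fst (snd p)"
  have h: "continuous_map ?PP T ?h" using c by (intro k_groupD(4,5)[OF kG] cPP)
  let ?C = "{p \<in> topspace ?PP. ?h p \<in> H}"
  have C: "closedin ?PP ?C" using closedin_continuous_map_preimage[OF h cH] .
  have cC: "CGWH (subtopology ?PP ?C)" using CGWH_closed_subtopology[OF cPP C] .
  have hC: "continuous_map (subtopology ?PP ?C) (subtopology T H) ?h"
    using h by (auto simp: continuous_map_in_subtopology continuous_map_from_subtopology)
  have "closedin (subtopology ?PP ?C) {p \<in> topspace (subtopology ?PP ?C). snd (fst p) = act X (?h p) m (snd (snd p))}"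
    by (rule closedin_eq_maps[OF cC XD(2) continuous_map_from_subtopology[OF c(3)]
          XD(10)[OF cC hC continuous_map_from_subtopology[OF c(4)]]])
  then have 1: "closedin ?PP {p \<in> topspace (subtopology ?PP ?C). snd (fst p) = act X (?h p) m (snd (snd p))}"
    using C closedin_trans_full by blast
  have pt: "closedin (ptop (lvl X m)) {pt (lvl X m)}"
    using closedin_WH_point XD(2,3) by (metis CGWH_def)
  have 2: "closedin ?PP ({p \<in> topspace ?PP. snd (fst p) \<in> {pt (lvl X m)}} \<inter> {p \<in> topspace ?PP. snd (snd p) \<in> {pt (lvl X m)}})"
    by (intro closedin_Int closedin_continuous_map_preimage[OF c(3) pt] closedin_continuous_map_preimage[OF c(4) pt])
  have "fib m = {p \<in> topspace (subtopology ?PP ?C). snd (fst p) = act X (?h p) m (snd (snd p))} \<union>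
     ({p \<in> topspace ?PP. snd (fst p) \<in> {pt (lvl X m)}} \<inter> {p \<in> topspace ?PP. snd (snd p) \<in> {pt (lvl X m)}})"
    by (auto simp: fib_def topspace_T)
  then show ?thesis using closedin_Un[OF 1 2] by simp
qed

text \<open>The quotient by the closed relation \<open>fib\<close> is compactly generated weak
  Hausdorff, and its projection respects the generators of the coequalizer. So points equal in the
  coequalizer are equal in this quotient.\<close>

lemma \<kappa>_eqD:
  assumes gx: "g \<in> carrier G" "x \<in> lvl_set X m" "g' \<in> carrier G" "x' \<in> lvl_set X m" and eq: "\<kappa> m g x = \<kappa> m g' x'"
  shows "((g, x), (g', x')) \<in> fib m"
proof -
  let ?P = "k_prod T (ptop (lvl X m))"
  let ?q = "\<lambda>p. fib m `` {p}"
  have qe: "?q p = ?q p' \<longleftrightarrow> (p, p') \<in> fib m" if "p \<in> topspace ?P" "p' \<in> topspace ?P" for p p'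
    using eq_equiv_class_iff[OF equiv_fib that] .
  have "{(p, p'). p \<in> topspace ?P \<and> p' \<in> topspace ?P \<and> ?q p = ?q p'} = fib m"
  proof (rule Set.set_eqI)
    fix z :: "('g \<times> 'a) \<times> ('g \<times> 'a)"
    obtain p p' where z: "z = (p, p')" by (cases z)
    have "p \<in> topspace ?P \<and> p' \<in> topspace ?P" if "(p, p') \<in> fib m"
      using that by (auto simp: fib_def topspace_T)
    then show "z \<in> {(p, p'). p \<in> topspace ?P \<and> p' \<in> topspace ?P \<and> ?q p = ?q p'} \<longleftrightarrow> z \<in> fib m"
      unfolding z using qe[of p p'] by blast
  qed
  then have W: "CGWH (quotient_topology ?P ?q)"
    using CGWH_quotient[OF CGWH_prod quotient_map_quotient_topology[of _ ?q]] closedin_fib[of m] by simp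
  \<comment> \<open>The adjoined point goes to the class of all base points; the unit is an
    arbitrary choice of representative.\<close>
  define F where "F = (\<lambda>(p, x). case p of None \<Rightarrow> ?q (\<one>\<^bsub>G\<^esub>, pt (lvl X m)) | Some g \<Rightarrow> ?q (g, x))"
  have "F (Some g, x) = F (Some g', x')"
  proof (rule ind_lift(2)[OF W _ _ _ gx eq])
    show "continuous_map ?P (quotient_topology ?P ?q) (\<lambda>(g, x). F (Some g, x))"
      using quotient_imp_continuous_map[OF quotient_map_quotient_topology] by (simp add: F_def case_prod_beta')
    show "F (Some g, pt (lvl X m)) = F (None, pt (lvl X m))" if "g \<in> carrier G" for g
      using that qe[of "(g, pt (lvl X m))" "(\<one>\<^bsub>G\<^esub>, pt (lvl X m))"] XD(3) by (simp add: F_def topspace_T fib_def)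
    show "F (Some (g \<otimes>\<^bsub>G\<^esub> h), x) = F (Some g, act X h m x)" if a: "g \<in> carrier G" "h \<in> H" "x \<in> lvl_set X m" for g h x
    proof -
      have "inv\<^bsub>G\<^esub> (g \<otimes>\<^bsub>G\<^esub> h) \<otimes>\<^bsub>G\<^esub> g = inv\<^bsub>G\<^esub> h" using a HG by (simp add: G.inv_mult_group G.m_assoc)
      then have "((g \<otimes>\<^bsub>G\<^esub> h, x), (g, act X h m x)) \<in> fib m"
        using a HG XD(11) act_inv_X subgroup.m_inv_closed[OF H] by (auto simp: fib_def)
      then show ?thesis using qe[of "(g \<otimes>\<^bsub>G\<^esub> h, x)" "(g, act X h m x)"] a HG XD(11) by (simp add: F_def topspace_T)
    qed
  qed
  then show ?thesis using qe[of "(g, x)" "(g', x')"] gx by (simp add: F_def topspace_T)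
qed

section \<open>The structure of the induced spectrum\<close>

lemma str_I:
  assumes "\<phi> \<in> Omor (Euc m) (Euc n)" "g \<in> carrier G" "x \<in> lvl_set X m"
  shows "str I m n \<phi> (\<kappa> m g x) = \<kappa> n g (str X m n \<phi> x)"
proof -
  let ?F = "\<lambda>(p, x). ind_class G T H X n p (str X m n \<phi> x)"
  have c\<phi>: "continuous_map K (ptop (Osp (Euc m) (Euc n))) (\<lambda>_. \<phi>)" for K :: "('g \<times> 'a) topology"
    using assms(1) topspace_Osp' by simp
  have "the_elem (?F ` \<kappa> m g x) = ?F (Some g, x)"
  proof (rule ind_lift(1)[OF CGWH_I])
    show "continuous_map (k_prod T (ptop (lvl X m))) (ptop (lvl I n)) (\<lambda>(g, x). ?F (Some g, x))"
      unfolding case_prod_beta' using c\<phi> by (simp only: fst_conv snd_conv \<kappa>_def[symmetric])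
         (intro continuous_map_\<kappa> CGWH_prod k_prod_fst XD(4) k_prod_snd)
    show "?F (Some g, pt (lvl X m)) = ?F (None, pt (lvl X m))" for g
      using XD(7)[OF assms(1)] \<kappa>_base[of n] by (simp add: \<kappa>_def)
    show "?F (Some (g \<otimes>\<^bsub>G\<^esub> h), x) = ?F (Some g, act X h m x)" if "g \<in> carrier G" "h \<in> H" "x \<in> lvl_set X m" for g h x
      using that \<kappa>_rel[OF that(1,2) XD(5)[OF assms(1) that(3)]] XD(15)[OF _ assms(1) that(3)] by (simp add: \<kappa>_def)
  qed (use assms in auto)
  then show ?thesis by (simp add: ind_spectrum_def \<kappa>_def)
qed

lemma act_I:
  assumes "k \<in> carrier G" "g \<in> carrier G" "x \<in> lvl_set X m"
  shows "act I k m (\<kappa> m g x) = \<kappa> m (k \<otimes>\<^bsub>G\<^esub> g) x"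
proof -
  let ?F = "\<lambda>(p, x). ind_class G T H X m (map_option (\<lambda>g. k \<otimes>\<^bsub>G\<^esub> g) p) x"
  have "the_elem (?F ` \<kappa> m g x) = ?F (Some g, x)"
  proof (rule ind_lift(1)[OF CGWH_I])
    show "continuous_map (k_prod T (ptop (lvl X m))) (ptop (lvl I m)) (\<lambda>(g, x). ?F (Some g, x))"
      unfolding case_prod_beta' using assms(1) by (simp only: fst_conv snd_conv option.map \<kappa>_def[symmetric])
         (intro continuous_map_\<kappa> CGWH_prod k_groupD(4)[OF kG] k_prod_fst k_prod_snd, simp add: topspace_T)
    show "?F (Some g, pt (lvl X m)) = ?F (None, pt (lvl X m))" for g
      using \<kappa>_base[of m] by (simp add: \<kappa>_def)
    show "?F (Some (g \<otimes>\<^bsub>G\<^esub> h), x) = ?F (Some g, act X h m x)" if "g \<in> carrier G" "h \<in> H" "x \<in> lvl_set X m" for g h x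
      using that \<kappa>_rel[of "k \<otimes>\<^bsub>G\<^esub> g" h x m] HG assms(1) by (simp add: \<kappa>_def G.m_assoc)
  qed (use assms in auto)
  then show ?thesis by (simp add: ind_spectrum_def \<kappa>_def)
qed

lemma spectrum_I: "orthogonal_spectrum G T I"
  unfolding orthogonal_spectrum_def
proof (intro conjI allI ballI)
  fix m n
  have O: "CGWH (ptop (Osp (Euc m) (Euc n)))" by (simp add: CGWH_Osp)
  show "based_CGWH (lvl I m)" by (rule based_I)
  show "continuous_map (k_prod (ptop (Osp (Euc m) (Euc n))) (ptop (lvl I m))) (ptop (lvl I n)) (\<lambda>(\<phi>, a). str I m n \<phi> a)"
  proof (rule continuous_map_quotient_param[OF CGWH_prod O CGWH_I quotient_\<kappa>])
    let ?K = "k_prod (ptop (Osp (Euc m) (Euc n))) (k_prod T (ptop (lvl X m)))"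
    have "continuous_map ?K (ptop (lvl I n)) (\<lambda>p. \<kappa> n (fst (snd p)) (str X m n (fst p) (snd (snd p))))"
      using O CGWH_T XD(2) by (intro continuous_map_\<kappa> XD(4) CGWH_k_prod continuous_map_comp[OF k_prod_fst k_prod_snd]
          continuous_map_comp[OF k_prod_snd k_prod_snd] k_prod_fst)
    then show "continuous_map ?K (ptop (lvl I n)) (\<lambda>(s, x). str I m n s (case x of (g, x) \<Rightarrow> \<kappa> m g x))"
      by (rule continuous_map_eq) (auto simp: str_I topspace_Osp' topspace_T)
  qed
  show "continuous_map (k_prod T (ptop (lvl I m))) (ptop (lvl I m)) (\<lambda>(g, a). act I g m a)"
  proof (rule continuous_map_quotient_param[OF CGWH_prod CGWH_T CGWH_I quotient_\<kappa>])
    let ?K = "k_prod T (k_prod T (ptop (lvl X m)))"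
    have "continuous_map ?K (ptop (lvl I m)) (\<lambda>p. \<kappa> m (fst p \<otimes>\<^bsub>G\<^esub> fst (snd p)) (snd (snd p)))"
      using CGWH_T XD(2) by (intro continuous_map_\<kappa> k_groupD(4)[OF kG] CGWH_k_prod continuous_map_comp[OF k_prod_fst k_prod_snd]
          continuous_map_comp[OF k_prod_snd k_prod_snd] k_prod_fst)
    then show "continuous_map ?K (ptop (lvl I m)) (\<lambda>(s, x). act I s m (case x of (g, x) \<Rightarrow> \<kappa> m g x))"
      by (rule continuous_map_eq) (auto simp: act_I topspace_T)
  qed
next
  fix m n a assume "a \<in> lvl_set I m"
  then show "str I m n (None, None) a = pt (lvl I n)"
    by (elim \<kappa>_surj) (metis str_I XD(6) Omor_None \<kappa>_base(1))
next
  fix m n \<phi> assume \<phi>: "\<phi> \<in> Omor (Euc m) (Euc n)"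
  show "str I m n \<phi> (pt (lvl I m)) = pt (lvl I n)"
    using str_I[OF \<phi> G.one_closed XD(3)] XD(7)[OF \<phi>] \<kappa>_base(1) by metis
next
  fix m a assume "a \<in> lvl_set I m"
  then show "str I m m (Oid (Euc m)) a = a"
    by (elim \<kappa>_surj) (simp add: str_I XD(8) Oid_in_Omor)
next
  fix l m n \<psi> \<phi> a assume a: "\<psi> \<in> Omor (Euc l) (Euc m)" "\<phi> \<in> Omor (Euc m) (Euc n)" "a \<in> lvl_set I l"
  then have "Ocomp (Euc l) \<phi> \<psi> \<in> Omor (Euc l) (Euc n)" by (intro Ocomp_in_Omor) auto
  with a show "str I l n (Ocomp (Euc l) \<phi> \<psi>) a = str I m n \<phi> (str I l m \<psi> a)"
    by (elim \<kappa>_surj) (simp add: str_I XD(9) XD(5))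
next
  fix m a assume "a \<in> lvl_set I m"
  then show "act I \<one>\<^bsub>G\<^esub> m a = a" by (elim \<kappa>_surj) (simp add: act_I)
next
  fix m g h a assume "g \<in> carrier G" "h \<in> carrier G" "a \<in> lvl_set I m"
  then show "act I (g \<otimes>\<^bsub>G\<^esub> h) m a = act I g m (act I h m a)" by (elim \<kappa>_surj) (simp add: act_I G.m_assoc)
next
  fix m g assume "g \<in> carrier G"
  then show "act I g m (pt (lvl I m)) = pt (lvl I m)"
    using act_I[OF _ G.one_closed XD(3), of g m] \<kappa>_base(1) by metis
next
  fix m n g \<phi> a assume "g \<in> carrier G" "\<phi> \<in> Omor (Euc m) (Euc n)" "a \<in> lvl_set I m"
  then show "act I g n (str I m n \<phi> a) = str I m n \<phi> (act I g m a)"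
    by (elim \<kappa>_surj) (simp add: act_I str_I XD(5))
qed

lemma unit_eq: "ind_unit G T H X m x = \<kappa> m \<one>\<^bsub>G\<^esub> x"
  by (simp add: ind_unit_def \<kappa>_def)

lemma unit_morphism: "ospectrum_morphism (G\<lparr>carrier := H\<rparr>) (subtopology T H) X (res_spectrum H I) (ind_unit G T H X)"
  unfolding ospectrum_morphism_def
proof (intro conjI allI ballI X res_spectrum_orthogonal[OF kG H cH] spectrum_I)
  fix m
  show "continuous_map (ptop (lvl X m)) (ptop (lvl (res_spectrum H I) m)) (ind_unit G T H X m)"
    unfolding unit_eq[abs_def] using continuous_map_\<kappa>[OF XD(2), of m "\<lambda>_. \<one>\<^bsub>G\<^esub>" m "\<lambda>x. x"]
    by (simp add: res_spectrum_def topspace_T del: lvl_I)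
  show "ind_unit G T H X m (pt (lvl X m)) = pt (lvl (res_spectrum H I) m)"
    unfolding unit_eq using \<kappa>_base(1)[of m "\<one>\<^bsub>G\<^esub>"] by (simp add: res_spectrum_def)
next
  fix m n \<phi> a assume "\<phi> \<in> Omor (Euc m) (Euc n)" "a \<in> lvl_set X m"
  then show "ind_unit G T H X n (str X m n \<phi> a) = str (res_spectrum H I) m n \<phi> (ind_unit G T H X m a)"
    unfolding unit_eq by (simp add: res_spectrum_def str_I)
next
  fix m g a assume "g \<in> carrier (G\<lparr>carrier := H\<rparr>)" "a \<in> lvl_set X m"
  then show "ind_unit G T H X m (act X g m a) = act (res_spectrum H I) g m (ind_unit G T H X m a)"
    unfolding unit_eq using HG \<kappa>_rel[of "\<one>\<^bsub>G\<^esub>" g a m] by (simp add: res_spectrum_def act_I)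
qed

text \<open>H-equivariance of \<open>u\<close> makes (g, x) -> g u(x) agree on the two sides of the
  relation gh \<and> x = g \<and> hx.\<close>

lemma adjoint_morphism:
  fixes Y :: "('g, 'b) ospectrum"
  assumes Y: "orthogonal_spectrum G T Y"
    and u: "ospectrum_morphism (G\<lparr>carrier := H\<rparr>) (subtopology T H) X (res_spectrum H Y) u"
  shows "g \<in> carrier G \<Longrightarrow> x \<in> lvl_set X m \<Longrightarrow> ind_adjoint Y u m (\<kappa> m g x) = act Y g m (u m x)"
    "ospectrum_morphism G T I Y (ind_adjoint Y u)"
proof -
  note YD = orthogonal_spectrumD[OF Y kG]
  have u1: "continuous_map (ptop (lvl X m)) (ptop (lvl Y m)) (u m)" "u m (pt (lvl X m)) = pt (lvl Y m)"
    "\<And>n \<phi> a. \<phi> \<in> Omor (Euc m) (Euc n) \<Longrightarrow> a \<in> lvl_set X m \<Longrightarrow> u n (str X m n \<phi> a) = str Y m n \<phi> (u m a)"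
    "\<And>g a. g \<in> H \<Longrightarrow> a \<in> lvl_set X m \<Longrightarrow> u m (act X g m a) = act Y g m (u m a)" for m
    using u by (auto simp: ospectrum_morphism_def res_spectrum_def)
  have u2: "x \<in> lvl_set X m \<Longrightarrow> u m x \<in> lvl_set Y m" for x m using continuous_map_point[OF u1(1)] .
  show adj: "ind_adjoint Y u m (\<kappa> m g x) = act Y g m (u m x)" if "g \<in> carrier G" "x \<in> lvl_set X m" for m g x
  proof -
    let ?F = "\<lambda>(p, x). case p of None \<Rightarrow> pt (lvl Y m) | Some g \<Rightarrow> act Y g m (u m x)"
    have "the_elem (?F ` \<kappa> m g x) = ?F (Some g, x)"
    proof (rule ind_lift(1)[OF YD(2)])
      show "continuous_map (k_prod T (ptop (lvl X m))) (ptop (lvl Y m)) (\<lambda>(g, x). ?F (Some g, x))"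
        unfolding case_prod_beta' by simp (intro YD(10) CGWH_prod k_prod_fst continuous_map_comp[OF u1(1) k_prod_snd])
      show "?F (Some g, pt (lvl X m)) = ?F (None, pt (lvl X m))" if "g \<in> carrier G" for g
        using that u1(2) YD(14) by simp
      show "?F (Some (g \<otimes>\<^bsub>G\<^esub> h), x) = ?F (Some g, act X h m x)" if "g \<in> carrier G" "h \<in> H" "x \<in> lvl_set X m" for g h x
        using that HG u1(4) u2 YD(13) by simp
    qed (use that in auto)
    then show ?thesis by (simp add: ind_adjoint_def)
  qed
  show "ospectrum_morphism G T I Y (ind_adjoint Y u)"
    unfolding ospectrum_morphism_def
  proof (intro conjI allI ballI Y spectrum_I)
    fix m
    have "continuous_map (k_prod T (ptop (lvl X m))) (ptop (lvl Y m)) (\<lambda>p. act Y (fst p) m (u m (snd p)))"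
      by (intro YD(10) CGWH_prod k_prod_fst continuous_map_comp[OF u1(1) k_prod_snd])
    then have "continuous_map (k_prod T (ptop (lvl X m))) (ptop (lvl Y m)) (ind_adjoint Y u m \<circ> (\<lambda>(g, x). \<kappa> m g x))"
      by (rule continuous_map_eq) (auto simp: adj topspace_T)
    then show "continuous_map (ptop (lvl I m)) (ptop (lvl Y m)) (ind_adjoint Y u m)"
      using continuous_compose_quotient_map[OF quotient_\<kappa>] by blast
    show "ind_adjoint Y u m (pt (lvl I m)) = pt (lvl Y m)"
      using adj[OF G.one_closed XD(3), of m] \<kappa>_base(1)[of m "\<one>\<^bsub>G\<^esub>"] u1(2) YD(14)[OF G.one_closed] by simp
  next
    fix m n \<phi> a assume "\<phi> \<in> Omor (Euc m) (Euc n)" "a \<in> lvl_set I m"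
    then show "ind_adjoint Y u n (str I m n \<phi> a) = str Y m n \<phi> (ind_adjoint Y u m a)"
      by (elim \<kappa>_surj) (simp add: str_I adj XD(5) u1(3) u2 YD(15))
  next
    fix m g a assume "g \<in> carrier G" "a \<in> lvl_set I m"
    then show "ind_adjoint Y u m (act I g m a) = act Y g m (ind_adjoint Y u m a)"
      by (elim \<kappa>_surj) (simp add: act_I adj u2 YD(13))
  qed
qed

end

section \<open>Evaluation at representations\<close>

lemma ips_subspace:
  assumes V: "inner_product_space V" and S: "subspace S" "S \<subseteq> V"
  shows "inner_product_space S"
proof -
  obtain B where B: "B \<subseteq> S" "independent B" "S \<subseteq> span B" using basis_exists[of S] by metis
  obtain C where "finite C" "V = span C" using V by (auto simp: inner_product_space_def)
  moreover from this have "B \<subseteq> span C" using B(1) S(2) by auto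
  ultimately have "finite B" using independent_span_bound[of C B] B(2) by blast
  moreover have "S = span B" using B S by (simp add: span_minimal subset_antisym)
  ultimately show ?thesis using S by (auto simp: inner_product_space_def)
qed

lemma CGWH_iso_top: "inner_product_space V \<Longrightarrow> inner_product_space W \<Longrightarrow> CGWH (iso_top V W)"
  by (simp add: compact_Hausdorff_imp_CGWH compact_iso_top)

lemma Olin_Omor: "inner_product_space W \<Longrightarrow> f \<in> isos V W \<Longrightarrow> Olin f \<in> Omor V W"
  using inner_product_space_props(1)[of W] by (auto simp: Olin_def Omor_def)

lemma continuous_map_Olin':
  "inner_product_space V \<Longrightarrow> inner_product_space W \<Longrightarrow> continuous_map S (iso_top V W) f \<Longrightarrow>
    continuous_map S (ptop (Osp V W)) (\<lambda>s. Olin (f s))"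
  using ips_pair.continuous_map_Olin[OF ips_pair.intro] .

abbreviation fr :: "vect set \<Rightarrow> omor" where "fr V \<equiv> Olin (frame V)"
abbreviation fri :: "vect set \<Rightarrow> omor" where "fri V \<equiv> Olin (frame_inv V)"

lemma fr_Omor: "inner_product_space V \<Longrightarrow> fr V \<in> Omor (Euc (dim V)) V"
  by (simp add: Olin_Omor frame_isos)

lemma fri_Omor: "inner_product_space V \<Longrightarrow> fri V \<in> Omor V (Euc (dim V))"
  by (simp add: Olin_Omor frame_inv_isos)

lemma compose_frame:
  assumes V: "inner_product_space V"
  shows "compose V (frame V) (frame_inv V) = (\<lambda>v\<in>V. v)"
    "compose (Euc (dim V)) (frame_inv V) (frame V) = (\<lambda>v\<in>Euc (dim V). v)"
  using frame_inv[OF V] by (auto simp: compose_def restrict_def fun_eq_iff)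

lemma fr_fri:
  assumes V: "inner_product_space V"
  shows "Ocomp V (fr V) (fri V) = Oid V" "Ocomp (Euc (dim V)) (fri V) (fr V) = Oid (Euc (dim V))"
  using Ocomp_Olin[OF _ frame_isos[OF V], of V "frame_inv V"] Ocomp_Olin[OF V frame_inv_isos[OF V], of "Euc (dim V)" "frame V"]
    compose_frame[OF V] by (simp_all add: Oid_def)

text \<open>The matrix of a morphism with respect to the chosen frames; it turns evaluation at
  \<open>V\<close> and \<open>W\<close> into a structure map between Euclidean levels.\<close>

definition cmor :: "vect set \<Rightarrow> vect set \<Rightarrow> omor \<Rightarrow> omor" where
  "cmor V W \<phi> = Ocomp (Euc (dim V)) (fri W) (Ocomp (Euc (dim V)) \<phi> (fr V))"

lemma cmor_Omor:
  assumes "inner_product_space V" "inner_product_space W" "\<phi> \<in> Omor V W"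
  shows "cmor V W \<phi> \<in> Omor (Euc (dim V)) (Euc (dim W))"
  unfolding cmor_def using assms fr_Omor fri_Omor
  by (intro Ocomp_in_Omor[OF inner_product_space_Euc assms(2)] Ocomp_in_Omor[OF inner_product_space_Euc assms(1)]) auto

lemma cmor_None [simp]: "cmor V W (None, None) = (None, None)"
  by (simp add: cmor_def)

lemma cmor_id: "inner_product_space V \<Longrightarrow> cmor V V (Oid V) = Oid (Euc (dim V))"
  by (simp add: cmor_def Ocomp_id_left[OF fr_Omor] fr_fri)

text \<open>The frame of the middle space cancels against its inverse.\<close>

lemma cmor_comp:
  assumes U: "inner_product_space U" and V: "inner_product_space V" and W: "inner_product_space W"
    and \<phi>: "\<phi> \<in> Omor V W" and \<psi>: "\<psi> \<in> Omor U V"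
  shows "cmor U W (Ocomp U \<phi> \<psi>) = Ocomp (Euc (dim U)) (cmor V W \<phi>) (cmor U V \<psi>)"
proof -
  let ?n = "Euc (dim U)" and ?m = "Euc (dim V)"
  note f = fr_Omor[OF U] fr_Omor[OF V] fri_Omor[OF V] fri_Omor[OF W]
  have n: "inner_product_space ?n" and m: "inner_product_space ?m" by simp_all
  have \<psi>f: "Ocomp ?n \<psi> (fr U) \<in> Omor ?n V" using Ocomp_in_Omor[OF n U V \<psi> f(1)] .
  have \<phi>f: "Ocomp ?m \<phi> (fr V) \<in> Omor ?m W" using Ocomp_in_Omor[OF m V W \<phi> f(2)] .
  have c\<psi>: "Ocomp ?n (fri V) (Ocomp ?n \<psi> (fr U)) \<in> Omor ?n ?m" using Ocomp_in_Omor[OF n V m f(3) \<psi>f] .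
  have "Ocomp ?n (cmor V W \<phi>) (cmor U V \<psi>) = Ocomp ?n (fri W) (Ocomp ?n (Ocomp ?m \<phi> (fr V)) (Ocomp ?n (fri V) (Ocomp ?n \<psi> (fr U))))"
    unfolding cmor_def by (rule Ocomp_assoc[OF n m f(4) \<phi>f c\<psi>])
  also have "Ocomp ?n (Ocomp ?m \<phi> (fr V)) (Ocomp ?n (fri V) (Ocomp ?n \<psi> (fr U)))
      = Ocomp ?n \<phi> (Ocomp ?n (fr V) (Ocomp ?n (fri V) (Ocomp ?n \<psi> (fr U))))"
    by (rule Ocomp_assoc[OF n m \<phi> f(2) c\<psi>])
  also have "Ocomp ?n (fr V) (Ocomp ?n (fri V) (Ocomp ?n \<psi> (fr U))) = Ocomp ?n (Ocomp V (fr V) (fri V)) (Ocomp ?n \<psi> (fr U))"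
    by (rule Ocomp_assoc[OF n V f(2,3) \<psi>f, symmetric])
  also have "\<dots> = Ocomp ?n \<psi> (fr U)" unfolding fr_fri(1)[OF V] by (rule Ocomp_id_left[OF \<psi>f])
  also have "Ocomp ?n \<phi> (Ocomp ?n \<psi> (fr U)) = Ocomp ?n (Ocomp U \<phi> \<psi>) (fr U)"
    by (rule Ocomp_assoc[OF n U \<phi> \<psi> f(1), symmetric])
  finally show ?thesis by (simp add: cmor_def)
qed

section \<open>The value of a spectrum at an inner product space\<close>

locale spec =
  fixes G :: "'g monoid" and T :: "'g topology" and A :: "('g, 'a) ospectrum"
  assumes kG: "k_group G T" and A: "orthogonal_spectrum G T A"
begin

sublocale G: group G using kG by (rule k_groupD)
lemmas AD = orthogonal_spectrumD[OF A kG]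
lemmas topspace_T = k_groupD(2)[OF kG] and CGWH_T = k_groupD(3)[OF kG]

text \<open>Fixing the frame of \<open>V\<close> identifies \<open>A\<^sub>V\<close> with \<open>A\<^sub>n\<close>; a point with another frame \<open>f\<close> is
  moved to this one by \<open>red V f\<close>.\<close>

definition E :: "vect set \<Rightarrow> 'a \<Rightarrow> 'a evpt set" where
  "E V a = ev_class A V (Some (frame V)) a"

definition red :: "vect set \<Rightarrow> (vect \<Rightarrow> vect) \<Rightarrow> 'a \<Rightarrow> 'a" where
  "red V f a = str A (dim V) (dim V) (Ocomp (Euc (dim V)) (fri V) (Olin f)) a"

abbreviation "EV V \<equiv> topspace (ptop (ev A V))"

context
  fixes V :: "vect set"
  assumes V: "inner_product_space V"
begin

lemma CGWH_frames: "CGWH (iso_top (Euc (dim V)) V)" by (simp add: CGWH_iso_top V)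

lemma based_ev_pre: "based_CGWH (ev_pre A V)"
  unfolding ev_pre_def using CGWH_frames AD(1) by (intro based_CGWH_smash based_CGWH_adjoin_pt)

lemma quotient_ev_pt:
  "quotient_map (k_prod (iso_top (Euc (dim V)) V) (ptop (lvl A (dim V)))) (ptop (ev_pre A V)) (\<lambda>(f, a). ev_pt A V (Some f) a)"
  using quotient_map_smash_adjoin_pt[OF CGWH_frames _ AD(1), of "frame V" "dim V"] frame_isos[OF V] by (simp add: ev_pt_def ev_pre_def)

lemma ev_pt_in: "f \<in> isos (Euc (dim V)) V \<Longrightarrow> a \<in> lvl_set A (dim V) \<Longrightarrow> ev_pt A V (Some f) a \<in> topspace (ptop (ev_pre A V))"
  using continuous_map_point[OF quotient_imp_continuous_map[OF quotient_ev_pt], of "(f, a)"] by simp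

lemma Olin_Euc: "k \<in> isos (Euc m) (Euc l) \<Longrightarrow> Olin k \<in> Omor (Euc m) (Euc l)"
  by (simp add: Olin_Omor)

lemma ev_rel_sub: "ev_rel A V \<subseteq> topspace (ptop (ev_pre A V)) \<times> topspace (ptop (ev_pre A V))"
  unfolding ev_rel_def by (auto intro!: ev_pt_in compose_isos AD(5) Olin_Euc)

lemma based_ev: "based_CGWH (ev A V)"
  unfolding ev_def by (rule based_CGWH_coeq[OF based_ev_pre ev_rel_sub])

lemma CGWH_ev: "CGWH (ptop (ev A V))" using based_ev by (simp add: based_CGWH_iff)

lemma pt_ev_in: "pt (ev A V) \<in> EV V" using based_ev by (simp add: based_CGWH_iff)

lemma quotient_ev:
  "quotient_map (k_prod (iso_top (Euc (dim V)) V) (ptop (lvl A (dim V)))) (ptop (ev A V)) (\<lambda>(f, a). ev_class A V (Some f) a)"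
  using quotient_map_compose[OF quotient_ev_pt quotient_map_coeq]
  by (simp add: o_def case_prod_beta' ev_class_def ev_def)

lemma ev_class_rel:
  "f \<in> isos (Euc (dim V)) V \<Longrightarrow> k \<in> isos (Euc (dim V)) (Euc (dim V)) \<Longrightarrow> a \<in> lvl_set A (dim V) \<Longrightarrow>
   ev_class A V (Some (compose (Euc (dim V)) f k)) a = ev_class A V (Some f) (str A (dim V) (dim V) (Olin k) a)"
  unfolding ev_class_def by (rule coeq_class_rel[OF ev_rel_sub]) (auto simp: ev_rel_def)

lemma ev_class_base: "ev_class A V (Some f) (pt (lvl A (dim V))) = pt (ev A V)" "ev_class A V None a = pt (ev A V)"
  by (auto simp: ev_class_def ev_pt_def smash_pt_def ev_def ev_pre_def)

text \<open>The universal property of the value at \<open>V\<close>. It is stated for points with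
  the chosen frame, which by \<open>ev_class_E\<close> are all points.\<close>

lemma ev_lift:
  assumes W: "CGWH W" and F: "continuous_map (k_prod (iso_top (Euc (dim V)) V) (ptop (lvl A (dim V)))) W (\<lambda>(f, a). F (Some f, a))"
    and F0: "\<And>f. f \<in> isos (Euc (dim V)) V \<Longrightarrow> F (Some f, pt (lvl A (dim V))) = F (None, pt (lvl A (dim V)))"
    and FR: "\<And>f k a. f \<in> isos (Euc (dim V)) V \<Longrightarrow> k \<in> isos (Euc (dim V)) (Euc (dim V)) \<Longrightarrow> a \<in> lvl_set A (dim V) \<Longrightarrow>
      F (Some (compose (Euc (dim V)) f k), a) = F (Some f, str A (dim V) (dim V) (Olin k) a)"
  shows "a \<in> lvl_set A (dim V) \<Longrightarrow> the_elem (F ` E V a) = F (Some (frame V), a)"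
    "a \<in> lvl_set A (dim V) \<Longrightarrow> b \<in> lvl_set A (dim V) \<Longrightarrow> E V a = E V b \<Longrightarrow> F (Some (frame V), a) = F (Some (frame V), b)"
proof -
  have Fs: "F (ev_pt A V (Some f) a) = F (Some f, a)" if "f \<in> isos (Euc (dim V)) V" for f a
    using F0[OF that] by (auto simp: ev_pt_def smash_pt_def)
  have "continuous_map (k_prod (iso_top (Euc (dim V)) V) (ptop (lvl A (dim V)))) W (F \<circ> (\<lambda>(f, a). ev_pt A V (Some f) a))"
    using F by (rule continuous_map_eq) (auto simp: Fs)
  then have c: "continuous_map (ptop (ev_pre A V)) W F"
    using continuous_compose_quotient_map[OF quotient_ev_pt] by blast
  have R: "F p = F p'" if "(p, p') \<in> ev_rel A V" for p p'
    using that FR Fs compose_isos[OF inner_product_space_Euc] by (auto simp: ev_rel_def)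
  have cp: "CGWH (ptop (ev_pre A V))" using based_ev_pre by (simp add: based_CGWH_iff)
  note fi = frame_isos[OF V]
  show "a \<in> lvl_set A (dim V) \<Longrightarrow> the_elem (F ` E V a) = F (Some (frame V), a)"
    unfolding E_def ev_class_def using coeq_the_elem[OF cp ev_rel_sub W c R ev_pt_in[OF fi]] Fs[OF fi] by simp
  show "a \<in> lvl_set A (dim V) \<Longrightarrow> b \<in> lvl_set A (dim V) \<Longrightarrow> E V a = E V b \<Longrightarrow> F (Some (frame V), a) = F (Some (frame V), b)"
    unfolding E_def ev_class_def
    using coeq_class_lift[OF cp ev_rel_sub W c R ev_pt_in[OF fi] ev_pt_in[OF fi], of a b] by (simp only: Fs[OF fi])
qed

lemma red_in: "f \<in> isos (Euc (dim V)) V \<Longrightarrow> a \<in> lvl_set A (dim V) \<Longrightarrow> red V f a \<in> lvl_set A (dim V)"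
  unfolding red_def
  by (rule AD(5)[OF Ocomp_in_Omor[OF inner_product_space_Euc V inner_product_space_Euc fri_Omor[OF V] Olin_Omor[OF V]]])

lemma continuous_map_red:
  assumes "CGWH K" "continuous_map K (iso_top (Euc (dim V)) V) f" "continuous_map K (ptop (lvl A (dim V))) a"
  shows "continuous_map K (ptop (lvl A (dim V))) (\<lambda>k. red V (f k) (a k))"
  unfolding red_def using assms fri_Omor[OF V]
  by (intro AD(4) continuous_map_Ocomp[OF inner_product_space_Euc V inner_product_space_Euc] continuous_map_Olin' V)
     (auto simp: topspace_Osp' V frame_inv_isos)

text \<open>Any frame is the chosen one composed with an orthogonal map of the Euclidean space, and
  the coequalizer moves that map across the smash.\<close>

lemma ev_class_E:
  assumes f: "f \<in> isos (Euc (dim V)) V" and a: "a \<in> lvl_set A (dim V)"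
  shows "ev_class A V (Some f) a = E V (red V f a)"
proof -
  let ?k = "compose (Euc (dim V)) (frame_inv V) f"
  have k: "?k \<in> isos (Euc (dim V)) (Euc (dim V))" using compose_isos[OF inner_product_space_Euc frame_inv_isos[OF V] f] .
  have "compose (Euc (dim V)) (frame V) ?k = f"
    using frame_inv(2)[OF V] isosD(1,5)[OF f] by (auto simp: compose_def fun_eq_iff extensional_def)
  moreover have "Olin ?k = Ocomp (Euc (dim V)) (fri V) (Olin f)" using Ocomp_Olin[OF V frame_inv_isos[OF V]] by simp
  ultimately show ?thesis using ev_class_rel[OF frame_isos[OF V] k a] by (simp add: E_def red_def)
qed

lemma red_frame: "a \<in> lvl_set A (dim V) \<Longrightarrow> red V (frame V) a = a"
  by (simp add: red_def fr_fri V AD(8))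

lemma red_rel:
  assumes f: "f \<in> isos (Euc (dim V)) V" and k: "k \<in> isos (Euc (dim V)) (Euc (dim V))" and a: "a \<in> lvl_set A (dim V)"
  shows "red V (compose (Euc (dim V)) f k) a = red V f (str A (dim V) (dim V) (Olin k) a)"
proof -
  have O: "Ocomp (Euc (dim V)) (fri V) (Olin f) \<in> Omor (Euc (dim V)) (Euc (dim V))"
    using fri_Omor[OF V] Olin_Omor[OF V f] by (intro Ocomp_in_Omor[OF inner_product_space_Euc V]) auto
  have "Ocomp (Euc (dim V)) (Ocomp (Euc (dim V)) (fri V) (Olin f)) (Olin k) = Ocomp (Euc (dim V)) (fri V) (Olin (compose (Euc (dim V)) f k))"
    using Ocomp_assoc[OF inner_product_space_Euc inner_product_space_Euc fri_Omor[OF V] Olin_Omor[OF V f] Olin_Euc[OF k]]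
      Ocomp_Olin[OF inner_product_space_Euc f] by simp
  then show ?thesis using AD(9)[OF Olin_Euc[OF k] O a] by (simp add: red_def)
qed

lemma E_surj:
  assumes "z \<in> EV V"
  obtains a where "a \<in> lvl_set A (dim V)" "z = E V a"
proof -
  have "z \<in> (\<lambda>(f, a). ev_class A V (Some f) a) ` topspace (k_prod (iso_top (Euc (dim V)) V) (ptop (lvl A (dim V))))"
    using quotient_ev assms unfolding quotient_map_def by simp
  then obtain f a where "f \<in> isos (Euc (dim V)) V" "a \<in> lvl_set A (dim V)" "z = ev_class A V (Some f) a" by auto
  then show ?thesis using that ev_class_E red_in by metis
qed

lemma continuous_map_E: "continuous_map (ptop (lvl A (dim V))) (ptop (ev A V)) (E V)"
proof -
  have "continuous_map (ptop (lvl A (dim V))) (k_prod (iso_top (Euc (dim V)) V) (ptop (lvl A (dim V)))) (\<lambda>a. (frame V, a))"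
    using frame_isos[OF V] by (intro continuous_map_into_k_prod CGWH_frames AD(2)) simp_all
  from continuous_map_comp[OF quotient_imp_continuous_map[OF quotient_ev] this] show ?thesis by (simp add: E_def[abs_def])
qed

lemma E_in: "a \<in> lvl_set A (dim V) \<Longrightarrow> E V a \<in> EV V"
  using continuous_map_point[OF continuous_map_E] .

text \<open>\<open>red\<close> respects the coequalizer relation and takes values in the Euclidean
  level, so it descends to a left inverse of \<open>E V\<close>.\<close>

lemma E_inj: "a \<in> lvl_set A (dim V) \<Longrightarrow> b \<in> lvl_set A (dim V) \<Longrightarrow> E V a = E V b \<Longrightarrow> a = b"
proof -
  assume ab: "a \<in> lvl_set A (dim V)" "b \<in> lvl_set A (dim V)" "E V a = E V b"
  define F where "F = (\<lambda>(p, a). case p of None \<Rightarrow> pt (lvl A (dim V)) | Some f \<Rightarrow> red V f a)"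
  have c: "CGWH (k_prod (iso_top (Euc (dim V)) V) (ptop (lvl A (dim V))))" using CGWH_frames AD(2) by blast
  have "F (Some (frame V), a) = F (Some (frame V), b)"
  proof (rule ev_lift(2)[OF AD(2)])
    show "continuous_map (k_prod (iso_top (Euc (dim V)) V) (ptop (lvl A (dim V)))) (ptop (lvl A (dim V))) (\<lambda>(f, a). F (Some f, a))"
      unfolding case_prod_beta' F_def by simp (intro continuous_map_red c k_prod_fst k_prod_snd)
    show "F (Some f, pt (lvl A (dim V))) = F (None, pt (lvl A (dim V)))" if "f \<in> isos (Euc (dim V)) V" for f
      using that fri_Omor[OF V] Olin_Omor[OF V that]
      by (simp add: F_def red_def AD(7) Ocomp_in_Omor[OF inner_product_space_Euc V inner_product_space_Euc])
    show "F (Some (compose (Euc (dim V)) f k), a) = F (Some f, str A (dim V) (dim V) (Olin k) a)"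
      if "f \<in> isos (Euc (dim V)) V" "k \<in> isos (Euc (dim V)) (Euc (dim V))" "a \<in> lvl_set A (dim V)" for f k a
      using red_rel[OF that] by (simp add: F_def)
  qed (use ab in auto)
  then show "a = b" using ab by (simp add: F_def red_frame)
qed

text \<open>\<open>E V\<close> after \<open>red\<close> is the quotient map that defines the value
  at \<open>V\<close>, which forces \<open>E V\<close> to be a quotient map as well.\<close>

lemma E_homeomorphic: "homeomorphic_map (ptop (lvl A (dim V))) (ptop (ev A V)) (E V)"
  unfolding homeomorphic_map_def
proof
  let ?P = "k_prod (iso_top (Euc (dim V)) V) (ptop (lvl A (dim V)))"
  have c: "CGWH ?P" using CGWH_frames AD(2) by blast
  have r: "continuous_map ?P (ptop (lvl A (dim V))) (\<lambda>p. red V (fst p) (snd p))"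
    by (intro continuous_map_red c k_prod_fst k_prod_snd)
  have "quotient_map ?P (ptop (ev A V)) (E V \<circ> (\<lambda>p. red V (fst p) (snd p)))"
    using quotient_ev by (rule quotient_map_eq) (auto simp: ev_class_E)
  then show "quotient_map (ptop (lvl A (dim V))) (ptop (ev A V)) (E V)"
    using quotient_map_from_composition[OF r continuous_map_E] by blast
  show "inj_on (E V) (lvl_set A (dim V))" using E_inj by (auto simp: inj_on_def)
qed

definition Einv :: "'a evpt set \<Rightarrow> 'a" where "Einv z = inv_into (lvl_set A (dim V)) (E V) z"

lemma Einv_E: "a \<in> lvl_set A (dim V) \<Longrightarrow> Einv (E V a) = a"
  using E_inj by (auto simp: Einv_def inj_on_def intro: inv_into_f_f)

lemma continuous_map_Einv: "continuous_map (ptop (ev A V)) (ptop (lvl A (dim V))) Einv"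
proof -
  have "continuous_map (ptop (lvl A (dim V))) (ptop (lvl A (dim V))) (Einv \<circ> E V)"
    using continuous_map_id by (rule continuous_map_eq) (simp add: Einv_E)
  then show ?thesis
    using continuous_compose_quotient_map E_homeomorphic unfolding homeomorphic_map_def by blast
qed

lemma E_pt: "E V (pt (lvl A (dim V))) = pt (ev A V)"
  by (simp add: E_def ev_class_base)

end

lemma EV_cases: "z \<in> EV V \<Longrightarrow> inner_product_space V \<Longrightarrow> (\<And>a. a \<in> lvl_set A (dim V) \<Longrightarrow> z = E V a \<Longrightarrow> P) \<Longrightarrow> P"
  by (rule E_surj)

text \<open>A change of frame by \<open>k\<close> composes on the right of the morphism, so
  functoriality of \<open>str\<close> gives compatibility with \<open>ev_rel\<close>.\<close>

lemma ev_map_E: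
  assumes V: "inner_product_space V" and W: "inner_product_space W" and \<phi>: "\<phi> \<in> Omor V W" and a: "a \<in> lvl_set A (dim V)"
  shows "ev_map A V W \<phi> (E V a) = E W (str A (dim V) (dim W) (cmor V W \<phi>) a)"
proof -
  let ?n = "dim V"
  let ?\<psi> = "\<lambda>f. Ocomp (Euc ?n) (fri W) (Ocomp (Euc ?n) \<phi> (Olin f))"
  define F where "F = (\<lambda>(p, a). case p of None \<Rightarrow> pt (ev A W)
       | Some f \<Rightarrow> ev_class A W (Some (frame W)) (str A ?n (dim W) (?\<psi> f) a))"
  have c: "CGWH (k_prod (iso_top (Euc ?n) V) (ptop (lvl A ?n)))" using CGWH_frames[OF V] AD(2) by blast
  have \<psi>: "?\<psi> f \<in> Omor (Euc ?n) (Euc (dim W))" if "f \<in> isos (Euc ?n) V" for f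
    using that fri_Omor[OF W] Olin_Omor[OF V] \<phi>
    by (intro Ocomp_in_Omor[OF inner_product_space_Euc W inner_product_space_Euc] Ocomp_in_Omor[OF inner_product_space_Euc V W]) auto
  have "the_elem (F ` E V a) = F (Some (frame V), a)"
  proof (rule ev_lift(1)[OF V CGWH_ev[OF W] _ _ _ a])
    have "continuous_map (k_prod (iso_top (Euc ?n) V) (ptop (lvl A ?n))) (ptop (lvl A (dim W))) (\<lambda>p. str A ?n (dim W) (?\<psi> (fst p)) (snd p))"
      using fri_Omor[OF W] \<phi>
      by (intro AD(4) c continuous_map_Ocomp[OF inner_product_space_Euc W inner_product_space_Euc]
          continuous_map_Ocomp[OF inner_product_space_Euc V W] continuous_map_Olin' k_prod_fst k_prod_snd V)
         (auto simp: topspace_Osp' V W frame_inv_isos)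
    from continuous_map_comp[OF continuous_map_E[OF W] this]
    show "continuous_map (k_prod (iso_top (Euc ?n) V) (ptop (lvl A ?n))) (ptop (ev A W)) (\<lambda>(f, a). F (Some f, a))"
      by (simp add: F_def E_def case_prod_beta')
    show "F (Some f, pt (lvl A ?n)) = F (None, pt (lvl A ?n))" if "f \<in> isos (Euc ?n) V" for f
      using \<psi>[OF that] by (simp add: F_def AD(7) ev_class_base[OF W])
    show "F (Some (compose (Euc ?n) f k), a) = F (Some f, str A ?n ?n (Olin k) a)"
      if f: "f \<in> isos (Euc ?n) V" and k: "k \<in> isos (Euc ?n) (Euc ?n)" and a: "a \<in> lvl_set A ?n" for f k a
    proof -
      note n = inner_product_space_Euc[of ?n]
      have "Ocomp (Euc ?n) (?\<psi> f) (Olin k) = Ocomp (Euc ?n) (fri W) (Ocomp (Euc ?n) (Ocomp (Euc ?n) \<phi> (Olin f)) (Olin k))"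
        by (rule Ocomp_assoc[OF n n fri_Omor[OF W] Ocomp_in_Omor[OF n V W \<phi> Olin_Omor[OF V f]] Olin_Euc[OF V k]])
      also have "Ocomp (Euc ?n) (Ocomp (Euc ?n) \<phi> (Olin f)) (Olin k) = Ocomp (Euc ?n) \<phi> (Ocomp (Euc ?n) (Olin f) (Olin k))"
        by (rule Ocomp_assoc[OF n n \<phi> Olin_Omor[OF V f] Olin_Euc[OF V k]])
      also have "Ocomp (Euc ?n) (Olin f) (Olin k) = Olin (compose (Euc ?n) f k)" using Ocomp_Olin[OF n f] .
      finally show ?thesis using AD(9)[OF Olin_Euc[OF V k] \<psi>[OF f] a] by (simp add: F_def)
    qed
  qed
  then show ?thesis by (simp add: ev_map_def F_def E_def cmor_def)
qed

lemma ev_map_in: "inner_product_space V \<Longrightarrow> inner_product_space W \<Longrightarrow> \<phi> \<in> Omor V W \<Longrightarrow> z \<in> EV V \<Longrightarrow> ev_map A V W \<phi> z \<in> EV W"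
  by (elim EV_cases) (simp_all add: ev_map_E E_in AD(5) cmor_Omor)

lemma ev_map_base:
  assumes "inner_product_space V" "inner_product_space W"
  shows "\<phi> \<in> Omor V W \<Longrightarrow> ev_map A V W \<phi> (pt (ev A V)) = pt (ev A W)"
    "z \<in> EV V \<Longrightarrow> ev_map A V W (None, None) z = pt (ev A W)"
proof -
  show "\<phi> \<in> Omor V W \<Longrightarrow> ev_map A V W \<phi> (pt (ev A V)) = pt (ev A W)"
    using assms by (simp add: E_pt[symmetric] ev_map_E AD(3,7) cmor_Omor)
  show "z \<in> EV V \<Longrightarrow> ev_map A V W (None, None) z = pt (ev A W)"
    by (elim EV_cases) (simp_all add: assms ev_map_E AD(6) E_pt)
qed

lemma ev_map_id: "inner_product_space V \<Longrightarrow> z \<in> EV V \<Longrightarrow> ev_map A V V (Oid V) z = z"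
  by (elim EV_cases) (simp_all add: ev_map_E Oid_in_Omor cmor_id AD(8))

lemma ev_map_comp:
  assumes "inner_product_space U" "inner_product_space V" "inner_product_space W" "\<phi> \<in> Omor V W" "\<psi> \<in> Omor U V" "z \<in> EV U"
  shows "ev_map A U W (Ocomp U \<phi> \<psi>) z = ev_map A V W \<phi> (ev_map A U V \<psi> z)"
proof -
  obtain a where a: "a \<in> lvl_set A (dim U)" "z = E U a" using E_surj[OF assms(1,6)] by blast
  show ?thesis using assms a
    by (simp add: ev_map_E Ocomp_in_Omor cmor_comp[OF assms(1-5)] AD(5) AD(9)[OF cmor_Omor cmor_Omor] cmor_Omor)
qed

lemma continuous_map_ev_map:
  assumes V: "inner_product_space V" and W: "inner_product_space W" and \<phi>: "\<phi> \<in> Omor V W"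
  shows "continuous_map (ptop (ev A V)) (ptop (ev A W)) (ev_map A V W \<phi>)"
proof (rule continuous_map_eq)
  show "continuous_map (ptop (ev A V)) (ptop (ev A W)) (\<lambda>z. E W (str A (dim V) (dim W) (cmor V W \<phi>) (Einv V z)))"
    using cmor_Omor[OF V W \<phi>]
    by (intro continuous_map_comp[OF continuous_map_E[OF W]] AD(4) CGWH_ev continuous_map_Einv V) (simp add: topspace_Osp')
  show "E W (str A (dim V) (dim W) (cmor V W \<phi>) (Einv V z)) = ev_map A V W \<phi> z" if "z \<in> EV V" for z
    using that by (rule E_surj[OF V]) (simp add: Einv_E V ev_map_E[OF V W \<phi>])
qed

end

section \<open>Representations\<close>

abbreviation "Rp V g \<equiv> Olin (snd V g)"

lemma repsD:
  assumes V: "V \<in> reps G T"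
  shows "inner_product_space (fst V)" "g \<in> carrier G \<Longrightarrow> snd V g \<in> isos (fst V) (fst V)"
    "snd V \<one>\<^bsub>G\<^esub> = (\<lambda>v\<in>fst V. v)"
    "g \<in> carrier G \<Longrightarrow> h \<in> carrier G \<Longrightarrow> snd V (g \<otimes>\<^bsub>G\<^esub> h) = compose (fst V) (snd V g) (snd V h)"
    "g \<in> carrier G \<Longrightarrow> v \<in> fst V \<Longrightarrow> snd V g v \<in> fst V"
    "g \<in> carrier G \<Longrightarrow> h \<in> carrier G \<Longrightarrow> v \<in> fst V \<Longrightarrow> snd V (g \<otimes>\<^bsub>G\<^esub> h) v = snd V g (snd V h v)"
    "v \<in> fst V \<Longrightarrow> snd V \<one>\<^bsub>G\<^esub> v = v"
    "g \<in> carrier G \<Longrightarrow> Rp V g \<in> Omor (fst V) (fst V)"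
    "Rp V \<one>\<^bsub>G\<^esub> = Oid (fst V)"
    "g \<in> carrier G \<Longrightarrow> h \<in> carrier G \<Longrightarrow> Rp V (g \<otimes>\<^bsub>G\<^esub> h) = Ocomp (fst V) (Rp V g) (Rp V h)"
    "snd V \<in> extensional (carrier G)"
proof -
  show 1: "inner_product_space (fst V)" and 2: "\<And>g. g \<in> carrier G \<Longrightarrow> snd V g \<in> isos (fst V) (fst V)"
    and 3: "snd V \<one>\<^bsub>G\<^esub> = (\<lambda>v\<in>fst V. v)"
    and 4: "\<And>g h. g \<in> carrier G \<Longrightarrow> h \<in> carrier G \<Longrightarrow> snd V (g \<otimes>\<^bsub>G\<^esub> h) = compose (fst V) (snd V g) (snd V h)"
    and "snd V \<in> extensional (carrier G)"
    using V by (auto simp: reps_def PiE_def)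
  show "g \<in> carrier G \<Longrightarrow> v \<in> fst V \<Longrightarrow> snd V g v \<in> fst V" using isosD(1)[OF 2] .
  show "g \<in> carrier G \<Longrightarrow> h \<in> carrier G \<Longrightarrow> v \<in> fst V \<Longrightarrow> snd V (g \<otimes>\<^bsub>G\<^esub> h) v = snd V g (snd V h v)"
    using 4 by (simp add: compose_def)
  show "v \<in> fst V \<Longrightarrow> snd V \<one>\<^bsub>G\<^esub> v = v" using 3 by simp
  show "g \<in> carrier G \<Longrightarrow> Rp V g \<in> Omor (fst V) (fst V)" using Olin_Omor[OF 1 2] .
  show "Rp V \<one>\<^bsub>G\<^esub> = Oid (fst V)" using 3 by (simp add: Oid_def)
  show "g \<in> carrier G \<Longrightarrow> h \<in> carrier G \<Longrightarrow> Rp V (g \<otimes>\<^bsub>G\<^esub> h) = Ocomp (fst V) (Rp V g) (Rp V h)"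
    using 4 Ocomp_Olin[OF 1 2] by simp
qed

lemma reps_continuous:
  assumes V: "V \<in> reps G T" and T: "topspace T = carrier G" and g: "continuous_map K T g"
  shows "continuous_map K (iso_top (fst V) (fst V)) (\<lambda>k. snd V (g k))"
  unfolding continuous_map_into_iso_top
proof (intro conjI ballI)
  fix k assume "k \<in> topspace K"
  then show "snd V (g k) \<in> isos (fst V) (fst V)" using continuous_map_point[OF g] repsD(2)[OF V] T by simp
next
  fix v assume v: "v \<in> fst V"
  have "continuous_map (prod_topology T (top_of_set (fst V))) (top_of_set (fst V)) (\<lambda>(g, v). snd V g v)"
    using V by (auto simp: reps_def)
  moreover have "continuous_map K (prod_topology T (top_of_set (fst V))) (\<lambda>k. (g k, v))"
    using g v by (intro continuous_map_pairedI) auto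
  ultimately show "continuous_map K (top_of_set (fst V)) (\<lambda>k. snd V (g k) v)" using continuous_map_comp by fastforce
qed

lemma repsI:
  assumes "inner_product_space V" "\<rho> \<in> extensional (carrier G)" "\<And>g. g \<in> carrier G \<Longrightarrow> \<rho> g \<in> isos V V"
    "\<And>v. v \<in> V \<Longrightarrow> \<rho> \<one>\<^bsub>G\<^esub> v = v" "\<one>\<^bsub>G\<^esub> \<in> carrier G"
    "\<And>g h v. g \<in> carrier G \<Longrightarrow> h \<in> carrier G \<Longrightarrow> v \<in> V \<Longrightarrow> \<rho> (g \<otimes>\<^bsub>G\<^esub> h) v = \<rho> g (\<rho> h v)"
    "\<And>g h. g \<in> carrier G \<Longrightarrow> h \<in> carrier G \<Longrightarrow> g \<otimes>\<^bsub>G\<^esub> h \<in> carrier G"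
    "continuous_map (prod_topology T (top_of_set V)) (top_of_set V) (\<lambda>(g, v). \<rho> g v)"
  shows "(V, \<rho>) \<in> reps G T"
proof -
  have "\<rho> \<one>\<^bsub>G\<^esub> = (\<lambda>v\<in>V. v)"
    by (rule isos_ext[OF assms(3)[OF assms(5)] id_isos[OF assms(1)]]) (simp add: assms(4))
  moreover have "\<rho> (g \<otimes>\<^bsub>G\<^esub> h) = compose V (\<rho> g) (\<rho> h)" if "g \<in> carrier G" "h \<in> carrier G" for g h
    by (rule isos_ext[OF assms(3)[OF assms(7)[OF that]] compose_isos[OF assms(1) assms(3)[OF that(1)] assms(3)[OF that(2)]]])
       (use that in \<open>simp add: assms(6) compose_def\<close>)
  ultimately show ?thesis using assms by (auto simp: reps_def PiE_def)
qed

lemma res_rep_in_reps: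
  assumes V: "V \<in> reps G T" and T: "topspace T = carrier G" and G: "group G" and H: "subgroup H G"
  shows "res_rep H V \<in> reps (G\<lparr>carrier := H\<rparr>) (subtopology T H)"
proof -
  interpret group G by (rule G)
  have HG: "H \<subseteq> carrier G" using subgroup.subset[OF H] .
  have c: "continuous_map (prod_topology T (top_of_set (fst V))) (top_of_set (fst V)) (\<lambda>(g, v). snd V g v)"
    using V by (auto simp: reps_def)
  have "continuous_map (prod_topology (subtopology T H) (top_of_set (fst V))) (top_of_set (fst V)) (\<lambda>(g, v). snd V g v)"
    using continuous_map_from_subtopology[OF c, of "H \<times> fst V"] by (simp add: subtopology_Times subtopology_subtopology)
  then have "continuous_map (prod_topology (subtopology T H) (top_of_set (fst V))) (top_of_set (fst V))
      (\<lambda>(g, v). restrict (snd V) H g v)"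
    by (rule continuous_map_eq) auto
  then show ?thesis unfolding res_rep_def
    using HG subgroup.one_closed[OF H] subgroup.m_closed[OF H] subsetD[OF HG]
    by (intro repsI) (auto simp: repsD[OF V] compose_def)
qed

lemma fst_res_rep [simp]: "fst (res_rep H V) = fst V"
  by (simp add: res_rep_def)

lemma snd_res_rep [simp]: "h \<in> H \<Longrightarrow> snd (res_rep H V) h = snd V h"
  by (simp add: res_rep_def)

lemma rep_fix_res [simp]: "N \<subseteq> H \<Longrightarrow> rep_fix N (res_rep H V) = rep_fix N V"
  by (auto simp: rep_fix_def subset_iff)

lemma ips_rep_fix:
  assumes V: "V \<in> reps G T" and N: "N \<subseteq> carrier G"
  shows "inner_product_space (rep_fix N V)"
proof (rule ips_subspace[OF repsD(1)[OF V]])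
  note P = inner_product_space_props[OF repsD(1)[OF V]]
  show "rep_fix N V \<subseteq> fst V" by (auto simp: rep_fix_def)
  show "subspace (rep_fix N V)"
  proof -
    have "snd V n 0 = 0" "x \<in> fst V \<Longrightarrow> y \<in> fst V \<Longrightarrow> snd V n (x + y) = snd V n x + snd V n y"
      "x \<in> fst V \<Longrightarrow> snd V n (c *\<^sub>R x) = c *\<^sub>R snd V n x" if "n \<in> N" for n x y c
    proof -
      have n: "snd V n \<in> isos (fst V) (fst V)" using repsD(2)[OF V] N that by blast
      show "snd V n 0 = 0" by (rule isos_zero[OF n P(1)])
      show "x \<in> fst V \<Longrightarrow> y \<in> fst V \<Longrightarrow> snd V n (x + y) = snd V n x + snd V n y" by (rule isosD(2)[OF n])
      show "x \<in> fst V \<Longrightarrow> snd V n (c *\<^sub>R x) = c *\<^sub>R snd V n x" by (rule isosD(3)[OF n])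
    qed
    then show ?thesis using P(1,2,3) by (simp add: subspace_def rep_fix_def)
  qed
qed

lemma rep_fix_sub: "v \<in> rep_fix N V \<Longrightarrow> v \<in> fst V"
  by (simp add: rep_fix_def)

section \<open>Actions on values at representations\<close>

lemma Oconj_alt: "Oconj G V W g \<phi> = Ocomp (fst V) (Rp W g) (Ocomp (fst V) \<phi> (Rp V (inv\<^bsub>G\<^esub> g)))"
  by (simp add: Oconj_def)

text \<open>The last hypothesis is what lets the composite restrict: the linear part of
  \<open>\<psi>\<close> sends fixed vectors to fixed vectors, and its translation vector is
  fixed.\<close>

lemma Ofix_comp:
  assumes U: "inner_product_space U" and "\<psi> \<in> Omor (fst U') (fst V)" "\<phi> \<in> Omor (fst V) W"
    and "Ofix N U' \<psi> \<in> Omor (rep_fix N U') (rep_fix N V)"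
  shows "Ofix N U' (Ocomp (fst U') \<phi> \<psi>) = Ocomp (rep_fix N U') (Ofix N V \<phi>) (Ofix N U' \<psi>)"
  using assms(2)
proof (cases rule: Omor_cases)
  case 1
  then show ?thesis by (simp add: Ofix_def)
next
  case \<psi>: (2 g y)
  then have gy: "restrict g (rep_fix N U') \<in> isos (rep_fix N U') (rep_fix N V)" "y \<in> rep_fix N V"
    using assms(4) by (auto simp: Ofix_def Omor_Some)
  have gN: "g v \<in> rep_fix N V" if "v \<in> rep_fix N U'" for v using isosD(1)[OF gy(1) that] that by simp
  show ?thesis using assms(3)
  proof (cases rule: Omor_cases)
    case 1
    then show ?thesis by (simp add: Ofix_def)
  next
    case \<phi>: (2 f x)
    show ?thesis
      using gy(2) gN by (auto simp: Ofix_def \<phi>(1) \<psi>(1) compose_def fun_eq_iff restrict_def rep_fix_sub)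
  qed
qed

text \<open>Interpreted both for G and for H, with the same N.\<close>

locale rep_group =
  fixes G :: "'g monoid" and T :: "'g topology" and N :: "'g set"
  assumes kG: "k_group G T" and nN: "N \<lhd> G" and cN: "closedin T N"
begin

sublocale G: group G using kG by (rule k_groupD)

lemma subgroup_N: "subgroup N G" using nN by (rule normal_imp_subgroup)
lemma NG: "n \<in> N \<Longrightarrow> n \<in> carrier G" using subgroup.mem_carrier[OF subgroup_N] .
lemma NG': "N \<subseteq> carrier G" using NG by blast
lemma N1: "\<one>\<^bsub>G\<^esub> \<in> N" using subgroup.one_closed[OF subgroup_N] .
lemma Ninv: "n \<in> N \<Longrightarrow> inv\<^bsub>G\<^esub> n \<in> N" using subgroup.m_inv_closed[OF subgroup_N] .
lemma Nconj: "n \<in> N \<Longrightarrow> g \<in> carrier G \<Longrightarrow> g \<otimes>\<^bsub>G\<^esub> n \<otimes>\<^bsub>G\<^esub> inv\<^bsub>G\<^esub> g \<in> N"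
  using normal.inv_op_closed2[OF nN] .
lemma Nconj': "n \<in> N \<Longrightarrow> g \<in> carrier G \<Longrightarrow> inv\<^bsub>G\<^esub> g \<otimes>\<^bsub>G\<^esub> n \<otimes>\<^bsub>G\<^esub> g \<in> N"
  using normal.inv_op_closed1[OF nN] .
lemma Ncomm: "n \<in> N \<Longrightarrow> g \<in> carrier G \<Longrightarrow> n \<otimes>\<^bsub>G\<^esub> g = g \<otimes>\<^bsub>G\<^esub> (inv\<^bsub>G\<^esub> g \<otimes>\<^bsub>G\<^esub> n \<otimes>\<^bsub>G\<^esub> g)"
  using NG by (simp add: G.m_assoc[symmetric])

lemmas topspace_T = k_groupD(2)[OF kG] and CGWH_T = k_groupD(3)[OF kG]

abbreviation "\<R> \<equiv> reps G T"
abbreviation "fx \<equiv> rep_fix N"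

lemma ips: "V \<in> \<R> \<Longrightarrow> inner_product_space (fst V)" by (rule repsD)
lemma ipsN: "V \<in> \<R> \<Longrightarrow> inner_product_space (fx V)" by (rule ips_rep_fix[OF _ NG'])

text \<open>By normality, n moves past g as a conjugate that again lies in N and fixes v.\<close>

lemma rep_fix_inv: "V \<in> \<R> \<Longrightarrow> g \<in> carrier G \<Longrightarrow> v \<in> fx V \<Longrightarrow> snd V g v \<in> fx V"
proof -
  assume a: "V \<in> \<R>" "g \<in> carrier G" "v \<in> fx V"
  have "snd V n (snd V g v) = snd V g v" if n: "n \<in> N" for n
  proof -
    have v: "v \<in> fst V" using a(3) by (rule rep_fix_sub)
    have "snd V n (snd V g v) = snd V (g \<otimes>\<^bsub>G\<^esub> (inv\<^bsub>G\<^esub> g \<otimes>\<^bsub>G\<^esub> n \<otimes>\<^bsub>G\<^esub> g)) v"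
      using repsD(6)[OF a(1) NG[OF n] a(2) v] Ncomm[OF n a(2)] by simp
    also have "\<dots> = snd V g (snd V (inv\<^bsub>G\<^esub> g \<otimes>\<^bsub>G\<^esub> n \<otimes>\<^bsub>G\<^esub> g) v)"
      using a NG[OF Nconj'[OF n a(2)]] v by (intro repsD(6)[OF a(1)])
    also have "snd V (inv\<^bsub>G\<^esub> g \<otimes>\<^bsub>G\<^esub> n \<otimes>\<^bsub>G\<^esub> g) v = v" using a(3) Nconj'[OF n a(2)] by (simp add: rep_fix_def)
    finally show ?thesis .
  qed
  then show ?thesis using a repsD(5)[OF a(1,2)] by (auto simp: rep_fix_def)
qed

abbreviation "Rf V g \<equiv> Olin (restrict (snd V g) (fx V))"

lemma Rf_eq: "Rf V g = Ofix N V (Rp V g)" by (simp add: Ofix_def Olin_def)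

lemma Rf_isos: "V \<in> \<R> \<Longrightarrow> g \<in> carrier G \<Longrightarrow> restrict (snd V g) (fx V) \<in> isos (fx V) (fx V)"
  by (rule restrict_isos[OF ipsN repsD(2)]) (auto intro: rep_fix_sub rep_fix_inv)

lemma Rf_Omor: "V \<in> \<R> \<Longrightarrow> g \<in> carrier G \<Longrightarrow> Rf V g \<in> Omor (fx V) (fx V)"
  by (rule Olin_Omor[OF ipsN Rf_isos])

lemma Rf_mult: "V \<in> \<R> \<Longrightarrow> g \<in> carrier G \<Longrightarrow> h \<in> carrier G \<Longrightarrow> Rf V (g \<otimes>\<^bsub>G\<^esub> h) = Ocomp (fx V) (Rf V g) (Rf V h)"
  unfolding Ocomp_Olin[OF ipsN Rf_isos]
  by (rule arg_cong[of _ _ Olin]) (auto simp: fun_eq_iff compose_def rep_fix_inv repsD(6) rep_fix_sub)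

lemma Rf_N: "n \<in> N \<Longrightarrow> Rf V n = Oid (fx V)"
  by (auto simp: Oid_def rep_fix_def restrict_def fun_eq_iff intro: arg_cong[of _ _ Olin])

lemma Rf_continuous:
  assumes V: "V \<in> \<R>" and g: "continuous_map K T g"
  shows "continuous_map K (ptop (Osp (fx V) (fx V))) (\<lambda>k. Rf V (g k))"
proof (rule continuous_map_Olin'[OF ipsN[OF V] ipsN[OF V]], unfold continuous_map_into_iso_top, intro conjI ballI)
  fix k assume "k \<in> topspace K"
  then show "restrict (snd V (g k)) (fx V) \<in> isos (fx V) (fx V)" using continuous_map_point[OF g] Rf_isos[OF V] topspace_T by simp
next
  fix v assume v: "v \<in> fx V"
  have "continuous_map K (top_of_set (fst V)) (\<lambda>k. snd V (g k) v)"
    using reps_continuous[OF V topspace_T g] rep_fix_sub[OF v] by (simp add: continuous_map_into_iso_top)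
  then have "continuous_map K (top_of_set (fx V)) (\<lambda>k. snd V (g k) v)"
    using rep_fix_inv[OF V] continuous_map_point[OF g] v topspace_T by (auto simp: continuous_map_in_subtopology)
  then show "continuous_map K (top_of_set (fx V)) (\<lambda>k. restrict (snd V (g k)) (fx V) v)" using v by simp
qed

lemma Rp_inv: "V \<in> \<R> \<Longrightarrow> g \<in> carrier G \<Longrightarrow> Ocomp (fst V) (Rp V (inv\<^bsub>G\<^esub> g)) (Rp V g) = Oid (fst V)"
  "V \<in> \<R> \<Longrightarrow> g \<in> carrier G \<Longrightarrow> Ocomp (fst V) (Rp V g) (Rp V (inv\<^bsub>G\<^esub> g)) = Oid (fst V)"
  using repsD(10)[of V G T "inv\<^bsub>G\<^esub> g" g] repsD(10)[of V G T g "inv\<^bsub>G\<^esub> g"] repsD(9)[of V G T] by simp_all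

lemma Rf_inv: "V \<in> \<R> \<Longrightarrow> g \<in> carrier G \<Longrightarrow> Ocomp (fx V) (Rf V (inv\<^bsub>G\<^esub> g)) (Rf V g) = Oid (fx V)"
  "V \<in> \<R> \<Longrightarrow> g \<in> carrier G \<Longrightarrow> Ocomp (fx V) (Rf V g) (Rf V (inv\<^bsub>G\<^esub> g)) = Oid (fx V)"
  using Rf_mult[of V "inv\<^bsub>G\<^esub> g" g] Rf_mult[of V g "inv\<^bsub>G\<^esub> g"] Rf_N[OF N1, of V] by simp_all

context
  fixes V W assumes V: "V \<in> \<R>" and W: "W \<in> \<R>"
begin

lemma Oconj_Omor: "g \<in> carrier G \<Longrightarrow> \<phi> \<in> Omor (fst V) (fst W) \<Longrightarrow> Oconj G V W g \<phi> \<in> Omor (fst V) (fst W)"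
  unfolding Oconj_alt using V W
  by (intro Ocomp_in_Omor[OF ips[OF V] ips[OF W] ips[OF W]] Ocomp_in_Omor[OF ips[OF V] ips[OF V] ips[OF W]]) (auto intro: repsD)

text \<open>Conjugation is the change of \<open>\<phi>\<close> that makes its square with the action
  of g commute.\<close>

lemma Oconj_Rp:
  assumes g: "g \<in> carrier G" and \<phi>: "\<phi> \<in> Omor (fst V) (fst W)"
  shows "Ocomp (fst V) (Oconj G V W g \<phi>) (Rp V g) = Ocomp (fst V) (Rp W g) \<phi>"
proof -
  note v = ips[OF V] and w = ips[OF W]
  have i: "inv\<^bsub>G\<^esub> g \<in> carrier G" using g by simp
  note R = repsD(8)[OF W g] repsD(8)[OF V i] repsD(8)[OF V g]
  have \<phi>R: "Ocomp (fst V) \<phi> (Rp V (inv\<^bsub>G\<^esub> g)) \<in> Omor (fst V) (fst W)"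
    by (rule Ocomp_in_Omor[OF v v w \<phi> R(2)])
  have "Ocomp (fst V) (Oconj G V W g \<phi>) (Rp V g) = Ocomp (fst V) (Rp W g) (Ocomp (fst V) (Ocomp (fst V) \<phi> (Rp V (inv\<^bsub>G\<^esub> g))) (Rp V g))"
    unfolding Oconj_alt by (rule Ocomp_assoc[OF v v R(1) \<phi>R R(3)])
  also have "Ocomp (fst V) (Ocomp (fst V) \<phi> (Rp V (inv\<^bsub>G\<^esub> g))) (Rp V g) = \<phi>"
    unfolding Ocomp_assoc[OF v v \<phi> R(2,3)] Rp_inv(1)[OF V g] by (rule Ocomp_id_right[OF v \<phi>])
  finally show ?thesis .
qed

lemma Oconj_mult:
  assumes g: "g \<in> carrier G" and h: "h \<in> carrier G" and \<phi>: "\<phi> \<in> Omor (fst V) (fst W)"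
  shows "Oconj G V W (g \<otimes>\<^bsub>G\<^esub> h) \<phi> = Oconj G V W g (Oconj G V W h \<phi>)"
proof -
  note v = ips[OF V] and w = ips[OF W]
  have gi: "inv\<^bsub>G\<^esub> g \<in> carrier G" and hi: "inv\<^bsub>G\<^esub> h \<in> carrier G" using g h by simp_all
  let ?C = "Ocomp (fst V)"
  note Wg = repsD(8)[OF W g] and Wh = repsD(8)[OF W h] and Vg = repsD(8)[OF V gi] and Vh = repsD(8)[OF V hi]
  have 1: "?C \<phi> (Rp V (inv\<^bsub>G\<^esub> h)) \<in> Omor (fst V) (fst W)" by (rule Ocomp_in_Omor[OF v v w \<phi> Vh])
  have 2: "?C (?C \<phi> (Rp V (inv\<^bsub>G\<^esub> h))) (Rp V (inv\<^bsub>G\<^esub> g)) \<in> Omor (fst V) (fst W)" by (rule Ocomp_in_Omor[OF v v w 1 Vg])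
  have "Oconj G V W g (Oconj G V W h \<phi>) = ?C (Rp W g) (?C (Rp W h) (?C (?C \<phi> (Rp V (inv\<^bsub>G\<^esub> h))) (Rp V (inv\<^bsub>G\<^esub> g))))"
    unfolding Oconj_alt Ocomp_assoc[OF v v Wh 1 Vg] ..
  also have "\<dots> = ?C (Ocomp (fst W) (Rp W g) (Rp W h)) (?C (?C \<phi> (Rp V (inv\<^bsub>G\<^esub> h))) (Rp V (inv\<^bsub>G\<^esub> g)))"
    by (rule Ocomp_assoc[OF v w Wg Wh 2, symmetric])
  also have "Ocomp (fst W) (Rp W g) (Rp W h) = Rp W (g \<otimes>\<^bsub>G\<^esub> h)" by (rule repsD(10)[OF W g h, symmetric])
  also have "?C (?C \<phi> (Rp V (inv\<^bsub>G\<^esub> h))) (Rp V (inv\<^bsub>G\<^esub> g)) = ?C \<phi> (Rp V (inv\<^bsub>G\<^esub> (g \<otimes>\<^bsub>G\<^esub> h)))"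
    unfolding Ocomp_assoc[OF v v \<phi> Vh Vg] using repsD(10)[OF V hi gi] G.inv_mult_group[OF g h] by simp
  finally show ?thesis by (simp add: Oconj_alt)
qed

lemma Omor_fixD: "\<phi> \<in> Omor_fix G N V W \<Longrightarrow> \<phi> \<in> Omor (fst V) (fst W)" "\<phi> \<in> Omor_fix G N V W \<Longrightarrow> n \<in> N \<Longrightarrow> Oconj G V W n \<phi> = \<phi>"
  by (auto simp: Omor_fix_def)

text \<open>Normality again: conjugating by n after g is conjugating by g after an element of
  N.\<close>

lemma Oconj_fix:
  assumes g: "g \<in> carrier G" and \<phi>: "\<phi> \<in> Omor_fix G N V W"
  shows "Oconj G V W g \<phi> \<in> Omor_fix G N V W"
proof -
  note O = Omor_fixD(1)[OF \<phi>]
  have "Oconj G V W n (Oconj G V W g \<phi>) = Oconj G V W g \<phi>" if n: "n \<in> N" for n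
  proof -
    have "Oconj G V W n (Oconj G V W g \<phi>) = Oconj G V W (g \<otimes>\<^bsub>G\<^esub> (inv\<^bsub>G\<^esub> g \<otimes>\<^bsub>G\<^esub> n \<otimes>\<^bsub>G\<^esub> g)) \<phi>"
      using Oconj_mult[OF NG[OF n] g O] Ncomm[OF n g] by simp
    also have "\<dots> = Oconj G V W g (Oconj G V W (inv\<^bsub>G\<^esub> g \<otimes>\<^bsub>G\<^esub> n \<otimes>\<^bsub>G\<^esub> g) \<phi>)"
      by (rule Oconj_mult[OF g NG[OF Nconj'[OF n g]] O])
    finally show ?thesis using Omor_fixD(2)[OF \<phi> Nconj'[OF n g]] by simp
  qed
  then show ?thesis using Oconj_Omor[OF g O] by (simp add: Omor_fix_def)
qed

lemma Omor_fix_Some: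
  "(Some f, Some x) \<in> Omor_fix G N V W \<longleftrightarrow> f \<in> isos (fst V) (fst W) \<and> x \<in> fx W \<and> (\<forall>v\<in>fst V. ip (f v) x = 0) \<and>
     (\<forall>n\<in>N. \<forall>v\<in>fst V. f (snd V n v) = snd W n (f v))"
proof (cases "f \<in> isos (fst V) (fst W) \<and> x \<in> fst W \<and> (\<forall>v\<in>fst V. ip (f v) x = 0)")
  case True
  then have f: "f \<in> isos (fst V) (fst W)" and x: "x \<in> fst W" by auto
  have "Oconj G V W n (Some f, Some x) = (Some f, Some x) \<longleftrightarrow> snd W n x = x \<and> (\<forall>v\<in>fst V. f (snd V n v) = snd W n (f v))"
    if n: "n \<in> N" for n
  proof -
    have nG: "n \<in> carrier G" "inv\<^bsub>G\<^esub> n \<in> carrier G" using NG[OF n] by simp_all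
    have c: "compose (fst V) (snd W n) (compose (fst V) f (snd V (inv\<^bsub>G\<^esub> n))) \<in> isos (fst V) (fst W)"
      by (intro compose_isos[OF ips[OF V] repsD(2)[OF W nG(1)]] compose_isos[OF ips[OF V] f] repsD(2)[OF V nG(2)])
    have "compose (fst V) (snd W n) (compose (fst V) f (snd V (inv\<^bsub>G\<^esub> n))) = f \<longleftrightarrow>
        (\<forall>v\<in>fst V. snd W n (f (snd V (inv\<^bsub>G\<^esub> n) v)) = f v)"
    proof
      assume eq: "compose (fst V) (snd W n) (compose (fst V) f (snd V (inv\<^bsub>G\<^esub> n))) = f"
      show "\<forall>v\<in>fst V. snd W n (f (snd V (inv\<^bsub>G\<^esub> n) v)) = f v"
      proof
        fix v assume "v \<in> fst V"
        then show "snd W n (f (snd V (inv\<^bsub>G\<^esub> n) v)) = f v" using fun_cong[OF eq, of v] by (simp add: compose_def)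
      qed
    qed (intro isos_ext[OF c f], simp add: compose_def)
    also have "\<dots> \<longleftrightarrow> (\<forall>v\<in>fst V. f (snd V n v) = snd W n (f v))"
    proof
      assume a: "\<forall>v\<in>fst V. snd W n (f (snd V (inv\<^bsub>G\<^esub> n) v)) = f v"
      show "\<forall>v\<in>fst V. f (snd V n v) = snd W n (f v)"
      proof
        fix v assume v: "v \<in> fst V"
        have "snd V (inv\<^bsub>G\<^esub> n) (snd V n v) = v"
          using repsD(6)[OF V nG(2,1) v] repsD(7)[OF V v] nG by simp
        then show "f (snd V n v) = snd W n (f v)" using a repsD(5)[OF V nG(1) v] by fastforce
      qed
    next
      assume a: "\<forall>v\<in>fst V. f (snd V n v) = snd W n (f v)"
      show "\<forall>v\<in>fst V. snd W n (f (snd V (inv\<^bsub>G\<^esub> n) v)) = f v"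
      proof
        fix v assume v: "v \<in> fst V"
        have "snd V n (snd V (inv\<^bsub>G\<^esub> n) v) = v"
          using repsD(6)[OF V nG v] repsD(7)[OF V v] nG by simp
        then show "snd W n (f (snd V (inv\<^bsub>G\<^esub> n) v)) = f v" using a repsD(5)[OF V nG(2) v] by fastforce
      qed
    qed
    finally have 1: "compose (fst V) (snd W n) (compose (fst V) f (snd V (inv\<^bsub>G\<^esub> n))) = f \<longleftrightarrow>
      (\<forall>v\<in>fst V. f (snd V n v) = snd W n (f v))" .
    have "Oconj G V W n (Some f, Some x) = (Some (compose (fst V) (snd W n) (compose (fst V) f (snd V (inv\<^bsub>G\<^esub> n)))), Some (snd W n x))"
      using isos_zero[OF f] inner_product_space_props(1)[OF ips[OF V]] by (simp add: Oconj_alt Olin_def)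
    then show ?thesis using 1 by auto
  qed
  then show ?thesis using True x by (auto simp: Omor_fix_def Omor_Some rep_fix_def)
next
  case False
  then show ?thesis by (auto simp: Omor_fix_def Omor_Some rep_fix_def)
qed

lemma Ofix_Omor:
  assumes \<phi>: "\<phi> \<in> Omor_fix G N V W"
  shows "Ofix N V \<phi> \<in> Omor (fx V) (fx W)"
  using Omor_fixD(1)[OF \<phi>]
proof (cases rule: Omor_cases)
  case 1
  then show ?thesis by (simp add: Ofix_def)
next
  case (2 f x)
  then have fx: "f \<in> isos (fst V) (fst W)" "x \<in> fx W" "\<And>v. v \<in> fst V \<Longrightarrow> ip (f v) x = 0"
     "\<And>n v. n \<in> N \<Longrightarrow> v \<in> fst V \<Longrightarrow> f (snd V n v) = snd W n (f v)"
    using \<phi> Omor_fix_Some[of f x] by auto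
  have "f v \<in> fx W" if "v \<in> fx V" for v
    using that fx(4) isosD(1)[OF fx(1)] by (auto simp: rep_fix_def) metis
  then have "restrict f (fx V) \<in> isos (fx V) (fx W)"
    by (intro restrict_isos[OF ipsN[OF V] fx(1)]) (auto intro: rep_fix_sub)
  then show ?thesis using fx by (simp add: 2(1) Ofix_def Omor_Some rep_fix_sub)
qed

text \<open>The square of \<open>Oconj_Rp\<close> restricted to fixed vectors. It moves g past a
  morphism in the coend at the price of a conjugation.\<close>

lemma Ofix_Oconj:
  assumes g: "g \<in> carrier G" and \<phi>: "\<phi> \<in> Omor_fix G N V W"
  shows "Ocomp (fx V) (Ofix N V (Oconj G V W g \<phi>)) (Rf V g) = Ocomp (fx V) (Rf W g) (Ofix N V \<phi>)"
proof -
  have "Ocomp (fx V) (Ofix N V (Oconj G V W g \<phi>)) (Rf V g) = Ofix N V (Ocomp (fst V) (Oconj G V W g \<phi>) (Rp V g))"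
    using Ofix_comp[OF ips[OF V] repsD(8)[OF V g] Oconj_Omor[OF g Omor_fixD(1)[OF \<phi>]], of N] Rf_Omor[OF V g] by (simp add: Rf_eq)
  also have "\<dots> = Ofix N V (Ocomp (fst V) (Rp W g) \<phi>)" unfolding Oconj_Rp[OF g Omor_fixD(1)[OF \<phi>]] ..
  also have "\<dots> = Ocomp (fx V) (Rf W g) (Ofix N V \<phi>)"
    using Ofix_comp[OF ips[OF V] Omor_fixD(1)[OF \<phi>] repsD(8)[OF W g] Ofix_Omor[OF \<phi>]] by (simp add: Rf_eq)
  finally show ?thesis .
qed

end

end

section \<open>The diagonal action on values at representations\<close>

context spec
begin

lemma continuous_map_ev_map2:
  assumes V: "inner_product_space V" and W: "inner_product_space W" and K: "CGWH K"
    and \<phi>: "continuous_map K (ptop (Osp V W)) \<phi>" and z: "continuous_map K (ptop (ev A V)) z"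
  shows "continuous_map K (ptop (ev A W)) (\<lambda>k. ev_map A V W (\<phi> k) (z k))"
proof (rule continuous_map_eq)
  have "continuous_map K (ptop (Osp (Euc (dim V)) (Euc (dim W)))) (\<lambda>k. cmor V W (\<phi> k))"
    unfolding cmor_def using fri_Omor[OF W] fr_Omor[OF V] \<phi>
    by (intro continuous_map_Ocomp[OF inner_product_space_Euc W inner_product_space_Euc]
        continuous_map_Ocomp[OF inner_product_space_Euc V W])
       (auto simp: topspace_Osp' V W)
  then show "continuous_map K (ptop (ev A W)) (\<lambda>k. E W (str A (dim V) (dim W) (cmor V W (\<phi> k)) (Einv V (z k))))"
    by (intro continuous_map_comp[OF continuous_map_E[OF W]] AD(4) K continuous_map_comp[OF continuous_map_Einv[OF V] z])
  fix k assume k: "k \<in> topspace K"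
  have "\<phi> k \<in> Omor V W" "z k \<in> EV V" using continuous_map_point[OF \<phi> k] continuous_map_point[OF z k] by (auto simp: topspace_Osp' V W)
  then show "E W (str A (dim V) (dim W) (cmor V W (\<phi> k)) (Einv V (z k))) = ev_map A V W (\<phi> k) (z k)"
    using V W by (elim EV_cases) (auto simp: Einv_E ev_map_E)
qed

text \<open>The action of \<open>G\<close> on \<open>A\<^sub>V\<close> that ignores the action on \<open>V\<close>.\<close>

definition lact :: "vect set \<Rightarrow> 'g \<Rightarrow> 'a evpt set \<Rightarrow> 'a evpt set" where
  "lact V g z = E V (act A g (dim V) (Einv V z))"

lemma lact_E: "inner_product_space V \<Longrightarrow> a \<in> lvl_set A (dim V) \<Longrightarrow> lact V g (E V a) = E V (act A g (dim V) a)"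
  by (simp add: lact_def Einv_E)

lemma lact_in: "inner_product_space V \<Longrightarrow> g \<in> carrier G \<Longrightarrow> z \<in> EV V \<Longrightarrow> lact V g z \<in> EV V"
  by (elim EV_cases) (simp_all add: lact_E E_in AD(11))

lemma lact_mult: "inner_product_space V \<Longrightarrow> g \<in> carrier G \<Longrightarrow> h \<in> carrier G \<Longrightarrow> z \<in> EV V \<Longrightarrow>
    lact V (g \<otimes>\<^bsub>G\<^esub> h) z = lact V g (lact V h z)"
  by (elim EV_cases) (simp_all add: lact_E AD(11) AD(13))

lemma lact_one: "inner_product_space V \<Longrightarrow> z \<in> EV V \<Longrightarrow> lact V \<one>\<^bsub>G\<^esub> z = z"
  by (elim EV_cases) (simp_all add: lact_E AD(12))

lemma lact_base: "inner_product_space V \<Longrightarrow> g \<in> carrier G \<Longrightarrow> lact V g (pt (ev A V)) = pt (ev A V)"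
  by (simp add: E_pt[symmetric] lact_E AD(3) AD(14))

lemma lact_map: "z \<in> EV V \<Longrightarrow> inner_product_space V \<Longrightarrow> inner_product_space W \<Longrightarrow> g \<in> carrier G \<Longrightarrow> \<phi> \<in> Omor V W \<Longrightarrow>
    lact W g (ev_map A V W \<phi> z) = ev_map A V W \<phi> (lact V g z)"
  by (elim EV_cases) (simp_all add: lact_E ev_map_E AD(5) AD(11) AD(15) cmor_Omor)

lemma continuous_map_lact:
  assumes V: "inner_product_space V" and K: "CGWH K" and g: "continuous_map K T g" and z: "continuous_map K (ptop (ev A V)) z"
  shows "continuous_map K (ptop (ev A V)) (\<lambda>k. lact V (g k) (z k))"
  unfolding lact_def
  by (intro continuous_map_comp[OF continuous_map_E[OF V]] AD(10) K g continuous_map_comp[OF continuous_map_Einv[OF V] z])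

text \<open>Factors the diagonal action into the action on the spectrum and the effect of the
  isometry of \<open>V\<close>, so that its algebra and its continuity reduce to those of
  \<open>lact\<close> and \<open>ev_map\<close>.\<close>

lemma ev_act_eq:
  assumes V: "V \<in> reps G T" and g: "g \<in> carrier G" and z: "z \<in> EV (fst V)"
  shows "ev_act A V g z = ev_map A (fst V) (fst V) (Rp V g) (lact (fst V) g z)"
proof -
  let ?U = "fst V" and ?n = "dim (fst V)"
  note U = repsD(1)[OF V] and \<rho> = repsD(2)[OF V g]
  note n = inner_product_space_Euc[of ?n]
  obtain a where a: "a \<in> lvl_set A ?n" "z = E ?U a" using E_surj[OF U z] by blast
  let ?P = "k_prod (iso_top (Euc ?n) ?U) (ptop (lvl A ?n))"
  have c: "CGWH ?P" using CGWH_frames[OF U] AD(2) by blast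
  define F where "F = (\<lambda>(p, a). ev_class A ?U (map_option (\<lambda>f. compose (Euc ?n) (snd V g) f) p) (act A g ?n a))"
  have FE: "F (Some f, a) = E ?U (red ?U (compose (Euc ?n) (snd V g) f) (act A g ?n a))"
    if "f \<in> isos (Euc ?n) ?U" "a \<in> lvl_set A ?n" for f a
    using ev_class_E[OF U compose_isos[OF n \<rho> that(1)] AD(11)[OF g that(2)]] by (simp add: F_def)
  have "the_elem (F ` E ?U a) = F (Some (frame ?U), a)"
  proof (rule ev_lift(1)[OF U CGWH_ev[OF U] _ _ _ a(1)])
    have "continuous_map ?P (iso_top (Euc ?n) ?U) (\<lambda>p. compose (Euc ?n) (snd V g) (fst p))"
      using \<rho> by (intro continuous_map_compose_isos[OF n U U] k_prod_fst) simp
    moreover have "continuous_map ?P (ptop (lvl A ?n)) (\<lambda>p. act A g ?n (snd p))"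
      using g by (intro AD(10) c k_prod_snd) (simp add: topspace_T)
    ultimately have "continuous_map ?P (ptop (ev A ?U)) (\<lambda>p. E ?U (red ?U (compose (Euc ?n) (snd V g) (fst p)) (act A g ?n (snd p))))"
      by (intro continuous_map_comp[OF continuous_map_E[OF U]] continuous_map_red[OF U c])
    then show "continuous_map ?P (ptop (ev A ?U)) (\<lambda>(f, a). F (Some f, a))"
      by (rule continuous_map_eq) (auto simp: FE)
    show "F (Some f, pt (lvl A ?n)) = F (None, pt (lvl A ?n))" if "f \<in> isos (Euc ?n) ?U" for f
      using AD(14)[OF g] by (simp add: F_def ev_class_base[OF U])
    show "F (Some (compose (Euc ?n) f k), a) = F (Some f, str A ?n ?n (Olin k) a)"
      if "f \<in> isos (Euc ?n) ?U" "k \<in> isos (Euc ?n) (Euc ?n)" "a \<in> lvl_set A ?n" for f k a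
    proof -
      have "compose (Euc ?n) (snd V g) (compose (Euc ?n) f k) = compose (Euc ?n) (compose (Euc ?n) (snd V g) f) k"
        using isosD(1)[OF that(2)] by (auto simp: compose_def fun_eq_iff)
      then show ?thesis
        using ev_class_rel[OF U compose_isos[OF n \<rho> that(1)] that(2) AD(11)[OF g that(3)]]
          AD(15)[OF g Olin_Euc[OF U that(2)] that(3)] by (simp add: F_def)
    qed
  qed
  then have "ev_act A V g z = E ?U (red ?U (compose (Euc ?n) (snd V g) (frame ?U)) (act A g ?n a))"
    using FE[OF frame_isos[OF U] a(1)] a(2) by (simp add: ev_act_def F_def)
  also have "red ?U (compose (Euc ?n) (snd V g) (frame ?U)) (act A g ?n a) = str A ?n ?n (cmor ?U ?U (Rp V g)) (act A g ?n a)"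
    unfolding red_def cmor_def using Ocomp_Olin[OF U \<rho>] by simp
  also have "E ?U \<dots> = ev_map A ?U ?U (Rp V g) (lact ?U g z)"
    using a U AD(11)[OF g a(1)] repsD(8)[OF V g] by (simp add: lact_E ev_map_E)
  finally show ?thesis .
qed

context
  fixes V assumes V: "V \<in> reps G T"
begin

lemmas U = repsD(1)[OF V]

lemma ev_act_in: "g \<in> carrier G \<Longrightarrow> z \<in> EV (fst V) \<Longrightarrow> ev_act A V g z \<in> EV (fst V)"
  using ev_act_eq[OF V] ev_map_in[OF U U repsD(8)[OF V]] lact_in[OF U] by simp

lemma ev_act_one: "z \<in> EV (fst V) \<Longrightarrow> ev_act A V \<one>\<^bsub>G\<^esub> z = z"
  using ev_act_eq[OF V G.one_closed] repsD(9)[OF V] by (simp add: lact_one U ev_map_id)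

lemma ev_act_mult:
  assumes "g \<in> carrier G" "h \<in> carrier G" "z \<in> EV (fst V)"
  shows "ev_act A V (g \<otimes>\<^bsub>G\<^esub> h) z = ev_act A V g (ev_act A V h z)"
proof -
  have "ev_act A V (g \<otimes>\<^bsub>G\<^esub> h) z = ev_map A (fst V) (fst V) (Ocomp (fst V) (Rp V g) (Rp V h)) (lact (fst V) g (lact (fst V) h z))"
    using assms by (simp add: ev_act_eq V repsD(10)[OF V] lact_mult U)
  also have "\<dots> = ev_map A (fst V) (fst V) (Rp V g) (ev_map A (fst V) (fst V) (Rp V h) (lact (fst V) g (lact (fst V) h z)))"
    using assms by (intro ev_map_comp U repsD(8)[OF V] lact_in)
  \<comment> \<open>The two factors of the diagonal action commute because \<open>lact\<close> is
    natural.\<close>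
  also have "ev_map A (fst V) (fst V) (Rp V h) (lact (fst V) g (lact (fst V) h z))
      = lact (fst V) g (ev_map A (fst V) (fst V) (Rp V h) (lact (fst V) h z))"
    using assms by (intro lact_map[symmetric] U repsD(8)[OF V] lact_in)
  finally show ?thesis
    using assms ev_act_in[OF assms(2,3)] ev_act_eq[OF V assms(2,3)] ev_act_eq[OF V assms(1) ev_act_in[OF assms(2,3)]] by simp
qed

lemma ev_act_base: "g \<in> carrier G \<Longrightarrow> ev_act A V g (pt (ev A (fst V))) = pt (ev A (fst V))"
  using ev_act_eq[OF V _ pt_ev_in[OF U]] by (simp add: lact_base U ev_map_base repsD(8)[OF V])

lemma continuous_map_ev_act:
  assumes K: "CGWH K" and g: "continuous_map K T g" and z: "continuous_map K (ptop (ev A (fst V))) z"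
  shows "continuous_map K (ptop (ev A (fst V))) (\<lambda>k. ev_act A V (g k) (z k))"
proof (rule continuous_map_eq)
  show "continuous_map K (ptop (ev A (fst V))) (\<lambda>k. ev_map A (fst V) (fst V) (Rp V (g k)) (lact (fst V) (g k) (z k)))"
    by (intro continuous_map_ev_map2[OF U U K] continuous_map_Olin'[OF U U] reps_continuous[OF V topspace_T g] continuous_map_lact[OF U K g z])
  show "ev_map A (fst V) (fst V) (Rp V (g k)) (lact (fst V) (g k) (z k)) = ev_act A V (g k) (z k)" if "k \<in> topspace K" for k
    using ev_act_eq[OF V] continuous_map_point[OF g that] continuous_map_point[OF z that] topspace_T by simp
qed

end

end

locale gspec = rep_group G T N + spec G T A for G :: "'g monoid" and T and N and A :: "('g, 'a) ospectrum"
begin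

text \<open>\<open>lact\<close> commutes with every morphism; the linear factor of the action is
  what conjugates \<open>\<phi>\<close>.\<close>

lemma ev_act_map:
  assumes V: "V \<in> \<R>" and W: "W \<in> \<R>" and g: "g \<in> carrier G" and \<phi>: "\<phi> \<in> Omor (fst V) (fst W)" and z: "z \<in> EV (fst V)"
  shows "ev_act A W g (ev_map A (fst V) (fst W) \<phi> z) = ev_map A (fst V) (fst W) (Oconj G V W g \<phi>) (ev_act A V g z)"
proof -
  note v = ips[OF V] and w = ips[OF W]
  note l = lact_in[OF v g z]
  have "ev_act A W g (ev_map A (fst V) (fst W) \<phi> z)
      = ev_map A (fst W) (fst W) (Rp W g) (ev_map A (fst V) (fst W) \<phi> (lact (fst V) g z))"
    using ev_act_eq[OF W g ev_map_in[OF v w \<phi> z]] lact_map[OF z v w g \<phi>] by simp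
  also have "\<dots> = ev_map A (fst V) (fst W) (Ocomp (fst V) (Rp W g) \<phi>) (lact (fst V) g z)"
    by (rule ev_map_comp[OF v w w repsD(8)[OF W g] \<phi> l, symmetric])
  also have "\<dots> = ev_map A (fst V) (fst W) (Oconj G V W g \<phi>) (ev_map A (fst V) (fst V) (Rp V g) (lact (fst V) g z))"
    unfolding Oconj_Rp[OF V W g \<phi>, symmetric]
    by (rule ev_map_comp[OF v v w Oconj_Omor[OF V W g \<phi>] repsD(8)[OF V g] l])
  finally show ?thesis using ev_act_eq[OF V g z] by simp
qed

definition FV :: "'g rep \<Rightarrow> 'a evpt set set" where
  "FV V = {z \<in> EV (fst V). \<forall>n\<in>N. ev_act A V n z = z}"

lemma FV_iff: "z \<in> FV V \<longleftrightarrow> z \<in> EV (fst V) \<and> (\<forall>n\<in>N. ev_act A V n z = z)"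
  by (auto simp: FV_def)

lemma topspace_ev_fix [simp]: "topspace (ptop (ev_fix N A V)) = FV V"
  by (auto simp: FV_def ev_fix_def)

lemma closedin_FV:
  assumes V: "V \<in> \<R>"
  shows "closedin (ptop (ev A (fst V))) (FV V)"
proof -
  let ?X = "ptop (ev A (fst V))"
  note c = CGWH_ev[OF ips[OF V]]
  have "closedin ?X {z \<in> topspace ?X. ev_act A V n z = z}" if "n \<in> N" for n
    using NG[OF that] by (intro closedin_eq_maps[OF c c] continuous_map_ev_act[OF V c]) (auto simp: topspace_T)
  then have "closedin ?X (\<Inter>n\<in>N. {z \<in> topspace ?X. ev_act A V n z = z})"
    using N1 by (intro closedin_Inter) auto
  moreover have "(\<Inter>n\<in>N. {z \<in> topspace ?X. ev_act A V n z = z}) = FV V" using N1 by (auto simp: FV_iff)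
  ultimately show ?thesis by simp
qed

lemma pt_ev_fix [simp]: "pt (ev_fix N A V) = pt (ev A (fst V))"
  by (simp add: ev_fix_def)

lemma ptop_ev_fix: "V \<in> \<R> \<Longrightarrow> ptop (ev_fix N A V) = subtopology (ptop (ev A (fst V))) (FV V)"
proof -
  have "FV V = EV (fst V) \<inter> {z. \<forall>n\<in>N. ev_act A V n z = z}" by (auto simp: FV_def)
  then show ?thesis by (simp add: ev_fix_def) (metis subtopology_restrict)
qed

lemma pt_FV: "V \<in> \<R> \<Longrightarrow> pt (ev A (fst V)) \<in> FV V"
  using pt_ev_in[OF ips] ev_act_base NG by (simp add: FV_iff)

lemma based_ev_fix: "V \<in> \<R> \<Longrightarrow> based_CGWH (ev_fix N A V)"
  using CGWH_closed_subtopology[OF CGWH_ev[OF ips] closedin_FV] pt_FV pt_ev_in[OF ips]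
  by (simp add: based_CGWH_iff ptop_ev_fix)

lemma continuous_map_into_ev_fix:
  "V \<in> \<R> \<Longrightarrow> continuous_map K (ptop (ev A (fst V))) z \<Longrightarrow> (\<And>k. k \<in> topspace K \<Longrightarrow> z k \<in> FV V) \<Longrightarrow>
    continuous_map K (ptop (ev_fix N A V)) z"
  by (auto simp: ptop_ev_fix continuous_map_in_subtopology)

lemma continuous_map_from_ev_fix:
  "continuous_map K (ptop (ev_fix N A V)) z \<Longrightarrow> continuous_map K (ptop (ev A (fst V))) z"
  by (auto simp: ev_fix_def continuous_map_in_subtopology)

lemma ev_act_fix: "V \<in> \<R> \<Longrightarrow> g \<in> carrier G \<Longrightarrow> z \<in> FV V \<Longrightarrow> ev_act A V g z \<in> FV V"
proof -
  assume a: "V \<in> \<R>" "g \<in> carrier G" "z \<in> FV V"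
  have z: "z \<in> EV (fst V)" using a(3) FV_iff by blast
  have "ev_act A V n (ev_act A V g z) = ev_act A V g z" if n: "n \<in> N" for n
  proof -
    have "ev_act A V n (ev_act A V g z) = ev_act A V (g \<otimes>\<^bsub>G\<^esub> (inv\<^bsub>G\<^esub> g \<otimes>\<^bsub>G\<^esub> n \<otimes>\<^bsub>G\<^esub> g)) z"
      using ev_act_mult[OF a(1) NG[OF n] a(2) z] Ncomm[OF n a(2)] by simp
    also have "\<dots> = ev_act A V g (ev_act A V (inv\<^bsub>G\<^esub> g \<otimes>\<^bsub>G\<^esub> n \<otimes>\<^bsub>G\<^esub> g) z)"
      by (rule ev_act_mult[OF a(1,2) NG[OF Nconj'[OF n a(2)]] z])
    finally show ?thesis using a(3) Nconj'[OF n a(2)] by (simp add: FV_iff)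
  qed
  then show ?thesis using ev_act_in[OF a(1,2) z] by (simp add: FV_iff)
qed

lemma ev_map_fix:
  assumes V: "V \<in> \<R>" and W: "W \<in> \<R>" and \<phi>: "\<phi> \<in> Omor_fix G N V W" and z: "z \<in> FV V"
  shows "ev_map A (fst V) (fst W) \<phi> z \<in> FV W"
proof -
  note O = Omor_fixD(1)[OF V W \<phi>]
  have z': "z \<in> EV (fst V)" using z FV_iff by blast
  have "ev_act A W n (ev_map A (fst V) (fst W) \<phi> z) = ev_map A (fst V) (fst W) \<phi> z" if "n \<in> N" for n
    using ev_act_map[OF V W NG[OF that] O z'] Omor_fixD(2)[OF V W \<phi> that] z that by (simp add: FV_iff)
  then show ?thesis using ev_map_in[OF ips[OF V] ips[OF W] O z'] by (simp add: FV_iff)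
qed

end

section \<open>Quotient groups\<close>

context rep_group
begin

abbreviation "J \<equiv> G Mod N"
abbreviation "TJ \<equiv> factor_group_topology G T N"
abbreviation cs :: "'g \<Rightarrow> 'g set" where "cs g \<equiv> N #>\<^bsub>G\<^esub> g"

lemma carrier_J: "carrier J = cs ` carrier G"
  by (auto simp: FactGroup_def RCOSETS_def)

lemma set_mult_cs: "g \<in> carrier G \<Longrightarrow> h \<in> carrier G \<Longrightarrow> cs g <#>\<^bsub>G\<^esub> cs h = cs (g \<otimes>\<^bsub>G\<^esub> h)"
  by (rule normal.rcos_sum[OF nN])

lemma mult_J: "g \<in> carrier G \<Longrightarrow> h \<in> carrier G \<Longrightarrow> cs g \<otimes>\<^bsub>J\<^esub> cs h = cs (g \<otimes>\<^bsub>G\<^esub> h)"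
  using set_mult_cs by (simp add: FactGroup_def)

lemma cs_one: "cs \<one>\<^bsub>G\<^esub> = N" by (rule G.coset_mult_one[OF NG'])

lemma one_J: "\<one>\<^bsub>J\<^esub> = cs \<one>\<^bsub>G\<^esub>"
  by (simp add: cs_one)

lemma group_J: "group J" by (rule normal.factorgroup_is_group[OF nN])

lemma inv_J: "g \<in> carrier G \<Longrightarrow> inv\<^bsub>J\<^esub> cs g = cs (inv\<^bsub>G\<^esub> g)"
  by (rule group.inv_equality[OF group_J]) (simp_all add: set_mult_cs cs_one carrier_J)

lemma cs_eq: "g \<in> carrier G \<Longrightarrow> h \<in> carrier G \<Longrightarrow> cs g = cs h \<longleftrightarrow> g \<otimes>\<^bsub>G\<^esub> inv\<^bsub>G\<^esub> h \<in> N"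
proof
  assume gh: "g \<in> carrier G" "h \<in> carrier G"
  { assume "cs g = cs h"
    then have "g \<in> cs h" using G.rcos_self[OF gh(1) subgroup_N] by simp
    then obtain n where "n \<in> N" "g = n \<otimes>\<^bsub>G\<^esub> h" by (auto simp: r_coset_def)
    then show "g \<otimes>\<^bsub>G\<^esub> inv\<^bsub>G\<^esub> h \<in> N" using gh NG by (simp add: G.m_assoc) }
  { assume "g \<otimes>\<^bsub>G\<^esub> inv\<^bsub>G\<^esub> h \<in> N"
    moreover have "g = g \<otimes>\<^bsub>G\<^esub> inv\<^bsub>G\<^esub> h \<otimes>\<^bsub>G\<^esub> h" using gh by (simp add: G.m_assoc)
    ultimately have "g \<in> cs h" unfolding r_coset_def by blast
    then show "cs g = cs h" using G.repr_independence[OF _ gh(2) subgroup_N] by simp }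
qed

lemma quotient_cs: "quotient_map T TJ cs"
  unfolding factor_group_topology_def by (rule quotient_map_quotient_topology)

text \<open>The kernel of the projection is the preimage of the closed set N under (x, y) -> x
  y^-1.\<close>

lemma CGWH_TJ: "CGWH TJ"
proof (rule CGWH_quotient[OF CGWH_T quotient_cs])
  have "continuous_map (k_prod T T) T (\<lambda>p. fst p \<otimes>\<^bsub>G\<^esub> inv\<^bsub>G\<^esub> (snd p))"
    using CGWH_T by (intro k_groupD(4,5)[OF kG] k_prod_fst k_prod_snd CGWH_k_prod)
  from closedin_continuous_map_preimage[OF this cN]
  have "closedin (k_prod T T) {p \<in> topspace (k_prod T T). fst p \<otimes>\<^bsub>G\<^esub> inv\<^bsub>G\<^esub> (snd p) \<in> N}" .
  moreover have "{p \<in> topspace (k_prod T T). fst p \<otimes>\<^bsub>G\<^esub> inv\<^bsub>G\<^esub> (snd p) \<in> N}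
      = {(x, y). x \<in> topspace T \<and> y \<in> topspace T \<and> cs x = cs y}"
    by (rule Set.set_eqI) (simp add: topspace_T cs_eq case_prod_beta' mem_Times_iff cong: conj_cong)
  ultimately show "closedin (k_prod T T) {(x, y). x \<in> topspace T \<and> y \<in> topspace T \<and> cs x = cs y}" by simp
qed

lemma continuous_cs: "continuous_map T TJ cs" by (rule quotient_imp_continuous_map[OF quotient_cs])

lemma k_group_J: "k_group J TJ"
  unfolding k_group_def
proof (intro conjI group_J CGWH_TJ)
  show "topspace TJ = carrier J" by (simp add: factor_group_topology_def carrier_J topspace_T)
  have "continuous_map (k_prod T T) TJ (\<lambda>p. cs (fst p \<otimes>\<^bsub>G\<^esub> snd p))"
    using CGWH_T by (intro continuous_map_comp[OF continuous_cs] k_groupD(4)[OF kG] k_prod_fst k_prod_snd CGWH_k_prod)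
  then have "continuous_map (k_prod T T) TJ (\<lambda>(x, y). cs x \<otimes>\<^bsub>J\<^esub> cs y)"
    by (rule continuous_map_eq) (simp add: topspace_T set_mult_cs case_prod_beta' mem_Times_iff)
  \<comment> \<open>The two variables pass to the quotient one after the other.\<close>
  then have "continuous_map (k_prod T TJ) TJ (\<lambda>(x, y). cs x \<otimes>\<^bsub>J\<^esub> y)"
    by (rule continuous_map_quotient_param[OF CGWH_T CGWH_T CGWH_TJ quotient_cs])
  then show "continuous_map (k_prod TJ TJ) TJ (\<lambda>(x, y). x \<otimes>\<^bsub>J\<^esub> y)"
    by (rule continuous_map_quotient_param1[OF CGWH_T CGWH_TJ CGWH_TJ quotient_cs])
  have "continuous_map T TJ (\<lambda>x. cs (inv\<^bsub>G\<^esub> x))"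
    by (intro continuous_map_comp[OF continuous_cs] k_groupD(5)[OF kG]) simp
  then have "continuous_map T TJ ((\<lambda>x. inv\<^bsub>J\<^esub> x) \<circ> cs)"
    by (rule continuous_map_eq) (simp add: inv_J topspace_T)
  then show "continuous_map TJ TJ (\<lambda>x. inv\<^bsub>J\<^esub> x)"
    using continuous_compose_quotient_map[OF quotient_cs] by blast
qed

text \<open>The zero representation indexes the summand whose base point serves as base point of the
  coend.\<close>

lemma zero_rep_reps: "zero_rep G \<in> \<R>"
  unfolding zero_rep_def
proof (rule repsI)
  have "inner_product_space {0 :: vect}" by (simp add: inner_product_space_def subspace_def) (metis finite.emptyI span_empty)
  then show "inner_product_space {0 :: vect}" .
  show "(\<lambda>g\<in>carrier G. \<lambda>v\<in>{0}. v) g \<in> isos {0} {0}" if "g \<in> carrier G" for g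
    using that by (auto intro!: isosI)
  show "continuous_map (prod_topology T (top_of_set {0})) (top_of_set {0}) (\<lambda>(g, v). (\<lambda>g\<in>carrier G. \<lambda>v\<in>{0}. v) g v)"
    by (rule continuous_map_eq[of _ _ "\<lambda>_. 0"]) (auto simp: topspace_T)
qed auto

end

section \<open>Geometric fixed points\<close>

context gspec
begin

abbreviation "\<Phi> \<equiv> gfix G T N A"
abbreviation "Om V m \<equiv> Omor (fx V) (Euc m)"
abbreviation "Os V m \<equiv> ptop (Osp (fx V) (Euc m))"
abbreviation "Fx V \<equiv> ptop (ev_fix N A V)"
abbreviation "\<gamma> m V \<theta> a \<equiv> gfix_class G T N A m V \<theta> a"
abbreviation "b0 \<equiv> (None, None)"

lemma CGWH_Os: "V \<in> \<R> \<Longrightarrow> CGWH (Os V m)" by (simp add: CGWH_Osp ipsN)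
lemma topspace_Os: "V \<in> \<R> \<Longrightarrow> topspace (Os V m) = Om V m" by (simp add: topspace_Osp' ipsN)
lemma CGWH_Fx: "V \<in> \<R> \<Longrightarrow> CGWH (Fx V)" using based_ev_fix by (simp add: based_CGWH_iff)

lemma based_Os: "V \<in> \<R> \<Longrightarrow> based_CGWH (Osp (fx V) (Euc m))"
  by (intro ips_pair.based_Osp ips_pair.intro ipsN inner_product_space_Euc)

lemma pt_Osp [simp]: "pt (Osp U W) = b0" by (simp add: Osp_def)

lemma based_summand: "V \<in> \<R> \<Longrightarrow> based_CGWH (gfix_summand N A m V)"
  unfolding gfix_summand_def by (intro based_CGWH_smash based_Os based_ev_fix)

lemma based_gpre: "based_CGWH (gfix_pre G T N A m)"
  unfolding based_CGWH_iff gfix_pre_def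
  using CGWH_sum[of \<R> "\<lambda>V. ptop (gfix_summand N A m V)"] based_summand zero_rep_reps by (auto simp: based_CGWH_iff)

lemma CGWH_gpre: "CGWH (ptop (gfix_pre G T N A m))" using based_gpre by (simp add: based_CGWH_iff)

lemma gfix_pt_base: "gfix_pt N A m V b0 a = (V, pt (gfix_summand N A m V))"
  "gfix_pt N A m V \<theta> (pt (ev A (fst V))) = (V, pt (gfix_summand N A m V))"
  by (auto simp: gfix_pt_def smash_pt_def gfix_summand_def)

lemma quotient_summand:
  "quotient_map (k_prod (Os V m) (Fx V)) (ptop (gfix_summand N A m V)) (smash_pt (Osp (fx V) (Euc m)) (ev_fix N A V))"
  unfolding gfix_summand_def by (rule quotient_map_smash)

lemma gfix_pt_in: "V \<in> \<R> \<Longrightarrow> \<theta> \<in> Om V m \<Longrightarrow> a \<in> FV V \<Longrightarrow> gfix_pt N A m V \<theta> a \<in> topspace (ptop (gfix_pre G T N A m))"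
  using continuous_map_point[OF quotient_imp_continuous_map[OF quotient_summand], of "(\<theta>, a)" V m]
  by (simp add: gfix_pt_def gfix_pre_def topspace_Os)

lemma Ocomp_Ofix: "V \<in> \<R> \<Longrightarrow> W \<in> \<R> \<Longrightarrow> \<phi> \<in> Omor_fix G N V W \<Longrightarrow> \<theta> \<in> Om W m \<Longrightarrow> Ocomp (fx V) \<theta> (Ofix N V \<phi>) \<in> Om V m"
  by (rule Ocomp_in_Omor[OF ipsN ipsN inner_product_space_Euc _ Ofix_Omor])

lemma gfix_rel_sub: "gfix_rel G T N A m \<subseteq> topspace (ptop (gfix_pre G T N A m)) \<times> topspace (ptop (gfix_pre G T N A m))"
proof -
  have "(V, pt (gfix_summand N A m V)) \<in> topspace (ptop (gfix_pre G T N A m))" if "V \<in> \<R>" for V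
    using that based_summand[OF that] by (simp add: gfix_pre_def based_CGWH_iff)
  moreover have "gfix_pt N A m V (Ocomp (fx V) \<theta> (Ofix N V \<phi>)) a \<in> topspace (ptop (gfix_pre G T N A m))"
    "gfix_pt N A m W \<theta> (ev_map A (fst V) (fst W) \<phi> a) \<in> topspace (ptop (gfix_pre G T N A m))"
    if "V \<in> \<R>" "W \<in> \<R>" "\<phi> \<in> Omor_fix G N V W" "\<theta> \<in> Om W m" "a \<in> FV V" for V W \<phi> \<theta> a
    using gfix_pt_in[OF that(1) Ocomp_Ofix[OF that(1-4)] that(5)]
      gfix_pt_in[OF that(2,4) ev_map_fix[OF that(1-3,5)]] by auto
  ultimately show ?thesis
    unfolding gfix_rel_def topspace_ev_fix by blast
qed

lemma lvl_\<Phi> [simp]: "lvl \<Phi> m = coeq (gfix_pre G T N A m) (gfix_rel G T N A m)"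
  by (simp add: gfix_def)

lemma based_\<Phi>: "based_CGWH (lvl \<Phi> m)"
  using based_CGWH_coeq[OF based_gpre gfix_rel_sub] by simp

lemma CGWH_\<Phi>: "CGWH (ptop (lvl \<Phi> m))" using based_\<Phi> by (simp add: based_CGWH_iff)

lemma \<gamma>_in: "V \<in> \<R> \<Longrightarrow> \<theta> \<in> Om V m \<Longrightarrow> a \<in> FV V \<Longrightarrow> \<gamma> m V \<theta> a \<in> lvl_set \<Phi> m"
  using gfix_pt_in by (simp add: gfix_class_def)

lemma \<gamma>_surj:
  assumes "z \<in> lvl_set \<Phi> m"
  obtains V \<theta> a where "V \<in> \<R>" "\<theta> \<in> Om V m" "a \<in> FV V" "z = \<gamma> m V \<theta> a"
proof -
  obtain p where p: "p \<in> topspace (ptop (gfix_pre G T N A m))" "z = coeq_class (gfix_pre G T N A m) (gfix_rel G T N A m) p"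
    using assms by auto
  then obtain V s where V: "V \<in> \<R>" "p = (V, s)" "s \<in> topspace (ptop (gfix_summand N A m V))"
    by (auto simp: gfix_pre_def)
  then have "s \<in> smash_pt (Osp (fx V) (Euc m)) (ev_fix N A V) ` topspace (k_prod (Os V m) (Fx V))"
    using quotient_summand[of V m] unfolding quotient_map_def by simp
  then obtain \<theta> a where "\<theta> \<in> Om V m" "a \<in> FV V" "s = smash_pt (Osp (fx V) (Euc m)) (ev_fix N A V) (\<theta>, a)"
    using topspace_Os[OF V(1)] by auto
  then show ?thesis using that V p by (simp add: gfix_class_def gfix_pt_def)
qed

lemma \<gamma>_base: "V \<in> \<R> \<Longrightarrow> \<gamma> m V b0 a = pt (lvl \<Phi> m)" "V \<in> \<R> \<Longrightarrow> \<gamma> m V \<theta> (pt (ev A (fst V))) = pt (lvl \<Phi> m)"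
proof -
  assume V: "V \<in> \<R>"
  have "((V, pt (gfix_summand N A m V)), (zero_rep G, pt (gfix_summand N A m (zero_rep G)))) \<in> gfix_rel G T N A m"
    unfolding gfix_rel_def using V zero_rep_reps by blast
  from coeq_class_rel[OF gfix_rel_sub this]
  show "\<gamma> m V b0 a = pt (lvl \<Phi> m)" "\<gamma> m V \<theta> (pt (ev A (fst V))) = pt (lvl \<Phi> m)"
    by (simp_all add: gfix_class_def gfix_pt_base gfix_pre_def)
qed

lemma \<gamma>_rel:
  assumes "V \<in> \<R>" "W \<in> \<R>" "\<phi> \<in> Omor_fix G N V W" "\<theta> \<in> Om W m" "a \<in> FV V"
  shows "\<gamma> m V (Ocomp (fx V) \<theta> (Ofix N V \<phi>)) a = \<gamma> m W \<theta> (ev_map A (fst V) (fst W) \<phi> a)"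
  unfolding gfix_class_def
  by (rule coeq_class_rel[OF gfix_rel_sub]) (use assms in \<open>unfold gfix_rel_def topspace_ev_fix, blast\<close>)

lemma continuous_map_\<gamma>:
  assumes V: "V \<in> \<R>" and K: "CGWH K" and \<theta>: "continuous_map K (Os V m) \<theta>" and a: "continuous_map K (Fx V) a"
  shows "continuous_map K (ptop (lvl \<Phi> m)) (\<lambda>k. \<gamma> m V (\<theta> k) (a k))"
proof -
  have "continuous_map K (ptop (gfix_summand N A m V)) (\<lambda>k. smash_pt (Osp (fx V) (Euc m)) (ev_fix N A V) (\<theta> k, a k))"
    using continuous_map_comp[OF quotient_imp_continuous_map[OF quotient_summand] continuous_map_into_k_prod[OF CGWH_Os[OF V] CGWH_Fx[OF V] K \<theta> a]] .
  from continuous_map_comp[OF continuous_map_component_injection[OF V, of "\<lambda>V. ptop (gfix_summand N A m V)"] this]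
  have "continuous_map K (ptop (gfix_pre G T N A m)) (\<lambda>k. gfix_pt N A m V (\<theta> k) (a k))"
    by (simp add: gfix_pre_def gfix_pt_def)
  from continuous_map_comp[OF quotient_imp_continuous_map[OF quotient_map_coeq] this] show ?thesis
    by (simp add: gfix_class_def)
qed

lemma continuous_map_gpre_param:
  assumes S: "CGWH S"
    and h: "\<And>V. V \<in> \<R> \<Longrightarrow> continuous_map (k_prod S (k_prod (Os V m) (Fx V))) W (\<lambda>(s, (\<theta>, a)). h s (gfix_pt N A m V \<theta> a))"
  shows "continuous_map (k_prod S (ptop (gfix_pre G T N A m))) W (\<lambda>(s, p). h s p)"
  unfolding gfix_pre_def pspace.simps
proof (rule continuous_map_sum_param[OF _ S])
  fix V assume V: "V \<in> \<R>"
  show c: "CGWH (ptop (gfix_summand N A m V))" using based_summand[OF V] by (simp add: based_CGWH_iff)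
  show "continuous_map (k_prod S (ptop (gfix_summand N A m V))) W (\<lambda>(s, x). h s (V, x))"
    using continuous_map_quotient_param[OF CGWH_k_prod[OF CGWH_Os[OF V] CGWH_Fx[OF V]] S c quotient_summand, of W "\<lambda>s x. h s (V, x)"]
      h[OF V] by (simp add: gfix_pt_def case_prod_beta')
qed

text \<open>Continuity on the coend is checked on a smash of two factors at a time: through the
  coequalizer, the disjoint union and the smash quotient, with the parameter carried along.\<close>

lemma continuous_map_\<Phi>_param:
  assumes S: "CGWH S"
    and h: "\<And>V. V \<in> \<R> \<Longrightarrow> continuous_map (k_prod S (k_prod (Os V m) (Fx V))) W (\<lambda>(s, (\<theta>, a)). h s (\<gamma> m V \<theta> a))"
  shows "continuous_map (k_prod S (ptop (lvl \<Phi> m))) W (\<lambda>(s, z). h s z)"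
proof -
  have "continuous_map (k_prod S (ptop (gfix_pre G T N A m))) W
      (\<lambda>(s, p). h s (coeq_class (gfix_pre G T N A m) (gfix_rel G T N A m) p))"
    using continuous_map_gpre_param[OF S, where h = "\<lambda>s p. h s (coeq_class (gfix_pre G T N A m) (gfix_rel G T N A m) p)"]
      h by (simp add: gfix_class_def)
  then show ?thesis
    unfolding lvl_\<Phi>
    using continuous_map_quotient_param[OF CGWH_gpre S _ quotient_map_coeq, of m] CGWH_\<Phi>[of m] by simp
qed

lemma CGWH_unit: "CGWH (discrete_topology {()})"
  by (intro compact_Hausdorff_imp_CGWH) (simp_all add: compact_space_discrete_topology)

lemma continuous_map_\<Phi>:
  assumes h: "\<And>V. V \<in> \<R> \<Longrightarrow> continuous_map (k_prod (Os V m) (Fx V)) W (\<lambda>(\<theta>, a). h (\<gamma> m V \<theta> a))"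
  shows "continuous_map (ptop (lvl \<Phi> m)) W h"
proof (rule continuous_map_unparam[OF CGWH_\<Phi>], rule continuous_map_\<Phi>_param[OF CGWH_unit])
  fix V assume V: "V \<in> \<R>"
  show "continuous_map (k_prod (discrete_topology {()}) (k_prod (Os V m) (Fx V))) W (\<lambda>(s, (\<theta>, a)). h (\<gamma> m V \<theta> a))"
    using continuous_map_comp[OF h[OF V] k_prod_snd] by (simp add: case_prod_beta')
qed

text \<open>The universal property of the coend. The single value \<open>c\<close> reflects that the
  base points of all summands are identified.\<close>

lemma gfix_lift:
  assumes W: "CGWH W"
    and F: "\<And>V. V \<in> \<R> \<Longrightarrow> continuous_map (k_prod (Os V m) (Fx V)) W (\<lambda>(\<theta>, a). F (V, \<theta>, a))"
    and F0: "\<And>V a. V \<in> \<R> \<Longrightarrow> a \<in> FV V \<Longrightarrow> F (V, b0, a) = c" "\<And>V \<theta>. V \<in> \<R> \<Longrightarrow> \<theta> \<in> Om V m \<Longrightarrow> F (V, \<theta>, pt (ev A (fst V))) = c"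
    and FR: "\<And>V V' \<phi> \<theta> a. V \<in> \<R> \<Longrightarrow> V' \<in> \<R> \<Longrightarrow> \<phi> \<in> Omor_fix G N V V' \<Longrightarrow> \<theta> \<in> Om V' m \<Longrightarrow> a \<in> FV V \<Longrightarrow>
      F (V, Ocomp (fx V) \<theta> (Ofix N V \<phi>), a) = F (V', \<theta>, ev_map A (fst V) (fst V') \<phi> a)"
    and V: "V \<in> \<R>" "\<theta> \<in> Om V m" "a \<in> FV V"
  shows "p \<in> \<gamma> m V \<theta> a \<Longrightarrow> F p = F (V, \<theta>, a)" "the_elem (F ` \<gamma> m V \<theta> a) = F (V, \<theta>, a)"
    "V' \<in> \<R> \<Longrightarrow> \<theta>' \<in> Om V' m \<Longrightarrow> a' \<in> FV V' \<Longrightarrow> \<gamma> m V \<theta> a = \<gamma> m V' \<theta>' a' \<Longrightarrow> F (V, \<theta>, a) = F (V', \<theta>', a')"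
proof -
  have Fp: "F (gfix_pt N A m V \<theta> a) = F (V, \<theta>, a)" if "V \<in> \<R>" "\<theta> \<in> Om V m" "a \<in> FV V" for V \<theta> a
    using that F0 F0(1)[OF that(1) pt_FV[OF that(1)]] by (auto simp: gfix_pt_def smash_pt_def)
  have Fb: "F (V, pt (gfix_summand N A m V)) = c" if "V \<in> \<R>" for V
    using F0(1)[OF that pt_FV[OF that]] by (simp add: gfix_summand_def)
  have c: "continuous_map (ptop (gfix_pre G T N A m)) W F"
  proof (rule continuous_map_unparam[OF CGWH_gpre], rule continuous_map_gpre_param[OF CGWH_unit])
    fix V assume V: "V \<in> \<R>"
    have "continuous_map (k_prod (discrete_topology {()}) (k_prod (Os V m) (Fx V))) W (\<lambda>p. case snd p of (\<theta>, a) \<Rightarrow> F (V, \<theta>, a))"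
      using continuous_map_comp[OF F[OF V] k_prod_snd] .
    then show "continuous_map (k_prod (discrete_topology {()}) (k_prod (Os V m) (Fx V))) W (\<lambda>(s, (\<theta>, a)). F (gfix_pt N A m V \<theta> a))"
      by (rule continuous_map_eq) (auto simp: Fp V topspace_Os)
  qed
  have R: "F p = F p'" if "(p, p') \<in> gfix_rel G T N A m" for p p'
    using that unfolding gfix_rel_def
  proof (elim UnE CollectE exE conjE)
    fix V W assume "(p, p') = ((V, pt (gfix_summand N A m V)), (W, pt (gfix_summand N A m W)))" "V \<in> \<R>" "W \<in> \<R>"
    then show ?thesis using Fb by simp
  next
    fix V W \<theta> \<phi> a assume "(p, p') = (gfix_pt N A m V (Ocomp (fx V) \<theta> (Ofix N V \<phi>)) a, gfix_pt N A m W \<theta> (ev_map A (fst V) (fst W) \<phi> a))"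
      and a: "V \<in> \<R>" "W \<in> \<R>" "\<phi> \<in> Omor_fix G N V W" "\<theta> \<in> Om W m" "a \<in> topspace (Fx V)"
    then show ?thesis using FR[OF a(1-4)] Fp[OF a(1) Ocomp_Ofix[OF a(1-4)]] Fp[OF a(2,4) ev_map_fix[OF a(1-3)]] by simp
  qed
  show "p \<in> \<gamma> m V \<theta> a \<Longrightarrow> F p = F (V, \<theta>, a)"
    using coeq_class_const[OF CGWH_gpre gfix_rel_sub W c R gfix_pt_in[OF V]] Fp[OF V] by (simp add: gfix_class_def)
  show "the_elem (F ` \<gamma> m V \<theta> a) = F (V, \<theta>, a)"
    using coeq_the_elem[OF CGWH_gpre gfix_rel_sub W c R gfix_pt_in[OF V]] Fp[OF V] by (simp add: gfix_class_def)
  show "V' \<in> \<R> \<Longrightarrow> \<theta>' \<in> Om V' m \<Longrightarrow> a' \<in> FV V' \<Longrightarrow> \<gamma> m V \<theta> a = \<gamma> m V' \<theta>' a' \<Longrightarrow> F (V, \<theta>, a) = F (V', \<theta>', a')"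
    using coeq_class_lift[OF CGWH_gpre gfix_rel_sub W c R gfix_pt_in[OF V] gfix_pt_in] Fp V by (simp add: gfix_class_def)
qed

lemma \<gamma>_self: "V \<in> \<R> \<Longrightarrow> \<theta> \<in> Om V m \<Longrightarrow> a \<in> FV V \<Longrightarrow> \<gamma> m V \<theta> a \<noteq> {}"
  using coeq_class_subset(1)[OF gfix_rel_sub gfix_pt_in, of V \<theta> m a] unfolding gfix_class_def by blast

lemma Ocomp_Om: "V \<in> \<R> \<Longrightarrow> \<psi> \<in> Omor (Euc m) (Euc n) \<Longrightarrow> \<theta> \<in> Om V m \<Longrightarrow> Ocomp (fx V) \<psi> \<theta> \<in> Om V n"
  by (rule Ocomp_in_Omor[OF ipsN inner_product_space_Euc inner_product_space_Euc])

lemma str_\<gamma>: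
  assumes \<psi>: "\<psi> \<in> Omor (Euc m) (Euc n)" and V: "V \<in> \<R>" "\<theta> \<in> Om V m" "a \<in> FV V"
  shows "str \<Phi> m n \<psi> (\<gamma> m V \<theta> a) = \<gamma> n V (Ocomp (fx V) \<psi> \<theta>) a"
proof -
  define F where "F = (\<lambda>(V, \<theta>, a). \<gamma> n V (Ocomp (fx V) \<psi> \<theta>) a)"
  have "the_elem (F ` \<gamma> m V \<theta> a) = F (V, \<theta>, a)"
  proof (rule gfix_lift(2)[OF CGWH_\<Phi>[of n] _ _ _ _ V, where c = "pt (lvl \<Phi> n)"])
    fix V assume V: "V \<in> \<R>"
    have "continuous_map (k_prod (Os V m) (Fx V)) (ptop (lvl \<Phi> n)) (\<lambda>p. \<gamma> n V (Ocomp (fx V) \<psi> (fst p)) (snd p))"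
      using CGWH_Os[OF V] CGWH_Fx[OF V] \<psi>
      by (intro continuous_map_\<gamma>[OF V] continuous_map_Ocomp[OF ipsN[OF V] inner_product_space_Euc[of m] inner_product_space_Euc[of n]]
          CGWH_k_prod k_prod_fst k_prod_snd) (simp_all add: topspace_Osp' continuous_map_const)
    then show "continuous_map (k_prod (Os V m) (Fx V)) (ptop (lvl \<Phi> n)) (\<lambda>(\<theta>, a). F (V, \<theta>, a))"
      by (simp add: F_def case_prod_beta')
    show "F (V, b0, a) = pt (lvl \<Phi> n)" for a using \<gamma>_base[OF V] by (simp add: F_def)
    show "F (V, \<theta>, pt (ev A (fst V))) = pt (lvl \<Phi> n)" for \<theta> using \<gamma>_base(2)[OF V] by (simp add: F_def)
  next
    fix V V' \<phi> \<theta> a assume a: "V \<in> \<R>" "V' \<in> \<R>" "\<phi> \<in> Omor_fix G N V V'" "\<theta> \<in> Om V' m" "a \<in> FV V"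
    have "Ocomp (fx V) \<psi> (Ocomp (fx V) \<theta> (Ofix N V \<phi>)) = Ocomp (fx V) (Ocomp (fx V') \<psi> \<theta>) (Ofix N V \<phi>)"
      by (rule Ocomp_assoc[OF ipsN[OF a(1)] ipsN[OF a(2)] \<psi> a(4) Ofix_Omor[OF a(1-3)], symmetric])
    then show "F (V, Ocomp (fx V) \<theta> (Ofix N V \<phi>), a) = F (V', \<theta>, ev_map A (fst V) (fst V') \<phi> a)"
      using \<gamma>_rel[OF a(1-3) Ocomp_Om[OF a(2) \<psi> a(4)] a(5)] by (simp add: F_def)
  qed
  then show ?thesis by (simp add: gfix_def F_def)
qed

section \<open>The action of the quotient group\<close>

text \<open>The action on representatives by an element of G, before it is known to respect the
  coend relation and to depend only on the coset.\<close>

definition \<alpha> :: "nat \<Rightarrow> 'g \<Rightarrow> 'g rep \<Rightarrow> omor \<Rightarrow> 'a evpt set \<Rightarrow> ('g, 'a) gfixpt set" where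
  "\<alpha> m g V \<theta> a = \<gamma> m V (Ocomp (fx V) \<theta> (Rf V (inv\<^bsub>G\<^esub> g))) (ev_act A V g a)"

lemma Ocomp_Rf: "V \<in> \<R> \<Longrightarrow> g \<in> carrier G \<Longrightarrow> \<theta> \<in> Om V m \<Longrightarrow> Ocomp (fx V) \<theta> (Rf V g) \<in> Om V m"
  by (rule Ocomp_in_Omor[OF ipsN ipsN inner_product_space_Euc _ Rf_Omor])

lemma Ocomp_Rf_assoc: "V \<in> \<R> \<Longrightarrow> g \<in> carrier G \<Longrightarrow> h \<in> carrier G \<Longrightarrow> \<theta> \<in> Om V m \<Longrightarrow>
    Ocomp (fx V) (Ocomp (fx V) \<theta> (Rf V g)) (Rf V h) = Ocomp (fx V) \<theta> (Rf V (g \<otimes>\<^bsub>G\<^esub> h))"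
  using Ocomp_assoc[OF ipsN ipsN _ Rf_Omor Rf_Omor] by (simp add: Rf_mult)

lemma Ocomp_Rf_N: "V \<in> \<R> \<Longrightarrow> n \<in> N \<Longrightarrow> \<theta> \<in> Om V m \<Longrightarrow> Ocomp (fx V) \<theta> (Rf V n) = \<theta>"
  using Ocomp_id_right[OF ipsN] by (simp add: Rf_N)

lemma continuous_map_\<alpha>:
  assumes V: "V \<in> \<R>" and K: "CGWH K" and g: "continuous_map K T g" and \<theta>: "continuous_map K (Os V m) \<theta>" and a: "continuous_map K (Fx V) a"
  shows "continuous_map K (ptop (lvl \<Phi> m)) (\<lambda>k. \<alpha> m (g k) V (\<theta> k) (a k))"
  unfolding \<alpha>_def
proof (rule continuous_map_\<gamma>[OF V K])
  show "continuous_map K (Os V m) (\<lambda>k. Ocomp (fx V) (\<theta> k) (Rf V (inv\<^bsub>G\<^esub> (g k))))"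
    by (intro continuous_map_Ocomp[OF ipsN[OF V] ipsN[OF V] inner_product_space_Euc] \<theta> Rf_continuous[OF V] k_groupD(5)[OF kG] g)
  show "continuous_map K (Fx V) (\<lambda>k. ev_act A V (g k) (a k))"
  proof (rule continuous_map_into_ev_fix[OF V])
    show "continuous_map K (ptop (ev A (fst V))) (\<lambda>k. ev_act A V (g k) (a k))"
      by (rule continuous_map_ev_act[OF V K g continuous_map_from_ev_fix[OF a]])
    show "ev_act A V (g k) (a k) \<in> FV V" if "k \<in> topspace K" for k
      using continuous_map_point[OF g that] continuous_map_point[OF a that] ev_act_fix[OF V] topspace_T by simp
  qed
qed

text \<open>On fixed vectors, \<open>\<phi>\<close> after g^-1 is g^-1 after the conjugate g
  \<open>\<phi>\<close> g^-1. The conjugate is still N-fixed, so the coend relation for it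
  transforms one side into the other.\<close>

lemma \<alpha>_rel:
  assumes a: "V \<in> \<R>" "V' \<in> \<R>" "\<phi> \<in> Omor_fix G N V V'" "\<theta> \<in> Om V' m" "a \<in> FV V" and g: "g \<in> carrier G"
  shows "\<alpha> m g V (Ocomp (fx V) \<theta> (Ofix N V \<phi>)) a = \<alpha> m g V' \<theta> (ev_map A (fst V) (fst V') \<phi> a)"
proof -
  have gi: "inv\<^bsub>G\<^esub> g \<in> carrier G" using g by simp
  let ?\<phi>' = "Oconj G V V' g \<phi>"
  note v = ipsN[OF a(1)] and w = ipsN[OF a(2)]
  have \<phi>': "?\<phi>' \<in> Omor_fix G N V V'" by (rule Oconj_fix[OF a(1,2) g a(3)])
  note of = Ofix_Omor[OF a(1-3)] and of' = Ofix_Omor[OF a(1,2) \<phi>']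
  note R = Rf_Omor[OF a(1) g] Rf_Omor[OF a(1) gi] Rf_Omor[OF a(2) g] Rf_Omor[OF a(2) gi]
  let ?C = "Ocomp (fx V)"
  have "?C (Ofix N V \<phi>) (Rf V (inv\<^bsub>G\<^esub> g)) = ?C (Rf V' (inv\<^bsub>G\<^esub> g)) (Ofix N V ?\<phi>')"
  proof -
    have "Ofix N V \<phi> = ?C (Ocomp (fx V') (Rf V' (inv\<^bsub>G\<^esub> g)) (Rf V' g)) (Ofix N V \<phi>)"
      unfolding Rf_inv(1)[OF a(2) g] by (rule Ocomp_id_left[OF of, symmetric])
    also have "\<dots> = ?C (Rf V' (inv\<^bsub>G\<^esub> g)) (?C (Rf V' g) (Ofix N V \<phi>))" by (rule Ocomp_assoc[OF v w R(4,3) of])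
    also have "\<dots> = ?C (Rf V' (inv\<^bsub>G\<^esub> g)) (?C (Ofix N V ?\<phi>') (Rf V g))" unfolding Ofix_Oconj[OF a(1,2) g a(3)] ..
    finally have "?C (Ofix N V \<phi>) (Rf V (inv\<^bsub>G\<^esub> g)) = ?C (?C (Rf V' (inv\<^bsub>G\<^esub> g)) (?C (Ofix N V ?\<phi>') (Rf V g))) (Rf V (inv\<^bsub>G\<^esub> g))"
      by simp
    also have "\<dots> = ?C (Rf V' (inv\<^bsub>G\<^esub> g)) (?C (?C (Ofix N V ?\<phi>') (Rf V g)) (Rf V (inv\<^bsub>G\<^esub> g)))"
      by (rule Ocomp_assoc[OF v v R(4) Ocomp_in_Omor[OF v v w of' R(1)] R(2)])
    also have "?C (?C (Ofix N V ?\<phi>') (Rf V g)) (Rf V (inv\<^bsub>G\<^esub> g)) = Ofix N V ?\<phi>'"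
      unfolding Ocomp_assoc[OF v v of' R(1,2)] Rf_inv(2)[OF a(1) g] by (rule Ocomp_id_right[OF v of'])
    finally show ?thesis .
  qed
  then have "?C (?C \<theta> (Ofix N V \<phi>)) (Rf V (inv\<^bsub>G\<^esub> g)) = ?C (Ocomp (fx V') \<theta> (Rf V' (inv\<^bsub>G\<^esub> g))) (Ofix N V ?\<phi>')"
    using Ocomp_assoc[OF v v a(4) of R(2)] Ocomp_assoc[OF v w a(4) R(4) of'] by simp
  then have "\<alpha> m g V (?C \<theta> (Ofix N V \<phi>)) a = \<gamma> m V (?C (Ocomp (fx V') \<theta> (Rf V' (inv\<^bsub>G\<^esub> g))) (Ofix N V ?\<phi>')) (ev_act A V g a)"
    by (simp add: \<alpha>_def)
  also have "\<dots> = \<gamma> m V' (Ocomp (fx V') \<theta> (Rf V' (inv\<^bsub>G\<^esub> g))) (ev_map A (fst V) (fst V') ?\<phi>' (ev_act A V g a))"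
    by (rule \<gamma>_rel[OF a(1,2) \<phi>' Ocomp_Rf[OF a(2) gi a(4)] ev_act_fix[OF a(1) g a(5)]])
  also have "ev_map A (fst V) (fst V') ?\<phi>' (ev_act A V g a) = ev_act A V' g (ev_map A (fst V) (fst V') \<phi> a)"
    using ev_act_map[OF a(1,2) g Omor_fixD(1)[OF a(1-3)], of a] a(5) FV_iff by simp
  finally show ?thesis unfolding \<alpha>_def .
qed

text \<open>N acts trivially both on the fixed vectors of \<open>V\<close> and on the fixed points
  of the value at \<open>V\<close>.\<close>

lemma \<alpha>_coset:
  assumes V: "V \<in> \<R>" "\<theta> \<in> Om V m" "a \<in> FV V" and g: "g \<in> carrier G" and n: "n \<in> N"
  shows "\<alpha> m (n \<otimes>\<^bsub>G\<^esub> g) V \<theta> a = \<alpha> m g V \<theta> a"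
proof -
  have nG: "n \<in> carrier G" using NG[OF n] .
  have a: "a \<in> EV (fst V)" using V(3) FV_iff by blast
  have "Ocomp (fx V) \<theta> (Rf V (inv\<^bsub>G\<^esub> (n \<otimes>\<^bsub>G\<^esub> g))) = Ocomp (fx V) \<theta> (Rf V (inv\<^bsub>G\<^esub> g))"
    using Ocomp_Rf_assoc[OF V(1) _ _ V(2), of "inv\<^bsub>G\<^esub> g" "inv\<^bsub>G\<^esub> n"] Ocomp_Rf_N[OF V(1) Ninv[OF n] Ocomp_Rf[OF V(1) _ V(2), of "inv\<^bsub>G\<^esub> g"]] g nG
    by (simp add: G.inv_mult_group)
  moreover have "ev_act A V (n \<otimes>\<^bsub>G\<^esub> g) a = ev_act A V g a"
    using ev_act_mult[OF V(1) nG g a] ev_act_fix[OF V(1) g V(3)] n by (simp add: FV_iff)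
  ultimately show ?thesis by (simp add: \<alpha>_def)
qed

text \<open>The image defining the action is a singleton: constant along the coend class by
  \<open>gfix_lift\<close>, and along the coset by \<open>\<alpha>_coset\<close>.\<close>

lemma act_\<gamma>:
  assumes V: "V \<in> \<R>" "\<theta> \<in> Om V m" "a \<in> FV V" and g: "g \<in> carrier G"
  shows "act \<Phi> (cs g) m (\<gamma> m V \<theta> a) = \<alpha> m g V \<theta> a"
proof -
  define F where "F = (\<lambda>g (V, \<theta>, a). \<alpha> m g V \<theta> a)"
  have F: "F h p = \<alpha> m h V \<theta> a" if h: "h \<in> carrier G" and p: "p \<in> \<gamma> m V \<theta> a" for h p
  proof -
    have "F h p = F h (V, \<theta>, a)"
    proof (rule gfix_lift(1)[OF CGWH_\<Phi>[of m] _ _ _ _ V p, where c = "pt (lvl \<Phi> m)"])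
      fix V assume V: "V \<in> \<R>"
      have "continuous_map (k_prod (Os V m) (Fx V)) (ptop (lvl \<Phi> m)) (\<lambda>p. \<alpha> m h V (fst p) (snd p))"
        using CGWH_Os[OF V] CGWH_Fx[OF V] h by (intro continuous_map_\<alpha>[OF V] CGWH_k_prod k_prod_fst k_prod_snd) (simp_all add: topspace_T)
      then show "continuous_map (k_prod (Os V m) (Fx V)) (ptop (lvl \<Phi> m)) (\<lambda>(\<theta>, a). F h (V, \<theta>, a))"
        by (simp add: F_def case_prod_beta')
      show "F h (V, b0, a) = pt (lvl \<Phi> m)" for a using \<gamma>_base[OF V] by (simp add: F_def \<alpha>_def)
      show "F h (V, \<theta>, pt (ev A (fst V))) = pt (lvl \<Phi> m)" for \<theta>
        using \<gamma>_base(2)[OF V] ev_act_base[OF V h] by (simp add: F_def \<alpha>_def)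
    next
      fix V V' \<phi> \<theta> a assume a: "V \<in> \<R>" "V' \<in> \<R>" "\<phi> \<in> Omor_fix G N V V'" "\<theta> \<in> Om V' m" "a \<in> FV V"
      show "F h (V, Ocomp (fx V) \<theta> (Ofix N V \<phi>), a) = F h (V', \<theta>, ev_map A (fst V) (fst V') \<phi> a)"
        using \<alpha>_rel[OF a h] by (simp add: F_def)
    qed
    then show ?thesis by (simp add: F_def)
  qed
  have "(\<lambda>(g, p). F g p) ` (cs g \<times> \<gamma> m V \<theta> a) = {\<alpha> m g V \<theta> a}"
  proof (rule subset_antisym)
    show "(\<lambda>(g, p). F g p) ` (cs g \<times> \<gamma> m V \<theta> a) \<subseteq> {\<alpha> m g V \<theta> a}"
    proof (rule image_subsetI)
      fix x assume "x \<in> cs g \<times> \<gamma> m V \<theta> a"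
      then obtain h p where x: "x = (h, p)" and h: "h \<in> cs g" and p: "p \<in> \<gamma> m V \<theta> a" by blast
      then obtain n where n: "n \<in> N" "h = n \<otimes>\<^bsub>G\<^esub> g" by (auto simp: r_coset_def)
      then have "h \<in> carrier G" using NG g by simp
      then show "(case x of (g, p) \<Rightarrow> F g p) \<in> {\<alpha> m g V \<theta> a}" using F[OF _ p] \<alpha>_coset[OF V g n(1)] n(2) x by simp
    qed
    obtain p where p: "p \<in> \<gamma> m V \<theta> a" using \<gamma>_self[OF V] by blast
    then have "(g, p) \<in> cs g \<times> \<gamma> m V \<theta> a" using G.rcos_self[OF g subgroup_N] by simp
    then have "F g p \<in> (\<lambda>(g, p). F g p) ` (cs g \<times> \<gamma> m V \<theta> a)" by force
    then show "{\<alpha> m g V \<theta> a} \<subseteq> (\<lambda>(g, p). F g p) ` (cs g \<times> \<gamma> m V \<theta> a)" using F[OF g p] by simp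
  qed
  then have "the_elem ((\<lambda>(g, p). F g p) ` (cs g \<times> \<gamma> m V \<theta> a)) = \<alpha> m g V \<theta> a" by simp
  moreover have "(\<lambda>(g, p). F g p) = (\<lambda>(g, V, \<theta>, a). \<gamma> m V (Ocomp (fx V) \<theta> (Rf V (inv\<^bsub>G\<^esub> g))) (ev_act A V g a))"
    by (auto simp: F_def \<alpha>_def fun_eq_iff)
  ultimately show ?thesis by (simp add: gfix_def)
qed

lemma spectrum_\<Phi>: "orthogonal_spectrum J TJ \<Phi>"
  unfolding orthogonal_spectrum_def
proof (intro conjI allI ballI)
  fix m n
  let ?O = "ptop (Osp (Euc m) (Euc n))"
  have O: "CGWH ?O" by (simp add: CGWH_Osp)
  show "based_CGWH (lvl \<Phi> m)" by (rule based_\<Phi>)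
  show "continuous_map (k_prod ?O (ptop (lvl \<Phi> m))) (ptop (lvl \<Phi> n)) (\<lambda>(\<phi>, a). str \<Phi> m n \<phi> a)"
  proof (rule continuous_map_\<Phi>_param[OF O])
    fix V assume V: "V \<in> \<R>"
    have "continuous_map (k_prod ?O (k_prod (Os V m) (Fx V))) (ptop (lvl \<Phi> n)) (\<lambda>p. \<gamma> n V (Ocomp (fx V) (fst p) (fst (snd p))) (snd (snd p)))"
      using CGWH_Os[OF V] CGWH_Fx[OF V] O
      by (intro continuous_map_\<gamma>[OF V] continuous_map_Ocomp[OF ipsN[OF V] inner_product_space_Euc[of m] inner_product_space_Euc[of n]]
          CGWH_k_prod k_prod_fst continuous_map_comp[OF k_prod_fst k_prod_snd] continuous_map_comp[OF k_prod_snd k_prod_snd])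
    then show "continuous_map (k_prod ?O (k_prod (Os V m) (Fx V))) (ptop (lvl \<Phi> n)) (\<lambda>(s, (\<theta>, a)). str \<Phi> m n s (\<gamma> m V \<theta> a))"
      by (rule continuous_map_eq) (auto simp: str_\<gamma> V topspace_Os topspace_Osp')
  qed
  \<comment> \<open>Joint continuity is shown for elements of G and then descends along the quotient
    map to G/N.\<close>
  have "continuous_map (k_prod T (ptop (lvl \<Phi> m))) (ptop (lvl \<Phi> m)) (\<lambda>(g, z). act \<Phi> (cs g) m z)"
  proof (rule continuous_map_\<Phi>_param[OF CGWH_T])
    fix V assume V: "V \<in> \<R>"
    have "continuous_map (k_prod T (k_prod (Os V m) (Fx V))) (ptop (lvl \<Phi> m)) (\<lambda>p. \<alpha> m (fst p) V (fst (snd p)) (snd (snd p)))"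
      using CGWH_Os[OF V] CGWH_Fx[OF V] CGWH_T
      by (intro continuous_map_\<alpha>[OF V] CGWH_k_prod k_prod_fst continuous_map_comp[OF k_prod_fst k_prod_snd] continuous_map_comp[OF k_prod_snd k_prod_snd])
    then show "continuous_map (k_prod T (k_prod (Os V m) (Fx V))) (ptop (lvl \<Phi> m)) (\<lambda>(s, (\<theta>, a)). act \<Phi> (cs s) m (\<gamma> m V \<theta> a))"
      by (rule continuous_map_eq) (auto simp: act_\<gamma> V topspace_Os topspace_T)
  qed
  then show "continuous_map (k_prod TJ (ptop (lvl \<Phi> m))) (ptop (lvl \<Phi> m)) (\<lambda>(g, a). act \<Phi> g m a)"
    by (rule continuous_map_quotient_param1[OF CGWH_T CGWH_\<Phi> CGWH_TJ quotient_cs])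
next
  fix m n a assume "a \<in> lvl_set \<Phi> m"
  then show "str \<Phi> m n (None, None) a = pt (lvl \<Phi> n)"
    by (elim \<gamma>_surj) (simp add: str_\<gamma> \<gamma>_base del: lvl_\<Phi>)
next
  fix m n \<phi> assume \<phi>: "\<phi> \<in> Omor (Euc m) (Euc n)"
  note Z = zero_rep_reps
  show "str \<Phi> m n \<phi> (pt (lvl \<Phi> m)) = pt (lvl \<Phi> n)"
    using str_\<gamma>[OF \<phi> Z Omor_None pt_FV[OF Z]] \<gamma>_base(1)[OF Z] by (simp del: lvl_\<Phi>)
next
  fix m a assume "a \<in> lvl_set \<Phi> m"
  then show "str \<Phi> m m (Oid (Euc m)) a = a"
    by (elim \<gamma>_surj) (simp add: str_\<gamma> Oid_in_Omor Ocomp_id_left)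
next
  fix l m n \<psi> \<phi> a assume a: "\<psi> \<in> Omor (Euc l) (Euc m)" "\<phi> \<in> Omor (Euc m) (Euc n)" "a \<in> lvl_set \<Phi> l"
  then obtain V \<theta> c where V: "V \<in> \<R>" "\<theta> \<in> Om V l" "c \<in> FV V" "a = \<gamma> l V \<theta> c" by (elim \<gamma>_surj)
  have "Ocomp (Euc l) \<phi> \<psi> \<in> Omor (Euc l) (Euc n)" using a by (intro Ocomp_in_Omor) auto
  then show "str \<Phi> l n (Ocomp (Euc l) \<phi> \<psi>) a = str \<Phi> m n \<phi> (str \<Phi> l m \<psi> a)"
    using a V Ocomp_assoc[OF ipsN[OF V(1)] inner_product_space_Euc a(2,1) V(2)] by (simp add: str_\<gamma> Ocomp_Om)
next
  fix m a assume "a \<in> lvl_set \<Phi> m"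
  then obtain V \<theta> c where V: "V \<in> \<R>" "\<theta> \<in> Om V m" "c \<in> FV V" "a = \<gamma> m V \<theta> c" by (elim \<gamma>_surj)
  have "c \<in> EV (fst V)" using V(3) FV_iff by blast
  then show "act \<Phi> \<one>\<^bsub>J\<^esub> m a = a"
    unfolding one_J using V Ocomp_Rf_N[OF V(1) N1 V(2)] ev_act_one[OF V(1)] by (simp add: act_\<gamma> \<alpha>_def)
next
  fix m g h a assume gh: "g \<in> carrier J" "h \<in> carrier J" and "a \<in> lvl_set \<Phi> m"
  then obtain V \<theta> c where V: "V \<in> \<R>" "\<theta> \<in> Om V m" "c \<in> FV V" "a = \<gamma> m V \<theta> c" by (elim \<gamma>_surj)
  have c: "c \<in> EV (fst V)" using V(3) FV_iff by blast
  obtain g' h' where g: "g' \<in> carrier G" "g = cs g'" and h: "h' \<in> carrier G" "h = cs h'"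
    using gh by (auto simp: carrier_J)
  have hi: "inv\<^bsub>G\<^esub> h' \<in> carrier G" and gi: "inv\<^bsub>G\<^esub> g' \<in> carrier G" using g h by simp_all
  have "act \<Phi> g m (act \<Phi> h m a) = \<alpha> m g' V (Ocomp (fx V) \<theta> (Rf V (inv\<^bsub>G\<^esub> h'))) (ev_act A V h' c)"
    using act_\<gamma>[OF V(1) Ocomp_Rf[OF V(1) hi V(2)] ev_act_fix[OF V(1) h(1) V(3)] g(1)] act_\<gamma>[OF V(1-3) h(1)]
    by (simp add: g h V(4) \<alpha>_def)
  also have "\<dots> = \<alpha> m (g' \<otimes>\<^bsub>G\<^esub> h') V \<theta> c"
    using Ocomp_Rf_assoc[OF V(1) hi gi V(2)] ev_act_mult[OF V(1) g(1) h(1) c] g h by (simp add: \<alpha>_def G.inv_mult_group)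
  finally show "act \<Phi> (g \<otimes>\<^bsub>J\<^esub> h) m a = act \<Phi> g m (act \<Phi> h m a)"
    using V g h by (simp add: set_mult_cs act_\<gamma>)
next
  fix m g assume "g \<in> carrier J"
  then obtain g' where g: "g' \<in> carrier G" "g = cs g'" by (auto simp: carrier_J)
  note Z = zero_rep_reps
  show "act \<Phi> g m (pt (lvl \<Phi> m)) = pt (lvl \<Phi> m)"
    using act_\<gamma>[OF Z Omor_None pt_FV[OF Z] g(1), of m] \<gamma>_base(1)[OF Z] by (simp add: g(2) \<alpha>_def del: lvl_\<Phi>)
next
  fix m n g \<phi> a assume gh: "g \<in> carrier J" "\<phi> \<in> Omor (Euc m) (Euc n)" and "a \<in> lvl_set \<Phi> m"
  then obtain V \<theta> c where V: "V \<in> \<R>" "\<theta> \<in> Om V m" "c \<in> FV V" "a = \<gamma> m V \<theta> c" by (elim \<gamma>_surj)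
  obtain g' where g: "g' \<in> carrier G" "g = cs g'" using gh by (auto simp: carrier_J)
  have gi: "inv\<^bsub>G\<^esub> g' \<in> carrier G" using g by simp
  show "act \<Phi> g n (str \<Phi> m n \<phi> a) = str \<Phi> m n \<phi> (act \<Phi> g m a)"
    using Ocomp_assoc[OF ipsN[OF V(1)] ipsN[OF V(1)] gh(2) V(2) Rf_Omor[OF V(1) gi]]
      str_\<gamma>[OF gh(2) V(1) Ocomp_Rf[OF V(1) gi V(2)] ev_act_fix[OF V(1) g(1) V(3)]]
      act_\<gamma>[OF V(1) Ocomp_Om[OF V(1) gh(2) V(2)] V(3) g(1)] str_\<gamma>[OF gh(2) V(1-3)] act_\<gamma>[OF V(1-3) g(1)]
    by (simp add: V(4) g(2) \<alpha>_def)
qed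

end

section \<open>Orthogonal sums and amalgamation of representations\<close>

text \<open>Orthogonal sums are formed by placing the summands on the even and the odd coordinates.\<close>

definition e0 :: "vect \<Rightarrow> vect" where
  "e0 v = Abs_poly_mapping (\<lambda>i. if even i then Poly_Mapping.lookup v (i div 2) else 0)"

definition e1 :: "vect \<Rightarrow> vect" where
  "e1 v = Abs_poly_mapping (\<lambda>i. if odd i then Poly_Mapping.lookup v (i div 2) else 0)"

definition p0 :: "vect \<Rightarrow> vect" where
  "p0 v = Abs_poly_mapping (\<lambda>i. Poly_Mapping.lookup v (2 * i))"

definition p1 :: "vect \<Rightarrow> vect" where
  "p1 v = Abs_poly_mapping (\<lambda>i. Poly_Mapping.lookup v (Suc (2 * i)))"

lemma lookup_e0 [simp]: "Poly_Mapping.lookup (e0 v) i = (if even i then Poly_Mapping.lookup v (i div 2) else 0)"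
proof -
  have "{i. (if even i then Poly_Mapping.lookup v (i div 2) else 0) \<noteq> 0} \<subseteq> (*) 2 ` Poly_Mapping.keys v"
    by (auto simp: in_keys_iff image_iff split: if_splits)
  then have "finite {i. (if even i then Poly_Mapping.lookup v (i div 2) else 0) \<noteq> 0}" by (rule finite_subset) simp
  then show ?thesis by (simp add: e0_def)
qed

lemma lookup_e1 [simp]: "Poly_Mapping.lookup (e1 v) i = (if odd i then Poly_Mapping.lookup v (i div 2) else 0)"
proof -
  have "{i. (if odd i then Poly_Mapping.lookup v (i div 2) else 0) \<noteq> 0} \<subseteq> (\<lambda>i. Suc (2 * i)) ` Poly_Mapping.keys v"
    by (auto simp: in_keys_iff image_iff elim!: oddE split: if_splits)
  then have "finite {i. (if odd i then Poly_Mapping.lookup v (i div 2) else 0) \<noteq> 0}" by (rule finite_subset) simp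
  then show ?thesis by (simp add: e1_def)
qed

lemma lookup_p0 [simp]: "Poly_Mapping.lookup (p0 v) i = Poly_Mapping.lookup v (2 * i)"
proof -
  have "finite {i. Poly_Mapping.lookup v (2 * i) \<noteq> 0}"
    using finite_vimageI[of "Poly_Mapping.keys v" "(*) 2"] by (simp add: inj_on_def vimage_def in_keys_iff)
  then show ?thesis by (simp add: p0_def)
qed

lemma lookup_p1 [simp]: "Poly_Mapping.lookup (p1 v) i = Poly_Mapping.lookup v (Suc (2 * i))"
proof -
  have "finite {i. Poly_Mapping.lookup v (Suc (2 * i)) \<noteq> 0}"
    using finite_vimageI[of "Poly_Mapping.keys v" "\<lambda>i. Suc (2 * i)"] by (simp add: inj_on_def vimage_def in_keys_iff)
  then show ?thesis by (simp add: p1_def)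
qed

lemma sum_proj [simp]: "p0 (e0 v) = v" "p1 (e0 v) = 0" "p0 (e1 v) = 0" "p1 (e1 v) = v"
  "p0 (x + y) = p0 x + p0 y" "p1 (x + y) = p1 x + p1 y" "p0 (c *\<^sub>R x) = c *\<^sub>R p0 x" "p1 (c *\<^sub>R x) = c *\<^sub>R p1 x"
  "p0 0 = 0" "p1 0 = 0" "e0 0 = 0" "e1 0 = 0"
  by (rule poly_mapping_eqI; simp add: lookup_add)+

lemma sum_inj: "e0 (x + y) = e0 x + e0 y" "e1 (x + y) = e1 x + e1 y" "e0 (c *\<^sub>R x) = c *\<^sub>R e0 x" "e1 (c *\<^sub>R x) = c *\<^sub>R e1 x"
  by (rule poly_mapping_eqI; simp add: lookup_add)+

lemma sum_decomp: "e0 (p0 x) + e1 (p1 x) = x"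
  by (rule poly_mapping_eqI) (auto simp: lookup_add elim!: evenE oddE)

lemma sum_ext: "p0 x = p0 y \<Longrightarrow> p1 x = p1 y \<Longrightarrow> x = y"
  by (metis sum_decomp)

lemma ip_sum: "ip x y = ip (p0 x) (p0 y) + ip (p1 x) (p1 y)"
proof -
  let ?l = Poly_Mapping.lookup
  obtain n where n: "\<And>i. i \<in> Poly_Mapping.keys x \<Longrightarrow> i < 2 * n"
  proof -
    have "finite (Poly_Mapping.keys x)" by simp
    then obtain m where "\<forall>i\<in>Poly_Mapping.keys x. i < m" using finite_nat_set_iff_bounded by blast
    then show ?thesis using that[of m] by force
  qed
  have k0: "Poly_Mapping.keys (p0 x) \<subseteq> {..<n}" and k1: "Poly_Mapping.keys (p1 x) \<subseteq> {..<n}"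
    using n by (force simp: in_keys_iff)+
  have "ip x y = (\<Sum>i<2 * n. ?l x i * ?l y i)" using n by (intro ip_superset) auto
  also have "\<dots> = (\<Sum>i<n. ?l x (2 * i) * ?l y (2 * i)) + (\<Sum>i<n. ?l x (Suc (2 * i)) * ?l y (Suc (2 * i)))"
    by (induction n) (simp_all add: algebra_simps)
  also have "\<dots> = ip (p0 x) (p0 y) + ip (p1 x) (p1 y)"
    using ip_superset[OF _ k0, of "p0 y"] ip_superset[OF _ k1, of "p1 y"] by simp
  finally show ?thesis .
qed

lemma ip_ext:
  assumes U: "inner_product_space U" and "x \<in> U" "y \<in> U" "\<And>w. w \<in> U \<Longrightarrow> ip x w = ip y w"
  shows "x = y"
proof -
  have "ip (x - y) (x - y) = 0" using assms inner_product_space_props(4)[OF U assms(2,3)] by (simp add: ip_diff_left)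
  then show ?thesis by simp
qed

text \<open>\<open>s\<close> is the adjoint of \<open>f\<close>, written with an orthonormal basis
  of \<open>U\<close>; the formula makes sense for every vector v.\<close>

lemma isos_adjoint:
  assumes U: "inner_product_space U" and V: "inner_product_space V" and f: "f \<in> isos U V"
  obtains s where "\<And>v. s v \<in> U" "\<And>v w. w \<in> U \<Longrightarrow> ip (s v) w = ip v (f w)"
proof -
  let ?s = "\<lambda>v. \<Sum>i<dim U. ip v (f (orthonormal_basis U i)) *\<^sub>R orthonormal_basis U i"
  have 1: "?s v \<in> U" for v
    using orthonormal_basis(1)[OF U] by (intro inner_product_space_props(6)[OF U] inner_product_space_props(3)[OF U]) auto
  have 2: "ip (?s v) w = ip v (f w)" if w: "w \<in> U" for v w
  proof -
    have "f w = f (\<Sum>i<dim U. ip w (orthonormal_basis U i) *\<^sub>R orthonormal_basis U i)" using orthonormal_basis(3)[OF U w] by simp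
    also have "\<dots> = (\<Sum>i<dim U. ip w (orthonormal_basis U i) *\<^sub>R f (orthonormal_basis U i))" using orthonormal_basis(1)[OF U] by (intro isos_sum[OF U f]) auto
    finally have "ip v (f w) = (\<Sum>i<dim U. ip w (orthonormal_basis U i) * ip v (f (orthonormal_basis U i)))" by (simp add: ip_sum_right ip_scaleR_right)
    then show ?thesis by (simp add: ip_sum_left ip_scaleR_left ip_commute[of w] mult.commute)
  qed
  show ?thesis by (rule that[of ?s, OF 1 2])
qed

section \<open>Amalgamation of representations over a common N-representation\<close>

context rep_group
begin

abbreviation "GN \<equiv> G\<lparr>carrier := N\<rparr>"
abbreviation "TN \<equiv> subtopology T N"

definition equivar :: "'g rep \<Rightarrow> 'g rep \<Rightarrow> (vect \<Rightarrow> vect) \<Rightarrow> bool" where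
  "equivar V W f \<longleftrightarrow> f \<in> isos (fst V) (fst W) \<and> (\<forall>n\<in>N. \<forall>v\<in>fst V. f (snd V n v) = snd W n (f v))"

text \<open>Finality is applied to the \<open>N\<close>-representation \<open>V' \<oplus> (V - f(W))\<close>, which has the same fixed
  points as \<open>V'\<close> because \<open>f\<close> maps onto the fixed points of \<open>V\<close>.\<close>

lemma amalgamation:
  assumes fin: "orthogonally_final G T N"
    and V: "V \<in> \<R>" and V': "V' \<in> \<R>" and W: "W \<in> reps GN TN"
    and f: "equivar W V f" and ff: "f ` fx W = fx V" and j: "equivar W V' j"
    and x: "x \<in> fx V'" "\<And>w. w \<in> fst W \<Longrightarrow> ip (j w) x = 0"
  obtains V'' h \<psi> where "V'' \<in> \<R>" "equivar V' V'' h" "equivar V V'' \<psi>" "h ` fx V' = fx V''"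
    "\<And>w. w \<in> fst W \<Longrightarrow> \<psi> (f w) = h (j w)" "\<And>v. v \<in> fst V \<Longrightarrow> ip (\<psi> v) (h x) = 0"
proof -
  let ?U = "fst W"
  have U: "inner_product_space ?U" using repsD(1)[OF W] .
  have fi: "f \<in> isos ?U (fst V)" and ji: "j \<in> isos ?U (fst V')"
    and feq: "\<And>n w. n \<in> N \<Longrightarrow> w \<in> ?U \<Longrightarrow> f (snd W n w) = snd V n (f w)"
    and jeq: "\<And>n w. n \<in> N \<Longrightarrow> w \<in> ?U \<Longrightarrow> j (snd W n w) = snd V' n (j w)"
    using f j by (auto simp: equivar_def)
  note PV = inner_product_space_props[OF ips[OF V]] and PV' = inner_product_space_props[OF ips[OF V']]
    and PU = inner_product_space_props[OF U]
  note iV = repsD(2)[OF V NG] and iV' = repsD(2)[OF V' NG]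
  \<comment> \<open>With \<open>s\<close> the adjoint of \<open>f\<close>, the vector f(s v) is the
    orthogonal projection of v to f(W).\<close>
  obtain s where s: "\<And>v. s v \<in> ?U" "\<And>v w. w \<in> ?U \<Longrightarrow> ip (s v) w = ip v (f w)"
    using isos_adjoint[OF U ips[OF V] fi] by blast
  have s_add: "s (v + w) = s v + s w" for v w
    by (rule ip_ext[OF U]) (auto simp: s PU ip_add_left)
  have s_scale: "s (c *\<^sub>R v) = c *\<^sub>R s v" for c v
    by (rule ip_ext[OF U]) (auto simp: s PU ip_scaleR_left)
  have s_f: "s (f w) = w" if "w \<in> ?U" for w
    by (rule ip_ext[OF U]) (use that in \<open>auto simp: s isosD(4)[OF fi]\<close>)
  have nW: "snd W n w \<in> ?U" if "n \<in> N" "w \<in> ?U" for n w using repsD(5)[OF W] that by simp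
  have inv_ip: "ip (snd V n v) w = ip v (snd V (inv\<^bsub>G\<^esub> n) w)" if "n \<in> N" "v \<in> fst V" "w \<in> fst V" for n v w
  proof -
    have "snd V n (snd V (inv\<^bsub>G\<^esub> n) w) = w"
      using repsD(6)[OF V NG[OF that(1)] NG[OF Ninv[OF that(1)]] that(3)] NG[OF that(1)] repsD(7)[OF V that(3)] by simp
    then show ?thesis
      using isosD(4)[OF iV[OF that(1)] that(2) repsD(5)[OF V NG[OF Ninv[OF that(1)]] that(3)]] by simp
  qed
  have fU: "f w \<in> fst V" if "w \<in> ?U" for w using isosD(1)[OF fi that] .
  \<comment> \<open>N acts by isometries, so the adjoint of n is its inverse and equivariance passes
    from \<open>f\<close> to \<open>s\<close>.\<close>
  have s_eq: "s (snd V n v) = snd W n (s v)" if n: "n \<in> N" and v: "v \<in> fst V" for n v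
  proof (rule ip_ext[OF U])
    fix w assume w: "w \<in> ?U"
    have wi: "snd W (inv\<^bsub>G\<^esub> n) w \<in> ?U" using nW[OF Ninv[OF n] w] .
    have "snd W n (snd W (inv\<^bsub>G\<^esub> n) w) = w"
      using repsD(6)[OF W _ _ w, of n "inv\<^bsub>G\<^esub> n"] n Ninv[OF n] NG[OF n] repsD(7)[OF W w] by simp
    then have "ip (snd W n (s v)) w = ip (s v) (snd W (inv\<^bsub>G\<^esub> n) w)"
      using isosD(4)[OF repsD(2)[OF W] s(1)[of v] wi, of n] n by simp
    also have "\<dots> = ip v (f (snd W (inv\<^bsub>G\<^esub> n) w))" by (rule s(2)[OF wi])
    also have "\<dots> = ip v (snd V (inv\<^bsub>G\<^esub> n) (f w))" using feq[OF Ninv[OF n] w] by simp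
    also have "\<dots> = ip (snd V n v) (f w)" using inv_ip[OF n v fU[OF w]] by simp
    finally show "ip (s (snd V n v)) w = ip (snd W n (s v)) w" using s(2)[OF w] by simp
  qed (use s nW n in auto)
  \<comment> \<open>The component of v orthogonal to f(W).\<close>
  define r where "r v = v - f (s v)" for v
  have rV: "r v \<in> fst V" if "v \<in> fst V" for v using that PV fU s by (auto simp: r_def)
  have rf: "ip (r v) (f w) = 0" if "w \<in> ?U" for v w
    using isosD(4)[OF fi s(1) that] s(2)[OF that] by (simp add: r_def ip_diff_left)
  \<comment> \<open>Even coordinates carry V', odd coordinates the orthogonal complement of f(W) in
    \<open>V\<close>.\<close>
  define Z where "Z = {z. p0 z \<in> fst V' \<and> p1 z \<in> fst V \<and> (\<forall>w\<in>?U. ip (p1 z) (f w) = 0)}"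
  obtain B B' where B: "finite B" "fst V = span B" "finite B'" "fst V' = span B'"
    using ips[OF V] ips[OF V'] by (auto simp: inner_product_space_def)
  let ?S = "span (e0 ` B' \<union> e1 ` B)"
  have Z: "inner_product_space Z"
  proof (rule ips_subspace[of ?S])
    show "inner_product_space ?S" using B by (auto simp: inner_product_space_def intro!: exI[of _ "e0 ` B' \<union> e1 ` B"])
    show "subspace Z" using PV PV' by (auto simp: Z_def subspace_def ip_add_left ip_scaleR_left)
    have "e0 v \<in> ?S" if "v \<in> span B'" for v
    proof -
      have "subspace {v. e0 v \<in> ?S}" by (auto simp: subspace_def sum_inj span_add span_scale span_zero)
      moreover have "B' \<subseteq> {v. e0 v \<in> ?S}" by (auto intro: span_base)
      ultimately show ?thesis using that span_minimal by blast
    qed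
    moreover have "e1 v \<in> ?S" if "v \<in> span B" for v
    proof -
      have "subspace {v. e1 v \<in> ?S}" by (auto simp: subspace_def sum_inj span_add span_scale span_zero)
      moreover have "B \<subseteq> {v. e1 v \<in> ?S}" by (auto intro: span_base)
      ultimately show ?thesis using that span_minimal by blast
    qed
    ultimately have "e0 (p0 z) + e1 (p1 z) \<in> ?S" if "z \<in> Z" for z
      using that B(2,4) by (intro span_add) (auto simp: Z_def)
    then show "Z \<subseteq> ?S" unfolding sum_decomp by blast
  qed
  note PZ = inner_product_space_props[OF Z]
  define \<sigma> where "\<sigma> = (\<lambda>n\<in>N. \<lambda>z\<in>Z. e0 (snd V' n (p0 z)) + e1 (snd V n (p1 z)))"
  have p\<sigma>: "p0 (\<sigma> n z) = snd V' n (p0 z)" "p1 (\<sigma> n z) = snd V n (p1 z)" if "n \<in> N" "z \<in> Z" for n z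
    using that by (simp_all add: \<sigma>_def)
  have zV: "p0 z \<in> fst V'" "p1 z \<in> fst V" if "z \<in> Z" for z using that by (auto simp: Z_def)
  have \<sigma>Z: "\<sigma> n z \<in> Z" if n: "n \<in> N" and z: "z \<in> Z" for n z
  proof -
    have "ip (snd V n (p1 z)) (f w) = 0" if w: "w \<in> ?U" for w
    proof -
      have "ip (snd V n (p1 z)) (f w) = ip (p1 z) (f (snd W (inv\<^bsub>G\<^esub> n) w))"
        using inv_ip[OF n zV(2)[OF z] fU[OF w]] feq[OF Ninv[OF n] w] by simp
      then show ?thesis using z nW[OF Ninv[OF n] w] by (simp add: Z_def)
    qed
    then show ?thesis
      using p\<sigma>[OF n z] repsD(5)[OF V' NG[OF n] zV(1)[OF z]] repsD(5)[OF V NG[OF n] zV(2)[OF z]] by (simp add: Z_def)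
  qed
  have ZR: "(Z, \<sigma>) \<in> reps GN TN"
  proof (rule repsI)
    show "inner_product_space Z" by (rule Z)
    show "\<sigma> \<in> extensional (carrier GN)" by (simp add: \<sigma>_def)
    show "\<sigma> n \<in> isos Z Z" if "n \<in> carrier GN" for n
    proof (rule isosI)
      have n: "n \<in> N" using that by simp
      show "\<sigma> n \<in> extensional Z" using n by (simp add: \<sigma>_def)
      show "\<sigma> n z \<in> Z" if "z \<in> Z" for z using \<sigma>Z[OF n that] .
      show "\<sigma> n (y + z) = \<sigma> n y + \<sigma> n z" if "y \<in> Z" "z \<in> Z" for y z
        using that n PZ(2)[OF that] isosD(2)[OF iV[OF n] zV(2)[OF that(1)] zV(2)[OF that(2)]]
           isosD(2)[OF iV'[OF n] zV(1)[OF that(1)] zV(1)[OF that(2)]]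
        by - (rule sum_ext, simp_all add: p\<sigma>)
      show "\<sigma> n (c *\<^sub>R z) = c *\<^sub>R \<sigma> n z" if "z \<in> Z" for c z
        using that n PZ(3)[OF that] isosD(3)[OF iV[OF n] zV(2)[OF that]] isosD(3)[OF iV'[OF n] zV(1)[OF that]]
        by - (rule sum_ext, simp_all add: p\<sigma>)
      show "ip (\<sigma> n y) (\<sigma> n z) = ip y z" if "y \<in> Z" "z \<in> Z" for y z
        using that n isosD(4)[OF iV[OF n] zV(2)[OF that(1)] zV(2)[OF that(2)]]
           isosD(4)[OF iV'[OF n] zV(1)[OF that(1)] zV(1)[OF that(2)]]
        by (simp add: ip_sum[of "\<sigma> n y"] ip_sum[of y] p\<sigma>)
    qed
    show "\<sigma> \<one>\<^bsub>GN\<^esub> z = z" if "z \<in> Z" for z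
      using that N1 repsD(7)[OF V zV(2)[OF that]] repsD(7)[OF V' zV(1)[OF that]] by - (rule sum_ext, simp_all add: p\<sigma>)
    show "\<one>\<^bsub>GN\<^esub> \<in> carrier GN" using N1 by simp
    show "m \<otimes>\<^bsub>GN\<^esub> n \<in> carrier GN" if "m \<in> carrier GN" "n \<in> carrier GN" for m n
      using that subgroup.m_closed[OF subgroup_N] by simp
    show "\<sigma> (m \<otimes>\<^bsub>GN\<^esub> n) z = \<sigma> m (\<sigma> n z)" if "m \<in> carrier GN" "n \<in> carrier GN" "z \<in> Z" for m n z
      using that NG subgroup.m_closed[OF subgroup_N] repsD(6)[OF V _ _ zV(2)[OF that(3)], of m n] repsD(6)[OF V' _ _ zV(1)[OF that(3)], of m n]
      by - (rule sum_ext, simp_all add: p\<sigma> \<sigma>Z)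
    let ?P = "prod_topology TN (top_of_set Z)"
    have tN: "topspace TN = N" using NG' topspace_T by auto
    have pc: "continuous_map (top_of_set Z) (top_of_set (fst V')) p0" "continuous_map (top_of_set Z) (top_of_set (fst V)) p1"
    proof -
      have "continuous_map (top_of_set Z) euclideanreal (\<lambda>z. ip (p0 z) v)" for v
        using continuous_map_ip[OF continuous_map_id[of "top_of_set Z"], of "e0 v"] ip_sum[of _ "e0 v"] by simp
      then show "continuous_map (top_of_set Z) (top_of_set (fst V')) p0"
        using zV by (intro continuous_map_into_ips[OF ips[OF V']]) auto
      have "continuous_map (top_of_set Z) euclideanreal (\<lambda>z. ip (p1 z) v)" for v
        using continuous_map_ip[OF continuous_map_id[of "top_of_set Z"], of "e1 v"] ip_sum[of _ "e1 v"] by simp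
      then show "continuous_map (top_of_set Z) (top_of_set (fst V)) p1"
        using zV by (intro continuous_map_into_ips[OF ips[OF V]]) auto
    qed
    have gN: "continuous_map ?P T fst" using continuous_map_fst[of TN "top_of_set Z"] by (simp add: continuous_map_in_subtopology)
    have c1: "continuous_map ?P (top_of_set (fst V)) (\<lambda>p. snd V (fst p) (p1 (snd p)))"
      by (rule continuous_map_apply[OF ips[OF V] ips[OF V] reps_continuous[OF V topspace_T gN] continuous_map_comp[OF pc(2) continuous_map_snd]])
    have c2: "continuous_map ?P (top_of_set (fst V')) (\<lambda>p. snd V' (fst p) (p0 (snd p)))"
      by (rule continuous_map_apply[OF ips[OF V'] ips[OF V'] reps_continuous[OF V' topspace_T gN] continuous_map_comp[OF pc(1) continuous_map_snd]])
    show "continuous_map ?P (top_of_set Z) (\<lambda>(n, z). \<sigma> n z)"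
    proof (rule continuous_map_into_ips[OF Z])
      show "(case p of (n, z) \<Rightarrow> \<sigma> n z) \<in> Z" if "p \<in> topspace ?P" for p using that \<sigma>Z tN by auto
      fix v
      have "continuous_map ?P euclideanreal (\<lambda>p. ip (snd V' (fst p) (p0 (snd p))) (p0 v) + ip (snd V (fst p) (p1 (snd p))) (p1 v))"
        by (intro continuous_map_add continuous_map_ip[OF c1] continuous_map_ip[OF c2])
      then show "continuous_map ?P euclideanreal (\<lambda>p. ip (case p of (n, z) \<Rightarrow> \<sigma> n z) v)"
        by (rule continuous_map_eq) (use tN p\<sigma> in \<open>auto simp: ip_sum[of "\<sigma> _ _"]\<close>)
    qed
  qed
  \<comment> \<open>Finality embeds \<open>Z\<close> into a G-representation without new fixed
    vectors; \<open>h\<close> and \<open>\<psi>\<close> are composites with this embedding.\<close>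
  then obtain V'' f'' where V'': "V'' \<in> \<R>" and f'': "f'' \<in> isos Z (fst V'')"
      "\<And>n z. n \<in> N \<Longrightarrow> z \<in> Z \<Longrightarrow> f'' (\<sigma> n z) = snd (res_rep N V'') n (f'' z)"
      "bij_betw f'' (fx (Z, \<sigma>)) (fx (res_rep N V''))"
    using fin unfolding orthogonally_final_def by fastforce
  have f''eq: "f'' (\<sigma> n z) = snd V'' n (f'' z)" if "n \<in> N" "z \<in> Z" for n z using f''(2)[OF that] that by simp
  have f''b: "f'' ` fx (Z, \<sigma>) = fx V''" using f''(3) by (simp add: bij_betw_def)
  have e0Z: "e0 v \<in> Z" if "v \<in> fst V'" for v using that PV by (simp add: Z_def)
  have fixZ: "fx (Z, \<sigma>) = e0 ` fx V'"
  proof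
    show "fx (Z, \<sigma>) \<subseteq> e0 ` fx V'"
    proof
      fix z assume "z \<in> fx (Z, \<sigma>)"
      then have z: "z \<in> Z" "\<And>n. n \<in> N \<Longrightarrow> \<sigma> n z = z" by (auto simp: rep_fix_def)
      have "snd V' n (p0 z) = p0 z" "snd V n (p1 z) = p1 z" if "n \<in> N" for n
        using p\<sigma>[OF that z(1)] z(2)[OF that] by simp_all
      then have "p0 z \<in> fx V'" "p1 z \<in> fx V" using zV[OF z(1)] by (auto simp: rep_fix_def)
      \<comment> \<open>A fixed vector of the complement is a fixed vector of \<open>V\<close>,
        hence in f(W). It is then orthogonal to itself and vanishes.\<close>
      then obtain w where w: "w \<in> fx W" "p1 z = f w" using ff by blast
      then have "ip (p1 z) (p1 z) = 0" using z(1) rep_fix_sub[OF w(1)] by (simp add: Z_def)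
      then have "z = e0 (p0 z)" by - (rule sum_ext, simp_all)
      then show "z \<in> e0 ` fx V'" using \<open>p0 z \<in> fx V'\<close> by blast
    qed
    show "e0 ` fx V' \<subseteq> fx (Z, \<sigma>)"
    proof
      fix z assume "z \<in> e0 ` fx V'"
      then obtain v where v: "v \<in> fx V'" "z = e0 v" by blast
      have z: "z \<in> Z" using e0Z[OF rep_fix_sub[OF v(1)]] v by simp
      have "\<sigma> n z = z" if n: "n \<in> N" for n
      proof (rule sum_ext)
        have "p0 z = v" "p1 z = 0" using v by simp_all
        then show "p0 (\<sigma> n z) = p0 z" "p1 (\<sigma> n z) = p1 z"
          unfolding p\<sigma>[OF n z] using v(1) n isos_zero[OF iV[OF n] PV(1)] by (simp_all add: rep_fix_def)
      qed
      then show "z \<in> fx (Z, \<sigma>)" using z by (simp add: rep_fix_def)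
    qed
  qed
  define h where "h = (\<lambda>v\<in>fst V'. f'' (e0 v))"
  \<comment> \<open>\<open>V\<close> is placed inside \<open>Z\<close>: its part in f(W) goes to V'
    through \<open>j\<close>, the complement stays on the odd coordinates. This forces \<psi> f = h
    j.\<close>
  define em where "em v = e0 (j (s v)) + e1 (r v)" for v
  define \<psi> where "\<psi> = (\<lambda>v\<in>fst V. f'' (em v))"
  have emZ: "em v \<in> Z" if "v \<in> fst V" for v
    using isosD(1)[OF ji s(1)] rV[OF that] rf by (simp add: Z_def em_def)
  have hi: "h \<in> isos (fst V') (fst V'')"
  proof (rule isosI)
    show "h (v + w) = h v + h w" if "v \<in> fst V'" "w \<in> fst V'" for v w
      using that PV'(2)[OF that] isosD(2)[OF f''(1) e0Z[OF that(1)] e0Z[OF that(2)]] by (simp add: h_def sum_inj)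
    show "h (c *\<^sub>R v) = c *\<^sub>R h v" if "v \<in> fst V'" for c v
      using that PV'(3)[OF that] isosD(3)[OF f''(1) e0Z[OF that]] by (simp add: h_def sum_inj)
    show "ip (h v) (h w) = ip v w" if "v \<in> fst V'" "w \<in> fst V'" for v w
      using that isosD(4)[OF f''(1) e0Z[OF that(1)] e0Z[OF that(2)]] by (simp add: h_def ip_sum[of "e0 v"])
  qed (use isosD(1)[OF f''(1) e0Z] in \<open>auto simp: h_def\<close>)
  have r_add: "r (v + w) = r v + r w" for v w using isosD(2)[OF fi s(1) s(1)] by (simp add: r_def s_add)
  have r_scale: "r (c *\<^sub>R v) = c *\<^sub>R r v" for c v using isosD(3)[OF fi s(1)] by (simp add: r_def s_scale scaleR_diff_right)
  have em_ip: "ip (em v) (em w) = ip v w" for v w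
  proof -
    have "v = f (s v) + r v" "w = f (s w) + r w" by (simp_all add: r_def)
    then have "ip v w = ip (f (s v) + r v) (f (s w) + r w)" by metis
    also have "\<dots> = ip (f (s v)) (f (s w)) + ip (r v) (r w)"
      using rf[OF s(1), of v w] rf[OF s(1), of w v] by (simp add: ip_add_left ip_add_right ip_commute[of "f (s v)" "r w"])
    also have "\<dots> = ip (j (s v)) (j (s w)) + ip (r v) (r w)"
      using isosD(4)[OF fi s(1) s(1)] isosD(4)[OF ji s(1) s(1)] by simp
    finally show ?thesis unfolding ip_sum[of "em v"] by (simp add: em_def)
  qed
  have \<psi>i: "\<psi> \<in> isos (fst V) (fst V'')"
  proof (rule isosI)
    have em_add: "em (v + w) = em v + em w" for v w
      using isosD(2)[OF ji s(1) s(1)] by (simp add: em_def s_add r_add sum_inj algebra_simps)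
    have em_scale: "em (c *\<^sub>R v) = c *\<^sub>R em v" for c v
      using isosD(3)[OF ji s(1)] by (simp add: em_def s_scale r_scale sum_inj algebra_simps)
    show "\<psi> (v + w) = \<psi> v + \<psi> w" if "v \<in> fst V" "w \<in> fst V" for v w
      using that PV(2)[OF that] isosD(2)[OF f''(1) emZ[OF that(1)] emZ[OF that(2)]] by (simp add: \<psi>_def em_add)
    show "\<psi> (c *\<^sub>R v) = c *\<^sub>R \<psi> v" if "v \<in> fst V" for c v
      using that PV(3)[OF that] isosD(3)[OF f''(1) emZ[OF that]] by (simp add: \<psi>_def em_scale)
    show "ip (\<psi> v) (\<psi> w) = ip v w" if "v \<in> fst V" "w \<in> fst V" for v w
      using that isosD(4)[OF f''(1) emZ[OF that(1)] emZ[OF that(2)]] by (simp add: \<psi>_def em_ip)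
  qed (use isosD(1)[OF f''(1) emZ] in \<open>auto simp: \<psi>_def\<close>)
  show ?thesis
  proof (rule that[OF V'', of h \<psi>])
    show "equivar V' V'' h"
      unfolding equivar_def
    proof (intro conjI hi ballI)
      fix n v assume n: "n \<in> N" and v: "v \<in> fst V'"
      have "\<sigma> n (e0 v) = e0 (snd V' n v)"
        using isos_zero[OF iV[OF n] PV(1)] by - (rule sum_ext, simp_all add: p\<sigma>[OF n e0Z[OF v]])
      then show "h (snd V' n v) = snd V'' n (h v)"
        using f''eq[OF n e0Z[OF v]] v repsD(5)[OF V' NG[OF n] v] by (simp add: h_def)
    qed
    show "equivar V V'' \<psi>"
      unfolding equivar_def
    proof (intro conjI \<psi>i ballI)
      fix n v assume n: "n \<in> N" and v: "v \<in> fst V"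
      have "r (snd V n v) = snd V n (r v)"
        using s_eq[OF n v] feq[OF n s(1)] isos_diff[OF ips[OF V] iV[OF n] v fU[OF s(1)]] by (simp add: r_def)
      then have "\<sigma> n (em v) = em (snd V n v)"
        using s_eq[OF n v] jeq[OF n s(1)] by - (rule sum_ext, simp_all add: p\<sigma>[OF n emZ[OF v]], simp_all add: em_def)
      then show "\<psi> (snd V n v) = snd V'' n (\<psi> v)"
        using f''eq[OF n emZ[OF v]] v repsD(5)[OF V NG[OF n] v] by (simp add: \<psi>_def)
    qed
    have "h ` fx V' = f'' ` e0 ` fx V'" by (auto simp: h_def rep_fix_sub image_iff)
    then show "h ` fx V' = fx V''" using f''b fixZ by simp
    show "\<psi> (f w) = h (j w)" if "w \<in> fst W" for w
      using that fU[OF that] isosD(1)[OF ji that] by (simp add: \<psi>_def h_def em_def s_f r_def)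
    show "ip (\<psi> v) (h x) = 0" if v: "v \<in> fst V" for v
    proof -
      have xV: "x \<in> fst V'" using rep_fix_sub[OF x(1)] .
      \<comment> \<open>\<open>e0 x\<close> meets only the even part of \<open>em v\<close>, which
        is a value of \<open>j\<close> and so orthogonal to x.\<close>
      have "ip (\<psi> v) (h x) = ip (em v) (e0 x)" using isosD(4)[OF f''(1) emZ[OF v] e0Z[OF xV]] v xV by (simp add: \<psi>_def h_def)
      also have "\<dots> = ip (j (s v)) x" unfolding ip_sum[of "em v"] by (simp add: em_def)
      finally show ?thesis using x(2)[OF s(1)] by simp
    qed
  qed
qed

end

section \<open>Geometric fixed points of morphisms\<close>

locale gspec_hom = gspec G T N A + B: gspec G T N B
  for G :: "'g monoid" and T and N and A :: "('g, 'a) ospectrum" and B :: "('g, 'b) ospectrum" +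
  fixes F :: "nat \<Rightarrow> 'a \<Rightarrow> 'b"
  assumes F: "ospectrum_morphism G T A B F"
begin

lemma F_continuous: "continuous_map (ptop (lvl A m)) (ptop (lvl B m)) (F m)"
  and F_pt: "F m (pt (lvl A m)) = pt (lvl B m)"
  and F_str: "\<phi> \<in> Omor (Euc m) (Euc n) \<Longrightarrow> a \<in> lvl_set A m \<Longrightarrow> F n (str A m n \<phi> a) = str B m n \<phi> (F m a)"
  and F_act: "g \<in> carrier G \<Longrightarrow> a \<in> lvl_set A m \<Longrightarrow> F m (act A g m a) = act B g m (F m a)"
  using F by (auto simp: ospectrum_morphism_def)

lemma F_in: "a \<in> lvl_set A m \<Longrightarrow> F m a \<in> lvl_set B m"
  by (rule continuous_map_point[OF F_continuous])

abbreviation "eh V \<equiv> ev_hom B F V"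

lemma ev_hom_E:
  assumes V: "inner_product_space V" and a: "a \<in> lvl_set A (dim V)"
  shows "eh V (E V a) = B.E V (F (dim V) a)"
proof -
  let ?n = "dim V" and ?F = "\<lambda>(p, a). ev_class B V p (F (dim V) a)"
  let ?P = "k_prod (iso_top (Euc ?n) V) (ptop (lvl A ?n))"
  have c: "CGWH ?P" using CGWH_frames[OF V] AD(2) by blast
  have "the_elem (?F ` E V a) = ?F (Some (frame V), a)"
  proof (rule ev_lift(1)[OF V B.CGWH_ev[OF V] _ _ _ a])
    have "continuous_map ?P (ptop (ev B V)) (\<lambda>p. B.E V (B.red V (fst p) (F ?n (snd p))))"
      by (intro continuous_map_comp[OF B.continuous_map_E[OF V]] B.continuous_map_red[OF V c] k_prod_fst
          continuous_map_comp[OF F_continuous k_prod_snd])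
    then show "continuous_map ?P (ptop (ev B V)) (\<lambda>(f, a). ?F (Some f, a))"
      by (rule continuous_map_eq) (auto simp: B.ev_class_E[OF V] F_in)
    show "?F (Some f, pt (lvl A ?n)) = ?F (None, pt (lvl A ?n))" if "f \<in> isos (Euc ?n) V" for f
      by (simp add: F_pt B.ev_class_base[OF V])
    show "?F (Some (compose (Euc ?n) f k), a) = ?F (Some f, str A ?n ?n (Olin k) a)"
      if "f \<in> isos (Euc ?n) V" "k \<in> isos (Euc ?n) (Euc ?n)" "a \<in> lvl_set A ?n" for f k a
      using B.ev_class_rel[OF V that(1,2) F_in[OF that(3)]] F_str[OF Olin_Euc[OF V that(2)] that(3)] by simp
  qed
  then show ?thesis by (simp add: ev_hom_def B.E_def)
qed

lemma ev_hom_in: "z \<in> EV V \<Longrightarrow> inner_product_space V \<Longrightarrow> eh V z \<in> B.EV V"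
  by (elim EV_cases) (simp_all add: ev_hom_E B.E_in F_in)

lemma continuous_map_ev_hom:
  assumes V: "inner_product_space V"
  shows "continuous_map (ptop (ev A V)) (ptop (ev B V)) (eh V)"
proof (rule continuous_map_eq)
  show "continuous_map (ptop (ev A V)) (ptop (ev B V)) (\<lambda>z. B.E V (F (dim V) (Einv V z)))"
    by (intro continuous_map_comp[OF B.continuous_map_E[OF V]] continuous_map_comp[OF F_continuous] continuous_map_Einv[OF V])
  show "B.E V (F (dim V) (Einv V z)) = eh V z" if "z \<in> EV V" for z
    using that V by (elim EV_cases) (simp_all add: ev_hom_E Einv_E)
qed

lemma ev_hom_pt: "inner_product_space V \<Longrightarrow> eh V (pt (ev A V)) = pt (ev B V)"
  using ev_hom_E[of V, OF _ AD(3)] by (simp add: E_pt B.E_pt F_pt)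

lemma ev_hom_map: "z \<in> EV V \<Longrightarrow> inner_product_space V \<Longrightarrow> inner_product_space W \<Longrightarrow> \<phi> \<in> Omor V W \<Longrightarrow>
    eh W (ev_map A V W \<phi> z) = ev_map B V W \<phi> (eh V z)"
  by (elim EV_cases) (simp_all add: ev_hom_E ev_map_E B.ev_map_E AD(5) cmor_Omor F_str F_in)

lemma ev_hom_lact: "z \<in> EV V \<Longrightarrow> inner_product_space V \<Longrightarrow> g \<in> carrier G \<Longrightarrow> eh V (lact V g z) = B.lact V g (eh V z)"
  by (elim EV_cases) (simp_all add: ev_hom_E lact_E B.lact_E AD(11) F_act F_in)

lemma ev_hom_act:
  assumes V: "V \<in> \<R>" and g: "g \<in> carrier G" and z: "z \<in> EV (fst V)"
  shows "eh (fst V) (ev_act A V g z) = ev_act B V g (eh (fst V) z)"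
  using ev_act_eq[OF V g z] B.ev_act_eq[OF V g ev_hom_in[OF z ips[OF V]]] ev_hom_lact[OF z ips[OF V] g]
    ev_hom_map[OF lact_in[OF ips[OF V] g z] ips[OF V] ips[OF V] repsD(8)[OF V g]] by simp

lemma ev_hom_FV: "V \<in> \<R> \<Longrightarrow> z \<in> FV V \<Longrightarrow> eh (fst V) z \<in> B.FV V"
proof -
  assume V: "V \<in> \<R>" and z: "z \<in> FV V"
  have z': "z \<in> EV (fst V)" using z FV_iff by blast
  have "ev_act B V n (eh (fst V) z) = eh (fst V) z" if "n \<in> N" for n
    using ev_hom_act[OF V NG[OF that] z'] z that by (simp add: FV_iff)
  then show ?thesis using ev_hom_in[OF z' ips[OF V]] by (simp add: B.FV_iff)
qed

lemma continuous_map_ev_hom_fix: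
  assumes V: "V \<in> \<R>" and z: "continuous_map K (Fx V) z"
  shows "continuous_map K (B.Fx V) (\<lambda>k. eh (fst V) (z k))"
proof (rule B.continuous_map_into_ev_fix[OF V])
  show "continuous_map K (ptop (ev B (fst V))) (\<lambda>k. eh (fst V) (z k))"
    by (rule continuous_map_comp[OF continuous_map_ev_hom[OF ips[OF V]] continuous_map_from_ev_fix[OF z]])
  show "eh (fst V) (z k) \<in> B.FV V" if "k \<in> topspace K" for k
    using ev_hom_FV[OF V] continuous_map_point[OF z that] by simp
qed

abbreviation "gh m z \<equiv> gfix_hom G T N B F m z"

lemma gfix_hom_\<gamma>:
  assumes V: "V \<in> \<R>" "\<theta> \<in> Om V m" "a \<in> FV V"
  shows "gh m (\<gamma> m V \<theta> a) = B.\<gamma> m V \<theta> (eh (fst V) a)"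
proof -
  let ?F = "\<lambda>(V, \<theta>, a). B.\<gamma> m V \<theta> (eh (fst V) a)"
  have "the_elem (?F ` \<gamma> m V \<theta> a) = ?F (V, \<theta>, a)"
  proof (rule gfix_lift(2)[OF B.CGWH_\<Phi>[of m] _ _ _ _ V, where c = "pt (lvl B.\<Phi> m)"])
    fix V assume V: "V \<in> \<R>"
    have "continuous_map (k_prod (Os V m) (Fx V)) (ptop (lvl B.\<Phi> m)) (\<lambda>p. B.\<gamma> m V (fst p) (eh (fst V) (snd p)))"
      using CGWH_Os[OF V] CGWH_Fx[OF V] by (intro B.continuous_map_\<gamma>[OF V] CGWH_k_prod k_prod_fst continuous_map_ev_hom_fix[OF V] k_prod_snd)
    then show "continuous_map (k_prod (Os V m) (Fx V)) (ptop (lvl B.\<Phi> m)) (\<lambda>(\<theta>, a). ?F (V, \<theta>, a))"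
      by (simp add: case_prod_beta')
    show "?F (V, b0, a) = pt (lvl B.\<Phi> m)" for a using B.\<gamma>_base[OF V] by simp
    show "?F (V, \<theta>, pt (ev A (fst V))) = pt (lvl B.\<Phi> m)" for \<theta> using B.\<gamma>_base(2)[OF V] ev_hom_pt[OF ips[OF V]] by simp
  next
    fix V V' \<phi> \<theta> a assume a: "V \<in> \<R>" "V' \<in> \<R>" "\<phi> \<in> Omor_fix G N V V'" "\<theta> \<in> Om V' m" "a \<in> FV V"
    have "a \<in> EV (fst V)" using a(5) FV_iff by blast
    then show "?F (V, Ocomp (fx V) \<theta> (Ofix N V \<phi>), a) = ?F (V', \<theta>, ev_map A (fst V) (fst V') \<phi> a)"
      using B.\<gamma>_rel[OF a(1-4) ev_hom_FV[OF a(1,5)]] ev_hom_map[OF _ ips[OF a(1)] ips[OF a(2)] Omor_fixD(1)[OF a(1-3)]] by simp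
  qed
  then show ?thesis by (simp add: gfix_hom_def)
qed

lemma gfix_hom_morphism: "ospectrum_morphism J TJ \<Phi> B.\<Phi> (\<lambda>m z. gh m z)"
  unfolding ospectrum_morphism_def
proof (intro conjI allI ballI spectrum_\<Phi> B.spectrum_\<Phi>)
  fix m n
  show "continuous_map (ptop (lvl \<Phi> m)) (ptop (lvl B.\<Phi> m)) (\<lambda>z. gh m z)"
  proof (rule continuous_map_\<Phi>)
    fix V assume V: "V \<in> \<R>"
    have "continuous_map (k_prod (Os V m) (Fx V)) (ptop (lvl B.\<Phi> m)) (\<lambda>p. B.\<gamma> m V (fst p) (eh (fst V) (snd p)))"
      using CGWH_Os[OF V] CGWH_Fx[OF V] by (intro B.continuous_map_\<gamma>[OF V] CGWH_k_prod k_prod_fst continuous_map_ev_hom_fix[OF V] k_prod_snd)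
    then show "continuous_map (k_prod (Os V m) (Fx V)) (ptop (lvl B.\<Phi> m)) (\<lambda>(\<theta>, a). gh m (\<gamma> m V \<theta> a))"
      by (rule continuous_map_eq) (auto simp: gfix_hom_\<gamma> V topspace_Os)
  qed
  note Z = zero_rep_reps
  show "gh m (pt (lvl \<Phi> m)) = pt (lvl B.\<Phi> m)"
    using gfix_hom_\<gamma>[OF Z Omor_None pt_FV[OF Z], of m] \<gamma>_base(1)[OF Z] B.\<gamma>_base(1)[OF Z] by (simp del: lvl_\<Phi> B.lvl_\<Phi>)
next
  fix m n \<phi> z assume \<phi>: "\<phi> \<in> Omor (Euc m) (Euc n)" and "z \<in> lvl_set \<Phi> m"
  then obtain V \<theta> c where V: "V \<in> \<R>" "\<theta> \<in> Om V m" "c \<in> FV V" "z = \<gamma> m V \<theta> c" by (elim \<gamma>_surj)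
  show "gh n (str \<Phi> m n \<phi> z) = str B.\<Phi> m n \<phi> (gh m z)"
    using str_\<gamma>[OF \<phi> V(1-3)] gfix_hom_\<gamma>[OF V(1-3)] gfix_hom_\<gamma>[OF V(1) Ocomp_Om[OF V(1) \<phi> V(2)] V(3)]
      B.str_\<gamma>[OF \<phi> V(1,2) ev_hom_FV[OF V(1,3)]] V(4) by simp
next
  fix m g z assume "g \<in> carrier J" and "z \<in> lvl_set \<Phi> m"
  then obtain V \<theta> c where V: "V \<in> \<R>" "\<theta> \<in> Om V m" "c \<in> FV V" "z = \<gamma> m V \<theta> c" by (elim \<gamma>_surj)
  obtain g' where g: "g' \<in> carrier G" "g = cs g'" using \<open>g \<in> carrier J\<close> by (auto simp: carrier_J)
  have gi: "inv\<^bsub>G\<^esub> g' \<in> carrier G" using g by simp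
  have "c \<in> EV (fst V)" using V(3) FV_iff by blast
  then show "gh m (act \<Phi> g m z) = act B.\<Phi> g m (gh m z)"
    using act_\<gamma>[OF V(1-3) g(1)] gfix_hom_\<gamma>[OF V(1-3)] gfix_hom_\<gamma>[OF V(1) Ocomp_Rf[OF V(1) gi V(2)] ev_act_fix[OF V(1) g(1) V(3)]]
      B.act_\<gamma>[OF V(1,2) ev_hom_FV[OF V(1,3)] g(1)] ev_hom_act[OF V(1) g(1)] V(4) g(2) by (simp add: \<alpha>_def B.\<alpha>_def)
qed

end

section \<open>Geometric fixed points and restriction to a subgroup\<close>

locale rep_sub = rep_group G T N for G :: "'g monoid" and T and N +
  fixes H
  assumes H: "subgroup H G" and cH: "closedin T H" and NH: "N \<subseteq> H"
begin

abbreviation "GH \<equiv> G\<lparr>carrier := H\<rparr>"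
abbreviation "TH \<equiv> subtopology T H"

lemma HG: "h \<in> H \<Longrightarrow> h \<in> carrier G" using subgroup.mem_carrier[OF H] .

lemma inv_GH: "h \<in> H \<Longrightarrow> inv\<^bsub>GH\<^esub> h = inv\<^bsub>G\<^esub> h"
  using G.m_inv_consistent[OF H] by simp

sublocale L: rep_group GH TH N
proof (rule rep_group.intro)
  show "k_group GH TH" by (rule k_group_subgroup[OF kG H cH])
  show "N \<lhd> GH" by (rule G.normal_restrict_supergroup[OF H nN NH])
  show "closedin TH N" using cN NH by (simp add: closedin_closed_subtopology[OF cH])
qed

lemma res_R: "V \<in> \<R> \<Longrightarrow> res_rep H V \<in> L.\<R>"
  by (rule res_rep_in_reps[OF _ topspace_T G.is_group H])

lemma fx_res [simp]: "fx (res_rep H V) = fx V"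
  by (rule rep_fix_res[OF NH])

lemma Ofix_res [simp]: "Ofix N (res_rep H V) = Ofix N V"
  by (simp add: Ofix_def fun_eq_iff)

lemma res_N_reps: "W \<in> L.\<R> \<Longrightarrow> res_rep N W \<in> reps GN TN"
  using res_rep_in_reps[OF _ L.topspace_T L.G.is_group L.subgroup_N, of W] NH
  by (simp add: subtopology_subtopology Int_absorb1)

lemma equivar_res: "equivar W (res_rep H V) f \<longleftrightarrow> equivar W V f" "equivar (res_rep H V) W f \<longleftrightarrow> equivar V W f"
  "equivar (res_rep N V) W f \<longleftrightarrow> equivar V W f"
  using NH by (auto simp: equivar_def subset_iff)

lemma Omor_fix_res: "V \<in> \<R> \<Longrightarrow> W \<in> \<R> \<Longrightarrow> Omor_fix GH N (res_rep H V) (res_rep H W) = Omor_fix G N V W"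
proof -
  have "Oconj GH (res_rep H V) (res_rep H W) n \<phi> = Oconj G V W n \<phi>" if "n \<in> N" for n \<phi>
  proof -
    have "n \<in> H" "inv\<^bsub>G\<^esub> n \<in> H" using that Ninv NH by auto
    then show ?thesis by (simp add: Oconj_def inv_GH)
  qed
  then show ?thesis by (simp add: Omor_fix_def)
qed

lemma finality:
  assumes fin: "orthogonally_final G T N" and W: "W \<in> L.\<R>"
  obtains V f where "V \<in> \<R>" "equivar W V f" "f ` fx W = fx V"
proof -
  obtain V f where V: "V \<in> \<R>" and f: "f \<in> isos (fst W) (fst V)"
      "\<forall>n\<in>N. \<forall>w\<in>fst W. f (snd (res_rep N W) n w) = snd (res_rep N V) n (f w)"
      "bij_betw f (fx (res_rep N W)) (fx (res_rep N V))"
    using fin res_N_reps[OF W] unfolding orthogonally_final_def by fastforce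
  show ?thesis
    by (rule that[OF V, of f]) (use f in \<open>auto simp: equivar_def bij_betw_def\<close>)
qed

lemma cs_L: "L.cs = cs" by (simp add: fun_eq_iff r_coset_def)

abbreviation "J0 \<equiv> carrier (GH Mod N)"

lemma J0_eq: "J0 = cs ` H" using L.carrier_J by (simp add: cs_L)

lemma cs_in_J0: "g \<in> carrier G \<Longrightarrow> cs g \<in> J0 \<longleftrightarrow> g \<in> H"
proof
  assume g: "g \<in> carrier G" and "cs g \<in> J0"
  then obtain h where h: "h \<in> H" "cs g = cs h" by (auto simp: J0_eq)
  then have "g \<otimes>\<^bsub>G\<^esub> inv\<^bsub>G\<^esub> h \<in> H" using cs_eq[OF g HG[OF h(1)]] NH by blast
  then have "g \<otimes>\<^bsub>G\<^esub> inv\<^bsub>G\<^esub> h \<otimes>\<^bsub>G\<^esub> h \<in> H" using h(1) subgroup.m_closed[OF H] by blast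
  then show "g \<in> H" using g HG[OF h(1)] by (simp add: G.m_assoc)
qed (simp add: J0_eq)

text \<open>Products of cosets are formed in the same way in H and in G, so the subgroup of G/N and
  the group H/N are equal as records and facts transfer by rewriting.\<close>

lemma Mod_restrict: "J\<lparr>carrier := J0\<rparr> = GH Mod N"
  by (simp add: FactGroup_def set_mult_def fun_eq_iff)

lemma subgroup_J0: "subgroup J0 J"
proof
  show "J0 \<subseteq> carrier J" using HG by (auto simp: J0_eq carrier_J)
  show "\<one>\<^bsub>J\<^esub> \<in> J0" unfolding one_J J0_eq using subgroup.one_closed[OF H] by blast
  fix x y assume "x \<in> J0" "y \<in> J0"
  then obtain g h where gh: "g \<in> H" "h \<in> H" "x = cs g" "y = cs h" by (auto simp: J0_eq)
  show "x \<otimes>\<^bsub>J\<^esub> y \<in> J0" "inv\<^bsub>J\<^esub> x \<in> J0"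
    using gh HG subgroup.m_closed[OF H] subgroup.m_inv_closed[OF H] by (simp_all only: mult_J inv_J J0_eq) blast+
qed

lemma closedin_J0: "closedin TJ J0"
proof -
  have "{g \<in> topspace T. cs g \<in> J0} = H" using HG by (auto simp: topspace_T cs_in_J0)
  moreover have "J0 \<subseteq> topspace TJ" using HG k_groupD(2)[OF k_group_J] by (auto simp: J0_eq carrier_J)
  ultimately show ?thesis using quotient_cs cH unfolding quotient_map_closedin by metis
qed

text \<open>H is the preimage of a closed subset of G/N. Restricting the quotient map to it gives a
  quotient map onto the subspace, while the factor group topology of H/N is the quotient topology
  along the same map.\<close>

lemma TJ_restrict: "subtopology TJ J0 = L.TJ"
proof -
  have "{g \<in> topspace T. cs g \<in> J0} = H" using HG by (auto simp: topspace_T cs_in_J0)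
  then have q: "quotient_map TH (subtopology TJ J0) cs"
    using quotient_map_restriction[OF quotient_cs] closedin_J0 by blast
  have q': "quotient_map TH L.TJ cs" using L.quotient_cs by (simp add: cs_L)
  have t: "topspace (subtopology TJ J0) = topspace L.TJ" using q q' by (simp add: quotient_map_def)
  show ?thesis
    unfolding topology_eq
  proof
    fix U
    show "openin (subtopology TJ J0) U = openin L.TJ U"
    proof (cases "U \<subseteq> topspace L.TJ")
      case True
      have "openin TH {x \<in> topspace TH. cs x \<in> U} = openin (subtopology TJ J0) U"
        using q True unfolding t[symmetric] quotient_map_def by blast
      moreover have "openin TH {x \<in> topspace TH. cs x \<in> U} = openin L.TJ U"
        using q' True unfolding quotient_map_def by blast
      ultimately show ?thesis by simp
    next
      case False
      then show ?thesis using openin_subset[of "subtopology TJ J0" U] openin_subset[of L.TJ U] unfolding t by blast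
    qed
  qed
qed

end

section \<open>Inverses of isometries on fixed vectors\<close>

definition iso_inv :: "vect set \<Rightarrow> vect set \<Rightarrow> (vect \<Rightarrow> vect) \<Rightarrow> vect \<Rightarrow> vect" where
  "iso_inv U V f = (\<lambda>v\<in>V. inv_into U f v)"

lemma iso_inv_isos:
  assumes U: "inner_product_space U" and V: "inner_product_space V" and f: "f \<in> isos U V" and im: "f ` U = V"
  shows "iso_inv U V f \<in> isos V U" "u \<in> U \<Longrightarrow> iso_inv U V f (f u) = u"
  using inverse_isos[OF U V f im] isos_inj[OF U f] im by (auto simp: iso_inv_def)

context rep_group
begin

text \<open>The inverse of the isomorphism of fixed vectors induced by \<open>f\<close>, as a
  morphism from the fixed vectors of \<open>V\<close> to those of \<open>W\<close>. It transports
  the first smash factor in the direction opposite to \<open>f\<close>.\<close>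

abbreviation fxi :: "'g rep \<Rightarrow> 'g rep \<Rightarrow> (vect \<Rightarrow> vect) \<Rightarrow> omor" where
  "fxi W V f \<equiv> Olin (iso_inv (fx W) (fx V) (restrict f (fx W)))"

lemma fxi:
  assumes W: "inner_product_space (fx W)" and V: "inner_product_space (fx V)" and f: "f \<in> isos (fst W) (fst V)" "f ` fx W = fx V"
  shows "restrict f (fx W) \<in> isos (fx W) (fx V)"
    "iso_inv (fx W) (fx V) (restrict f (fx W)) \<in> isos (fx V) (fx W)"
    "w \<in> fx W \<Longrightarrow> iso_inv (fx W) (fx V) (restrict f (fx W)) (f w) = w"
    "fxi W V f \<in> Omor (fx V) (fx W)"
proof -
  show 1: "restrict f (fx W) \<in> isos (fx W) (fx V)" using f by (intro restrict_isos[OF W f(1)]) (auto intro: rep_fix_sub)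
  have 2: "restrict f (fx W) ` fx W = fx V" using f(2) by simp
  show 3: "iso_inv (fx W) (fx V) (restrict f (fx W)) \<in> isos (fx V) (fx W)" by (rule iso_inv_isos(1)[OF W V 1 2])
  show "w \<in> fx W \<Longrightarrow> iso_inv (fx W) (fx V) (restrict f (fx W)) (f w) = w" using iso_inv_isos(2)[OF W V 1 2] by force
  show "fxi W V f \<in> Omor (fx V) (fx W)" by (rule Olin_Omor[OF W 3])
qed

end

lemma res_spectrum_simps [simp]:
  "lvl (res_spectrum H Y) = lvl Y" "str (res_spectrum H Y) = str Y" "h \<in> H \<Longrightarrow> act (res_spectrum H Y) h = act Y h"
  by (simp_all add: res_spectrum_def)

locale gspec_sub = gspec G T N Y + rep_sub G T N H
  for G :: "'g monoid" and T and N and Y :: "('g, 'a) ospectrum" and H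
begin

abbreviation "R \<equiv> res_spectrum H Y"

lemma ev_R [simp]: "ev R V = ev Y V" and ev_class_R [simp]: "ev_class R V = ev_class Y V"
  by (simp_all add: ev_def ev_class_def ev_pre_def ev_rel_def ev_pt_def fun_eq_iff)

lemma ev_map_R [simp]: "ev_map R V W = ev_map Y V W"
proof (intro ext)
  show "ev_map R V W \<phi> z = ev_map Y V W \<phi> z" for \<phi> z
    unfolding ev_map_def ev_R ev_class_R res_spectrum_simps ..
qed

lemma ev_act_R [simp]: "h \<in> H \<Longrightarrow> ev_act R W h = ev_act Y W h"
  by (simp add: ev_act_def fun_eq_iff)

lemma ev_act_res [simp]: "h \<in> H \<Longrightarrow> ev_act Y (res_rep H V) h = ev_act Y V h"
  by (simp add: ev_act_def fun_eq_iff)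

lemma ev_act_NR [simp]: "n \<in> N \<Longrightarrow> ev_act R W n = ev_act Y W n" "n \<in> N \<Longrightarrow> ev_act Y (res_rep H V) n = ev_act Y V n"
  using NH by auto

sublocale L: gspec GH TH N R
  by (rule gspec.intro[OF L.rep_group_axioms spec.intro[OF L.kG res_spectrum_orthogonal[OF kG H cH A]]])

lemma FV_res [simp]: "L.FV (res_rep H V) = FV V"
  by (simp add: FV_def L.FV_def)

lemma ev_fix_res [simp]: "ev_fix N R (res_rep H V) = ev_fix N Y V"
  by (simp add: ev_fix_def)

lemma E_R: "L.E V = E V"
  by (simp add: fun_eq_iff E_def L.E_def)

lemma lact_R: "inner_product_space V \<Longrightarrow> h \<in> H \<Longrightarrow> L.lact V h z = lact V h z"
  by (simp add: lact_def L.lact_def Einv_def L.Einv_def E_R)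

text \<open>Here \<open>W\<close> carries an action of H and \<open>V\<close> one of G, and
  \<open>f\<close> respects only N; so \<open>ev_act_map\<close>, which lives over one group, is
  replaced by a direct computation.\<close>

lemma ev_act_equivar:
  assumes W: "W \<in> L.\<R>" and V: "V \<in> \<R>" and f: "equivar W V f" and n: "n \<in> N" and z: "z \<in> EV (fst W)"
  shows "ev_act Y V n (ev_map Y (fst W) (fst V) (Olin f) z) = ev_map Y (fst W) (fst V) (Olin f) (ev_act Y W n z)"
proof -
  have nH: "n \<in> H" and nG: "n \<in> carrier G" using n NH NG by auto
  have fi: "f \<in> isos (fst W) (fst V)" using f by (simp add: equivar_def)
  note v = ips[OF V] and w = L.ips[OF W]
  have l: "lact (fst W) n z \<in> EV (fst W)" using lact_in[OF w nG z] .
  have \<rho>: "snd W n \<in> isos (fst W) (fst W)" using repsD(2)[OF W] nH by simp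
  note O = Olin_Omor[OF v fi] and \<rho>O = Olin_Omor[OF w \<rho>]
  have "compose (fst W) (snd V n) f = compose (fst W) f (snd W n)"
    using f n by (auto simp: compose_def equivar_def fun_eq_iff)
  then have c: "Ocomp (fst W) (Rp V n) (Olin f) = Ocomp (fst W) (Olin f) (Rp W n)"
    using Ocomp_Olin[OF v repsD(2)[OF V nG]] Ocomp_Olin[OF w fi] by simp
  have "ev_act Y V n (ev_map Y (fst W) (fst V) (Olin f) z)
      = ev_map Y (fst V) (fst V) (Rp V n) (ev_map Y (fst W) (fst V) (Olin f) (lact (fst W) n z))"
    using ev_act_eq[OF V nG ev_map_in[OF w v O z]] lact_map[OF z w v nG O] by simp
  also have "\<dots> = ev_map Y (fst W) (fst V) (Ocomp (fst W) (Rp V n) (Olin f)) (lact (fst W) n z)"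
    by (rule ev_map_comp[OF w v v repsD(8)[OF V nG] O l, symmetric])
  also have "\<dots> = ev_map Y (fst W) (fst V) (Olin f) (ev_map Y (fst W) (fst W) (Rp W n) (lact (fst W) n z))"
    unfolding c by (rule ev_map_comp[OF w w v O \<rho>O l])
  also have "ev_map Y (fst W) (fst W) (Rp W n) (lact (fst W) n z) = ev_act Y W n z"
    using L.ev_act_eq[OF W, of n z] nH z w by (simp add: lact_R)
  finally show ?thesis .
qed

lemma ev_map_equivar_FV:
  assumes W: "W \<in> L.\<R>" and V: "V \<in> \<R>" and f: "equivar W V f" and z: "z \<in> L.FV W"
  shows "ev_map Y (fst W) (fst V) (Olin f) z \<in> FV V"
proof -
  have zE: "z \<in> EV (fst W)" using z by (simp add: L.FV_iff)
  have fi: "f \<in> isos (fst W) (fst V)" using f by (simp add: equivar_def)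
  have "ev_act Y V n (ev_map Y (fst W) (fst V) (Olin f) z) = ev_map Y (fst W) (fst V) (Olin f) z" if n: "n \<in> N" for n
    using ev_act_equivar[OF W V f n zE] z n by (simp add: L.FV_iff)
  then show ?thesis using ev_map_in[OF L.ips[OF W] ips[OF V] Olin_Omor[OF ips[OF V] fi] zE] by (simp add: FV_iff)
qed

lemma gfix_res_\<gamma>:
  assumes V: "V \<in> \<R>" "\<theta> \<in> Om V m" "a \<in> FV V"
  shows "gfix_res G T H N Y m (\<gamma> m V \<theta> a) = L.\<gamma> m (res_rep H V) \<theta> a"
proof -
  let ?F = "\<lambda>(V, \<theta>, a). L.\<gamma> m (res_rep H V) \<theta> a"
  have "the_elem (?F ` \<gamma> m V \<theta> a) = ?F (V, \<theta>, a)"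
  proof (rule gfix_lift(2)[OF L.CGWH_\<Phi>[of m] _ _ _ _ V, where c = "pt (lvl L.\<Phi> m)"])
    fix V assume V: "V \<in> \<R>"
    have "continuous_map (k_prod (Os V m) (Fx V)) (ptop (lvl L.\<Phi> m)) (\<lambda>p. L.\<gamma> m (res_rep H V) (fst p) (snd p))"
      using CGWH_Os[OF V] CGWH_Fx[OF V] by (intro L.continuous_map_\<gamma>[OF res_R[OF V]] CGWH_k_prod) (simp_all add: k_prod_fst k_prod_snd)
    then show "continuous_map (k_prod (Os V m) (Fx V)) (ptop (lvl L.\<Phi> m)) (\<lambda>(\<theta>, a). ?F (V, \<theta>, a))"
      by (simp add: case_prod_beta')
    show "?F (V, b0, a) = pt (lvl L.\<Phi> m)" for a using L.\<gamma>_base[OF res_R[OF V]] by simp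
    show "?F (V, \<theta>, pt (ev Y (fst V))) = pt (lvl L.\<Phi> m)" for \<theta> using L.\<gamma>_base(2)[OF res_R[OF V]] by simp
  next
    fix V V' \<phi> \<theta> a assume a: "V \<in> \<R>" "V' \<in> \<R>" "\<phi> \<in> Omor_fix G N V V'" "\<theta> \<in> Om V' m" "a \<in> FV V"
    show "?F (V, Ocomp (fx V) \<theta> (Ofix N V \<phi>), a) = ?F (V', \<theta>, ev_map Y (fst V) (fst V') \<phi> a)"
      using L.\<gamma>_rel[OF res_R[OF a(1)] res_R[OF a(2)], of \<phi> \<theta> m a] a by (simp add: Omor_fix_res)
  qed
  then show ?thesis by (simp add: gfix_res_def)
qed

text \<open>The point of the geometric fixed points of \<open>Y\<close> that corresponds to \<open>\<theta> \<and> b\<close> at the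
  \<open>H\<close>-representation \<open>W\<close> when \<open>f : W \<rightarrow> V\<close> is as in orthogonal finality.\<close>

definition \<sigma> :: "nat \<Rightarrow> 'g rep \<Rightarrow> (vect \<Rightarrow> vect) \<Rightarrow> 'g rep \<Rightarrow> omor \<Rightarrow> 'a evpt set \<Rightarrow> ('g, 'a) gfixpt set" where
  "\<sigma> m V f W \<theta> b = \<gamma> m V (Ocomp (fx V) \<theta> (fxi W V f)) (ev_map Y (fst W) (fst V) (Olin f) b)"

end

context gspec_sub
begin

text \<open>Both the independence of \<open>\<sigma>\<close> of the choice of \<open>f : W \<rightarrow> V\<close> (take \<open>\<phi>\<close> to be the identity) and
  its compatibility with the coend: amalgamate \<open>f\<close> with \<open>f'\<phi>\<close>.\<close>

lemma \<sigma>_rel: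
  assumes fin: "orthogonally_final G T N"
    and W: "W \<in> L.\<R>" "W' \<in> L.\<R>" and V: "V \<in> \<R>" "V' \<in> \<R>"
    and f: "equivar W V f" "f ` fx W = fx V" and f': "equivar W' V' f'" "f' ` fx W' = fx V'"
    and \<phi>: "\<phi> \<in> Omor_fix GH N W W'" and \<theta>: "\<theta> \<in> L.Om W' m" and b: "b \<in> L.FV W"
  shows "\<sigma> m V f W (Ocomp (fx W) \<theta> (Ofix N W \<phi>)) b = \<sigma> m V' f' W' \<theta> (ev_map Y (fst W) (fst W') \<phi> b)"
proof -
  note w = L.ips[OF W(1)] and w' = L.ips[OF W(2)] and v = ips[OF V(1)] and v' = ips[OF V(2)]
  note wN = L.ipsN[OF W(1)] and wN' = L.ipsN[OF W(2)] and vN = ipsN[OF V(1)] and vN' = ipsN[OF V(2)]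
  note O = L.Omor_fixD(1)[OF W \<phi>]
  have fi: "f \<in> isos (fst W) (fst V)" "f' \<in> isos (fst W') (fst V')" using f f' by (simp_all add: equivar_def)
  note fO = Olin_Omor[OF v fi(1)] and fO' = Olin_Omor[OF v' fi(2)]
  have bE: "b \<in> EV (fst W)" using b by (simp add: L.FV_iff)
  note X = fxi[OF wN vN fi(1) f(2)] and X' = fxi[OF wN' vN' fi(2) f'(2)]
  show ?thesis using O
  proof (cases rule: Omor_cases)
    case 1
    then show ?thesis
      using \<gamma>_base[OF V(1)] \<gamma>_base(2)[OF V(2)] ev_map_base(2)[OF w w' bE] ev_map_base(1)[OF w' v' fO']
      by (simp add: \<sigma>_def Ofix_def)
  next
    case (2 k x)
    have k: "k \<in> isos (fst W) (fst W')" "x \<in> fx W'" "\<And>u. u \<in> fst W \<Longrightarrow> ip (k u) x = 0"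
        "\<And>n u. n \<in> N \<Longrightarrow> u \<in> fst W \<Longrightarrow> k (snd W n u) = snd W' n (k u)"
      using \<phi> L.Omor_fix_Some[OF W, of k x] 2(1) by auto
    have kf: "k u \<in> fx W'" if "u \<in> fx W" for u
      using that k(4) isosD(1)[OF k(1)] by (auto simp: rep_fix_def) metis
    have fx': "f' x \<in> fx V'" using f'(2) k(2) by blast
    \<comment> \<open>The second embedding of \<open>W\<close>, through the linear part of
      \<open>\<phi>\<close> and f'. The amalgamation takes place over \<open>W\<close> with its
      N-action.\<close>
    define j where "j = compose (fst W) f' k"
    have ji: "j \<in> isos (fst W) (fst V')" unfolding j_def by (rule compose_isos[OF w fi(2) k(1)])
    have j: "equivar (res_rep N W) V' j"
      using ji k(4) f'(1) isosD(1)[OF k(1)] repsD(5)[OF W(1)] NH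
      by (auto simp: equivar_def j_def compose_def subset_iff)
    have fN: "equivar (res_rep N W) V f" "f ` fx (res_rep N W) = fx V" using f by (simp_all add: equivar_res)
    have jx: "ip (j u) (f' x) = 0" if "u \<in> fst (res_rep N W)" for u
      using that isosD(4)[OF fi(2) isosD(1)[OF k(1)] rep_fix_sub[OF k(2)], of u] k(3) by (simp add: j_def compose_def)
    obtain V'' h \<psi> where V'': "V'' \<in> \<R>" and h: "equivar V' V'' h" "h ` fx V' = fx V''" and \<psi>: "equivar V V'' \<psi>"
        "\<And>u. u \<in> fst (res_rep N W) \<Longrightarrow> \<psi> (f u) = h (j u)" "\<And>u. u \<in> fst V \<Longrightarrow> ip (\<psi> u) (h (f' x)) = 0"
      by (rule amalgamation[OF fin V res_N_reps[OF W(1)] fN j fx' jx], assumption) (rule that; assumption)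
    note v'' = ips[OF V''] and vN'' = ipsN[OF V'']
    have hi: "h \<in> isos (fst V') (fst V'')" and \<psi>i: "\<psi> \<in> isos (fst V) (fst V'')" using h \<psi> by (simp_all add: equivar_def)
    note Y = fxi[OF vN' vN'' hi h(2)]
    note hO = Olin_Omor[OF v'' hi]
    \<comment> \<open>The translation vector is chosen so that \<psi>' after f equals h after f'
      after \<phi>. Its orthogonality to the image of \<open>\<psi>\<close> is the last conclusion
      of \<open>amalgamation\<close>.\<close>
    define \<psi>' where "\<psi>' = (Some \<psi>, Some (h (f' x)))"
    have hx: "h (f' x) \<in> fx V''" using h(2) fx' by blast
    have hf: "Olin h \<in> Omor_fix G N V' V''"
      using h(1) hi isos_zero[OF hi] inner_product_space_props(1)[OF vN''] inner_product_space_props(1)[OF v'']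
      unfolding Olin_def Omor_fix_Some[OF V(2) V''] by (simp add: equivar_def)
    have \<psi>f: "\<psi>' \<in> Omor_fix G N V V''"
      using \<psi>(1,3) \<psi>i hx unfolding \<psi>'_def Omor_fix_Some[OF V(1) V''] by (simp add: equivar_def)
    note \<psi>O = Omor_fixD(1)[OF V(1) V'' \<psi>f] and \<psi>N = Ofix_Omor[OF V(1) V'' \<psi>f] and hN = Ofix_Omor[OF V(2) V'' hf]
    note \<phi>N = L.Ofix_Omor[OF W \<phi>]
    define \<theta>' where "\<theta>' = Ocomp (fx V') \<theta> (fxi W' V' f')"
    \<comment> \<open>\<open>\<theta>\<close> carried to the fixed vectors of V'' by inverting f'
      and h there.\<close>
    define \<eta> where "\<eta> = Ocomp (fx V'') \<theta>' (fxi V' V'' h)"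
    have \<theta>': "\<theta>' \<in> Om V' m" unfolding \<theta>'_def by (rule Ocomp_in_Omor[OF vN' wN' inner_product_space_Euc \<theta> X'(4)])
    have \<eta>: "\<eta> \<in> Om V'' m" unfolding \<eta>_def by (rule Ocomp_in_Omor[OF vN'' vN' inner_product_space_Euc \<theta>' Y(4)])
    have ru: "restrict f (fx W) \<in> isos (fx W) (fx V)" using X(1) .
    have r1: "Ocomp (fx V') \<eta> (Ofix N V' (Olin h)) = \<theta>'"
    proof -
      have "Ocomp (fx V') (fxi V' V'' h) (Ofix N V' (Olin h)) = Oid (fx V')"
        using Y(3) Ocomp_Olin[OF vN'' Y(2)]
        by (auto simp: Ofix_def Olin_def[of h] Olin_def[of "restrict h _", symmetric] Oid_def compose_def fun_eq_iff intro!: arg_cong[of _ _ Olin])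
      then show ?thesis
        unfolding \<eta>_def using Ocomp_assoc[OF vN' vN'' \<theta>' Y(4) hN] Ocomp_id_right[OF vN' \<theta>'] by simp
    qed
    have r2: "Ocomp (fx V) \<eta> (Ofix N V \<psi>') = Ocomp (fx V) (Ocomp (fx W) \<theta> (Ofix N W \<phi>)) (fxi W V f)"
    proof -
      let ?C = "Ocomp (fx V)"
      have e: "iso_inv (fx W') (fx V') (restrict f' (fx W')) (iso_inv (fx V') (fx V'') (restrict h (fx V')) (\<psi> u))
          = k (iso_inv (fx W) (fx V) (restrict f (fx W)) u)" if u: "u \<in> fx V" for u
      proof -
        obtain u' where u': "u' \<in> fx W" "u = f u'" using u f(2) by blast
        have "f' (k u') \<in> fx V'" using kf[OF u'(1)] f'(2) by blast
        moreover have "\<psi> u = h (f' (k u'))" using \<psi>(2)[of u'] rep_fix_sub[OF u'(1)] u'(2) by (simp add: j_def compose_def)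
        ultimately show ?thesis using Y(3) X'(3)[OF kf[OF u'(1)]] X(3)[OF u'(1)] u'(2) by simp
      qed
      have "?C (fxi W' V' f') (?C (fxi V' V'' h) (Ofix N V \<psi>')) = ?C (Ofix N W \<phi>) (fxi W V f)"
      proof -
        have "k 0 = 0" "0 \<in> fx W" using isos_zero[OF k(1)] inner_product_space_props(1)[OF w] inner_product_space_props(1)[OF wN] by simp_all
        then show ?thesis
          using Y(3)[OF fx'] X'(3)[OF k(2)] e isosD(1)[OF X(2)]
          by (simp add: Olin_def Ofix_def \<psi>'_def 2(1) compose_def fun_eq_iff)
      qed
      moreover have "?C \<eta> (Ofix N V \<psi>') = ?C \<theta>' (?C (fxi V' V'' h) (Ofix N V \<psi>'))"
        unfolding \<eta>_def by (rule Ocomp_assoc[OF vN vN'' \<theta>' Y(4) \<psi>N])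
      moreover have "\<dots> = ?C \<theta> (?C (fxi W' V' f') (?C (fxi V' V'' h) (Ofix N V \<psi>')))"
        unfolding \<theta>'_def by (rule Ocomp_assoc[OF vN vN' \<theta> X'(4) Ocomp_in_Omor[OF vN vN'' vN' Y(4) \<psi>N]])
      moreover have "?C (Ocomp (fx W) \<theta> (Ofix N W \<phi>)) (fxi W V f) = ?C \<theta> (?C (Ofix N W \<phi>) (fxi W V f))"
        by (rule Ocomp_assoc[OF vN wN \<theta> \<phi>N X(4)])
      ultimately show ?thesis by simp
    qed
    let ?b = "ev_map Y (fst W) (fst V) (Olin f) b" and ?c = "ev_map Y (fst W') (fst V') (Olin f') (ev_map Y (fst W) (fst W') \<phi> b)"
    have bF: "?b \<in> FV V" by (rule ev_map_equivar_FV[OF W(1) V(1) f(1) b])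
    have \<phi>b: "ev_map Y (fst W) (fst W') \<phi> b \<in> L.FV W'" using L.ev_map_fix[OF W \<phi> b] by simp
    have cF: "?c \<in> FV V'" by (rule ev_map_equivar_FV[OF W(2) V(2) f'(1) \<phi>b])
    have r3: "ev_map Y (fst V) (fst V'') \<psi>' ?b = ev_map Y (fst V') (fst V'') (Olin h) ?c"
    proof -
      have "Ocomp (fst W) \<psi>' (Olin f) = Ocomp (fst W) (Olin h) (Ocomp (fst W) (Olin f') \<phi>)"
      proof -
        have "\<psi> 0 = 0" using isos_zero[OF \<psi>i] inner_product_space_props(1)[OF v] by simp
        then show ?thesis
          using \<psi>(2) by (simp add: Olin_def \<psi>'_def 2(1) fun_eq_iff compose_def j_def)
      qed
      moreover have "ev_map Y (fst V) (fst V'') \<psi>' ?b = ev_map Y (fst W) (fst V'') (Ocomp (fst W) \<psi>' (Olin f)) b"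
        by (rule ev_map_comp[OF w v v'' \<psi>O fO bE, symmetric])
      moreover have "ev_map Y (fst W) (fst V'') (Ocomp (fst W) (Olin h) (Ocomp (fst W) (Olin f') \<phi>)) b
          = ev_map Y (fst V') (fst V'') (Olin h) (ev_map Y (fst W) (fst V') (Ocomp (fst W) (Olin f') \<phi>) b)"
        by (rule ev_map_comp[OF w v' v'' hO Ocomp_in_Omor[OF w w' v' fO' O] bE])
      moreover have "ev_map Y (fst W) (fst V') (Ocomp (fst W) (Olin f') \<phi>) b = ?c"
        by (rule ev_map_comp[OF w w' v' fO' O bE])
      ultimately show ?thesis by simp
    qed
    \<comment> \<open>The two sides meet at V'': one coend relation along \<open>\<psi>'\<close>,
      another along \<open>h\<close>.\<close>
    have "\<sigma> m V f W (Ocomp (fx W) \<theta> (Ofix N W \<phi>)) b = \<gamma> m V (Ocomp (fx V) \<eta> (Ofix N V \<psi>')) ?b"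
      by (simp add: \<sigma>_def r2)
    also have "\<dots> = \<gamma> m V'' \<eta> (ev_map Y (fst V) (fst V'') \<psi>' ?b)" by (rule \<gamma>_rel[OF V(1) V'' \<psi>f \<eta> bF])
    also have "\<dots> = \<gamma> m V' (Ocomp (fx V') \<eta> (Ofix N V' (Olin h))) ?c"
      unfolding r3 by (rule \<gamma>_rel[OF V(2) V'' hf \<eta> cF, symmetric])
    finally show ?thesis by (simp add: \<sigma>_def r1 \<theta>'_def)
  qed
qed

end

text \<open>For \<open>f\<close> from finality, \<open>\<theta>\<close> is itself after inverting
  \<open>f\<close> on fixed vectors and applying it again. The coend relation for \<open>f\<close>
  therefore moves the point to the restricted representation.\<close>

lemma (in rep_sub) gfix_surj_res:
  assumes fin: "orthogonally_final G T N" and X: "gspec GH TH N X" and z: "z \<in> lvl_set (gfix GH TH N X) m"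
  obtains V \<theta> a where "V \<in> \<R>" "\<theta> \<in> Omor (fx V) (Euc m)" "a \<in> gspec.FV N X (res_rep H V)" "z = gfix_class GH TH N X m (res_rep H V) \<theta> a"
proof -
  interpret X: gspec GH TH N X by (rule X)
  obtain W \<theta> b where W: "W \<in> L.\<R>" "\<theta> \<in> X.Om W m" "b \<in> X.FV W" "z = X.\<gamma> m W \<theta> b" using X.\<gamma>_surj[OF z] .
  obtain V f where V: "V \<in> \<R>" and f: "equivar W V f" "f ` fx W = fx V" using finality[OF fin W(1)] .
  have fi: "f \<in> isos (fst W) (fst V)" using f by (simp add: equivar_def)
  note wN = L.ipsN[OF W(1)] and vN = ipsN[OF V]
  note O = fxi[OF wN vN fi f(2)]
  have ff: "Olin f \<in> Omor_fix GH N W (res_rep H V)"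
    using f(1) fi inner_product_space_props(1)[OF vN] NH
    unfolding Olin_def L.Omor_fix_Some[OF W(1) res_R[OF V]] by (auto simp: equivar_def)
  have \<theta>f: "Ocomp (fx V) \<theta> (fxi W V f) \<in> Omor (fx V) (Euc m)" by (rule Ocomp_in_Omor[OF vN wN inner_product_space_Euc W(2) O(4)])
  have "Ocomp (fx W) (Ocomp (fx V) \<theta> (fxi W V f)) (Ofix N W (Olin f)) = \<theta>"
  proof -
    have "Ocomp (fx W) (fxi W V f) (Ofix N W (Olin f)) = Oid (fx W)"
      using O(3) Ocomp_Olin[OF vN O(2)]
      by (auto simp: Ofix_def Olin_def[of f] Olin_def[of "restrict f _", symmetric] Oid_def compose_def fun_eq_iff intro!: arg_cong[of _ _ Olin])
    then show ?thesis
      using Ocomp_assoc[OF wN vN W(2) O(4), of "Ofix N W (Olin f)"] L.Ofix_Omor[OF W(1) res_R[OF V] ff] Ocomp_id_right[OF wN W(2)] by simp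
  qed
  then have "z = X.\<gamma> m (res_rep H V) (Ocomp (fx V) \<theta> (fxi W V f)) (ev_map X (fst W) (fst V) (Olin f) b)"
    using X.\<gamma>_rel[OF W(1) res_R[OF V] ff, of "Ocomp (fx V) \<theta> (fxi W V f)" m b] \<theta>f W(3,4) by simp
  then show ?thesis
    using that[OF V \<theta>f] X.ev_map_fix[OF W(1) res_R[OF V] ff W(3)] by simp
qed

section \<open>Inverting restriction for an orthogonally final subgroup\<close>

locale gspec_final = gspec_sub +
  assumes fin: "orthogonally_final G T N"
begin

text \<open>One embedding into a G-representation is chosen for each \<open>W\<close>. The choices
  for different \<open>W\<close> are unrelated; \<open>\<sigma>_rel\<close> makes them
  compatible.\<close>

definition ext :: "'a rep \<Rightarrow> 'a rep \<times> (vect \<Rightarrow> vect)" where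
  "ext W = (SOME p. fst p \<in> \<R> \<and> equivar W (fst p) (snd p) \<and> snd p ` fx W = fx (fst p))"

lemma ext: "W \<in> L.\<R> \<Longrightarrow> fst (ext W) \<in> \<R> \<and> equivar W (fst (ext W)) (snd (ext W)) \<and> snd (ext W) ` fx W = fx (fst (ext W))"
proof -
  assume W: "W \<in> L.\<R>"
  obtain V f where "V \<in> \<R>" "equivar W V f" "f ` fx W = fx V" using finality[OF fin W] .
  then have "\<exists>p. fst p \<in> \<R> \<and> equivar W (fst p) (snd p) \<and> snd p ` fx W = fx (fst p)"
    by (intro exI[of _ "(V, f)"]) simp
  then show ?thesis unfolding ext_def by (rule someI_ex)
qed

text \<open>The candidate for the inverse of \<open>gfix_res\<close>. Unlike
  \<open>gfix_res_inv\<close> it has the shape needed for the universal property of the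
  coend.\<close>

definition res_section :: "nat \<Rightarrow> ('a, 'b) gfixpt set \<Rightarrow> ('a, 'b) gfixpt set" where
  "res_section m z = the_elem ((\<lambda>(W, \<theta>, b). \<sigma> m (fst (ext W)) (snd (ext W)) W \<theta> b) ` z)"

lemma continuous_map_\<sigma>:
  assumes W: "W \<in> L.\<R>" and V: "V \<in> \<R>" and f: "equivar W V f" "f ` fx W = fx V"
  shows "continuous_map (k_prod (L.Os W m) (L.Fx W)) (ptop (lvl \<Phi> m)) (\<lambda>p. \<sigma> m V f W (fst p) (snd p))"
  unfolding \<sigma>_def
proof (rule continuous_map_\<gamma>[OF V])
  let ?P = "k_prod (L.Os W m) (L.Fx W)"
  have fi: "f \<in> isos (fst W) (fst V)" using f by (simp add: equivar_def)
  note X = fxi[OF L.ipsN[OF W] ipsN[OF V] fi f(2)]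
  show c: "CGWH ?P" using L.CGWH_Os[OF W] L.CGWH_Fx[OF W] by blast
  show "continuous_map ?P (Os V m) (\<lambda>p. Ocomp (fx V) (fst p) (fxi W V f))"
    using X(4) by (intro continuous_map_Ocomp[OF ipsN[OF V] L.ipsN[OF W] inner_product_space_Euc] k_prod_fst)
      (simp add: topspace_Osp' ipsN[OF V] L.ipsN[OF W])
  have s: "continuous_map ?P (L.Fx W) snd" by (rule k_prod_snd)
  show "continuous_map ?P (Fx V) (\<lambda>p. ev_map Y (fst W) (fst V) (Olin f) (snd p))"
  proof (rule continuous_map_into_ev_fix[OF V])
    show "continuous_map ?P (ptop (ev Y (fst V))) (\<lambda>p. ev_map Y (fst W) (fst V) (Olin f) (snd p))"
      using continuous_map_comp[OF continuous_map_ev_map[OF L.ips[OF W] ips[OF V] Olin_Omor[OF ips[OF V] fi]], of ?P snd]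
        L.continuous_map_from_ev_fix[OF s] by simp
    show "ev_map Y (fst W) (fst V) (Olin f) (snd p) \<in> FV V" if "p \<in> topspace ?P" for p
      using that by (intro ev_map_equivar_FV[OF W V f(1)]) auto
  qed
qed

lemma res_section_\<gamma>0:
  assumes W: "W \<in> L.\<R>" "\<theta> \<in> L.Om W m" "b \<in> L.FV W"
  shows "res_section m (L.\<gamma> m W \<theta> b) = \<sigma> m (fst (ext W)) (snd (ext W)) W \<theta> b"
proof -
  let ?F = "\<lambda>(W, \<theta>, b). \<sigma> m (fst (ext W)) (snd (ext W)) W \<theta> b"
  have "the_elem (?F ` L.\<gamma> m W \<theta> b) = ?F (W, \<theta>, b)"
  proof (rule L.gfix_lift(2)[OF CGWH_\<Phi>[of m] _ _ _ _ W, where c = "pt (lvl \<Phi> m)"])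
    fix W assume W: "W \<in> L.\<R>"
    note V = ext[OF W]
    show "continuous_map (k_prod (L.Os W m) (L.Fx W)) (ptop (lvl \<Phi> m)) (\<lambda>(\<theta>, b). ?F (W, \<theta>, b))"
      using continuous_map_\<sigma>[OF W, of "fst (ext W)" "snd (ext W)" m] V by (simp add: case_prod_beta')
    show "?F (W, b0, a) = pt (lvl \<Phi> m)" for a using \<gamma>_base V by (simp add: \<sigma>_def)
    have "snd (ext W) \<in> isos (fst W) (fst (fst (ext W)))" using V by (simp add: equivar_def)
    then show "?F (W, \<theta>, pt (ev R (fst W))) = pt (lvl \<Phi> m)" for \<theta>
      using \<gamma>_base(2) V ev_map_base(1)[OF L.ips[OF W] ips Olin_Omor[OF ips]] by (simp add: \<sigma>_def)
  next
    fix W W' \<phi> \<theta> b assume a: "W \<in> L.\<R>" "W' \<in> L.\<R>" "\<phi> \<in> Omor_fix GH N W W'" "\<theta> \<in> L.Om W' m" "b \<in> L.FV W"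
    show "?F (W, Ocomp (fx W) \<theta> (Ofix N W \<phi>), b) = ?F (W', \<theta>, ev_map R (fst W) (fst W') \<phi> b)"
      using \<sigma>_rel[OF fin a(1,2) _ _ _ _ _ _ a(3-5)] ext[OF a(1)] ext[OF a(2)] by simp
  qed
  then show ?thesis by (simp add: res_section_def)
qed

lemma res_section_\<gamma>:
  assumes W: "W \<in> L.\<R>" "\<theta> \<in> L.Om W m" "b \<in> L.FV W" and V: "V \<in> \<R>" and f: "equivar W V f" "f ` fx W = fx V"
  shows "res_section m (L.\<gamma> m W \<theta> b) = \<sigma> m V f W \<theta> b"
proof -
  have "(\<lambda>w\<in>fst W. w) \<in> isos (fst W) (fst W)" using id_isos[OF L.ips[OF W(1)]] .
  then have i: "Oid (fst W) \<in> Omor_fix GH N W W"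
    using inner_product_space_props(1)[OF L.ipsN[OF W(1)]] repsD(5)[OF W(1)] NH
    unfolding Oid_def Olin_def L.Omor_fix_Some[OF W(1) W(1)] by auto
  have "Ofix N W (Oid (fst W)) = Oid (fx W)"
    by (auto simp: Ofix_def Oid_def Olin_def restrict_def fun_eq_iff rep_fix_sub)
  moreover have "ev_map Y (fst W) (fst W) (Oid (fst W)) b = b"
    using W(3) L.ips[OF W(1)] by (intro ev_map_id) (auto simp: L.FV_iff)
  ultimately show ?thesis
    using \<sigma>_rel[OF fin W(1) W(1) _ V _ _ f i W(2,3), of "fst (ext W)" "snd (ext W)"] ext[OF W(1)] res_section_\<gamma>0[OF W]
      Ocomp_id_right[OF L.ipsN[OF W(1)] W(2)] by simp
qed

text \<open>A restricted representation extends by the identity, and the chosen extension may be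
  replaced by this one.\<close>

lemma res_section_res:
  assumes V: "V \<in> \<R>" "\<theta> \<in> Om V m" "a \<in> FV V"
  shows "res_section m (L.\<gamma> m (res_rep H V) \<theta> a) = \<gamma> m V \<theta> a"
proof -
  let ?f = "\<lambda>v\<in>fst V. v"
  have f: "equivar (res_rep H V) V ?f" "?f ` fx (res_rep H V) = fx V"
    using id_isos[OF ips[OF V(1)]] repsD(5)[OF V(1) NG] NH by (auto simp: equivar_def rep_fix_sub)
  have "res_section m (L.\<gamma> m (res_rep H V) \<theta> a) = \<sigma> m V ?f (res_rep H V) \<theta> a"
    using V res_section_\<gamma>[OF res_R[OF V(1)] _ _ V(1) f] by simp
  moreover have "fxi (res_rep H V) V ?f = Oid (fx V)"
  proof -
    have "restrict ?f (fx V) = (\<lambda>v\<in>fx V. v)" by (auto simp: restrict_def fun_eq_iff rep_fix_sub)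
    moreover have "iso_inv (fx V) (fx V) (\<lambda>v\<in>fx V. v) = (\<lambda>v\<in>fx V. v)"
      using iso_inv_isos(2)[OF ipsN[OF V(1)] ipsN[OF V(1)] id_isos[OF ipsN[OF V(1)]]] by (force simp: iso_inv_def)
    ultimately show ?thesis by (simp add: Oid_def)
  qed
  moreover have "ev_map Y (fst V) (fst V) (Olin ?f) a = a"
    using ev_map_id[OF ips[OF V(1)], of a] V(3) by (simp add: FV_iff Oid_def)
  ultimately show ?thesis
    using Ocomp_id_right[OF ipsN[OF V(1)] V(2)] by (simp add: \<sigma>_def)
qed

lemma \<gamma>_surj_res:
  assumes "z \<in> lvl_set L.\<Phi> m"
  obtains V \<theta> a where "V \<in> \<R>" "\<theta> \<in> Om V m" "a \<in> FV V" "z = L.\<gamma> m (res_rep H V) \<theta> a"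
  using gfix_surj_res[OF fin L.gspec_axioms assms] that by auto

abbreviation "ri m z \<equiv> gfix_res_inv G T H N Y m z"

text \<open>\<open>res_section\<close> is a left inverse of \<open>gfix_res\<close>, so
  \<open>inv_into\<close> is applied to an injective map.\<close>

lemma gfix_res_inv_\<gamma>:
  assumes V: "V \<in> \<R>" "\<theta> \<in> Om V m" "a \<in> FV V"
  shows "ri m (L.\<gamma> m (res_rep H V) \<theta> a) = \<gamma> m V \<theta> a"
  unfolding gfix_res_inv_def
proof (rule inv_into_f_eq)
  show "inj_on (gfix_res G T H N Y m) (lvl_set \<Phi> m)"
  proof (rule inj_on_inverseI[where g = "res_section m"])
    fix z assume "z \<in> lvl_set \<Phi> m"
    then show "res_section m (gfix_res G T H N Y m z) = z" by (elim \<gamma>_surj) (simp add: gfix_res_\<gamma> res_section_res)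
  qed
qed (use V \<gamma>_in gfix_res_\<gamma> in auto)

text \<open>Transfers continuity from \<open>res_section\<close>, where the coend provides it, to
  the inverse that enters the natural map.\<close>

lemma gfix_res_inv_S: "z \<in> lvl_set L.\<Phi> m \<Longrightarrow> ri m z = res_section m z"
  by (elim \<gamma>_surj_res) (simp add: gfix_res_inv_\<gamma> res_section_res)

lemma gfix_res_inv_morphism: "ospectrum_morphism (GH Mod N) L.TJ L.\<Phi> (res_spectrum J0 \<Phi>) (\<lambda>m z. ri m z)"
  unfolding ospectrum_morphism_def
proof (intro conjI allI ballI L.spectrum_\<Phi>)
  show "orthogonal_spectrum (GH Mod N) L.TJ (res_spectrum J0 \<Phi>)"
    using res_spectrum_orthogonal[OF k_group_J subgroup_J0 closedin_J0 spectrum_\<Phi>] by (simp only: Mod_restrict TJ_restrict)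
  fix m n
  have "continuous_map (ptop (lvl L.\<Phi> m)) (ptop (lvl \<Phi> m)) (res_section m)"
  proof (rule L.continuous_map_\<Phi>)
    fix W assume W: "W \<in> L.\<R>"
    show "continuous_map (k_prod (L.Os W m) (L.Fx W)) (ptop (lvl \<Phi> m)) (\<lambda>(\<theta>, b). res_section m (L.\<gamma> m W \<theta> b))"
      by (rule continuous_map_eq[OF continuous_map_\<sigma>[OF W, of "fst (ext W)" "snd (ext W)"]])
         (use ext[OF W] res_section_\<gamma>0[OF W] in \<open>auto simp: L.topspace_Os[OF W]\<close>)
  qed
  then have "continuous_map (ptop (lvl L.\<Phi> m)) (ptop (lvl \<Phi> m)) (\<lambda>z. ri m z)"
    by (rule continuous_map_eq) (simp only: gfix_res_inv_S)
  then show "continuous_map (ptop (lvl L.\<Phi> m)) (ptop (lvl (res_spectrum J0 \<Phi>) m)) (\<lambda>z. ri m z)"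
    by simp
  note Z = zero_rep_reps
  show "ri m (pt (lvl L.\<Phi> m)) = pt (lvl (res_spectrum J0 \<Phi>) m)"
    using gfix_res_inv_\<gamma>[OF Z Omor_None pt_FV[OF Z], of m] \<gamma>_base(1)[OF Z] L.\<gamma>_base(1)[OF res_R[OF Z]] by (simp del: lvl_\<Phi> L.lvl_\<Phi>)
next
  fix m n \<phi> z assume \<phi>: "\<phi> \<in> Omor (Euc m) (Euc n)" and "z \<in> lvl_set L.\<Phi> m"
  then obtain V \<theta> c where V: "V \<in> \<R>" "\<theta> \<in> Om V m" "c \<in> FV V" "z = L.\<gamma> m (res_rep H V) \<theta> c" by (elim \<gamma>_surj_res)
  show "ri n (str L.\<Phi> m n \<phi> z) = str (res_spectrum J0 \<Phi>) m n \<phi> (ri m z)"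
    using L.str_\<gamma>[OF \<phi> res_R[OF V(1)], of \<theta> c] str_\<gamma>[OF \<phi> V(1-3)] gfix_res_inv_\<gamma>[OF V(1-3)] gfix_res_inv_\<gamma>[OF V(1) Ocomp_Om[OF V(1) \<phi> V(2)] V(3)] V
    by simp
next
  fix m g z assume g: "g \<in> carrier (GH Mod N)" and "z \<in> lvl_set L.\<Phi> m"
  then obtain V \<theta> c where V: "V \<in> \<R>" "\<theta> \<in> Om V m" "c \<in> FV V" "z = L.\<gamma> m (res_rep H V) \<theta> c" by (elim \<gamma>_surj_res)
  obtain h where h: "h \<in> H" "g = cs h" using g unfolding J0_eq by blast
  have hG: "h \<in> carrier G" "inv\<^bsub>G\<^esub> h \<in> carrier G" and hi: "inv\<^bsub>G\<^esub> h \<in> H" using h HG subgroup.m_inv_closed[OF H] by auto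
  have "act L.\<Phi> g m z = L.\<alpha> m h (res_rep H V) \<theta> c"
    using L.act_\<gamma>[OF res_R[OF V(1)], of \<theta> m c h] V h by (simp add: cs_L)
  also have "\<dots> = L.\<gamma> m (res_rep H V) (Ocomp (fx V) \<theta> (Rf V (inv\<^bsub>G\<^esub> h))) (ev_act Y V h c)"
    using h hi by (simp add: L.\<alpha>_def inv_GH)
  finally have "ri m (act L.\<Phi> g m z) = \<alpha> m h V \<theta> c"
    using gfix_res_inv_\<gamma>[OF V(1) Ocomp_Rf[OF V(1) hG(2) V(2)] ev_act_fix[OF V(1) hG(1) V(3)]] by (simp add: \<alpha>_def)
  moreover have "act (res_spectrum J0 \<Phi>) g m (ri m z) = act \<Phi> (cs h) m (\<gamma> m V \<theta> c)"
    using g h(2) gfix_res_inv_\<gamma>[OF V(1-3)] V(4) by simp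
  ultimately show "ri m (act L.\<Phi> g m z) = act (res_spectrum J0 \<Phi>) g m (ri m z)"
    using act_\<gamma>[OF V(1-3) hG(1)] by simp
qed

end

section \<open>The inverse of the natural map\<close>

locale natural_setup = rep_sub G T N H + ind_setup G T H X
  for G :: "'g monoid" and T and N and H and X :: "('g, 'a) ospectrum" +
  assumes fin: "orthogonally_final G T N"
begin

sublocale Y: gspec_final G T N I H
  by (intro gspec_final.intro gspec_sub.intro gspec.intro spec.intro rep_group_axioms rep_sub_axioms
      gspec_final_axioms.intro kG spectrum_I fin)

sublocale h: gspec_hom GH TH N X "res_spectrum H I" "ind_unit G T H X"
  by (intro gspec_hom.intro gspec.intro spec.intro L.rep_group_axioms kH X Y.L.gspec_axioms
      gspec_hom_axioms.intro unit_morphism Y.L.spec_axioms)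

abbreviation "\<Psi> \<equiv> gfix GH TH N X"

sublocale K: ind_setup J TJ J0 \<Psi>
  by (intro ind_setup.intro k_group_J subgroup_J0 closedin_J0) (simp only: Mod_restrict TJ_restrict h.spectrum_\<Phi>)

text \<open>\<open>\<iota> U g\<close> is the map \<open>X\<^sub>U \<rightarrow> (G\<^sub>+ \<and>\<^sub>H X)\<^sub>U\<close> induced by \<open>x \<mapsto> g \<and> x\<close>, which is natural in \<open>U\<close>,
  unlike the map \<open>translate V g\<close> below, which uses the diagonal action.\<close>

definition \<iota> :: "vect set \<Rightarrow> 'g \<Rightarrow> 'a evpt set \<Rightarrow> ('g option \<times> 'a) set evpt set" where
  "\<iota> U g y = Y.lact U g (h.eh U y)"

lemma ev_hom_E: "inner_product_space U \<Longrightarrow> a \<in> lvl_set X (dim U) \<Longrightarrow> h.eh U (h.E U a) = Y.E U (\<kappa> (dim U) \<one>\<^bsub>G\<^esub> a)"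
  using h.ev_hom_E Y.E_R by (simp add: unit_eq)

lemma \<iota>_E: "inner_product_space U \<Longrightarrow> g \<in> carrier G \<Longrightarrow> a \<in> lvl_set X (dim U) \<Longrightarrow> \<iota> U g (h.E U a) = Y.E U (\<kappa> (dim U) g a)"
  by (simp add: \<iota>_def ev_hom_E Y.lact_E \<kappa>_in act_I del: lvl_I)

lemma \<iota>_one: "inner_product_space U \<Longrightarrow> y \<in> h.EV U \<Longrightarrow> \<iota> U \<one>\<^bsub>G\<^esub> y = h.eh U y"
  using h.ev_hom_in[of y U] by (simp add: \<iota>_def Y.lact_one)

lemma \<iota>_map: "inner_product_space U \<Longrightarrow> inner_product_space W \<Longrightarrow> g \<in> carrier G \<Longrightarrow> y \<in> h.EV U \<Longrightarrow> \<phi> \<in> Omor U W \<Longrightarrow>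
    ev_map I U W \<phi> (\<iota> U g y) = \<iota> W g (ev_map X U W \<phi> y)"
  using h.ev_hom_in[of y U] by (simp add: \<iota>_def h.ev_hom_map Y.lact_map)

lemma \<iota>_surj:
  assumes U: "inner_product_space U" and z: "z \<in> Y.EV U"
  obtains g y where "g \<in> carrier G" "y \<in> h.EV U" "z = \<iota> U g y"
proof -
  obtain b where b: "b \<in> lvl_set I (dim U)" "z = Y.E U b" using Y.E_surj[OF U z] .
  obtain g x where "g \<in> carrier G" "x \<in> lvl_set X (dim U)" "b = \<kappa> (dim U) g x" using \<kappa>_surj[OF b(1)] .
  then show ?thesis using that[of g "h.E U x"] b(2) U by (simp add: h.E_in \<iota>_E)
qed

text \<open>In the chosen frame both sides are points of one Euclidean level of the induced
  spectrum, where \<open>\<kappa>_eqD\<close> describes the fibres.\<close>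

lemma \<iota>_eqD:
  assumes U: "inner_product_space U" and g: "g \<in> carrier G" and y: "y \<in> h.EV U" "y' \<in> h.EV U" and eq: "\<iota> U \<one>\<^bsub>G\<^esub> y = \<iota> U g y'"
  shows "g \<in> H \<and> y = h.lact U g y' \<or> y = pt (ev X U) \<and> y' = pt (ev X U)"
proof -
  obtain a where a: "a \<in> lvl_set X (dim U)" "y = h.E U a" using h.E_surj[OF U y(1)] .
  obtain a' where a': "a' \<in> lvl_set X (dim U)" "y' = h.E U a'" using h.E_surj[OF U y(2)] .
  have "\<kappa> (dim U) \<one>\<^bsub>G\<^esub> a = \<kappa> (dim U) g a'"
    by (rule Y.E_inj[OF U \<kappa>_in[OF G.one_closed a(1)] \<kappa>_in[OF g a'(1)]])
       (use eq in \<open>simp add: a(2) a'(2) \<iota>_E[OF U] a(1) a'(1) g\<close>)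
  from \<kappa>_eqD[OF G.one_closed a(1) g a'(1) this] show ?thesis
    using g a a' h.E_pt[OF U] by (auto simp: fib_def h.lact_E[OF U])
qed

abbreviation "fX V \<equiv> h.FV (res_rep H V)"

definition translate :: "'g rep \<Rightarrow> 'g \<Rightarrow> 'a evpt set \<Rightarrow> ('g option \<times> 'a) set evpt set" where
  "translate V g y = ev_act I V g (h.eh (fst V) y)"

context
  fixes V assumes V: "V \<in> \<R>"
begin

abbreviation (input) "u \<equiv> fst V"
lemma U: "inner_product_space u" by (rule ips[OF V])

lemma translate_\<iota>: "g \<in> carrier G \<Longrightarrow> y \<in> h.EV u \<Longrightarrow> translate V g y = \<iota> u g (ev_map X u u (Rp V g) y)"
  using h.ev_hom_in[OF _ U, of y] \<iota>_map[OF U U, of g y "Rp V g"] repsD(8)[OF V, of g] Y.ev_act_eq[OF V, of g "h.eh u y"]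
  by (simp add: translate_def \<iota>_def)

lemma translate_one: "y \<in> h.EV u \<Longrightarrow> translate V \<one>\<^bsub>G\<^esub> y = h.eh u y"
  using h.ev_hom_in[OF _ U, of y] Y.ev_act_one[OF V, of "h.eh u y"] by (simp add: translate_def)

lemma translate_mult: "k \<in> carrier G \<Longrightarrow> g \<in> carrier G \<Longrightarrow> y \<in> h.EV u \<Longrightarrow> ev_act I V k (translate V g y) = translate V (k \<otimes>\<^bsub>G\<^esub> g) y"
  using h.ev_hom_in[OF _ U, of y] Y.ev_act_mult[OF V, of k g "h.eh u y"] by (simp add: translate_def)

lemma translate_surj:
  assumes z: "z \<in> Y.EV u"
  obtains g y where "g \<in> carrier G" "y \<in> h.EV u" "z = translate V g y"
proof -
  obtain g y where gy: "g \<in> carrier G" "y \<in> h.EV u" "z = \<iota> u g y" using \<iota>_surj[OF U z] .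
  have gi: "inv\<^bsub>G\<^esub> g \<in> carrier G" using gy by simp
  \<comment> \<open>The linear action of g^-1 is applied in advance, to cancel the linear part of
    the diagonal action of g.\<close>
  let ?y = "ev_map X u u (Rp V (inv\<^bsub>G\<^esub> g)) y"
  have "ev_map X u u (Rp V g) ?y = y"
    using h.ev_map_comp[OF U U U repsD(8)[OF V gy(1)] repsD(8)[OF V gi] gy(2)] Rp_inv(2)[OF V gy(1)] h.ev_map_id[OF U gy(2)] by simp
  moreover have "?y \<in> h.EV u" by (rule h.ev_map_in[OF U U repsD(8)[OF V gi] gy(2)])
  ultimately show ?thesis using that[OF gy(1), of ?y] translate_\<iota>[OF gy(1), of ?y] gy(3) by simp
qed

text \<open>Multiplying by g^-1 reduces to g = 1, where \<open>\<iota>_eqD\<close> applies; the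
  linear action of the quotient then recombines with \<open>lact\<close> into the diagonal
  action.\<close>

lemma translate_eqD:
  assumes g: "g \<in> carrier G" "g' \<in> carrier G" and y: "y \<in> h.EV u" "y' \<in> h.EV u" and eq: "translate V g y = translate V g' y'"
  shows "inv\<^bsub>G\<^esub> g \<otimes>\<^bsub>G\<^esub> g' \<in> H \<and> y = ev_act X V (inv\<^bsub>G\<^esub> g \<otimes>\<^bsub>G\<^esub> g') y' \<or> y = pt (ev X u) \<and> y' = pt (ev X u)"
proof -
  let ?h = "inv\<^bsub>G\<^esub> g \<otimes>\<^bsub>G\<^esub> g'"
  have h: "?h \<in> carrier G" "inv\<^bsub>G\<^esub> ?h \<in> carrier G" using g by simp_all
  let ?y = "ev_map X u u (Rp V ?h) y'"
  have y': "?y \<in> h.EV u" by (rule h.ev_map_in[OF U U repsD(8)[OF V h(1)] y(2)])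
  have "translate V \<one>\<^bsub>G\<^esub> y = translate V ?h y'"
    using translate_mult[of "inv\<^bsub>G\<^esub> g" g y] translate_mult[of "inv\<^bsub>G\<^esub> g" g' y'] g y eq by simp
  then have "\<iota> u \<one>\<^bsub>G\<^esub> y = \<iota> u ?h ?y" using translate_one[OF y(1)] \<iota>_one[OF U y(1)] translate_\<iota>[OF h(1) y(2)] by simp
  from \<iota>_eqD[OF U h(1) y(1) y' this] show ?thesis
  proof
    assume a: "?h \<in> H \<and> y = h.lact u ?h ?y"
    have "h.lact u ?h ?y = ev_map X u u (Rp V ?h) (h.lact u ?h y')"
      using h.lact_map[OF y(2) U U _ repsD(8)[OF V h(1)], of ?h] a by simp
    also have "\<dots> = ev_act X (res_rep H V) ?h y'"
      using h.ev_act_eq[OF res_R[OF V], of ?h y'] a y(2) by simp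
    also have "\<dots> = ev_act X V ?h y'" using a by (simp add: ev_act_def)
    finally show ?thesis using a by simp
  next
    assume a: "y = pt (ev X u) \<and> ?y = pt (ev X u)"
    \<comment> \<open>The linear action is invertible and preserves the base point, so y' is the
      base point too.\<close>
    have "y' = ev_map X u u (Rp V (inv\<^bsub>G\<^esub> ?h)) ?y"
      using h.ev_map_comp[OF U U U repsD(8)[OF V h(2)] repsD(8)[OF V h(1)] y(2)] Rp_inv(1)[OF V h(1)] h.ev_map_id[OF U y(2)] by simp
    then show ?thesis using a h.ev_map_base(1)[OF U U repsD(8)[OF V h(2)]] by simp
  qed
qed

lemma fX_iff: "y \<in> fX V \<longleftrightarrow> y \<in> h.EV u \<and> (\<forall>n\<in>N. ev_act X V n y = y)"
proof -
  have "ev_act X (res_rep H V) n = ev_act X V n" if "n \<in> N" for n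
    using that NH by (auto simp: ev_act_def fun_eq_iff)
  then show ?thesis by (simp add: h.FV_iff)
qed

text \<open>If N fixes gy, then g n g^-1 fixes it, so g and gn give the same point with y. The fibre
  description for the quotient n, which lies in H, returns ny = y.\<close>

lemma translate_fix:
  assumes g: "g \<in> carrier G" and y: "y \<in> h.EV u"
  shows "translate V g y \<in> Y.FV V \<longleftrightarrow> y \<in> fX V"
proof
  assume "y \<in> fX V"
  then have "h.eh u y \<in> Y.FV V" using h.ev_hom_FV[OF res_R[OF V], of y] by simp
  then show "translate V g y \<in> Y.FV V" unfolding translate_def by (rule Y.ev_act_fix[OF V g])
next
  assume z: "translate V g y \<in> Y.FV V"
  have "y = ev_act X V n y" if n: "n \<in> N" for n
  proof -
    have "translate V g y = ev_act I V (g \<otimes>\<^bsub>G\<^esub> n \<otimes>\<^bsub>G\<^esub> inv\<^bsub>G\<^esub> g) (translate V g y)" using z Nconj[OF n g] by (simp add: Y.FV_iff)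
    also have "\<dots> = translate V (g \<otimes>\<^bsub>G\<^esub> n) y" using translate_mult[OF _ g y, of "g \<otimes>\<^bsub>G\<^esub> n \<otimes>\<^bsub>G\<^esub> inv\<^bsub>G\<^esub> g"] g NG[OF n] by (simp add: G.m_assoc)
    finally have "n \<in> H \<and> y = ev_act X V n y \<or> y = pt (ev X u)"
      using translate_eqD[OF g _ y y, of "g \<otimes>\<^bsub>G\<^esub> n"] g NG[OF n] by (auto simp: G.m_assoc[symmetric])
    then show ?thesis
    proof
      assume "y = pt (ev X u)"
      moreover have "ev_act X V n (pt (ev X u)) = pt (ev X u)"
        using h.pt_FV[OF res_R[OF V]] n by (simp add: fX_iff)
      ultimately show ?thesis by simp
    qed simp
  qed
  then show "y \<in> fX V" using y by (simp add: fX_iff)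
qed

lemma translate_surj_fix:
  assumes z: "z \<in> Y.FV V"
  obtains g y where "g \<in> carrier G" "y \<in> fX V" "z = translate V g y"
proof -
  have "z \<in> Y.EV u" using z by (simp add: Y.FV_iff)
  then obtain g y where "g \<in> carrier G" "y \<in> h.EV u" "z = translate V g y" by (rule translate_surj)
  then show ?thesis using that translate_fix z by simp
qed

text \<open>The shear (g, a) -> (g, g^-1 a), with g^-1 acting linearly, turns the map into
  \<open>Y.E u\<close> after \<open>\<kappa>\<close>, a composite of quotient maps. The last factor
  of a quotient composite is a quotient map.\<close>

lemma quotient_translate: "quotient_map (k_prod T (ptop (ev X u))) (ptop (ev I u)) (\<lambda>(g, y). translate V g y)"
proof (rule quotient_map_from_composition)
  let ?t = "\<lambda>(g, a). (g, ev_map X u u (Rp V (inv\<^bsub>G\<^esub> g)) (h.E u a))"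
  let ?S = "k_prod T (ptop (lvl X (dim u)))"
  have c: "CGWH ?S" using CGWH_T XD(2) by blast
  have cE: "CGWH (ptop (ev X u))" by (rule h.CGWH_ev[OF U])
  have cV: "continuous_map ?S (ptop (ev X u)) (\<lambda>p. ev_map X u u (Rp V (inv\<^bsub>G\<^esub> (fst p))) (h.E u (snd p)))"
    by (intro h.continuous_map_ev_map2[OF U U c] continuous_map_Olin'[OF U U] reps_continuous[OF V topspace_T]
        k_groupD(5)[OF kG] k_prod_fst continuous_map_comp[OF h.continuous_map_E[OF U] k_prod_snd])
  show "continuous_map ?S (k_prod T (ptop (ev X u))) ?t"
    using continuous_map_into_k_prod[OF CGWH_T cE c k_prod_fst cV] by (simp add: case_prod_beta')
  have c': "CGWH (k_prod T (ptop (ev X u)))" using CGWH_T cE by blast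
  have "continuous_map (ptop (ev X u)) (ptop (ev I u)) (h.eh u)" using h.continuous_map_ev_hom[OF U] by simp
  then have "continuous_map (k_prod T (ptop (ev X u))) (ptop (ev I u)) (\<lambda>p. translate V (fst p) (snd p))"
    unfolding translate_def by (intro Y.continuous_map_ev_act[OF V c'] k_prod_fst continuous_map_comp[OF _ k_prod_snd])
  then show "continuous_map (k_prod T (ptop (ev X u))) (ptop (ev I u)) (\<lambda>(g, y). translate V g y)"
    by (simp add: case_prod_beta')
  have "quotient_map ?S (ptop (ev I u)) (Y.E u \<circ> (\<lambda>(g, a). \<kappa> (dim u) g a))"
    by (rule quotient_map_compose[OF quotient_\<kappa> Y.E_homeomorphic[OF U, unfolded homeomorphic_map_def, THEN conjunct1]])
  moreover have "(Y.E u \<circ> (\<lambda>(g, a). \<kappa> (dim u) g a)) p = ((\<lambda>(g, y). translate V g y) \<circ> ?t) p" if p: "p \<in> topspace ?S" for p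
  proof -
    obtain g a where ga: "p = (g, a)" "g \<in> carrier G" "a \<in> lvl_set X (dim u)" using p topspace_T by auto
    have gi: "inv\<^bsub>G\<^esub> g \<in> carrier G" using ga by simp
    have y: "h.E u a \<in> h.EV u" using h.E_in[OF U ga(3)] .
    have "ev_map X u u (Rp V g) (ev_map X u u (Rp V (inv\<^bsub>G\<^esub> g)) (h.E u a)) = h.E u a"
      using h.ev_map_comp[OF U U U repsD(8)[OF V ga(2)] repsD(8)[OF V gi] y] Rp_inv(2)[OF V ga(2)] h.ev_map_id[OF U y] by simp
    then show ?thesis
      using translate_\<iota>[OF ga(2) h.ev_map_in[OF U U repsD(8)[OF V gi] y]] \<iota>_E[OF U ga(2,3)] ga(1) by simp
  qed
  ultimately show "quotient_map ?S (ptop (ev I u)) ((\<lambda>(g, y). translate V g y) \<circ> ?t)"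
    by (rule quotient_map_eq)
qed

abbreviation (input) "translate_dom \<equiv> subtopology (k_prod T (ptop (ev X u))) (carrier G \<times> fX V)"

lemma CGWH_translate_dom: "CGWH translate_dom"
proof (rule CGWH_closed_subtopology)
  show "CGWH (k_prod T (ptop (ev X u)))" using CGWH_T h.CGWH_ev[OF U] by blast
  have "closedin (ptop (ev X u)) (fX V)" using h.closedin_FV[OF res_R[OF V]] by simp
  from closedin_continuous_map_preimage[OF k_prod_snd this]
  have "closedin (k_prod T (ptop (ev X u))) {p \<in> topspace (k_prod T (ptop (ev X u))). snd p \<in> fX V}" .
  moreover have "{p \<in> topspace (k_prod T (ptop (ev X u))). snd p \<in> fX V} = carrier G \<times> fX V"
    using topspace_T by (auto simp: fX_iff)
  ultimately show "closedin (k_prod T (ptop (ev X u))) (carrier G \<times> fX V)" by simp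
qed

lemma topspace_translate_dom: "topspace translate_dom = carrier G \<times> fX V"
  using topspace_T by (auto simp: fX_iff)

text \<open>By \<open>translate_fix\<close> the domain is the full preimage of the closed set of
  fixed points, and quotient maps restrict over closed sets.\<close>

lemma quotient_translate_fix: "quotient_map translate_dom (Y.Fx V) (\<lambda>(g, y). translate V g y)"
proof -
  have "{p \<in> topspace (k_prod T (ptop (ev X u))). (\<lambda>(g, y). translate V g y) p \<in> Y.FV V} = carrier G \<times> fX V"
    using translate_fix topspace_T by (auto simp: fX_iff)
  then show ?thesis
    unfolding Y.ptop_ev_fix[OF V] using quotient_map_restriction[OF quotient_translate] Y.closedin_FV[OF V] by blast
qed

lemma continuous_translate_dom: "continuous_map translate_dom T fst" "continuous_map translate_dom (h.Fx (res_rep H V)) snd"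
proof -
  show "continuous_map translate_dom T fst" by (intro continuous_map_from_subtopology k_prod_fst)
  show "continuous_map translate_dom (h.Fx (res_rep H V)) snd"
    by (rule h.continuous_map_into_ev_fix[OF res_R[OF V]])
       (simp_all add: continuous_map_from_subtopology k_prod_snd mem_Times_iff)
qed

end

end

section \<open>Criteria for morphisms and isomorphisms of spectra\<close>

text \<open>A continuous levelwise inverse inherits compatibility with base points, structure maps
  and action from \<open>F\<close>.\<close>

lemma ospectrum_isomorphismI:
  assumes F: "ospectrum_morphism G T A B F"
    and c: "\<And>m. continuous_map (ptop (lvl B m)) (ptop (lvl A m)) (F' m)"
    and i: "\<And>m a. a \<in> lvl_set A m \<Longrightarrow> F' m (F m a) = a" "\<And>m b. b \<in> lvl_set B m \<Longrightarrow> F m (F' m b) = b"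
    and kG: "k_group G T"
  shows "ospectrum_isomorphism G T A B F"
proof -
  have A: "orthogonal_spectrum G T A" and B: "orthogonal_spectrum G T B"
    and Fc: "\<And>m. continuous_map (ptop (lvl A m)) (ptop (lvl B m)) (F m)"
    and F0: "\<And>m. F m (pt (lvl A m)) = pt (lvl B m)"
    and Fs: "\<And>m n \<phi> a. \<phi> \<in> Omor (Euc m) (Euc n) \<Longrightarrow> a \<in> lvl_set A m \<Longrightarrow> F n (str A m n \<phi> a) = str B m n \<phi> (F m a)"
    and Fa: "\<And>m g a. g \<in> carrier G \<Longrightarrow> a \<in> lvl_set A m \<Longrightarrow> F m (act A g m a) = act B g m (F m a)"
    using F by (auto simp: ospectrum_morphism_def)
  note AD = orthogonal_spectrumD[OF A kG] and BD = orthogonal_spectrumD[OF B kG]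
  have "ospectrum_morphism G T B A F'"
    unfolding ospectrum_morphism_def
  proof (intro conjI allI ballI A B c)
    show "F' m (pt (lvl B m)) = pt (lvl A m)" for m using i(1)[OF AD(3), of m] F0[of m] by simp
    fix m b assume b: "b \<in> lvl_set B m"
    note a = continuous_map_point[OF c[of m] b]
    show "F' n (str B m n \<phi> b) = str A m n \<phi> (F' m b)" if "\<phi> \<in> Omor (Euc m) (Euc n)" for n \<phi>
      using i(1)[OF AD(5)[OF that a]] Fs[OF that a] i(2)[OF b] by simp
    show "F' m (act B g m b) = act A g m (F' m b)" if "g \<in> carrier G" for g
      using i(1)[OF AD(11)[OF that a]] Fa[OF that a] i(2)[OF b] by simp
  qed
  then show ?thesis using F i unfolding ospectrum_isomorphism_def by blast
qed

lemma ospectrum_morphism_comp: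
  assumes F: "ospectrum_morphism G T A B F" and F': "ospectrum_morphism G T B C F'"
  shows "ospectrum_morphism G T A C (\<lambda>m a. F' m (F m a))"
proof -
  have "continuous_map (ptop (lvl A m)) (ptop (lvl B m)) (F m)" "continuous_map (ptop (lvl B m)) (ptop (lvl C m)) (F' m)" for m
    using F F' by (simp_all add: ospectrum_morphism_def)
  note c = continuous_map_comp[OF this(2,1)] and i = continuous_map_point[OF this(1)]
  show ?thesis
    using F F' c i unfolding ospectrum_morphism_def by simp
qed

section \<open>The natural map on representatives and its inverse\<close>

context natural_setup
begin

abbreviation "gX m V \<theta> y \<equiv> h.\<gamma> m (res_rep H V) \<theta> y"
abbreviation "nat_map \<equiv> natural_map G T H N X"

lemma natural_map_eq: "nat_map = ind_adjoint Y.\<Phi> (\<lambda>m z. Y.ri m (h.gh m z))"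
  by (simp add: natural_map_def Let_def fun_eq_iff)

lemma comparison_morphism: "ospectrum_morphism (J\<lparr>carrier := J0\<rparr>) (subtopology TJ J0) \<Psi> (res_spectrum J0 Y.\<Phi>) (\<lambda>m z. Y.ri m (h.gh m z))"
  unfolding Mod_restrict TJ_restrict by (rule ospectrum_morphism_comp[OF h.gfix_hom_morphism Y.gfix_res_inv_morphism])

lemmas nat_map_morphism = K.adjoint_morphism(2)[OF Y.spectrum_\<Phi> comparison_morphism, folded natural_map_eq]

lemma nat_map_\<kappa>:
  assumes V: "V \<in> \<R>" "\<theta> \<in> Y.Om V m" "y \<in> fX V" and g: "g \<in> carrier G"
  shows "nat_map m (K.\<kappa> m (cs g) (gX m V \<theta> y)) = Y.\<gamma> m V (Ocomp (fx V) \<theta> (Rf V (inv\<^bsub>G\<^esub> g))) (translate V g y)"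
proof -
  have V': "res_rep H V \<in> L.\<R>" "\<theta> \<in> h.Om (res_rep H V) m" using res_R[OF V(1)] V(2) by simp_all
  have y: "h.eh (fst V) y \<in> Y.FV V" using h.ev_hom_FV[OF V'(1) V(3)] by simp
  have "nat_map m (K.\<kappa> m (cs g) (gX m V \<theta> y)) = act Y.\<Phi> (cs g) m (Y.ri m (h.gh m (gX m V \<theta> y)))"
    unfolding natural_map_eq
    by (rule K.adjoint_morphism(1)[OF Y.spectrum_\<Phi> comparison_morphism])
       (use g h.\<gamma>_in[OF V' V(3)] in \<open>auto simp: carrier_J\<close>)
  also have "h.gh m (gX m V \<theta> y) = Y.L.\<gamma> m (res_rep H V) \<theta> (h.eh (fst V) y)" using h.gfix_hom_\<gamma>[OF V' V(3)] by simp
  also have "Y.ri m \<dots> = Y.\<gamma> m V \<theta> (h.eh (fst V) y)" by (rule Y.gfix_res_inv_\<gamma>[OF V(1,2) y])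
  also have "act Y.\<Phi> (cs g) m \<dots> = Y.\<alpha> m g V \<theta> (h.eh (fst V) y)" by (rule Y.act_\<gamma>[OF V(1,2) y g])
  finally show ?thesis by (simp add: Y.\<alpha>_def translate_def)
qed

text \<open>The value of the inverse at \<open>\<theta> \<and> gy\<close>.\<close>

definition inverse_term :: "nat \<Rightarrow> 'g rep \<Rightarrow> omor \<Rightarrow> 'g \<Rightarrow> 'a evpt set \<Rightarrow> ('g set option \<times> ('g, 'a) gfixpt set) set" where
  "inverse_term m V \<theta> g y = K.\<kappa> m (cs g) (gX m V (Ocomp (fx V) \<theta> (Rf V g)) y)"

lemma gX_in: "V \<in> \<R> \<Longrightarrow> \<theta> \<in> Y.Om V m \<Longrightarrow> y \<in> fX V \<Longrightarrow> gX m V \<theta> y \<in> lvl_set \<Psi> m"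
  using h.\<gamma>_in[OF res_R, of V \<theta> m y] by simp

text \<open>Two presentations of a point differ by an h in H, whose coset acts on the geometric
  fixed points of \<open>X\<close>. The relation defining the induced J-spectrum absorbs it into the
  first factor. If instead y and y' are base points, both values are the base point.\<close>

lemma inverse_term_cong:
  assumes V: "V \<in> \<R>" "\<theta> \<in> Y.Om V m" and g: "g \<in> carrier G" "g' \<in> carrier G" and y: "y \<in> fX V" "y' \<in> fX V"
    and eq: "translate V g y = translate V g' y'"
  shows "inverse_term m V \<theta> g y = inverse_term m V \<theta> g' y'"
proof -
  let ?h = "inv\<^bsub>G\<^esub> g \<otimes>\<^bsub>G\<^esub> g'"
  note V' = res_R[OF V(1)]
  have "y \<in> h.EV (fst V)" "y' \<in> h.EV (fst V)" using y by (simp_all add: h.FV_iff)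
  from translate_eqD[OF V(1) g this eq] show ?thesis
  proof
    assume a: "?h \<in> H \<and> y = ev_act X V ?h y'"
    then have hH: "?h \<in> H" "inv\<^bsub>G\<^esub> ?h \<in> H" using subgroup.m_inv_closed[OF H] by auto
    have hG: "?h \<in> carrier G" "inv\<^bsub>G\<^esub> ?h \<in> carrier G" using g by simp_all
    have gh: "g' \<otimes>\<^bsub>G\<^esub> inv\<^bsub>G\<^esub> ?h = g" "g \<otimes>\<^bsub>G\<^esub> ?h = g'" using g by (simp_all add: G.inv_mult_group G.m_assoc[symmetric])
    have o: "Ocomp (fx V) \<theta> (Rf V g') \<in> Y.Om V m" by (rule Y.Ocomp_Rf[OF V(1) g(2) V(2)])
    have yy: "ev_act X (res_rep H V) ?h y' = y" using a hH by (simp add: ev_act_def)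
    have "act \<Psi> (cs ?h) m (gX m V (Ocomp (fx V) \<theta> (Rf V g')) y') = h.\<alpha> m ?h (res_rep H V) (Ocomp (fx V) \<theta> (Rf V g')) y'"
      using h.act_\<gamma>[OF V' _ y(2), of "Ocomp (fx V) \<theta> (Rf V g')" m ?h] o hH by (simp add: cs_L)
    also have "\<dots> = gX m V (Ocomp (fx V) (Ocomp (fx V) \<theta> (Rf V g')) (Rf V (inv\<^bsub>G\<^esub> ?h))) y"
      unfolding h.\<alpha>_def yy using hH by (simp add: inv_GH)
    also have "\<dots> = gX m V (Ocomp (fx V) \<theta> (Rf V g)) y"
      using Y.Ocomp_Rf_assoc[OF V(1) g(2) hG(2) V(2)] gh(1) by simp
    finally have e: "act \<Psi> (cs ?h) m (gX m V (Ocomp (fx V) \<theta> (Rf V g')) y') = gX m V (Ocomp (fx V) \<theta> (Rf V g)) y" .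
    have "inverse_term m V \<theta> g y = K.\<kappa> m (cs g) (act \<Psi> (cs ?h) m (gX m V (Ocomp (fx V) \<theta> (Rf V g')) y'))"
      by (simp add: inverse_term_def e)
    also have "\<dots> = K.\<kappa> m (cs g \<otimes>\<^bsub>J\<^esub> cs ?h) (gX m V (Ocomp (fx V) \<theta> (Rf V g')) y')"
      using K.\<kappa>_rel[OF _ _ gX_in[OF V(1) o y(2)], of "cs g" "cs ?h"] g hH by (simp add: carrier_J J0_eq)
    also have "cs g \<otimes>\<^bsub>J\<^esub> cs ?h = cs g'" using mult_J[OF g(1) hG(1)] gh(2) by simp
    finally show ?thesis unfolding inverse_term_def[of m V \<theta> g' y'] .
  next
    assume a: "y = pt (ev X (fst V)) \<and> y' = pt (ev X (fst V))"
    have "gX m V \<theta>' (pt (ev X (fst V))) = pt (lvl \<Psi> m)" for \<theta>' using h.\<gamma>_base(2)[OF V'] by simp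
    then show ?thesis using a K.\<kappa>_base(1)[of m] by (simp add: inverse_term_def del: K.lvl_I h.lvl_\<Phi>)
  qed
qed

text \<open>The presentation of \<open>z\<close> as gy is picked arbitrarily;
  \<open>inverse_at_translate\<close> allows any other one.\<close>

definition inverse_at :: "nat \<Rightarrow> 'g rep \<Rightarrow> omor \<Rightarrow> ('g option \<times> 'a) set evpt set \<Rightarrow> ('g set option \<times> ('g, 'a) gfixpt set) set" where
  "inverse_at m V \<theta> z = (case SOME p. fst p \<in> carrier G \<and> snd p \<in> fX V \<and> translate V (fst p) (snd p) = z of (g, y) \<Rightarrow> inverse_term m V \<theta> g y)"

lemma inverse_at_translate:
  assumes V: "V \<in> \<R>" "\<theta> \<in> Y.Om V m" and gy: "g \<in> carrier G" "y \<in> fX V"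
  shows "inverse_at m V \<theta> (translate V g y) = inverse_term m V \<theta> g y"
proof -
  let ?Q = "\<lambda>p. fst p \<in> carrier G \<and> snd p \<in> fX V \<and> translate V (fst p) (snd p) = translate V g y"
  have "?Q (g, y)" using gy by simp
  then have "?Q (SOME p. ?Q p)" by (rule someI)
  then show ?thesis using inverse_term_cong[OF V _ gy(1) _ gy(2)] by (simp add: inverse_at_def case_prod_beta')
qed

text \<open>No continuous choice of presentation is required: the formula is continuous in
  (\<theta>, g, y) and descends along the quotient map (g, y) -> gy.\<close>

lemma continuous_map_inverse_at:
  assumes V: "V \<in> \<R>"
  shows "continuous_map (k_prod (Y.Os V m) (Y.Fx V)) (ptop (lvl K.I m)) (\<lambda>(\<theta>, z). inverse_at m V \<theta> z)"
proof (rule continuous_map_quotient_param[OF CGWH_translate_dom[OF V] Y.CGWH_Os[OF V] Y.CGWH_Fx[OF V] quotient_translate_fix[OF V]])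
  let ?PF = "subtopology (k_prod T (ptop (ev X (fst V)))) (carrier G \<times> fX V)"
  let ?S = "k_prod (Y.Os V m) ?PF"
  have c: "CGWH ?S" using CGWH_translate_dom[OF V] Y.CGWH_Os[OF V] by blast
  note s = continuous_map_comp[OF continuous_translate_dom(1)[OF V] k_prod_snd] continuous_map_comp[OF continuous_translate_dom(2)[OF V] k_prod_snd]
  have \<theta>: "continuous_map ?S (Y.Os V m) (\<lambda>p. Ocomp (fx V) (fst p) (Rf V (fst (snd p))))"
    by (intro continuous_map_Ocomp[OF ipsN[OF V] ipsN[OF V] inner_product_space_Euc] k_prod_fst Rf_continuous[OF V] s)
  have "continuous_map ?S (ptop (lvl K.I m)) (\<lambda>p. inverse_term m V (fst p) (fst (snd p)) (snd (snd p)))"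
    unfolding inverse_term_def
    by (intro K.continuous_map_\<kappa>[OF c] continuous_map_comp[OF continuous_cs s(1)] h.continuous_map_\<gamma>[OF res_R[OF V] c] s(2))
       (simp add: \<theta>)
  then show "continuous_map ?S (ptop (lvl K.I m)) (\<lambda>(\<theta>, p). inverse_at m V \<theta> ((\<lambda>(g, y). translate V g y) p))"
    by (rule continuous_map_eq) (use topspace_translate_dom[OF V] in \<open>auto simp: inverse_at_translate V Y.topspace_Os[OF V] simp del: topspace_subtopology\<close>)
qed

lemma inverse_at_rel:
  assumes a: "V \<in> \<R>" "V' \<in> \<R>" "\<phi> \<in> Omor_fix G N V V'" "\<theta> \<in> Y.Om V' m" "z \<in> Y.FV V"
  shows "inverse_at m V (Ocomp (fx V) \<theta> (Ofix N V \<phi>)) z = inverse_at m V' \<theta> (ev_map I (fst V) (fst V') \<phi> z)"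
proof -
  obtain g y where gy: "g \<in> carrier G" "y \<in> fX V" "z = translate V g y" using translate_surj_fix[OF a(1,5)] .
  have gi: "inv\<^bsub>G\<^esub> g \<in> carrier G" using gy by simp
  have y: "y \<in> h.EV (fst V)" using gy(2) by (simp add: h.FV_iff)
  note v = ips[OF a(1)] and v' = ips[OF a(2)]
  \<comment> \<open>Applying \<phi> to gy is applying g to the value of this conjugate at y, which
    presents the image point.\<close>
  let ?\<phi> = "Oconj G V V' (inv\<^bsub>G\<^esub> g) \<phi>"
  have \<phi>': "?\<phi> \<in> Omor_fix G N V V'" by (rule Oconj_fix[OF a(1,2) gi a(3)])
  note O = Omor_fixD(1)[OF a(1-3)] and O' = Omor_fixD(1)[OF a(1,2) \<phi>']
  have \<phi>: "Oconj G V V' g ?\<phi> = \<phi>"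
    using Oconj_mult[OF a(1,2) gy(1) gi O] Omor_fixD(2)[OF a(1-3) N1] gy(1) by simp
  have \<phi>H: "?\<phi> \<in> Omor_fix GH N (res_rep H V) (res_rep H V')" using \<phi>' Omor_fix_res[OF a(1,2)] by simp
  let ?y = "ev_map X (fst V) (fst V') ?\<phi> y"
  have y': "?y \<in> fX V'" using h.ev_map_fix[OF res_R[OF a(1)] res_R[OF a(2)] \<phi>H gy(2)] by simp
  have "ev_map I (fst V) (fst V') \<phi> z = translate V' g ?y"
    using Y.ev_act_map[OF a(1,2) gy(1) O' h.ev_hom_in[OF y v, simplified]] h.ev_hom_map[OF y v v' O'] \<phi>
    by (simp add: gy(3) translate_def)
  then have "inverse_at m V' \<theta> (ev_map I (fst V) (fst V') \<phi> z) = K.\<kappa> m (cs g) (gX m V' (Ocomp (fx V') \<theta> (Rf V' g)) ?y)"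
    using inverse_at_translate[OF a(2,4) gy(1) y'] by (simp add: inverse_term_def)
  also have "gX m V' (Ocomp (fx V') \<theta> (Rf V' g)) ?y = gX m V (Ocomp (fx V) (Ocomp (fx V') \<theta> (Rf V' g)) (Ofix N V ?\<phi>)) y"
    using h.\<gamma>_rel[OF res_R[OF a(1)] res_R[OF a(2)] \<phi>H _ gy(2), of "Ocomp (fx V') \<theta> (Rf V' g)" m] Y.Ocomp_Rf[OF a(2) gy(1) a(4)] by simp
  also have "Ocomp (fx V) (Ocomp (fx V') \<theta> (Rf V' g)) (Ofix N V ?\<phi>) = Ocomp (fx V) (Ocomp (fx V) \<theta> (Ofix N V \<phi>)) (Rf V g)"
    using Ocomp_assoc[OF ipsN[OF a(1)] ipsN[OF a(2)] a(4) Rf_Omor[OF a(2) gy(1)] Ofix_Omor[OF a(1,2) \<phi>']]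
      Ocomp_assoc[OF ipsN[OF a(1)] ipsN[OF a(1)] a(4) Ofix_Omor[OF a(1-3)] Rf_Omor[OF a(1) gy(1)]]
      Ofix_Oconj[OF a(1,2) gy(1) \<phi>'] \<phi> by simp
  finally show ?thesis
    using inverse_at_translate[OF a(1) Y.Ocomp_Ofix[OF a(1-4)] gy(1,2)] gy(3) by (simp add: inverse_term_def)
qed

definition inverse_map :: "nat \<Rightarrow> ('g, ('g option \<times> 'a) set) gfixpt set \<Rightarrow> ('g set option \<times> ('g, 'a) gfixpt set) set" where
  "inverse_map m z = the_elem ((\<lambda>(V, \<theta>, z). inverse_at m V \<theta> z) ` z)"

lemma inverse_map_\<gamma>:
  assumes V: "V \<in> \<R>" "\<theta> \<in> Y.Om V m" "z \<in> Y.FV V"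
  shows "inverse_map m (Y.\<gamma> m V \<theta> z) = inverse_at m V \<theta> z"
proof -
  let ?F = "\<lambda>(V, \<theta>, z). inverse_at m V \<theta> z"
  have "the_elem (?F ` Y.\<gamma> m V \<theta> z) = ?F (V, \<theta>, z)"
  proof (rule Y.gfix_lift(2)[OF K.CGWH_I[of m] _ _ _ _ V, where c = "pt (lvl K.I m)"])
    fix V assume V: "V \<in> \<R>"
    show "continuous_map (k_prod (Y.Os V m) (Y.Fx V)) (ptop (lvl K.I m)) (\<lambda>(\<theta>, z). ?F (V, \<theta>, z))"
      using continuous_map_inverse_at[OF V] by simp
    show "?F (V, (None, None), z) = pt (lvl K.I m)" if z: "z \<in> Y.FV V" for z
    proof -
      obtain g y where gy: "g \<in> carrier G" "y \<in> fX V" "z = translate V g y" using translate_surj_fix[OF V z] .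
      then show ?thesis
        using inverse_at_translate[OF V Omor_None gy(1,2)] h.\<gamma>_base(1)[OF res_R[OF V]] K.\<kappa>_base(1)[of m]
        by (simp add: inverse_term_def del: K.lvl_I h.lvl_\<Phi>)
    qed
    have p: "pt (ev X (fst V)) \<in> fX V" using h.pt_FV[OF res_R[OF V]] by simp
    have "translate V \<one>\<^bsub>G\<^esub> (pt (ev X (fst V))) = pt (ev I (fst V))"
      using translate_one[OF V h.pt_ev_in[OF ips[OF V]]] h.ev_hom_pt[OF ips[OF V]] by simp
    then show "?F (V, \<theta>, pt (ev I (fst V))) = pt (lvl K.I m)" if "\<theta> \<in> Y.Om V m" for \<theta>
      using inverse_at_translate[OF V that G.one_closed p] h.\<gamma>_base(2)[OF res_R[OF V]] K.\<kappa>_base(1)[of m]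
      by (simp add: inverse_term_def del: K.lvl_I h.lvl_\<Phi>)
  next
    fix V V' \<phi> \<theta> z assume "V \<in> \<R>" "V' \<in> \<R>" "\<phi> \<in> Omor_fix G N V V'" "\<theta> \<in> Y.Om V' m" "z \<in> Y.FV V"
    from inverse_at_rel[OF this]
    show "?F (V, Ocomp (fx V) \<theta> (Ofix N V \<phi>), z) = ?F (V', \<theta>, ev_map I (fst V) (fst V') \<phi> z)" by simp
  qed
  then show ?thesis by (simp add: inverse_map_def)
qed

lemma continuous_map_inverse_map: "continuous_map (ptop (lvl Y.\<Phi> m)) (ptop (lvl K.I m)) (inverse_map m)"
proof (rule Y.continuous_map_\<Phi>)
  fix V assume V: "V \<in> \<R>"
  show "continuous_map (k_prod (Y.Os V m) (Y.Fx V)) (ptop (lvl K.I m)) (\<lambda>(\<theta>, z). inverse_map m (Y.\<gamma> m V \<theta> z))"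
    by (rule continuous_map_eq[OF continuous_map_inverse_at[OF V]]) (auto simp: inverse_map_\<gamma> V Y.topspace_Os)
qed

lemma inverse_map_translate:
  assumes V: "V \<in> \<R>" "\<theta> \<in> Y.Om V m" and gy: "g \<in> carrier G" "y \<in> fX V"
  shows "inverse_map m (Y.\<gamma> m V \<theta> (translate V g y)) = K.\<kappa> m (cs g) (gX m V (Ocomp (fx V) \<theta> (Rf V g)) y)"
proof -
  have "y \<in> h.EV (fst V)" using gy(2) by (simp add: h.FV_iff)
  then have "translate V g y \<in> Y.FV V" using translate_fix[OF V(1) gy(1)] gy(2) by simp
  then show ?thesis using inverse_map_\<gamma>[OF V] inverse_at_translate[OF V gy] by (simp add: inverse_term_def)
qed

text \<open>Both composites are computed on presentations for which the maps are explicit: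
  restricted representations on the source, translates gy on the target. There the actions of g and
  g^-1 on the fixed vectors cancel.\<close>

theorem natural_map_isomorphism: "ospectrum_isomorphism J TJ K.I Y.\<Phi> nat_map"
proof (rule ospectrum_isomorphismI[OF nat_map_morphism continuous_map_inverse_map _ _ k_group_J])
  fix m z assume "z \<in> lvl_set K.I m"
  then obtain j x where j: "j \<in> carrier J" "x \<in> lvl_set \<Psi> m" "z = K.\<kappa> m j x" by (rule K.\<kappa>_surj)
  obtain g where g: "g \<in> carrier G" "j = cs g" using j(1) by (auto simp: carrier_J)
  obtain V \<theta> y where V: "V \<in> \<R>" "\<theta> \<in> Y.Om V m" "y \<in> fX V" "x = gX m V \<theta> y"
    using gfix_surj_res[OF fin h.gspec_axioms j(2)] .
  have gi: "inv\<^bsub>G\<^esub> g \<in> carrier G" using g by simp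
  have "Ocomp (fx V) (Ocomp (fx V) \<theta> (Rf V (inv\<^bsub>G\<^esub> g))) (Rf V g) = \<theta>"
    using Y.Ocomp_Rf_assoc[OF V(1) gi g(1) V(2)] Y.Ocomp_Rf_N[OF V(1) N1 V(2)] g(1) by simp
  then show "inverse_map m (nat_map m z) = z"
    using nat_map_\<kappa>[OF V(1-3) g(1)] inverse_map_translate[OF V(1) Y.Ocomp_Rf[OF V(1) gi V(2)] g(1) V(3)] j(3) g(2) V(4) by simp
next
  fix m z assume "z \<in> lvl_set Y.\<Phi> m"
  then obtain V \<theta> z' where V: "V \<in> \<R>" "\<theta> \<in> Y.Om V m" "z' \<in> Y.FV V" "z = Y.\<gamma> m V \<theta> z'" by (rule Y.\<gamma>_surj)
  obtain g y where gy: "g \<in> carrier G" "y \<in> fX V" "z' = translate V g y" using translate_surj_fix[OF V(1,3)] .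
  have gi: "inv\<^bsub>G\<^esub> g \<in> carrier G" using gy by simp
  have "Ocomp (fx V) (Ocomp (fx V) \<theta> (Rf V g)) (Rf V (inv\<^bsub>G\<^esub> g)) = \<theta>"
    using Y.Ocomp_Rf_assoc[OF V(1) gy(1) gi V(2)] Y.Ocomp_Rf_N[OF V(1) N1 V(2)] gy(1) by simp
  then show "nat_map m (inverse_map m z) = z"
    using inverse_map_translate[OF V(1,2) gy(1,2)] nat_map_\<kappa>[OF V(1) Y.Ocomp_Rf[OF V(1) gy(1) V(2)] gy(2,1)] V(4) gy(3) by simp
qed

end

theorem proposition4p3p6:
  fixes G :: "'g monoid" and T :: "'g topology" and H N :: "'g set"
    and X :: "('g, 'a) ospectrum"
  assumes "compact_Lie_group G T"
    and "subgroup H G" and "closedin T H"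
    and "N \<lhd> G" and "closedin T N" and "N \<subseteq> H"
    and "orthogonally_final G T N"
    and "orthogonal_spectrum (G\<lparr>carrier := H\<rparr>) (subtopology T H) X"
  shows "ospectrum_isomorphism (G Mod N) (factor_group_topology G T N)
     (ind_spectrum (G Mod N) (factor_group_topology G T N) (carrier (G\<lparr>carrier := H\<rparr> Mod N))
        (gfix (G\<lparr>carrier := H\<rparr>) (subtopology T H) N X))
     (gfix G T N (ind_spectrum G T H X))
     (natural_map G T H N X)"
proof -
  have "k_group G T" using assms(1) by (rule compact_Lie_group_imp_k_group)
  then interpret natural_setup G T N H X
    using assms by (intro natural_setup.intro rep_sub.intro rep_group.intro rep_sub_axioms.intro ind_setup.intro
        natural_setup_axioms.intro)
  show ?thesis by (rule natural_map_isomorphism)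
qed

end
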